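(* Let $G$ be a compact connected Abelian topological group whose topology has a countable basis, with normalized Haar measure $dg$ and infinite dual $\hat G$. Let $T$ be a centered real-valued isotropic Gaussian field on $G$ with $\mathbb{E}[T(g)^2]=1$, let $a_\pi=\int_G T(g)\chi_\pi(g^{-1})dg$ and $C_\pi=\mathbb{E}|a_\pi|^2$, and assume $C_\pi>0$ for every $\pi\in\hat G$. Fix $p\ge2$ and integers $2\le m_1<\dots<m_p$, and for $\pi\in\hat G$ set $\widetilde{\widetilde a}_\pi(H_{m_j})=\widetilde a_\pi(H_{m_j})/\sqrt{m_j!\,\widehat C_{\pi,m_j}}$, where $\widetilde a_\pi(H_m)=\int_G H_m(T(g))\chi_\pi(g^{-1})dg$. Let $\{\pi_l\}\subset\hat G$ be a sequence, and suppose that for every $j=1,\dots,p$, with $m=m_j$, one (equivalently all) of the following holds as $l\to\infty$ ($\pi=\pi_l$): (a) $\widetilde{\widetilde a}_\pi(H_m)\to N+iN'$ in law, $N,N'$ independent $\mathcal N(0,1/2)$; (b) $[m!\widehat C_{\pi,m}]^{-2}\mathbb{E}[\Re(\widetilde a_\pi(H_m))^4]\to3/4$ and $[m!\widehat C_{\pi,m}]^{-2}\mathbb{E}[\Im(\widetilde a_\pi(H_m))^4]\to3/4$; (c) $\widehat C_{\pi,m}^{-2}\sum_{\lambda}\widehat C_{\lambda,q}^2\widehat C_{\pi\lambda^{-1},m-q}^2\to0$ for all $q=1,\dots,m-1$; (d) $\max_{q=1,\dots,m-1}\frac{\sup_\lambda\widehat C_{\lambda,q}\widehat C_{\pi\lambda^{-1},m-q}}{\sum_\mu\widehat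 C_{\mu,q}\widehat C_{\pi\mu^{-1},m-q}}\to0$. Then $$\big\{T\,;\,(\widetilde{\widetilde a}_\pi(H_{m_1}),\dots,\widetilde{\widetilde a}_\pi(H_{m_p}))\big\}\to\big\{T\,;\,(N_1+iN_1',\dots,N_p+iN_p')\big\}$$ in the sense of finite-dimensional distributions, i.e. for every $k\ge1$ and $g_1,\dots,g_k\in G$, $(T(g_1),\dots,T(g_k),\widetilde{\widetilde a}_\pi(H_{m_1}),\dots,\widetilde{\widetilde a}_\pi(H_{m_p}))\to(T(g_1),\dots,T(g_k),N_1+iN_1',\dots,N_p+iN_p')$ in law, where $(N_1,\dots,N_p)$ and $(N_1',\dots,N_p')$ are independent vectors of i.i.d. $\mathcal N(0,1/2)$ random variables, both independent of $T$. Conversely, if this joint convergence holds, then conditions (a)–(d) hold for every $m=m_j$, $j=1,\dots,p$.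
   Context: $\hat G$ is the set of irreducible unitary representations of $G$, identified with their characters $\chi_\pi$; it is an Abelian group under $\pi\sigma:=\pi\otimes\sigma$ with identity the trivial representation $\pi_0$ and $\pi^{-1}=\bar\pi$. Isotropy of $T$: for all $p\ge1$, $h,g_1,\dots,g_p\in G$, $(T(hg_1),\dots,T(hg_p))\overset{law}{=}(T(g_1),\dots,T(g_p))$; $T$ is jointly measurable. $H_m(x)=(-1)^me^{x^2/2}\frac{d^m}{dx^m}e^{-x^2/2}$. For $m\ge1$, $\widehat C_{\pi,m}=\sum_{\sigma_1\cdots\sigma_m=\pi}C_{\sigma_1}\cdots C_{\sigma_m}$; it is known that $\mathbb{E}|\widetilde a_\pi(H_m)|^2=m!\widehat C_{\pi,m}$. *)

theory Defs
  imports "HOL-Probability.Probability"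
begin

text \<open>The compact Abelian group G is a type 'g of class topological_ab_group_add
(group law written additively: g + h corresponds to gh, - g to g^{-1}).\<close>

definition normalized_haar :: "'g::topological_ab_group_add measure \<Rightarrow> bool" where
  "normalized_haar H \<longleftrightarrow> sets H = sets borel \<and> prob_space H \<and>
     (\<forall>h. distr H borel (\<lambda>g. h + g) = H)"

text \<open>The dual: irreducible unitary representations of an Abelian compact group,
identified with their characters (continuous unitary homomorphisms into the circle).\<close>

definition dual :: "('g::topological_ab_group_add \<Rightarrow> complex) set" where
  "dual = {chi. continuous_on UNIV chi \<and> (\<forall>g. norm (chi g) = 1) \<and>
              (\<forall>g h. chi (g + h) = chi g * chi h)}"

definition centered_normal_rv :: "'w measure \<Rightarrow> ('w \<Rightarrow> real) \<Rightarrow> bool" where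
  "centered_normal_rv M X \<longleftrightarrow> X \<in> borel_measurable M \<and>
     ((\<exists>\<sigma>>0. distributed M lborel X (normal_density 0 \<sigma>)) \<or> (AE w in M. X w = 0))"

definition centered_gaussian_field :: "'w measure \<Rightarrow> ('g \<Rightarrow> 'w \<Rightarrow> real) \<Rightarrow> bool" where
  "centered_gaussian_field M T \<longleftrightarrow>
     (\<forall>(n::nat) (gs::nat \<Rightarrow> 'g) (c::nat \<Rightarrow> real).
        centered_normal_rv M (\<lambda>w. \<Sum>i<n. c i * T (gs i) w))"

definition isotropic_field :: "'w measure \<Rightarrow> ('g::plus \<Rightarrow> 'w \<Rightarrow> real) \<Rightarrow> bool" where
  "isotropic_field M T \<longleftrightarrow>
     (\<forall>(p::nat) h (gs::nat \<Rightarrow> 'g). p \<ge> 1 \<longrightarrow>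
        distr M (PiM {..<p} (\<lambda>_. borel)) (\<lambda>w. \<lambda>i\<in>{..<p}. T (h + gs i) w) =
        distr M (PiM {..<p} (\<lambda>_. borel)) (\<lambda>w. \<lambda>i\<in>{..<p}. T (gs i) w))"

definition hermite :: "nat \<Rightarrow> real \<Rightarrow> real" where
  "hermite m x = (-1) ^ m * exp (x\<^sup>2 / 2) * ((deriv ^^ m) (\<lambda>y. exp (- y\<^sup>2 / 2)) x)"

definition coef :: "'g measure \<Rightarrow> ('g \<Rightarrow> 'w \<Rightarrow> real) \<Rightarrow> ('g::uminus \<Rightarrow> complex) \<Rightarrow> 'w \<Rightarrow> complex" where
  "coef H T chi w = (LINT g|H. complex_of_real (T g w) * chi (- g))"

definition hcoef :: "'g measure \<Rightarrow> ('g \<Rightarrow> 'w \<Rightarrow> real) \<Rightarrow> nat \<Rightarrow> ('g::uminus \<Rightarrow> complex) \<Rightarrow> 'w \<Rightarrow> complex" where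
  "hcoef H T m chi w = (LINT g|H. complex_of_real (hermite m (T g w)) * chi (- g))"

definition spec :: "'w measure \<Rightarrow> 'g measure \<Rightarrow> ('g \<Rightarrow> 'w \<Rightarrow> real) \<Rightarrow> ('g::uminus \<Rightarrow> complex) \<Rightarrow> real" where
  "spec M H T chi = (\<integral>w. (cmod (coef H T chi w))\<^sup>2 \<partial>M)"

definition spec_conv :: "'w measure \<Rightarrow> 'g measure \<Rightarrow> ('g \<Rightarrow> 'w \<Rightarrow> real) \<Rightarrow>
    ('g::topological_ab_group_add \<Rightarrow> complex) \<Rightarrow> nat \<Rightarrow> real" where
  "spec_conv M H T \<pi> m =
     infsum (\<lambda>\<sigma>. \<Prod>i<m. spec M H T (\<sigma> i))
       {\<sigma> \<in> Pi\<^sub>E {..<m} (\<lambda>_. dual). (\<lambda>g. \<Prod>i<m. \<sigma> i g) = \<pi>}"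

definition nhcoef :: "'w measure \<Rightarrow> 'g measure \<Rightarrow> ('g \<Rightarrow> 'w \<Rightarrow> real) \<Rightarrow> nat \<Rightarrow>
    ('g::topological_ab_group_add \<Rightarrow> complex) \<Rightarrow> 'w \<Rightarrow> complex" where
  "nhcoef M H T m \<pi> w = hcoef H T m \<pi> w / complex_of_real (sqrt (fact m * spec_conv M H T \<pi> m))"

definition char_div :: "('g \<Rightarrow> complex) \<Rightarrow> ('g \<Rightarrow> complex) \<Rightarrow> 'g \<Rightarrow> complex" where
  "char_div \<pi> la = (\<lambda>g. \<pi> g * cnj (la g))"

definition converges_in_law :: "'w measure \<Rightarrow> (nat \<Rightarrow> 'w \<Rightarrow> 'b::topological_space) \<Rightarrow> 'b measure \<Rightarrow> bool" where
  "converges_in_law M X \<mu> \<longleftrightarrow>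
     (\<forall>f :: 'b \<Rightarrow> real. continuous_on UNIV f \<longrightarrow> bounded (range f) \<longrightarrow>
        (\<lambda>l. \<integral>w. f (X l w) \<partial>M) \<longlonglongrightarrow> (\<integral>x. f x \<partial>\<mu>))"

definition half_normal :: "real measure" where
  "half_normal = density lborel (\<lambda>x. ennreal (normal_density 0 (sqrt (1/2)) x))"

definition cgauss :: "complex measure" where
  "cgauss = distr (half_normal \<Otimes>\<^sub>M half_normal) borel (\<lambda>(x, y). Complex x y)"

definition cgauss_vec :: "nat \<Rightarrow> (nat \<Rightarrow> complex) measure" where
  "cgauss_vec p = distr (PiM {..<2*p} (\<lambda>_. half_normal)) borel
      (\<lambda>x. \<lambda>j. if j < p then Complex (x j) (x (p + j)) else 0)"

definition cond_a where
  "cond_a M H T m \<pi>s \<longleftrightarrow> converges_in_law M (\<lambda>l. nhcoef M H T m (\<pi>s l)) cgauss"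

definition cond_b where
  "cond_b M H T m \<pi>s \<longleftrightarrow>
     (\<lambda>l. (fact m * spec_conv M H T (\<pi>s l) m) powi (-2) *
           (\<integral>w. (Re (hcoef H T m (\<pi>s l) w)) ^ 4 \<partial>M)) \<longlonglongrightarrow> 3/4 \<and>
     (\<lambda>l. (fact m * spec_conv M H T (\<pi>s l) m) powi (-2) *
           (\<integral>w. (Im (hcoef H T m (\<pi>s l) w)) ^ 4 \<partial>M)) \<longlonglongrightarrow> 3/4"

definition cond_c where
  "cond_c M H T m \<pi>s \<longleftrightarrow>
     (\<forall>q\<in>{1..m-1}.
       (\<lambda>l. (spec_conv M H T (\<pi>s l) m) powi (-2) *
             infsum (\<lambda>la. (spec_conv M H T la q)\<^sup>2 *
                          (spec_conv M H T (char_div (\<pi>s l) la) (m - q))\<^sup>2) dual)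
       \<longlonglongrightarrow> 0)"

definition cond_d where
  "cond_d M H T m \<pi>s \<longleftrightarrow>
     (\<lambda>l. Max ((\<lambda>q. (SUP la\<in>dual. spec_conv M H T la q * spec_conv M H T (char_div (\<pi>s l) la) (m - q))
                  / infsum (\<lambda>\<mu>. spec_conv M H T \<mu> q * spec_conv M H T (char_div (\<pi>s l) \<mu>) (m - q)) dual)
                ` {1..m-1}))
     \<longlonglongrightarrow> 0"

end

theory Submission
  imports Defs "HOL-Computational_Algebra.Polynomial"
begin

text \<open>The field is expanded in characters: the Fourier coefficients of the Hermite transforms
have joint moments given by sums over complete pairings (Wick's formula), each pairing being
weighted by convolution powers of the spectral measure. Condition (c) says exactly that every
contribution in which two coefficients are only partially paired is negligible, by the
Cauchy-Schwarz inequality; hence the moments of the normalised coefficients together with the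
first-order coefficients of the field itself converge to Gaussian moments, which gives the joint
convergence of characteristic functions. Conversely convergence in law and bounded eighth moments
give the fourth moments, and the fourth moment exceeds its Gaussian value by at least a multiple
of each contraction norm in (c). Connectedness of the group makes its dual torsion-free, so only
charge-neutral products contribute.\<close>

text \<open>The diagram sums live in an arbitrary Abelian group with weights in [0, \<infinity>], so
  summability is never an issue. Spending Cauchy-Schwarz on every edge bounds a squared moment by a
  product of convolution powers, which up to factorials is the normalisation of the coefficients;
  keeping one bundle of parallel edges unsplit yields the sums in (c) instead. The field is only
  jointly measurable, so continuity of its covariance has to be earned: almost all paths are
  L1-continuous under translation, and the L1 norm of a Gaussian increment determines its variance.
  Continuity lets the completeness of characters identify the covariance with its Fourier series;
  completeness comes from minimal idempotents of the convolution algebra. Integration by parts is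
  used only for finitely many values of the field; the coefficients, integrals of such values,
  inherit it through Fubini. Vertices of order one satisfy (c) vacuously, so the field itself enters
  the same limit theorem as the coefficients, once it is replaced by a finite symmetric Fourier sum
  with an error uniform along the sequence.\<close>

section \<open>Sums with values in [0, \<infinity>] and weighted Cauchy-Schwarz\<close>

abbreviation nsum :: "('a \<Rightarrow> ennreal) \<Rightarrow> ennreal" where
  "nsum f \<equiv> (\<integral>\<^sup>+x. f x \<partial>count_space UNIV)"

lemma nsum_swap: "nsum (\<lambda>x. nsum (\<lambda>y. f x y)) = nsum (\<lambda>y. nsum (\<lambda>x. f x y))"
  using nn_integral_fst_count_space[of "\<lambda>(x,y). f x y"] nn_integral_snd_count_space[of "\<lambda>(x,y). f x y"]
  by simp

lemma nsum_cmult: "nsum (\<lambda>x. c * f x) = c * nsum f"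
  by (rule nn_integral_cmult) simp

lemma nsum_multc: "nsum (\<lambda>x. f x * c) = nsum f * c"
  by (rule nn_integral_multc) simp

lemma nsum_sum: "nsum (\<lambda>x. \<Sum>i\<in>I. f i x) = (\<Sum>i\<in>I. nsum (f i))"
  by (rule nn_integral_sum) simp

lemma nsum_bij: "bij g \<Longrightarrow> nsum (\<lambda>x. f (g x)) = nsum f"
  by (rule nn_integral_bij_count_space) 

lemma nsum_delta: "nsum (\<lambda>x. if x = a then f x else 0) = f a"
proof -
  have "nsum (\<lambda>x. if x = a then f x else 0) = (\<Sum>x\<in>{a}. if x = a then f x else 0)"
    by (rule nn_integral_count_space') auto
  then show ?thesis by simp
qed

lemma nsum_shift: "nsum (\<lambda>x. f (x + a :: 'd::group_add)) = nsum f"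
proof (rule nsum_bij)
  show "bij (\<lambda>x. x + a)" by (rule bijI') (auto intro: exI[of _ "_ - a"])
qed

lemma nsum_minus_shift: "nsum (\<lambda>x. f (a - x :: 'd::ab_group_add)) = nsum f"
proof (rule nsum_bij)
  show "bij (\<lambda>x. a - x)" by (rule bijI') (auto intro: exI[of _ "a - _"])
qed

lemma nsum_ge: "f a \<le> nsum f"
proof -
  have "nsum (\<lambda>x. if x = a then f x else 0) \<le> nsum f" by (rule nn_integral_mono) auto
  then show ?thesis by (simp add: nsum_delta)
qed

text \<open>Serves only to write \<open>c x * a x\<close> as a square inside Cauchy-Schwarz; later
  bounds are stated for squares, so no root survives.\<close>

definition esqrt :: "ennreal \<Rightarrow> ennreal" where
  "esqrt x = (if x = top then top else ennreal (sqrt (enn2real x)))"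

lemma esqrt_square: "(esqrt x)\<^sup>2 = x"
  by (cases x) (auto simp: esqrt_def ennreal_power top_power_ennreal)

lemma ennreal_le_if_square_le: "x\<^sup>2 \<le> y\<^sup>2 \<Longrightarrow> x \<le> (y::ennreal)"
  by (cases x; cases y)
    (auto simp: ennreal_power top_power_ennreal top_unique intro: power2_le_imp_le ennreal_leI)

text \<open>The pointwise hypothesis is the shape in which an induction hypothesis delivers a bound,
  so an estimate for one edge passes directly to the sum over that edge.\<close>

lemma cauchy_schwarz_weighted:
  assumes "\<And>x. (w x)\<^sup>2 \<le> a x * b x"
  shows "(\<integral>\<^sup>+x. c x * w x \<partial>count_space A)\<^sup>2
    \<le> (\<integral>\<^sup>+x. c x * a x \<partial>count_space A) * (\<integral>\<^sup>+x. c x * b x \<partial>count_space A)"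
proof -
  have "c x * w x \<le> esqrt (c x * a x) * esqrt (c x * b x)" for x
  proof (rule ennreal_le_if_square_le)
    show "(c x * w x)\<^sup>2 \<le> (esqrt (c x * a x) * esqrt (c x * b x))\<^sup>2"
    proof -
      have "(c x)\<^sup>2 * (w x)\<^sup>2 \<le> (c x)\<^sup>2 * (a x * b x)"
        by (rule mult_left_mono[OF assms]) simp
      also have "\<dots> = (c x * a x) * (c x * b x)"
        by (simp only: power2_eq_square mult_ac)
      finally show ?thesis unfolding power_mult_distrib esqrt_square .
    qed
  qed
  then have "(\<integral>\<^sup>+x. c x * w x \<partial>count_space A)
      \<le> (\<integral>\<^sup>+x. esqrt (c x * a x) * esqrt (c x * b x) \<partial>count_space A)"
    by (rule nn_integral_mono)
  then have "(\<integral>\<^sup>+x. c x * w x \<partial>count_space A)\<^sup>2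
      \<le> (\<integral>\<^sup>+x. esqrt (c x * a x) * esqrt (c x * b x) \<partial>count_space A)\<^sup>2"
    by (intro power_mono) auto
  also have "\<dots> \<le> (\<integral>\<^sup>+x. (esqrt (c x * a x))\<^sup>2 \<partial>count_space A) * (\<integral>\<^sup>+x. (esqrt (c x * b x))\<^sup>2 \<partial>count_space A)"
    by (rule Cauchy_Schwarz_nn_integral) auto
  finally show ?thesis by (simp add: esqrt_square)
qed

lemma nsum_square_le:
  assumes "\<And>x. (w x)\<^sup>2 \<le> a x * b x"
  shows "(nsum (\<lambda>x. c x * w x))\<^sup>2 \<le> nsum (\<lambda>x. c x * a x) * nsum (\<lambda>x. c x * b x)"
  by (rule cauchy_schwarz_weighted[OF assms])

text \<open>The finite version with \<open>a = K\<close> and the constant \<open>b = P\<close>; the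
  price is the factor \<open>card I\<close>.\<close>

lemma sum_square_le:
  fixes x :: "'i \<Rightarrow> ennreal"
  assumes "finite I" "\<And>i. i \<in> I \<Longrightarrow> (x i)\<^sup>2 \<le> K i * P"
  shows "(\<Sum>i\<in>I. x i)\<^sup>2 \<le> (of_nat (card I) * (\<Sum>i\<in>I. K i)) * P"
proof -
  have "(\<integral>\<^sup>+i. 1 * (if i \<in> I then x i else 0) \<partial>count_space I)\<^sup>2
     \<le> (\<integral>\<^sup>+i. 1 * (if i \<in> I then K i else 0) \<partial>count_space I) * (\<integral>\<^sup>+i. 1 * P \<partial>count_space I)"
    by (rule cauchy_schwarz_weighted) (use assms in auto)
  then show ?thesis
    using assms(1) by (simp add: nn_integral_count_space_finite mult_ac)
qed

section \<open>Convolution powers of a weight on an Abelian group\<close>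

text \<open>For the spectrum this is C-hat of order n, with the point mass at 0 for n = 0. The
  recursion avoids tuples; \<open>cpow_eq_tuple_sum\<close> reconciles the two forms.\<close>

primrec cpow :: "('d::ab_group_add \<Rightarrow> ennreal) \<Rightarrow> nat \<Rightarrow> 'd \<Rightarrow> ennreal" where
  "cpow C 0 \<pi> = (if \<pi> = 0 then 1 else 0)"
| "cpow C (Suc n) \<pi> = nsum (\<lambda>l. C l * cpow C n (\<pi> - l))"

lemma cpow_1: "cpow C (Suc 0) \<pi> = C \<pi>"
proof -
  have "cpow C (Suc 0) \<pi> = nsum (\<lambda>x. if x = \<pi> then C x else 0)"
    by (auto intro!: nn_integral_cong simp: )
  then show ?thesis by (simp only: nsum_delta)
qed

lemma cpow_add: "nsum (\<lambda>\<mu>. cpow C q \<mu> * cpow C r (\<pi> - \<mu>)) = cpow C (q + r) \<pi>"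
proof (induction q arbitrary: \<pi>)
  case 0
  have "nsum (\<lambda>\<mu>. cpow C 0 \<mu> * cpow C r (\<pi> - \<mu>)) = nsum (\<lambda>x. if x = 0 then cpow C r (\<pi> - x) else 0)"
    by (auto intro!: nn_integral_cong)
  then show ?case by (simp only: nsum_delta) simp
next
  case (Suc q)
  have "nsum (\<lambda>\<mu>. cpow C (Suc q) \<mu> * cpow C r (\<pi> - \<mu>))
     = nsum (\<lambda>\<mu>. nsum (\<lambda>l. C l * (cpow C q (\<mu> - l) * cpow C r (\<pi> - \<mu>))))"
    by (simp add: nsum_multc[symmetric] mult.assoc)
  also have "\<dots> = nsum (\<lambda>l. C l * nsum (\<lambda>\<mu>. cpow C q (\<mu> - l) * cpow C r (\<pi> - \<mu>)))"
    by (subst nsum_swap) (simp add: nsum_cmult)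
  also have "\<dots> = nsum (\<lambda>l. C l * nsum (\<lambda>\<mu>. cpow C q \<mu> * cpow C r (\<pi> - l - \<mu>)))"
  proof -
    have "nsum (\<lambda>\<mu>. cpow C q (\<mu> - l) * cpow C r (\<pi> - \<mu>)) = nsum (\<lambda>\<mu>. cpow C q \<mu> * cpow C r (\<pi> - l - \<mu>))" for l
      using nsum_shift[of "\<lambda>\<mu>. cpow C q (\<mu> - l) * cpow C r (\<pi> - \<mu>)" l] by (simp add: algebra_simps)
    then show ?thesis by simp
  qed
  finally show ?case by (simp add: Suc.IH)
qed

lemma cpow_uminus:
  assumes "\<And>x. C (- x) = C x"
  shows "cpow C n (- \<pi>) = cpow C n \<pi>"
proof (induction n arbitrary: \<pi>)
  case (Suc n)
  have "cpow C (Suc n) (- \<pi>) = nsum (\<lambda>l. C (0 - l) * cpow C n (- \<pi> - (0 - l)))"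
    using nsum_minus_shift[of "\<lambda>x. C x * cpow C n (- \<pi> - x)" 0] by simp
  also have "\<dots> = nsum (\<lambda>l. C l * cpow C n (\<pi> - l))"
  proof (intro nn_integral_cong arg_cong2[where f="(*)"])
    show "C (0 - l) = C l" for l using assms by simp
    show "cpow C n (- \<pi> - (0 - l)) = cpow C n (\<pi> - l)" for l
      using Suc.IH[of "\<pi> - l"] by (simp add: algebra_simps)
  qed
  finally show ?case by simp
qed simp

text \<open>Needed because an edge of charge \<open>l\<close> leaves its far end with charge
  \<open>\<pi> + l\<close> rather than \<open>\<pi> - l\<close>.\<close>

lemma cpow_uminus_Suc:
  assumes "\<And>x. C (- x) = C x"
  shows "nsum (\<lambda>l. C l * cpow C n (\<pi> + l)) = cpow C (Suc n) \<pi>"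
  using nsum_minus_shift[of "\<lambda>x. C x * cpow C n (\<pi> - x)" 0] assms by simp

lemma nsum_cpow: "nsum (cpow C n) = (nsum C) ^ n"
proof (induction n)
  case 0
  then show ?case using nsum_delta[of 0 "\<lambda>_. 1"] by simp
next
  case (Suc n)
  have "nsum (cpow C (Suc n)) = nsum (\<lambda>\<pi>. nsum (\<lambda>l. C l * cpow C n (\<pi> - l)))" by simp
  also have "\<dots> = nsum (\<lambda>l. C l * nsum (\<lambda>\<pi>. cpow C n (\<pi> + (- l))))"
    by (subst nsum_swap) (simp add: nsum_cmult)
  also have "\<dots> = nsum C * nsum (cpow C n)" by (simp only: nsum_shift nsum_multc)
  finally show ?case using Suc by simp
qed

lemma cpow_le: "nsum C \<le> 1 \<Longrightarrow> cpow C n \<pi> \<le> 1"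
  using nsum_ge[of "cpow C n" \<pi>] power_mono[of "nsum C" 1 n] by (simp add: nsum_cpow)

lemma cpow_pos:
  assumes "\<And>x. C x > 0" "n > 0"
  shows "cpow C n \<pi> > 0"
  using assms(2)
proof (induction n arbitrary: \<pi> rule: nat_induct_non_zero)
  case 1 then show ?case using assms by (simp only: One_nat_def cpow_1)
next
  case (Suc n)
  have "0 < C 0 * cpow C n (\<pi> - 0)" using Suc assms by (simp add: ennreal_zero_less_mult_iff)
  also have "\<dots> \<le> cpow C (Suc n) \<pi>" unfolding cpow.simps by (rule nsum_ge)
  finally show ?case .
qed

section \<open>Wick sums over pairings that carry charges\<close>

text \<open>The \<open>edges\<close>-sum attaches the \<open>m\<close> half-edges of a vertex of total charge \<open>\<rho>\<close> to the vertices
  in \<open>J\<close>; the remaining configuration is evaluated by \<open>Wf\<close>.\<close>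

primrec edges :: "('d::ab_group_add \<Rightarrow> ennreal) \<Rightarrow> ((nat \<Rightarrow> nat) \<Rightarrow> (nat \<Rightarrow> 'd) \<Rightarrow> ennreal) \<Rightarrow>
    nat set \<Rightarrow> nat \<Rightarrow> 'd \<Rightarrow> (nat \<Rightarrow> nat) \<Rightarrow> (nat \<Rightarrow> 'd) \<Rightarrow> ennreal" where
  "edges C Wf J 0 \<rho> n \<pi> = (if \<rho> = 0 then Wf n \<pi> else 0)"
| "edges C Wf J (Suc m) \<rho> n \<pi> =
    (\<Sum>j\<in>J. of_nat (n j) * nsum (\<lambda>l. C l * edges C Wf J m (\<rho> - l) (n(j := n j - 1)) (\<pi>(j := \<pi> j + l))))"

text \<open>Each vertex sends its half-edges only to later ones, since Hermite polynomials admit no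
  pairing inside a vertex. \<open>n i\<close> counts the half-edges still free at \<open>i\<close>,
  and \<open>\<pi> i\<close> is the charge they have to carry in total.\<close>

primrec wick :: "('d::ab_group_add \<Rightarrow> ennreal) \<Rightarrow> nat list \<Rightarrow> (nat \<Rightarrow> nat) \<Rightarrow> (nat \<Rightarrow> 'd) \<Rightarrow> ennreal" where
  "wick C [] n \<pi> = 1"
| "wick C (v # vs) n \<pi> = edges C (wick C vs) (set vs) (n v) (\<pi> v) n \<pi>"

lemma edges_cong:
  assumes "\<And>n n' \<pi> \<pi>'. (\<And>i. i \<in> I \<Longrightarrow> n i = n' i \<and> \<pi> i = \<pi>' i) \<Longrightarrow> Wf n \<pi> = Wf n' \<pi>'"
    and "J \<subseteq> I" "\<And>i. i \<in> I \<Longrightarrow> n i = n' i \<and> \<pi> i = \<pi>' i"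
  shows "edges C Wf J m \<rho> n \<pi> = edges C Wf J m \<rho> n' \<pi>'"
  using assms(3)
proof (induction m arbitrary: \<rho> n n' \<pi> \<pi>')
  case 0
  then show ?case using assms(1)[of n n' \<pi> \<pi>'] by simp
next
  case (Suc m)
  show ?case unfolding edges.simps
  proof (rule sum.cong[OF refl], intro arg_cong2[where f="(*)"] nn_integral_cong refl)
    fix j assume "j \<in> J"
    then have j: "j \<in> I" using assms(2) by auto
    then show "of_nat (n j) = (of_nat (n' j) :: ennreal)" using Suc.prems by simp
    show "edges C Wf J m (\<rho> - l) (n(j := n j - 1)) (\<pi>(j := \<pi> j + l))
      = edges C Wf J m (\<rho> - l) (n'(j := n' j - 1)) (\<pi>'(j := \<pi>' j + l))" for l
      using Suc.prems j by (intro Suc.IH) auto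
  qed
qed

lemma wick_cong:
  assumes "\<And>i. i \<in> set vs \<Longrightarrow> n i = n' i \<and> \<pi> i = \<pi>' i"
  shows "wick C vs n \<pi> = wick C vs n' \<pi>'"
  using assms
proof (induction vs arbitrary: n n' \<pi> \<pi>')
  case (Cons v vs)
  have "n v = n' v" "\<pi> v = \<pi>' v" using Cons.prems by auto
  moreover have "edges C (wick C vs) (set vs) m \<rho> n \<pi> = edges C (wick C vs) (set vs) m \<rho> n' \<pi>'" for m \<rho>
  proof (rule edges_cong[where I="set vs"])
    show "wick C vs n1 \<pi>1 = wick C vs n2 \<pi>2"
      if "\<And>i. i \<in> set vs \<Longrightarrow> n1 i = n2 i \<and> \<pi>1 i = \<pi>2 i" for n1 n2 \<pi>1 \<pi>2
      by (rule Cons.IH[OF that])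
    show "set vs \<subseteq> set vs" ..
    show "n i = n' i \<and> \<pi> i = \<pi>' i" if "i \<in> set vs" for i
      using Cons.prems that by simp
  qed
  ultimately show ?case by simp
qed simp

text \<open>The configurations in which \<open>q\<close> edges end at \<open>i\<close> and
  \<open>r\<close> elsewhere, without their multiplicity. The \<open>q\<close> parallel edges are
  already summed into one convolution power of total charge \<open>\<mu>\<close>.\<close>

definition pairing :: "('d::ab_group_add \<Rightarrow> ennreal) \<Rightarrow> ((nat \<Rightarrow> nat) \<Rightarrow> (nat \<Rightarrow> 'd) \<Rightarrow> ennreal) \<Rightarrow>
    nat set \<Rightarrow> nat \<Rightarrow> nat \<Rightarrow> nat \<Rightarrow> 'd \<Rightarrow> (nat \<Rightarrow> nat) \<Rightarrow> (nat \<Rightarrow> 'd) \<Rightarrow> ennreal" where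
  "pairing C Wf J i r q \<rho> n \<pi> =
    nsum (\<lambda>\<mu>. cpow C q \<mu> * edges C Wf (J - {i}) r (\<rho> - \<mu>) (n(i := n i - q)) (\<pi>(i := \<pi> i + \<mu>)))"

text \<open>One more edge to \<open>i\<close>: its charge merges with that of the bundle after
  replacing \<open>\<mu>\<close> by \<open>\<mu> - l\<close>, so the bundle remains a single
  convolution power.\<close>

lemma pairing_same:
  "nsum (\<lambda>l. C l * pairing C Wf J i r q (\<rho> - l) (n(i := n i - 1)) (\<pi>(i := \<pi> i + l)))
    = pairing C Wf J i r (Suc q) \<rho> n \<pi>"
proof -
  let ?E = "\<lambda>\<mu>. edges C Wf (J - {i}) r (\<rho> - \<mu>) (n(i := n i - Suc q)) (\<pi>(i := \<pi> i + \<mu>))"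
  have "pairing C Wf J i r q (\<rho> - l) (n(i := n i - 1)) (\<pi>(i := \<pi> i + l))
    = nsum (\<lambda>\<mu>. cpow C q (\<mu> - l) * ?E \<mu>)" for l
    unfolding pairing_def
    using nsum_shift[of "\<lambda>\<mu>. cpow C q (\<mu> - l) * ?E \<mu>" l] by (simp add: algebra_simps)
  then have "nsum (\<lambda>l. C l * pairing C Wf J i r q (\<rho> - l) (n(i := n i - 1)) (\<pi>(i := \<pi> i + l)))
    = nsum (\<lambda>l. nsum (\<lambda>\<mu>. C l * cpow C q (\<mu> - l) * ?E \<mu>))"
    by (simp add: nsum_cmult mult.assoc)
  also have "\<dots> = nsum (\<lambda>\<mu>. nsum (\<lambda>l. C l * cpow C q (\<mu> - l)) * ?E \<mu>)"
    by (subst nsum_swap) (simp add: nsum_multc)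
  finally show ?thesis by (simp add: pairing_def)
qed

text \<open>An edge that avoids \<open>i\<close> does not touch the bundle, so the two sums only
  have to be exchanged.\<close>

lemma pairing_other:
  "(\<Sum>j\<in>J - {i}. of_nat (n j) * nsum (\<lambda>l. C l * pairing C Wf J i r q (\<rho> - l) (n(j := n j - 1)) (\<pi>(j := \<pi> j + l))))
    = pairing C Wf J i (Suc r) q \<rho> n \<pi>"
proof -
  let ?E = "\<lambda>j \<mu> l. edges C Wf (J - {i}) r (\<rho> - \<mu> - l) (n(i := n i - q, j := n j - 1)) (\<pi>(i := \<pi> i + \<mu>, j := \<pi> j + l))"
  have "of_nat (n j) * nsum (\<lambda>l. C l * pairing C Wf J i r q (\<rho> - l) (n(j := n j - 1)) (\<pi>(j := \<pi> j + l)))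
     = nsum (\<lambda>\<mu>. cpow C q \<mu> * (of_nat (n j) * nsum (\<lambda>l. C l * ?E j \<mu> l)))" if "j \<in> J - {i}" for j
  proof -
    have "pairing C Wf J i r q (\<rho> - l) (n(j := n j - 1)) (\<pi>(j := \<pi> j + l))
       = nsum (\<lambda>\<mu>. cpow C q \<mu> * ?E j \<mu> l)" for l
      using that unfolding pairing_def by (simp add: fun_upd_twist algebra_simps)
    then have "nsum (\<lambda>l. C l * pairing C Wf J i r q (\<rho> - l) (n(j := n j - 1)) (\<pi>(j := \<pi> j + l)))
       = nsum (\<lambda>l. nsum (\<lambda>\<mu>. cpow C q \<mu> * (C l * ?E j \<mu> l)))"
      by (simp add: nsum_cmult[symmetric] mult_ac)
    also have "\<dots> = nsum (\<lambda>\<mu>. cpow C q \<mu> * nsum (\<lambda>l. C l * ?E j \<mu> l))"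
      by (subst nsum_swap) (simp add: nsum_cmult)
    finally show ?thesis by (simp add: nsum_cmult[symmetric] mult_ac)
  qed
  then have "(\<Sum>j\<in>J - {i}. of_nat (n j) * nsum (\<lambda>l. C l * pairing C Wf J i r q (\<rho> - l) (n(j := n j - 1)) (\<pi>(j := \<pi> j + l))))
    = (\<Sum>j\<in>J - {i}. nsum (\<lambda>\<mu>. cpow C q \<mu> * (of_nat (n j) * nsum (\<lambda>l. C l * ?E j \<mu> l))))"
    by (rule sum.cong[OF refl])
  also have "\<dots> = nsum (\<lambda>\<mu>. cpow C q \<mu> * (\<Sum>j\<in>J - {i}. of_nat (n j) * nsum (\<lambda>l. C l * ?E j \<mu> l)))"
    by (simp add: nsum_sum sum_distrib_left)
  also have "\<dots> = pairing C Wf J i (Suc r) q \<rho> n \<pi>"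
    unfolding pairing_def
  proof (intro nn_integral_cong arg_cong2[where f="(*)"] refl)
    fix \<mu>
    show "(\<Sum>j\<in>J - {i}. of_nat (n j) * nsum (\<lambda>l. C l * ?E j \<mu> l)) =
      edges C Wf (J - {i}) (Suc r) (\<rho> - \<mu>) (n(i := n i - q)) (\<pi>(i := \<pi> i + \<mu>))"
      unfolding edges.simps by (rule sum.cong) auto
  qed
  finally show ?thesis .
qed

text \<open>The number of ways to match \<open>q\<close> half-edges of one vertex with
  \<open>q\<close> of another, as in the product formula for Hermite polynomials.\<close>

definition pcoef :: "nat \<Rightarrow> nat \<Rightarrow> nat \<Rightarrow> nat" where
  "pcoef m k q = fact q * (m choose q) * (k choose q)"

text \<open>Either the added half-edge is matched, with one of \<open>k\<close> partners, or it is
  not.\<close>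

lemma pcoef_Suc: "pcoef (Suc m) k (Suc q) = k * pcoef m (k - 1) q + pcoef m k (Suc q)"
proof -
  have "Suc q * (k choose Suc q) = k * ((k - 1) choose q)"
    by (cases k) (simp_all add: Suc_times_binomial del: binomial_Suc_Suc mult_Suc mult_Suc_right)
  then have "fact (Suc q) * (k choose Suc q) = k * (fact q * ((k - 1) choose q))"
    by (metis fact_Suc mult.assoc mult.left_commute of_nat_id)
  then have "(m choose q) * (fact (Suc q) * (k choose Suc q)) = k * pcoef m (k - 1) q"
    by (simp add: pcoef_def)
  then show ?thesis by (simp add: pcoef_def algebra_simps)
qed

text \<open>Place one half-edge at a time: it joins the bundle to \<open>i\<close>
  (\<open>pairing_same\<close>) or goes elsewhere (\<open>pairing_other\<close>), and the
  multiplicities follow \<open>pcoef_Suc\<close>. Sorting by the size of one bundle is what isolates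
  a contraction of order \<open>q\<close>.\<close>

lemma edges_product:
  assumes "finite J" "i \<in> J"
  shows "edges C Wf J m \<rho> n \<pi> = (\<Sum>q\<le>m. of_nat (pcoef m (n i) q) * pairing C Wf J i (m - q) q \<rho> n \<pi>)"
proof (induction m arbitrary: \<rho> n \<pi>)
  case 0
  have "pairing C Wf J i 0 0 \<rho> n \<pi> = nsum (\<lambda>\<mu>. if \<mu> = 0 then edges C Wf (J - {i}) 0 (\<rho> - \<mu>) (n(i := n i)) (\<pi>(i := \<pi> i + \<mu>)) else 0)"
    unfolding pairing_def by (rule nn_integral_cong) auto
  then show ?case by (simp only: nsum_delta) (simp add: pcoef_def)
next
  case (Suc m)
  let ?P = "\<lambda>r q. pairing C Wf J i r q \<rho> n \<pi>"
  have A: "of_nat (n i) * nsum (\<lambda>l. C l * edges C Wf J m (\<rho> - l) (n(i := n i - 1)) (\<pi>(i := \<pi> i + l)))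
     = (\<Sum>q\<le>m. of_nat (n i * pcoef m (n i - 1) q) * ?P (m - q) (Suc q))"
    by (simp add: Suc.IH fun_upd_same sum_distrib_left nsum_sum nsum_cmult[symmetric] pairing_same[symmetric] mult_ac
        del: One_nat_def fun_upd_apply)
  have "(\<Sum>j\<in>J - {i}. of_nat (n j) * nsum (\<lambda>l. C l * edges C Wf J m (\<rho> - l) (n(j := n j - 1)) (\<pi>(j := \<pi> j + l))))
    = (\<Sum>j\<in>J - {i}. \<Sum>q\<le>m. of_nat (pcoef m (n i) q) *
         (of_nat (n j) * nsum (\<lambda>l. C l * pairing C Wf J i (m - q) q (\<rho> - l) (n(j := n j - 1)) (\<pi>(j := \<pi> j + l)))))"
    by (rule sum.cong[OF refl])
      (auto simp: Suc.IH fun_upd_other sum_distrib_left nsum_sum nsum_cmult[symmetric] mult_ac simp del: fun_upd_apply)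
  also have "\<dots> = (\<Sum>q\<le>m. of_nat (pcoef m (n i) q) * ?P (Suc (m - q)) q)"
    by (subst sum.swap) (simp only: sum_distrib_left[symmetric] pairing_other)
  also have "\<dots> = (\<Sum>q\<le>Suc m. of_nat (pcoef m (n i) q) * ?P (Suc m - q) q)"
    by (simp add: pcoef_def Suc_diff_le)
  also have "\<dots> = of_nat (pcoef m (n i) 0) * ?P (Suc m) 0 + (\<Sum>q\<le>m. of_nat (pcoef m (n i) (Suc q)) * ?P (m - q) (Suc q))"
    by (subst sum.atMost_Suc_shift) simp
  finally have B: "(\<Sum>j\<in>J - {i}. of_nat (n j) * nsum (\<lambda>l. C l * edges C Wf J m (\<rho> - l) (n(j := n j - 1)) (\<pi>(j := \<pi> j + l))))
    = of_nat (pcoef (Suc m) (n i) 0) * ?P (Suc m) 0 + (\<Sum>q\<le>m. of_nat (pcoef m (n i) (Suc q)) * ?P (m - q) (Suc q))"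
    by (simp add: pcoef_def)
  have "edges C Wf J (Suc m) \<rho> n \<pi> = (\<Sum>q\<le>m. of_nat (n i * pcoef m (n i - 1) q) * ?P (m - q) (Suc q)) +
     (of_nat (pcoef (Suc m) (n i) 0) * ?P (Suc m) 0 + (\<Sum>q\<le>m. of_nat (pcoef m (n i) (Suc q)) * ?P (m - q) (Suc q)))"
    unfolding edges.simps using assms by (subst sum.remove[of J i]) (simp_all only: A B)
  also have "\<dots> = of_nat (pcoef (Suc m) (n i) 0) * ?P (Suc m) 0 +
       (\<Sum>q\<le>m. of_nat (pcoef (Suc m) (n i) (Suc q)) * ?P (m - q) (Suc q))"
    by (simp add: pcoef_Suc sum.distrib algebra_simps)
  also have "\<dots> = (\<Sum>q\<le>Suc m. of_nat (pcoef (Suc m) (n i) q) * ?P (Suc m - q) q)"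
    by (subst sum.atMost_Suc_shift) simp
  finally show ?case .
qed

text \<open>Here \<open>i\<close> is the vertex reached by the first half-edge, so every bundle is
  nonempty and every vertex takes its turn as partner, as a recursion for Gaussian moments
  requires.\<close>

lemma edges_expand:
  assumes "finite J"
  shows "edges C Wf J (Suc m) \<rho> n \<pi> =
    (\<Sum>i\<in>J. \<Sum>q\<le>m. of_nat (n i * pcoef m (n i - 1) q) * pairing C Wf J i (m - q) (Suc q) \<rho> n \<pi>)"
  unfolding edges.simps
  by (rule sum.cong[OF refl])
    (simp add: edges_product[OF assms] fun_upd_same sum_distrib_left nsum_sum nsum_cmult[symmetric] pairing_same[symmetric] mult_ac
        del: One_nat_def fun_upd_apply)

lemma edges_zero_vertex:
  assumes "\<And>n \<pi>. n i = 0 \<Longrightarrow> Wf n \<pi> = (if \<pi> i = 0 then Wf' n \<pi> else 0)" "n i = 0" "finite J"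
  shows "edges C Wf J m \<rho> n \<pi> = (if \<pi> i = 0 then edges C Wf' (J - {i}) m \<rho> n \<pi> else 0)"
  using assms(2)
proof (induction m arbitrary: \<rho> n \<pi>)
  case 0
  then show ?case by (simp add: assms(1))
next
  case (Suc m)
  have "edges C Wf J (Suc m) \<rho> n \<pi> =
    (\<Sum>j\<in>J - {i}. of_nat (n j) * nsum (\<lambda>l. C l * edges C Wf J m (\<rho> - l) (n(j := n j - 1)) (\<pi>(j := \<pi> j + l))))"
    unfolding edges.simps
    by (rule sum.mono_neutral_right) (use Suc.prems assms(3) in auto)
  also have "\<dots> = (\<Sum>j\<in>J - {i}. of_nat (n j) * nsum (\<lambda>l. C l * (if \<pi> i = 0 then edges C Wf' (J - {i}) m (\<rho> - l) (n(j := n j - 1)) (\<pi>(j := \<pi> j + l)) else 0)))"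
  proof (intro sum.cong refl arg_cong2[where f="(*)"] nn_integral_cong)
    fix j l assume "j \<in> J - {i}"
    then show "edges C Wf J m (\<rho> - l) (n(j := n j - 1)) (\<pi>(j := \<pi> j + l)) =
      (if \<pi> i = 0 then edges C Wf' (J - {i}) m (\<rho> - l) (n(j := n j - 1)) (\<pi>(j := \<pi> j + l)) else 0)"
      using Suc.prems by (subst Suc.IH) auto
  qed
  also have "\<dots> = (if \<pi> i = 0 then edges C Wf' (J - {i}) (Suc m) \<rho> n \<pi> else 0)"
    by simp
  finally show ?case .
qed

text \<open>The factor \<open>n i\<close> forbids edges into a vertex without half-edges; its charge
  therefore never changes and has to be 0 from the start.\<close>

lemma wick_zero_vertex:
  assumes "distinct vs" "i \<in> set vs" "n i = 0"
  shows "wick C vs n \<pi> = (if \<pi> i = 0 then wick C (remove1 i vs) n \<pi> else 0)"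
  using assms
proof (induction vs arbitrary: n \<pi>)
  case (Cons v vs)
  show ?case
  proof (cases "v = i")
    case True
    then show ?thesis using Cons.prems by simp
  next
    case False
    have "edges C (wick C vs) (set vs) m \<rho> n \<pi> =
      (if \<pi> i = 0 then edges C (wick C (remove1 i vs)) (set vs - {i}) m \<rho> n \<pi> else 0)" for m \<rho>
      by (rule edges_zero_vertex) (use Cons False in auto)
    then show ?thesis using False Cons.prems by simp
  qed
qed simp

section \<open>Cauchy-Schwarz bounds for Wick sums\<close>

text \<open>Induction over the half-edges with one weighted Cauchy-Schwarz per edge. A whole family
  indexed by \<open>x\<close> is carried along so that its sum ends up outside the square: since
  \<open>\<rho>\<close> is injective, at most one \<open>x\<close> has no residual charge when the
  last edge is placed, so no cross terms arise. \<open>B\<close> holds the vertices whose charge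
  varies with \<open>x\<close>; edges go only to \<open>J\<close>, away from
  \<open>B\<close>.\<close>

lemma edges_bound:
  fixes C :: "'d::ab_group_add \<Rightarrow> ennreal"
  assumes sym: "\<And>x. C (- x) = C x"
    and fin: "finite I" and J: "J \<subseteq> I" and B: "B \<subseteq> I" "B \<inter> J = {}"
    and W: "\<And>n. \<exists>K<top. \<forall>\<pi>. (Wf n \<pi>)\<^sup>2 \<le> K * (\<Prod>i\<in>I. cpow C (n i) (\<pi> i))"
  shows "\<exists>K<top. \<forall>(c::'x \<Rightarrow> ennreal) \<rho> (\<pi>f :: 'x \<Rightarrow> nat \<Rightarrow> 'd) \<pi>0. inj \<rho> \<longrightarrow> (\<forall>x. \<forall>j\<in>I - B. \<pi>f x j = \<pi>0 j) \<longrightarrow>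
    (nsum (\<lambda>x. c x * edges C Wf J m (\<rho> x) n (\<pi>f x)))\<^sup>2
      \<le> K * (nsum (\<lambda>x. (c x)\<^sup>2 * cpow C m (\<rho> x) * (\<Prod>i\<in>B. cpow C (n i) (\<pi>f x i)))
             * (\<Prod>j\<in>I - B. cpow C (n j) (\<pi>0 j)))"
proof (induction m arbitrary: n)
  case 0
  obtain K where K: "K < top" "\<And>\<pi>. (Wf n \<pi>)\<^sup>2 \<le> K * (\<Prod>i\<in>I. cpow C (n i) (\<pi> i))"
    using W by blast
  show ?case
  proof (intro exI[of _ K] conjI K(1) allI impI)
    fix c :: "'x \<Rightarrow> ennreal" and \<rho> :: "'x \<Rightarrow> 'd" and \<pi>f :: "'x \<Rightarrow> nat \<Rightarrow> 'd" and \<pi>0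
    assume inj: "inj \<rho>" and eq: "\<forall>x. \<forall>j\<in>I - B. \<pi>f x j = \<pi>0 j"
    let ?R = "\<lambda>x. (c x)\<^sup>2 * cpow C 0 (\<rho> x) * (\<Prod>i\<in>B. cpow C (n i) (\<pi>f x i))"
    let ?P = "\<Prod>j\<in>I - B. cpow C (n j) (\<pi>0 j)"
    show "(nsum (\<lambda>x. c x * edges C Wf J 0 (\<rho> x) n (\<pi>f x)))\<^sup>2 \<le> K * (nsum ?R * ?P)"
    proof (cases "\<exists>x. \<rho> x = 0")
      case True
      then obtain x0 where x0: "\<rho> x0 = 0" by blast
      then have "\<rho> x = 0 \<longleftrightarrow> x = x0" for x using inj by (metis injD)
      then have "nsum (\<lambda>x. c x * edges C Wf J 0 (\<rho> x) n (\<pi>f x)) = nsum (\<lambda>x. if x = x0 then c x * Wf n (\<pi>f x) else 0)"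
        by (intro nn_integral_cong) auto
      then have "(nsum (\<lambda>x. c x * edges C Wf J 0 (\<rho> x) n (\<pi>f x)))\<^sup>2 = (c x0)\<^sup>2 * (Wf n (\<pi>f x0))\<^sup>2"
        by (simp only: nsum_delta power_mult_distrib)
      also have "\<dots> \<le> (c x0)\<^sup>2 * (K * (\<Prod>i\<in>I. cpow C (n i) (\<pi>f x0 i)))"
        by (intro mult_left_mono K) auto
      also have "(\<Prod>i\<in>I. cpow C (n i) (\<pi>f x0 i)) = ?P * (\<Prod>i\<in>B. cpow C (n i) (\<pi>f x0 i))"
        by (subst prod.subset_diff[OF B(1) fin]) (use eq in auto)
      also have "(c x0)\<^sup>2 * (K * (?P * (\<Prod>i\<in>B. cpow C (n i) (\<pi>f x0 i)))) = K * (?R x0 * ?P)"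
        by (simp add: x0 mult_ac)
      also have "\<dots> \<le> K * (nsum ?R * ?P)"
        by (intro mult_left_mono mult_right_mono nsum_ge) auto
      finally show ?thesis .
    next
      case False
      then have "nsum (\<lambda>x. c x * edges C Wf J 0 (\<rho> x) n (\<pi>f x)) = 0" by simp
      then show ?thesis by simp
    qed
  qed
next
  case (Suc m)
  have "\<exists>K. \<forall>j. K j < top \<and> (\<forall>(c::'x \<Rightarrow> ennreal) \<rho> (\<pi>f :: 'x \<Rightarrow> nat \<Rightarrow> 'd) \<pi>0. inj \<rho> \<longrightarrow> (\<forall>x. \<forall>k\<in>I - B. \<pi>f x k = \<pi>0 k) \<longrightarrow>
    (nsum (\<lambda>x. c x * edges C Wf J m (\<rho> x) (n(j := n j - 1)) (\<pi>f x)))\<^sup>2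
      \<le> K j * (nsum (\<lambda>x. (c x)\<^sup>2 * cpow C m (\<rho> x) * (\<Prod>i\<in>B. cpow C ((n(j := n j - 1)) i) (\<pi>f x i)))
             * (\<Prod>k\<in>I - B. cpow C ((n(j := n j - 1)) k) (\<pi>0 k))))"
    using Suc.IH by (intro choice allI) blast
  then obtain K where Kt: "\<And>j. K j < top" and
    K: "\<And>j (c::'x \<Rightarrow> ennreal) \<rho> (\<pi>f :: 'x \<Rightarrow> nat \<Rightarrow> 'd) \<pi>0. inj \<rho> \<Longrightarrow> (\<forall>x. \<forall>k\<in>I - B. \<pi>f x k = \<pi>0 k) \<Longrightarrow>
    (nsum (\<lambda>x. c x * edges C Wf J m (\<rho> x) (n(j := n j - 1)) (\<pi>f x)))\<^sup>2
      \<le> K j * (nsum (\<lambda>x. (c x)\<^sup>2 * cpow C m (\<rho> x) * (\<Prod>i\<in>B. cpow C ((n(j := n j - 1)) i) (\<pi>f x i)))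
             * (\<Prod>k\<in>I - B. cpow C ((n(j := n j - 1)) k) (\<pi>0 k)))"
    by blast
  let ?K = "of_nat (card J) * (\<Sum>j\<in>J. (of_nat (n j))\<^sup>2 * K j)"
  have finJ: "finite J" using fin J finite_subset by blast
  show ?case
  proof (intro exI[of _ ?K] conjI allI impI)
    show "?K < top" using Kt finJ
      by (auto simp: ennreal_mult_less_top power2_eq_square of_nat_less_top)
    fix c :: "'x \<Rightarrow> ennreal" and \<rho> :: "'x \<Rightarrow> 'd" and \<pi>f :: "'x \<Rightarrow> nat \<Rightarrow> 'd" and \<pi>0
    assume inj: "inj \<rho>" and eq: "\<forall>x. \<forall>j\<in>I - B. \<pi>f x j = \<pi>0 j"
    let ?A = "nsum (\<lambda>x. (c x)\<^sup>2 * cpow C (Suc m) (\<rho> x) * (\<Prod>i\<in>B. cpow C (n i) (\<pi>f x i)))"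
    let ?P = "\<Prod>j\<in>I - B. cpow C (n j) (\<pi>0 j)"
    \<comment> \<open>The part in which the first half-edge ends at \<open>j\<close> with charge
      \<open>l\<close>. As \<open>j\<close> lies outside \<open>B\<close> its charge is
      \<open>\<pi>0 j\<close> for every \<open>x\<close>, and shifting \<open>\<rho>\<close> by
      \<open>l\<close> keeps it injective, so the induction hypothesis covers
      \<open>br j l\<close>.\<close>
    define br where "br j l = nsum (\<lambda>x. c x * edges C Wf J m (\<rho> x - l) (n(j := n j - 1)) ((\<pi>f x)(j := \<pi>0 j + l)))" for j l
    have "nsum (\<lambda>x. c x * edges C Wf J (Suc m) (\<rho> x) n (\<pi>f x)) =
       nsum (\<lambda>x. \<Sum>j\<in>J. nsum (\<lambda>l. of_nat (n j) * (C l * (c x * edges C Wf J m (\<rho> x - l) (n(j := n j - 1)) ((\<pi>f x)(j := \<pi>0 j + l))))))"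
    proof (intro nn_integral_cong)
      fix x
      have "edges C Wf J (Suc m) (\<rho> x) n (\<pi>f x) =
        (\<Sum>j\<in>J. of_nat (n j) * nsum (\<lambda>l. C l * edges C Wf J m (\<rho> x - l) (n(j := n j - 1)) ((\<pi>f x)(j := \<pi>0 j + l))))"
      proof -
        have "\<pi>f x j = \<pi>0 j" if "j \<in> J" for j using eq J B that by blast
        then show ?thesis unfolding edges.simps by simp
      qed
      then show "c x * edges C Wf J (Suc m) (\<rho> x) n (\<pi>f x) =
         (\<Sum>j\<in>J. nsum (\<lambda>l. of_nat (n j) * (C l * (c x * edges C Wf J m (\<rho> x - l) (n(j := n j - 1)) ((\<pi>f x)(j := \<pi>0 j + l))))))"
        by (simp add: sum_distrib_left nsum_cmult[symmetric] mult_ac)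
    qed
    also have "\<dots> = (\<Sum>j\<in>J. nsum (\<lambda>l. nsum (\<lambda>x. of_nat (n j) * (C l * (c x * edges C Wf J m (\<rho> x - l) (n(j := n j - 1)) ((\<pi>f x)(j := \<pi>0 j + l)))))))"
      by (simp only: nsum_sum) (intro sum.cong refl nsum_swap)
    also have "\<dots> = (\<Sum>j\<in>J. of_nat (n j) * nsum (\<lambda>l. C l * br j l))"
      by (simp add: nsum_cmult br_def)
    finally have S: "nsum (\<lambda>x. c x * edges C Wf J (Suc m) (\<rho> x) n (\<pi>f x)) = (\<Sum>j\<in>J. of_nat (n j) * nsum (\<lambda>l. C l * br j l))" .
    have "(\<Sum>j\<in>J. of_nat (n j) * nsum (\<lambda>l. C l * br j l))\<^sup>2 \<le> ?K * (?A * ?P)"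
    proof (rule sum_square_le[OF finJ])
      fix j assume j: "j \<in> J"
      then have jI: "j \<in> I - B" using J B by auto
      show "(of_nat (n j) * nsum (\<lambda>l. C l * br j l))\<^sup>2 \<le> (of_nat (n j))\<^sup>2 * K j * (?A * ?P)"
      proof (cases "n j")
        case (Suc k)
        let ?a = "\<lambda>l. nsum (\<lambda>x. (c x)\<^sup>2 * cpow C m (\<rho> x - l) * (\<Prod>i\<in>B. cpow C (n i) (\<pi>f x i)))"
        let ?Q = "\<Prod>i\<in>I - B - {j}. cpow C (n i) (\<pi>0 i)"
        \<comment> \<open>The hypothesis splits the square of \<open>br j l\<close> into a factor in
          \<open>\<rho> x - l\<close> and one in \<open>\<pi>0 j + l\<close>; summing either against
          \<open>C l\<close> raises its convolution power by one.\<close>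
        have "(nsum (\<lambda>l. C l * br j l))\<^sup>2 \<le> nsum (\<lambda>l. C l * (K j * ?a l)) * nsum (\<lambda>l. C l * (cpow C k (\<pi>0 j + l) * ?Q))"
        proof (rule nsum_square_le)
          fix l
          have "inj (\<lambda>x. \<rho> x - l)" using inj by (auto simp: inj_def)
          moreover have "\<forall>x. \<forall>k\<in>I - B. ((\<pi>f x)(j := \<pi>0 j + l)) k = (\<pi>0(j := \<pi>0 j + l)) k" using eq by auto
          ultimately have "(br j l)\<^sup>2 \<le> K j * (nsum (\<lambda>x. (c x)\<^sup>2 * cpow C m (\<rho> x - l) * (\<Prod>i\<in>B. cpow C ((n(j := n j - 1)) i) (((\<pi>f x)(j := \<pi>0 j + l)) i)))
             * (\<Prod>k\<in>I - B. cpow C ((n(j := n j - 1)) k) ((\<pi>0(j := \<pi>0 j + l)) k)))"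
            unfolding br_def by (rule K)
          also have "(\<lambda>x. (c x)\<^sup>2 * cpow C m (\<rho> x - l) * (\<Prod>i\<in>B. cpow C ((n(j := n j - 1)) i) (((\<pi>f x)(j := \<pi>0 j + l)) i)))
             = (\<lambda>x. (c x)\<^sup>2 * cpow C m (\<rho> x - l) * (\<Prod>i\<in>B. cpow C (n i) (\<pi>f x i)))"
            using jI by (intro ext arg_cong2[where f="(*)"] refl prod.cong) auto
          also have "(\<Prod>k\<in>I - B. cpow C ((n(j := n j - 1)) k) ((\<pi>0(j := \<pi>0 j + l)) k)) = cpow C k (\<pi>0 j + l) * ?Q"
            using jI fin Suc by (subst prod.remove[of "I - B" j]) (auto intro!: prod.cong)
          finally show "(br j l)\<^sup>2 \<le> (K j * ?a l) * (cpow C k (\<pi>0 j + l) * ?Q)" by (simp add: mult_ac)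
        qed
        also have "nsum (\<lambda>l. C l * (cpow C k (\<pi>0 j + l) * ?Q)) = cpow C (n j) (\<pi>0 j) * ?Q"
          using cpow_uminus_Suc[of C k "\<pi>0 j", OF sym] Suc by (simp add: mult.assoc[symmetric] nsum_multc)
        also have "\<dots> = ?P"
          using jI fin by (intro prod.remove[symmetric]) auto
        also have "nsum (\<lambda>l. C l * (K j * ?a l)) = K j * ?A"
        proof -
          have "nsum (\<lambda>l. C l * (K j * ?a l)) = K j * nsum (\<lambda>l. nsum (\<lambda>x. (c x)\<^sup>2 * (C l * cpow C m (\<rho> x - l)) * (\<Prod>i\<in>B. cpow C (n i) (\<pi>f x i))))"
            by (simp add: nsum_cmult[symmetric] mult_ac)
          also have "nsum (\<lambda>l. nsum (\<lambda>x. (c x)\<^sup>2 * (C l * cpow C m (\<rho> x - l)) * (\<Prod>i\<in>B. cpow C (n i) (\<pi>f x i)))) = ?A"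
            by (subst nsum_swap) (simp add: nsum_multc nsum_cmult)
          finally show ?thesis .
        qed
        finally have "(nsum (\<lambda>l. C l * br j l))\<^sup>2 \<le> K j * ?A * ?P" .
        from mult_left_mono[OF this, of "(of_nat (n j))\<^sup>2"] show ?thesis
          by (simp add: power_mult_distrib mult_ac)
      qed simp
    qed
    then show "(nsum (\<lambda>x. c x * edges C Wf J (Suc m) (\<rho> x) n (\<pi>f x)))\<^sup>2 \<le> ?K * (?A * ?P)"
      by (simp only: S)
  qed
qed

text \<open>\<open>K\<close> does not depend on the charges. After normalisation every mixed moment
  is therefore bounded along any sequence of characters, which takes the place of
  hypercontractivity.\<close>

lemma wick_bound:
  fixes C :: "'d::ab_group_add \<Rightarrow> ennreal"
  assumes sym: "\<And>x. C (- x) = C x" and "distinct vs"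
  shows "\<exists>K<top. \<forall>\<pi>. (wick C vs n \<pi>)\<^sup>2 \<le> K * (\<Prod>i\<in>set vs. cpow C (n i) (\<pi> i))"
  using assms(2)
proof (induction vs arbitrary: n)
  case Nil
  show ?case by (intro exI[of _ 1]) simp
next
  case (Cons v vs)
  \<comment> \<open>A one-point index set and \<open>B = {}\<close> reduce the family bound to a
    single configuration.\<close>
  have "\<exists>K<top. \<forall>(c::unit \<Rightarrow> ennreal) \<rho> (\<pi>f :: unit \<Rightarrow> nat \<Rightarrow> 'd) \<pi>0. inj \<rho> \<longrightarrow> (\<forall>x. \<forall>j\<in>set vs - {}. \<pi>f x j = \<pi>0 j) \<longrightarrow>
    (nsum (\<lambda>x. c x * edges C (wick C vs) (set vs) (n v) (\<rho> x) n (\<pi>f x)))\<^sup>2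
      \<le> K * (nsum (\<lambda>x. (c x)\<^sup>2 * cpow C (n v) (\<rho> x) * (\<Prod>i\<in>{}. cpow C (n i) (\<pi>f x i)))
             * (\<Prod>j\<in>set vs - {}. cpow C (n j) (\<pi>0 j)))"
    by (rule edges_bound[where C=C, OF sym]) (use Cons in auto)
  then obtain K where Kt: "K < top" and K: "\<And>(c::unit \<Rightarrow> ennreal) \<rho> (\<pi>f :: unit \<Rightarrow> nat \<Rightarrow> 'd) \<pi>0. inj \<rho> \<Longrightarrow> (\<forall>x. \<forall>j\<in>set vs - {}. \<pi>f x j = \<pi>0 j) \<Longrightarrow>
    (nsum (\<lambda>x. c x * edges C (wick C vs) (set vs) (n v) (\<rho> x) n (\<pi>f x)))\<^sup>2
      \<le> K * (nsum (\<lambda>x. (c x)\<^sup>2 * cpow C (n v) (\<rho> x) * (\<Prod>i\<in>{}. cpow C (n i) (\<pi>f x i)))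
             * (\<Prod>j\<in>set vs - {}. cpow C (n j) (\<pi>0 j)))"
    by blast
  have unit: "nsum (f :: unit \<Rightarrow> ennreal) = f ()" for f
    using nsum_delta[of "()" f] by simp
  have "(wick C (v # vs) n \<pi>)\<^sup>2 \<le> K * (\<Prod>i\<in>set (v # vs). cpow C (n i) (\<pi> i))" for \<pi>
    using K[of "\<lambda>_. \<pi> v" "\<lambda>_. \<pi>" \<pi> "\<lambda>_. 1"] Cons.prems by (simp add: unit inj_def)
  then show ?case using Kt by blast
qed

text \<open>The family index is now the charge \<open>\<mu>\<close> of the bundle to
  \<open>i\<close>, with \<open>c = cpow C q\<close>. The weight of the bundle stays squared instead
  of being shared between its ends, and this is the surplus that (c) controls.\<close>

lemma pairing_bound:
  fixes C :: "'d::ab_group_add \<Rightarrow> ennreal"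
  assumes sym: "\<And>x. C (- x) = C x" and vs: "distinct vs" "i \<in> set vs" "q \<le> n i"
  shows "\<exists>K<top. \<forall>\<rho> \<pi>. (pairing C (wick C vs) (set vs) i r q \<rho> n \<pi>)\<^sup>2 \<le>
     K * (nsum (\<lambda>\<mu>. (cpow C q \<mu>)\<^sup>2 * cpow C r (\<rho> - \<mu>) * cpow C (n i - q) (\<pi> i + \<mu>))
       * (\<Prod>j\<in>set vs - {i}. cpow C (n j) (\<pi> j)))"
proof -
  let ?n = "n(i := n i - q)"
  have "\<exists>K<top. \<forall>(c::'d \<Rightarrow> ennreal) \<rho> (\<pi>f :: 'd \<Rightarrow> nat \<Rightarrow> 'd) \<pi>0. inj \<rho> \<longrightarrow> (\<forall>x. \<forall>j\<in>set vs - {i}. \<pi>f x j = \<pi>0 j) \<longrightarrow>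
    (nsum (\<lambda>x. c x * edges C (wick C vs) (set vs - {i}) r (\<rho> x) ?n (\<pi>f x)))\<^sup>2
      \<le> K * (nsum (\<lambda>x. (c x)\<^sup>2 * cpow C r (\<rho> x) * (\<Prod>k\<in>{i}. cpow C (?n k) (\<pi>f x k)))
             * (\<Prod>j\<in>set vs - {i}. cpow C (?n j) (\<pi>0 j)))"
    by (rule edges_bound[where C=C, OF sym]) (use vs wick_bound[where C=C, OF sym vs(1)] in auto)
  then obtain K where Kt: "K < top" and K: "\<And>(c::'d \<Rightarrow> ennreal) \<rho> (\<pi>f :: 'd \<Rightarrow> nat \<Rightarrow> 'd) \<pi>0. inj \<rho> \<Longrightarrow> (\<forall>x. \<forall>j\<in>set vs - {i}. \<pi>f x j = \<pi>0 j) \<Longrightarrow>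
    (nsum (\<lambda>x. c x * edges C (wick C vs) (set vs - {i}) r (\<rho> x) ?n (\<pi>f x)))\<^sup>2
      \<le> K * (nsum (\<lambda>x. (c x)\<^sup>2 * cpow C r (\<rho> x) * (\<Prod>k\<in>{i}. cpow C (?n k) (\<pi>f x k)))
             * (\<Prod>j\<in>set vs - {i}. cpow C (?n j) (\<pi>0 j)))"
    by blast
  have "(\<Prod>j\<in>set vs - {i}. cpow C (?n j) (\<pi> j)) = (\<Prod>j\<in>set vs - {i}. cpow C (n j) (\<pi> j))" for \<pi>
    by (rule prod.cong) auto
  then have "(pairing C (wick C vs) (set vs) i r q \<rho> n \<pi>)\<^sup>2 \<le>
     K * (nsum (\<lambda>\<mu>. (cpow C q \<mu>)\<^sup>2 * cpow C r (\<rho> - \<mu>) * cpow C (n i - q) (\<pi> i + \<mu>))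
       * (\<Prod>j\<in>set vs - {i}. cpow C (n j) (\<pi> j)))" for \<rho> \<pi>
    using K[of "\<lambda>\<mu>. \<rho> - \<mu>" "\<lambda>\<mu>. \<pi>(i := \<pi> i + \<mu>)" \<pi> "cpow C q"] by (simp add: inj_def pairing_def)
  then show ?thesis using Kt by blast
qed

text \<open>The contraction of order \<open>q\<close> between two vertices. It is to be compared
  with the product of \<open>cpow C n1 \<pi>1\<close> and \<open>cpow C n2 \<pi>2\<close>; the
  quotient tends to 0 in \<open>gain_ratio\<close>.\<close>

definition gain :: "('d::ab_group_add \<Rightarrow> ennreal) \<Rightarrow> nat \<Rightarrow> 'd \<Rightarrow> nat \<Rightarrow> 'd \<Rightarrow> nat \<Rightarrow> ennreal" where
  "gain C n1 \<pi>1 n2 \<pi>2 q =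
    nsum (\<lambda>\<mu>. (cpow C q \<mu>)\<^sup>2 * cpow C (n1 - q) (\<pi>1 - \<mu>) * cpow C (n2 - q) (\<pi>2 + \<mu>))"

text \<open>Only the complete matching of two vertices of equal order is excluded; a bundle that
  exhausts the smaller of two unequal vertices counts as partial.\<close>

definition partial_pairings :: "nat \<Rightarrow> nat list \<Rightarrow> (nat \<Rightarrow> nat) \<Rightarrow> (nat \<times> nat) set" where
  "partial_pairings v vs n =
    {(i, q). i \<in> set vs \<and> 1 \<le> q \<and> q \<le> n v \<and> q \<le> n i \<and> \<not> (n i = n v \<and> q = n v)}"

lemma finite_partial_pairings: "finite (partial_pairings v vs n)"
  by (rule finite_subset[of _ "set vs \<times> {..n v}"]) (auto simp: partial_pairings_def)

lemma pairing_full: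
  "pairing C Wf J i 0 q \<rho> n \<pi> = cpow C q \<rho> * Wf (n(i := n i - q)) (\<pi>(i := \<pi> i + \<rho>))"
proof -
  have "pairing C Wf J i 0 q \<rho> n \<pi> =
     nsum (\<lambda>\<mu>. if \<mu> = \<rho> then cpow C q \<mu> * Wf (n(i := n i - q)) (\<pi>(i := \<pi> i + \<mu>)) else 0)"
    unfolding pairing_def by (rule nn_integral_cong) auto
  then show ?thesis by (simp only: nsum_delta)
qed

text \<open>Expand at the partner \<open>i\<close> of the first half-edge of \<open>v\<close> and at
  the size \<open>q\<close> of the bundle to it. The bundles that saturate both ends form the
  Gaussian recursion, all others go into \<open>R\<close>. The constant \<open>K\<close> is chosen
  before the charges.\<close>

lemma wick_decomp:
  fixes C :: "'d::ab_group_add \<Rightarrow> ennreal"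
  assumes sym: "\<And>x. C (- x) = C x" and vs: "distinct (v # vs)" and nv: "n v > 0"
  shows "\<exists>K<top. \<forall>\<pi>. \<exists>R. wick C (v # vs) n \<pi> =
      (\<Sum>i\<in>set vs. if n i = n v \<and> \<pi> v + \<pi> i = 0 then fact (n v) * cpow C (n v) (\<pi> v) * wick C (remove1 i vs) n \<pi> else 0) + R \<and>
      R\<^sup>2 \<le> K * (\<Sum>(i, q)\<in>partial_pairings v vs n. gain C (n v) (\<pi> v) (n i) (\<pi> i) q * (\<Prod>j\<in>set vs - {i}. cpow C (n j) (\<pi> j)))"
proof -
  obtain m where m: "n v = Suc m" using nv by (cases "n v") auto
  let ?S = "partial_pairings v vs n"
  \<comment> \<open>\<open>q\<close> counts the whole bundle, first half-edge included, whereas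
    \<open>pcoef\<close> counts the remaining edges, hence \<open>q - 1\<close>.\<close>
  let ?c = "\<lambda>i q. of_nat (n i * pcoef m (n i - 1) (q - 1)) :: ennreal"
  let ?P = "\<lambda>i q \<pi>. pairing C (wick C vs) (set vs) i (Suc m - q) q (\<pi> v) n \<pi>"
  let ?G = "\<lambda>\<pi> (i, q). gain C (n v) (\<pi> v) (n i) (\<pi> i) q * (\<Prod>j\<in>set vs - {i}. cpow C (n j) (\<pi> j))"
  have "\<exists>K. \<forall>s\<in>?S. K s < top \<and> (\<forall>\<pi>. (?P (fst s) (snd s) \<pi>)\<^sup>2 \<le> K s * ?G \<pi> s)"
  proof (intro bchoice ballI)
    fix s assume s: "s \<in> ?S"
    obtain i q where iq: "s = (i, q)" by force
    show "\<exists>K. K < top \<and> (\<forall>\<pi>. (?P (fst s) (snd s) \<pi>)\<^sup>2 \<le> K * ?G \<pi> s)"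
      using pairing_bound[of C vs i q n "Suc m - q", OF sym] vs s m
      by (auto simp: iq partial_pairings_def gain_def)
  qed
  then obtain K where K: "\<And>s. s \<in> ?S \<Longrightarrow> K s < top" "\<And>s \<pi>. s \<in> ?S \<Longrightarrow> (?P (fst s) (snd s) \<pi>)\<^sup>2 \<le> K s * ?G \<pi> s"
    by blast
  let ?K = "of_nat (card ?S) * (\<Sum>s\<in>?S. (?c (fst s) (snd s))\<^sup>2 * K s)"
  show ?thesis
  proof (rule exI[of _ ?K], intro conjI allI)
    show "?K < top" using K(1) finite_partial_pairings
      by (auto simp: ennreal_mult_less_top power2_eq_square of_nat_less_top)
    fix \<pi>
    let ?R = "\<Sum>s\<in>?S. ?c (fst s) (snd s) * ?P (fst s) (snd s) \<pi>"
    let ?M = "\<lambda>i. if n i = n v \<and> \<pi> v + \<pi> i = 0 then fact (n v) * cpow C (n v) (\<pi> v) * wick C (remove1 i vs) n \<pi> else 0"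
    let ?Q = "\<lambda>i. {q. 1 \<le> q \<and> q \<le> n v \<and> q \<le> n i \<and> \<not> (n i = n v \<and> q = n v)}"
    have finQ: "finite (?Q i)" for i by (rule finite_subset[of _ "{..n v}"]) auto
    have S: "?S = Sigma (set vs) ?Q" by (auto simp: partial_pairings_def)
    have "wick C (v # vs) n \<pi> = (\<Sum>i\<in>set vs. \<Sum>q\<le>m. ?c i (Suc q) * ?P i (Suc q) \<pi>)"
      by (simp add: m edges_expand del: edges.simps)
    also have "\<dots> = (\<Sum>i\<in>set vs. \<Sum>q\<in>{1..Suc m}. ?c i q * ?P i q \<pi>)"
      by (intro sum.cong refl sum.reindex_bij_witness[of _ "\<lambda>q. q - 1" Suc]) auto
    also have "\<dots> = (\<Sum>i\<in>set vs. ?M i + (\<Sum>q\<in>?Q i. ?c i q * ?P i q \<pi>))"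
    proof (rule sum.cong[OF refl])
      fix i assume i: "i \<in> set vs"
      have z: "?c i q = 0" if "q > n i" for q using that by (auto simp: pcoef_def)
      show "(\<Sum>q\<in>{1..Suc m}. ?c i q * ?P i q \<pi>) = ?M i + (\<Sum>q\<in>?Q i. ?c i q * ?P i q \<pi>)"
      proof (cases "n i = n v")
        case True
        \<comment> \<open>The full bundle uses up \<open>v\<close> and \<open>i\<close> together;
          \<open>i\<close> is then removed as an empty vertex, which forces opposite
          charges.\<close>
        have "?c i (Suc m) * ?P i (Suc m) \<pi> = ?M i"
        proof -
          have "wick C vs (n(i := 0)) (\<pi>(i := \<pi> i + \<pi> v)) =
            (if \<pi> v + \<pi> i = 0 then wick C (remove1 i vs) n \<pi> else 0)"
            by (subst wick_zero_vertex[of _ i])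
              (use vs i in \<open>auto intro!: wick_cong simp: add.commute\<close>)
          moreover have "n i * pcoef m (n i - 1) m = fact (Suc m)"
            using True m by (simp add: pcoef_def)
          ultimately show ?thesis using True m by (simp add: pairing_full mult.assoc del: fact_Suc)
        qed
        moreover have "{1..Suc m} = insert (Suc m) (?Q i)" "Suc m \<notin> ?Q i"
          using True m by auto
        ultimately show ?thesis using finQ[of i] by simp
      next
        case False
        have "(\<Sum>q\<in>{1..Suc m}. ?c i q * ?P i q \<pi>) = (\<Sum>q\<in>?Q i. ?c i q * ?P i q \<pi>)"
        proof (rule sum.mono_neutral_right)
          show "\<forall>q\<in>{1..Suc m} - ?Q i. ?c i q * ?P i q \<pi> = 0"
          proof
            fix q assume "q \<in> {1..Suc m} - ?Q i"
            then have "q > n i" using False m by auto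
            then show "?c i q * ?P i q \<pi> = 0" by (simp only: z mult_zero_left)
          qed
        qed (use False m in auto)
        then show ?thesis using False by simp
      qed
    qed
    also have "\<dots> = (\<Sum>i\<in>set vs. ?M i) + ?R"
      unfolding sum.distrib S by (subst sum.Sigma) (use finQ in \<open>auto simp: case_prod_beta\<close>)
    finally have 1: "wick C (v # vs) n \<pi> = (\<Sum>i\<in>set vs. ?M i) + ?R" .
    have "?R\<^sup>2 \<le> (of_nat (card ?S) * (\<Sum>s\<in>?S. (?c (fst s) (snd s))\<^sup>2 * K s * ?G \<pi> s)) * 1"
    proof (rule sum_square_le[OF finite_partial_pairings])
      fix s assume "s \<in> ?S"
      from mult_left_mono[OF K(2)[OF this], of "(?c (fst s) (snd s))\<^sup>2" \<pi>]
      show "(?c (fst s) (snd s) * ?P (fst s) (snd s) \<pi>)\<^sup>2 \<le> (?c (fst s) (snd s))\<^sup>2 * K s * ?G \<pi> s * 1"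
        by (simp add: power_mult_distrib mult_ac)
    qed
    also have "\<dots> \<le> of_nat (card ?S) * (\<Sum>s\<in>?S. (?c (fst s) (snd s))\<^sup>2 * K s * (\<Sum>s\<in>?S. ?G \<pi> s))"
      unfolding mult_1_right
      by (intro mult_left_mono sum_mono member_le_sum finite_partial_pairings) auto
    also have "\<dots> = ?K * (\<Sum>s\<in>?S. ?G \<pi> s)"
      by (simp only: sum_distrib_right mult.assoc)
    finally have 2: "?R\<^sup>2 \<le> ?K * (\<Sum>s\<in>?S. ?G \<pi> s)" .
    show "\<exists>R. wick C (v # vs) n \<pi> = (\<Sum>i\<in>set vs. ?M i) + R \<and> R\<^sup>2 \<le> ?K * (\<Sum>(i, q)\<in>?S. gain C (n v) (\<pi> v) (n i) (\<pi> i) q * (\<Prod>j\<in>set vs - {i}. cpow C (n j) (\<pi> j)))"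
      using 1 2 by blast
  qed
qed

section \<open>Exact values and lower bounds for small diagrams\<close>

lemma edges_empty: "edges C Wf {} m \<rho> n \<pi> = (if m = 0 \<and> \<rho> = 0 then Wf n \<pi> else 0)"
  by (cases m) auto

lemma wick_pair:
  assumes "a \<noteq> b"
  shows "wick C [a, b] n \<pi> = (if n a = n b \<and> \<pi> a + \<pi> b = 0 then fact (n a) * cpow C (n a) (\<pi> a) else 0)"
proof -
  let ?m = "n a"
  have 0: "pairing C (wick C [b]) {b} b r q (\<pi> a) n \<pi> = 0" if "r > 0" for r q
    using that by (simp add: pairing_def edges_empty)
  have "wick C [a, b] n \<pi> = (\<Sum>q\<le>?m. of_nat (pcoef ?m (n b) q) * pairing C (wick C [b]) {b} b (?m - q) q (\<pi> a) n \<pi>)"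
    using edges_product[of "{b}" b C "wick C [b]" ?m] by simp
  also have "\<dots> = (\<Sum>q\<in>{?m}. of_nat (pcoef ?m (n b) q) * pairing C (wick C [b]) {b} b (?m - q) q (\<pi> a) n \<pi>)"
    by (rule sum.mono_neutral_right) (auto intro!: 0)
  also have "\<dots> = of_nat (pcoef ?m (n b) ?m) * (cpow C ?m (\<pi> a) * (if n b \<le> ?m \<and> \<pi> a + \<pi> b = 0 then 1 else 0))"
    by (simp add: pairing_full edges_empty add.commute)
  finally show ?thesis by (cases "n b < ?m") (auto simp: pcoef_def)
qed

lemma edges_ge_pairing:
  assumes "finite J" "i \<in> J" "q \<le> m"
  shows "of_nat (pcoef m (n i) q) * pairing C Wf J i (m - q) q \<rho> n \<pi> \<le> edges C Wf J m \<rho> n \<pi>"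
  unfolding edges_product[OF assms(1,2), of C Wf m]
  by (rule member_le_sum[of q "{..m}" "\<lambda>q. of_nat (pcoef m (n i) q) * pairing C Wf J i (m - q) q \<rho> n \<pi>"])
    (use assms in auto)

lemma edges_ge_full:
  assumes "finite J" "i \<in> J" "m \<le> n i"
  shows "fact m * (cpow C m \<rho> * Wf (n(i := n i - m)) (\<pi>(i := \<pi> i + \<rho>))) \<le> edges C Wf J m \<rho> n \<pi>"
proof -
  have "fact m * 1 \<le> pcoef m (n i) m"
    unfolding pcoef_def using assms(3) by (auto simp: Suc_le_eq)
  then have "(fact m :: ennreal) \<le> of_nat (pcoef m (n i) m)"
    by (metis mult_1_right of_nat_fact of_nat_le_iff)
  then have "fact m * (cpow C m \<rho> * Wf (n(i := n i - m)) (\<pi>(i := \<pi> i + \<rho>)))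
     \<le> of_nat (pcoef m (n i) m) * pairing C Wf J i (m - m) m \<rho> n \<pi>"
    unfolding diff_self_eq_0 pairing_full by (rule mult_right_mono) simp
  also have "\<dots> \<le> edges C Wf J m \<rho> n \<pi>" by (rule edges_ge_pairing[OF assms(1,2)]) simp
  finally show ?thesis .
qed

text \<open>Every edge takes a charge from one end and adds it to the other, so the total charge is
  invariant while edges are placed, and at the end it has to be 0.\<close>

lemma wick_neutral:
  assumes "distinct vs" "wick C vs n \<pi> \<noteq> 0"
  shows "(\<Sum>i\<in>set vs. \<pi> i) = 0"
proof -
  have edges: "edges C Wf J m \<rho> n \<pi> = 0" if "\<And>n \<pi>. (\<Sum>i\<in>I. \<pi> i) \<noteq> 0 \<Longrightarrow> Wf n \<pi> = 0"
    "finite I" "J \<subseteq> I" "\<rho> + (\<Sum>i\<in>I. \<pi> i) \<noteq> 0" for Wf J I m \<rho> n \<pi>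
    using that(4)
  proof (induction m arbitrary: \<rho> n \<pi>)
    case 0
    then show ?case using that(1) by auto
  next
    case (Suc m)
    have "edges C Wf J m (\<rho> - l) (n(j := n j - 1)) (\<pi>(j := \<pi> j + l)) = 0" if "j \<in> J" for j l
    proof (rule Suc.IH)
      have "j \<in> I" using that \<open>J \<subseteq> I\<close> by auto
      then have "(\<Sum>i\<in>I. (\<pi>(j := \<pi> j + l)) i) = \<pi> j + l + (\<Sum>i\<in>I - {j}. \<pi> i)"
        using \<open>finite I\<close> by (simp add: sum.remove)
      also have "\<dots> = (\<Sum>i\<in>I. \<pi> i) + l"
        using \<open>finite I\<close> \<open>j \<in> I\<close> by (simp add: sum.remove algebra_simps)
      finally show "\<rho> - l + (\<Sum>i\<in>I. (\<pi>(j := \<pi> j + l)) i) \<noteq> 0" using Suc.prems by (simp add: algebra_simps)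
    qed
    then show ?case by simp
  qed
  show ?thesis using assms
  proof (induction vs arbitrary: n \<pi>)
    case (Cons v vs)
    have "edges C (wick C vs) (set vs) (n v) (\<pi> v) n \<pi> = 0" if "\<pi> v + (\<Sum>i\<in>set vs. \<pi> i) \<noteq> 0"
      by (rule edges[where I="set vs"]) (use Cons that in auto)
    then show ?case using Cons.prems by auto
  qed simp
qed

lemma wick_finite:
  fixes C :: "'d::ab_group_add \<Rightarrow> ennreal"
  assumes sym: "\<And>x. C (- x) = C x" and "nsum C \<le> 1" "distinct vs"
  shows "wick C vs n \<pi> < top"
proof -
  obtain K where K: "K < top" "(wick C vs n \<pi>)\<^sup>2 \<le> K * (\<Prod>i\<in>set vs. cpow C (n i) (\<pi> i))"
    using wick_bound[where C=C, OF sym assms(3)] by blast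
  have "(\<Prod>i\<in>set vs. cpow C (n i) (\<pi> i)) \<le> 1"
    by (rule prod_le_1) (auto intro!: cpow_le assms)
  then have "K * (\<Prod>i\<in>set vs. cpow C (n i) (\<pi> i)) \<le> K * 1" by (rule mult_left_mono) simp
  then have "(wick C vs n \<pi>)\<^sup>2 < top" using K by (simp add: le_less_trans)
  then show ?thesis by (simp add: power_less_top_ennreal)
qed

text \<open>All diagrams are nonnegative, so some may be dropped. The two complete matchings of
  opposite charges give the Gaussian part, and one cyclic diagram gives the square sum of
  (c).\<close>

lemma wick_fourth_lower:
  fixes C :: "'d::ab_group_add \<Rightarrow> ennreal"
  assumes sym: "\<And>x. C (- x) = C x" and m: "1 \<le> q" "q < m"
    and \<pi>: "\<pi> 0 = \<tau>" "\<pi> 1 = - \<tau>" "\<pi> 2 = \<tau>" "\<pi> 3 = - \<tau>"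
  shows "wick C [0, 1, 2, 3] (\<lambda>_. m) \<pi> \<ge>
    2 * (fact m * cpow C m \<tau>)\<^sup>2 + nsum (\<lambda>\<mu>. (cpow C q \<mu>)\<^sup>2 * (cpow C (m - q) (\<tau> - \<mu>))\<^sup>2)"
proof -
  let ?n = "\<lambda>_::nat. m"
  define W where "W = wick C [1, 2, 3]"
  let ?J = "{1, 2, 3} :: nat set"
  have [simp]: "\<pi> (Suc 0) = - \<tau>" using \<pi> by simp
  let ?t = "\<lambda>k. of_nat (pcoef m m k) * pairing C W ?J 1 (m - k) k \<tau> ?n \<pi>"
  have "wick C [0, 1, 2, 3] ?n \<pi> = (\<Sum>k\<le>m. ?t k)"
  proof -
    have "wick C [0, 1, 2, 3] ?n \<pi> = edges C W ?J m \<tau> ?n \<pi>" using \<pi> unfolding W_def by (subst wick.simps) auto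
    also have "\<dots> = (\<Sum>k\<le>m. ?t k)" by (subst edges_product[of ?J 1]) auto
    finally show ?thesis .
  qed
  \<comment> \<open>\<open>k\<close> counts the edges between the vertices 0 and 1; the three values
    are distinct because \<open>q\<close> lies strictly between 0 and \<open>m\<close>.\<close>
  also have "\<dots> \<ge> (\<Sum>k\<in>{0, q, m}. ?t k)"
    by (rule sum_mono2) (use m in auto)
  finally have W: "wick C [0, 1, 2, 3] ?n \<pi> \<ge> ?t 0 + ?t q + ?t m"
    using m by (simp add: add.assoc)
  have Wi: "W (?n(1 := 0)) (\<pi>(1 := 0)) = fact m * cpow C m \<tau>"
    unfolding W_def by (subst wick_zero_vertex[of _ 1]) (auto simp: wick_pair \<pi> simp del: wick.simps)
  have Wi3: "W (?n(3 := 0)) (\<pi>(3 := 0)) = fact m * cpow C m \<tau>"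
    unfolding W_def by (subst wick_zero_vertex[of _ 3]) (auto simp: wick_pair \<pi> cpow_uminus[of C, OF sym] simp del: wick.simps)
  have tm: "?t m = (fact m * cpow C m \<tau>)\<^sup>2"
    using Wi by (simp add: pairing_full pcoef_def power2_eq_square mult_ac del: wick.simps)
  have "?t 0 = nsum (\<lambda>\<mu>. if \<mu> = 0 then edges C W (?J - {1}) m (\<tau> - \<mu>) (?n(1 := m)) (\<pi>(1 := \<pi> 1 + \<mu>)) else 0)"
    unfolding pairing_def by (auto intro!: nn_integral_cong simp: pcoef_def)
  also have "\<dots> = edges C W (?J - {1}) m \<tau> (?n(1 := m)) (\<pi>(1 := \<pi> 1 + 0))"
    by (simp only: nsum_delta) simp
  also have "\<dots> = edges C W (?J - {1}) m \<tau> ?n \<pi>"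
    by (intro arg_cong2[where f="edges C W (?J - {1}) m \<tau>"]) auto
  \<comment> \<open>No edge joins 0 and 1; keep the complete matching of 0 with 3, which leaves 1
    with 2.\<close>
  also have "\<dots> \<ge> fact m * (cpow C m \<tau> * W (?n(3 := m - m)) (\<pi>(3 := \<pi> 3 + \<tau>)))"
    by (rule edges_ge_full) auto
  finally have t0: "?t 0 \<ge> (fact m * cpow C m \<tau>)\<^sup>2"
    using Wi3 by (simp add: \<pi> power2_eq_square mult_ac del: wick.simps fun_upd_apply)
  \<comment> \<open>The cycle 0-1-2-3: bundles of \<open>q\<close> edges on 0-1 and 2-3 carry
    \<open>\<mu>\<close>, bundles of \<open>m - q\<close> edges on 0-3 and 1-2 carry
    \<open>\<tau> - \<mu>\<close>, up to sign.\<close>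
  have "nsum (\<lambda>\<mu>. (cpow C q \<mu>)\<^sup>2 * (cpow C (m - q) (\<tau> - \<mu>))\<^sup>2) \<le> pairing C W ?J 1 (m - q) q \<tau> ?n \<pi>"
    unfolding pairing_def
  proof (rule nn_integral_mono)
    fix \<mu> :: 'd
    let ?n1 = "?n(1 := m - q)" and ?\<pi>1 = "\<pi>(1 := \<pi> 1 + \<mu>)"
    let ?n2 = "?n1(3 := q)" and ?\<pi>2 = "?\<pi>1(3 := - \<mu>)"
    have one: "1 \<le> (fact k :: ennreal)" for k using fact_ge_1[of k] by (metis of_nat_1 of_nat_fact of_nat_le_iff)
    have "cpow C q \<mu> \<le> wick C [2, 3] (?n2(2 := q)) (?\<pi>2(2 := \<mu>))"
      using mult_right_mono[OF one[of q], of "cpow C q \<mu>"] by (subst wick_pair) auto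
    then have "1 * (cpow C (m - q) (\<tau> - \<mu>) * cpow C q \<mu>) \<le>
       fact (m - q) * (cpow C (m - q) (?\<pi>2 1) * wick C [2, 3] (?n2(2 := ?n2 2 - (m - q))) (?\<pi>2(2 := ?\<pi>2 2 + ?\<pi>2 1)))"
      using m cpow_uminus[of C "m - q" "\<tau> - \<mu>", OF sym] one[of "m - q"]
      by (intro mult_mono) (auto simp: \<pi> simp del: wick.simps)
    also have "\<dots> \<le> edges C (wick C [2, 3]) {2, 3} (m - q) (?\<pi>2 1) ?n2 ?\<pi>2"
      by (rule edges_ge_full) (use m in auto)
    also have "\<dots> = W ?n2 ?\<pi>2" using m by (simp add: W_def)
    finally have "1 * (cpow C (m - q) (\<tau> - \<mu>) * (cpow C (m - q) (\<tau> - \<mu>) * cpow C q \<mu>)) \<le>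
       fact (m - q) * (cpow C (m - q) (\<tau> - \<mu>) * W (?n1(3 := ?n1 3 - (m - q))) (?\<pi>1(3 := ?\<pi>1 3 + (\<tau> - \<mu>))))"
      using m one[of "m - q"]
      by (intro mult_mono) (auto simp: \<pi> simp del: wick.simps)
    also have "\<dots> \<le> edges C W (?J - {1}) (m - q) (\<tau> - \<mu>) ?n1 ?\<pi>1"
      by (rule edges_ge_full) (use m in auto)
    finally have "cpow C q \<mu> * (cpow C (m - q) (\<tau> - \<mu>) * (cpow C (m - q) (\<tau> - \<mu>) * cpow C q \<mu>)) \<le>
       cpow C q \<mu> * edges C W (?J - {1}) (m - q) (\<tau> - \<mu>) ?n1 ?\<pi>1"
      by (intro mult_left_mono) auto
    then show "(cpow C q \<mu>)\<^sup>2 * (cpow C (m - q) (\<tau> - \<mu>))\<^sup>2 \<le>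
      cpow C q \<mu> * edges C W (?J - {1}) (m - q) (\<tau> - \<mu>) (?n(1 := m - q)) (\<pi>(1 := \<pi> 1 + \<mu>))"
      by (simp add: power2_eq_square mult_ac)
  qed
  moreover have "1 \<le> pcoef m m q" using m by (simp add: pcoef_def Suc_le_eq)
  then have "(1::ennreal) \<le> of_nat (pcoef m m q)" by (metis of_nat_1 of_nat_le_iff)
  ultimately have "1 * nsum (\<lambda>\<mu>. (cpow C q \<mu>)\<^sup>2 * (cpow C (m - q) (\<tau> - \<mu>))\<^sup>2) \<le> ?t q"
    by (intro mult_mono) auto
  then have "(fact m * cpow C m \<tau>)\<^sup>2 + nsum (\<lambda>\<mu>. (cpow C q \<mu>)\<^sup>2 * (cpow C (m - q) (\<tau> - \<mu>))\<^sup>2) + (fact m * cpow C m \<tau>)\<^sup>2 \<le> ?t 0 + ?t q + ?t m"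
    using t0 tm by (intro add_mono) auto
  then show ?thesis using W by (simp add: mult_2 algebra_simps del: wick.simps)
qed

section \<open>Hermite polynomials\<close>

fun hpoly :: "nat \<Rightarrow> real poly" where
  "hpoly 0 = 1"
| "hpoly (Suc n) = [:0, 1:] * hpoly n - pderiv (hpoly n)"

lemma pderiv_hpoly: "pderiv (hpoly n) = smult (of_nat n) (hpoly (n - 1))"
proof (induction n)
  case (Suc n)
  have "pderiv (hpoly (Suc n)) = hpoly n + [:0, 1:] * pderiv (hpoly n) - pderiv (pderiv (hpoly n))"
    by (simp add: pderiv_mult pderiv_diff pderiv_pCons algebra_simps)
  also have "pderiv (pderiv (hpoly n)) = smult (of_nat n) (pderiv (hpoly (n - 1)))"
    by (simp add: Suc.IH pderiv_smult)
  also have "[:0, 1:] * pderiv (hpoly n) = smult (of_nat n) ([:0, 1:] * hpoly (n - 1))"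
    by (simp add: Suc.IH)
  also have "hpoly n + smult (of_nat n) ([:0, 1:] * hpoly (n - 1)) - smult (of_nat n) (pderiv (hpoly (n - 1)))
    = hpoly n + smult (of_nat n) (hpoly n)"
    by (cases n) (auto simp: smult_diff_right)
  finally show ?case by (simp add: smult_add_left)
qed (simp add: pderiv_1)

lemma pderiv_sum: "pderiv (\<Sum>i\<in>A. f i) = (\<Sum>i\<in>A. pderiv (f i))"
  by (induction A rule: infinite_finite_induct) (auto simp: pderiv_add)

text \<open>Rodrigues' formula: differentiating a polynomial times the Gaussian reproduces the
  recursion of \<open>hpoly\<close> up to sign.\<close>

lemma hermite_eq_poly: "hermite m x = poly (hpoly m) x"
proof -
  have "(deriv ^^ m) (\<lambda>y::real. exp (- y\<^sup>2 / 2)) = (\<lambda>x. (-1) ^ m * poly (hpoly m) x * exp (- x\<^sup>2 / 2))"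
  proof (induction m)
    case (Suc m)
    have "(deriv ^^ Suc m) (\<lambda>y::real. exp (- y\<^sup>2 / 2)) = deriv (\<lambda>x. (-1) ^ m * poly (hpoly m) x * exp (- x\<^sup>2 / 2))"
      by (simp only: funpow.simps comp_apply Suc.IH)
    also have "\<dots> = (\<lambda>x. (-1) ^ Suc m * poly (hpoly (Suc m)) x * exp (- x\<^sup>2 / 2))"
    proof
      fix x :: real
      have "((\<lambda>x. (-1) ^ m * poly (hpoly m) x * exp (- x\<^sup>2 / 2)) has_real_derivative
        (-1) ^ m * poly (hpoly m) x * (exp (- x\<^sup>2 / 2) * (- x)) + (-1) ^ m * poly (pderiv (hpoly m)) x * exp (- x\<^sup>2 / 2)) (at x)"
        by (auto intro!: derivative_eq_intros simp: power2_eq_square)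
      then show "deriv (\<lambda>x. (-1) ^ m * poly (hpoly m) x * exp (- x\<^sup>2 / 2)) x =
         (-1) ^ Suc m * poly (hpoly (Suc m)) x * exp (- x\<^sup>2 / 2)"
        by (intro DERIV_imp_deriv) (simp add: algebra_simps)
    qed
    finally show ?case .
  qed simp
  then have "hermite m x = ((-1) ^ m * (-1) ^ m) * (exp (x\<^sup>2 / 2) * exp (- x\<^sup>2 / 2)) * poly (hpoly m) x"
    unfolding hermite_def by (simp only: mult_ac)
  then show ?thesis by (simp flip: exp_add power_mult_distrib)
qed

section \<open>Random variables with moments of all orders\<close>

text \<open>Being closed under sums, products and polynomials, it makes the integrability of every
  mixed moment a matter of syntax.\<close>

definition all_moments :: "'w measure \<Rightarrow> ('w \<Rightarrow> 'a::{real_normed_field, second_countable_topology, banach}) \<Rightarrow> bool" where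
  "all_moments M X \<longleftrightarrow> X \<in> borel_measurable M \<and> (\<forall>k::nat. integrable M (\<lambda>w. norm (X w) ^ k))"

lemma all_moments_measurable[measurable_dest]: "all_moments M X \<Longrightarrow> X \<in> borel_measurable M"
  by (simp add: all_moments_def)

lemma all_moments_integrable: "all_moments M X \<Longrightarrow> integrable M X"
  using integrable_norm_cancel[of M X] by (auto simp: all_moments_def dest: spec[of _ 1])

lemma all_moments_mult:
  assumes "all_moments M X" "all_moments M Y"
  shows "all_moments M (\<lambda>w. X w * Y w)"
  unfolding all_moments_def
proof (intro conjI allI)
  have [measurable]: "X \<in> borel_measurable M" "Y \<in> borel_measurable M" using assms by (auto simp: all_moments_def)
  show "(\<lambda>w. X w * Y w) \<in> borel_measurable M" by measurable
  fix k :: nat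
  have "integrable M (\<lambda>w. norm (X w) ^ (2 * k) + norm (Y w) ^ (2 * k))"
    using assms by (intro Bochner_Integration.integrable_add) (auto simp: all_moments_def)
  then show "integrable M (\<lambda>w. norm (X w * Y w) ^ k)"
  proof (rule Bochner_Integration.integrable_bound)
    show "AE w in M. norm (norm (X w * Y w) ^ k) \<le> norm (norm (X w) ^ (2 * k) + norm (Y w) ^ (2 * k))"
    proof (rule AE_I2)
      fix w
      have "norm (X w) ^ k * norm (Y w) ^ k \<le> (norm (X w) ^ k)\<^sup>2 + (norm (Y w) ^ k)\<^sup>2"
      proof -
        have "0 \<le> norm (X w) ^ k * norm (Y w) ^ k" by simp
        then show ?thesis using sum_squares_bound[of "norm (X w) ^ k" "norm (Y w) ^ k"] by linarith
      qed
      then show "norm (norm (X w * Y w) ^ k) \<le> norm (norm (X w) ^ (2 * k) + norm (Y w) ^ (2 * k))"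
        by (simp add: norm_mult power_mult_distrib power_even_eq)
    qed
  qed measurable
qed

lemma all_moments_add:
  assumes "all_moments M X" "all_moments M Y"
  shows "all_moments M (\<lambda>w. X w + Y w)"
  unfolding all_moments_def
proof (intro conjI allI)
  have [measurable]: "X \<in> borel_measurable M" "Y \<in> borel_measurable M" using assms by (auto simp: all_moments_def)
  show "(\<lambda>w. X w + Y w) \<in> borel_measurable M" by measurable
  fix k :: nat
  have "integrable M (\<lambda>w. 2 ^ k * (norm (X w) ^ k + norm (Y w) ^ k))"
    using assms by (intro integrable_mult_right Bochner_Integration.integrable_add) (auto simp: all_moments_def)
  then show "integrable M (\<lambda>w. norm (X w + Y w) ^ k)"
  proof (rule Bochner_Integration.integrable_bound)
    show "AE w in M. norm (norm (X w + Y w) ^ k) \<le> norm (2 ^ k * (norm (X w) ^ k + norm (Y w) ^ k))"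
    proof (rule AE_I2)
      fix w
      let ?m = "max (norm (X w)) (norm (Y w))"
      have "norm (X w + Y w) \<le> 2 * ?m" using norm_triangle_ineq[of "X w" "Y w"] by linarith
      then have "norm (X w + Y w) ^ k \<le> 2 ^ k * ?m ^ k" 
        using power_mono[of "norm (X w + Y w)" "2 * ?m" k] by (simp add: power_mult_distrib)
      also have "?m ^ k \<le> norm (X w) ^ k + norm (Y w) ^ k" by (simp add: max_def)
      finally show "norm (norm (X w + Y w) ^ k) \<le> norm (2 ^ k * (norm (X w) ^ k + norm (Y w) ^ k))" by simp
    qed
  qed measurable
qed

lemma (in finite_measure) all_moments_bounded:
  assumes [measurable]: "X \<in> borel_measurable M" and "\<And>w. norm (X w) \<le> B"
  shows "all_moments M X"
  unfolding all_moments_def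
proof (intro conjI allI)
  fix k
  show "integrable M (\<lambda>w. norm (X w) ^ k)"
    by (rule integrable_const_bound[of _ "B ^ k"]) (auto intro!: power_mono assms)
qed (rule assms)

lemma (in finite_measure) all_moments_const: "all_moments M (\<lambda>_. c)"
  by (rule all_moments_bounded[of _ "norm c"]) auto

lemma (in finite_measure) all_moments_prod:
  "(\<And>i. i \<in> I \<Longrightarrow> all_moments M (X i)) \<Longrightarrow> all_moments M (\<lambda>w. \<Prod>i\<in>I. X i w)"
  by (induction I rule: infinite_finite_induct) (auto intro!: all_moments_mult all_moments_const)

lemma (in finite_measure) all_moments_sum:
  "(\<And>i. i \<in> I \<Longrightarrow> all_moments M (X i)) \<Longrightarrow> all_moments M (\<lambda>w. \<Sum>i\<in>I. X i w)"
  by (induction I rule: infinite_finite_induct) (auto intro!: all_moments_add all_moments_const)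

lemma (in finite_measure) all_moments_power:
  "all_moments M X \<Longrightarrow> all_moments M (\<lambda>w. X w ^ n)"
  by (induction n) (auto intro!: all_moments_mult all_moments_const)

lemma (in finite_measure) all_moments_poly:
  "all_moments M X \<Longrightarrow> all_moments M (\<lambda>w. poly p (X w))"
  unfolding poly_altdef by (intro all_moments_sum all_moments_mult all_moments_const all_moments_power)

section \<open>Moments of centred Gaussian variables\<close>

text \<open>The k-th moment of the standard normal law.\<close>

definition normal_mom :: "nat \<Rightarrow> real" where
  "normal_mom k = (if even k then fact k / (2 ^ (k div 2) * fact (k div 2)) else 0)"

lemma normal_mom_0: "normal_mom 0 = 1" and normal_mom_1: "normal_mom (Suc 0) = 0"
  by (auto simp: normal_mom_def)

lemma normal_mom_Suc_Suc: "normal_mom (Suc (Suc k)) = (real k + 1) * normal_mom k"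
proof (cases "even k")
  case True
  then obtain b where b: "k = 2 * b" by (elim evenE)
  have "normal_mom (Suc (Suc k)) = fact (Suc (Suc (2 * b))) / (2 ^ Suc b * fact (Suc b))"
    by (simp add: normal_mom_def b)
  also have "fact (Suc (Suc (2 * b))) = (2 * (real b + 1)) * ((real k + 1) * fact k)"
    by (simp add: b algebra_simps)
  also have "2 ^ Suc b * fact (Suc b) = (2 * (real b + 1)) * (2 ^ b * fact b)"
    by (simp add: algebra_simps)
  also have "(2 * (real b + 1)) * ((real k + 1) * fact k) / ((2 * (real b + 1)) * (2 ^ b * fact b)) = (real k + 1) * fact k / (2 ^ b * fact b)"
    by (rule mult_divide_mult_cancel_left) simp
  finally show ?thesis by (simp add: normal_mom_def b)
qed (simp add: normal_mom_def)

text \<open>The scale is the root of the second moment instead of a density parameter, so the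
  degenerate law is covered as well, with \<open>0 ^ 0 = 1\<close>.\<close>

lemma (in prob_space) centered_normal_moments:
  assumes "centered_normal_rv M X"
  shows "all_moments M X"
    and "expectation (\<lambda>w. X w ^ k) = normal_mom k * (sqrt (expectation (\<lambda>w. (X w)\<^sup>2))) ^ k"
proof -
  have [measurable]: "X \<in> borel_measurable M" using assms by (simp add: centered_normal_rv_def)
  consider \<sigma> where "\<sigma> > 0" "distributed M lborel X (normal_density 0 \<sigma>)" | "AE w in M. X w = 0"
    using assms by (auto simp: centered_normal_rv_def)
  then have "all_moments M X \<and> expectation (\<lambda>w. X w ^ k) = normal_mom k * (sqrt (expectation (\<lambda>w. (X w)\<^sup>2))) ^ k"
  proof cases
    case 1
    have i: "integrable M (\<lambda>w. norm (X w) ^ n)" for n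
      using distributed_integrable[OF 1(2), of "\<lambda>x. \<bar>x\<bar> ^ n"] integrable_normal_moment_abs[OF 1(1), of 0 n] by simp
    have e: "expectation (\<lambda>w. X w ^ n) = (LINT x|lborel. normal_density 0 \<sigma> x * (x - 0) ^ n)" for n
      using distributed_integral[OF 1(2), of "\<lambda>x. x ^ n"] by simp
    have "expectation (\<lambda>w. X w ^ (2 * n)) = normal_mom (2 * n) * \<sigma> ^ (2 * n)" for n
      unfolding e integral_normal_moment_even[OF 1(1)]
      using 1(1) by (simp add: normal_mom_def power_divide power_mult)
    moreover have "expectation (\<lambda>w. X w ^ (2 * n + 1)) = 0" for n
      unfolding e integral_normal_moment_odd[OF 1(1)] ..
    ultimately have m: "expectation (\<lambda>w. X w ^ n) = normal_mom n * \<sigma> ^ n" for n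
      by (cases "even n") (auto simp: normal_mom_def elim!: evenE oddE)
    have "expectation (\<lambda>w. (X w)\<^sup>2) = \<sigma>\<^sup>2"
      using m[of 2] by (simp add: normal_mom_def)
    then show ?thesis using i m 1 by (simp add: all_moments_def)
  next
    case 2
    have ae: "AE w in M. X w ^ n = 0 ^ n" for n using 2 by eventually_elim simp
    have "integrable M (\<lambda>w. norm (X w) ^ n)" for n
    proof (rule integrable_cong_AE_imp)
      show "integrable M (\<lambda>_. 0 ^ n :: real)" by simp
      show "AE w in M. 0 ^ n = norm (X w) ^ n" using 2 by eventually_elim simp
    qed simp
    moreover have "expectation (\<lambda>w. X w ^ n) = 0 ^ n" for n
      using integral_cong_AE[OF _ _ ae, of n] by (simp add: prob_space)
    moreover have "expectation (\<lambda>w. (X w)\<^sup>2) = 0" using calculation(2)[of 2] by simp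
    ultimately show ?thesis by (cases "k = 0") (simp_all add: all_moments_def normal_mom_def power_0_left prob_space)
  qed
  then show "all_moments M X" "expectation (\<lambda>w. X w ^ k) = normal_mom k * (sqrt (expectation (\<lambda>w. (X w)\<^sup>2))) ^ k" by auto
qed

section \<open>Gaussian integration by parts\<close>

text \<open>Polarisation: an identity for powers of X + s Y that holds for all real \<open>s\<close>
  is one between polynomials in \<open>s\<close>, and the coefficient of \<open>s ^ b\<close> is the
  corresponding identity for the monomial in X and Y.\<close>

lemma coefficient_extraction:
  fixes \<alpha> \<delta> \<beta> :: "nat \<Rightarrow> nat \<Rightarrow> real"
  assumes "\<And>K s. (\<Sum>j\<le>K. real (K choose j) * s ^ j * \<alpha> (K - j) j) =
     (\<Sum>j\<le>K. real (K choose j) * s ^ j * \<delta> (K - j) j)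
     + real K * (u + s * v) * (\<Sum>j\<le>K - 1. real (K - 1 choose j) * s ^ j * \<beta> (K - 1 - j) j)"
  shows "\<alpha> a b = \<delta> a b + real a * u * \<beta> (a - 1) b + real b * v * \<beta> a (b - 1)"
proof (cases "a + b")
  case 0
  then show ?thesis using assms[of 0 0] by simp
next
  case (Suc k)
  \<comment> \<open>Coefficients of the \<beta>-sum after multiplication by \<open>s\<close>:
    shifted by one, with nothing at index 0.\<close>
  let ?g = "\<lambda>j. if j = 0 then 0 else real (k choose (j - 1)) * \<beta> (Suc k - j) (j - 1)"
  have "(\<Sum>j\<le>Suc k. (real (Suc k choose j) * \<alpha> (Suc k - j) j) * s ^ j) =
    (\<Sum>j\<le>Suc k. (real (Suc k choose j) * \<delta> (Suc k - j) j
       + real (Suc k) * u * real (k choose j) * \<beta> (k - j) j + real (Suc k) * v * ?g j) * s ^ j)" for s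
  proof -
    have "(\<Sum>j\<le>Suc k. ?g j * s ^ j) = s * (\<Sum>j\<le>k. real (k choose j) * s ^ j * \<beta> (k - j) j)"
      by (subst sum.atMost_Suc_shift) (simp add: sum_distrib_left mult_ac)
    moreover have "(\<Sum>j\<le>Suc k. real (k choose j) * \<beta> (k - j) j * s ^ j) = (\<Sum>j\<le>k. real (k choose j) * s ^ j * \<beta> (k - j) j)"
      by (simp add: mult_ac)
    ultimately show ?thesis
      using assms[of "Suc k" s]
      by (simp only: distrib_right sum.distrib mult.assoc sum_distrib_left[symmetric] diff_Suc_1)
         (simp add: algebra_simps sum_distrib_left)
  qed
  then have "\<forall>j\<le>Suc k. real (Suc k choose j) * \<alpha> (Suc k - j) j = real (Suc k choose j) * \<delta> (Suc k - j) j
       + real (Suc k) * u * real (k choose j) * \<beta> (k - j) j + real (Suc k) * v * ?g j"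
    by (intro polyfun_eq_coeffs[THEN iffD1] allI)
  then have "real (Suc k choose b) * \<alpha> a b = real (Suc k choose b) * \<delta> a b
       + real (Suc k) * u * real (k choose b) * \<beta> (k - b) b + real (Suc k) * v * ?g b"
    using Suc by (metis add_diff_cancel_right' le_add2)
  moreover have "real (Suc k) * real (k choose b) * \<beta> (k - b) b = real (Suc k choose b) * (real a * \<beta> (a - 1) b)"
  proof (cases a)
    case 0
    then show ?thesis using Suc by simp
  next
    case (Suc a')
    then have "a * (Suc k choose b) = Suc k * (k choose b)"
      using \<open>a + b = Suc k\<close> binomial_absorb_comp[of "Suc k" b] by (metis add_diff_cancel_right' diff_Suc_1)
    then have "real a * real (Suc k choose b) = real (Suc k) * real (k choose b)" by (metis of_nat_mult)
    moreover have "k - b = a - 1" using Suc \<open>a + b = Suc k\<close> by simp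
    moreover have "real (Suc k choose b) * (real a * B) = (real a * real (Suc k choose b)) * B" for B
      by (simp only: mult_ac)
    ultimately show ?thesis by (simp only:)
  qed
  moreover have "real (Suc k) * ?g b = real (Suc k choose b) * (real b * \<beta> a (b - 1))"
  proof (cases b)
    case (Suc b')
    then have "b * (Suc k choose b) = Suc k * (k choose (b - 1))"
      using binomial_absorption[of b' "Suc k"] by simp
    then have "real b * real (Suc k choose b) = real (Suc k) * real (k choose (b - 1))" by (metis of_nat_mult)
    moreover have "Suc k - b = a" using \<open>a + b = Suc k\<close> by simp
    moreover have "real (Suc k choose b) * (real b * B) = (real b * real (Suc k choose b)) * B" for B
      by (simp only: mult_ac)
    moreover have "?g b = real (k choose (b - 1)) * \<beta> (Suc k - b) (b - 1)" using Suc by simp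
    ultimately show ?thesis by (simp only: mult.assoc)
  qed simp
  ultimately have "real (Suc k choose b) * \<alpha> a b = real (Suc k choose b) *
     (\<delta> a b + real a * u * \<beta> (a - 1) b + real b * v * \<beta> a (b - 1))"
    by (simp only: distrib_left mult_ac)
  moreover have "Suc k choose b > 0" using Suc by simp
  ultimately show ?thesis by simp
qed

text \<open>Compare derivatives at \<open>s = 0\<close>. Odd and even \<open>k\<close> are separated
  so that the root disappears before anything is differentiated.\<close>

lemma gaussian_coefficient:
  assumes "\<And>s. (\<Sum>j\<le>k. real (k choose j) * s ^ j * a j) = normal_mom k * sqrt (\<alpha> + 2 * s * \<beta> + s\<^sup>2 * \<gamma>) ^ k"
    and nn: "\<And>s. 0 \<le> \<alpha> + 2 * s * \<beta> + s\<^sup>2 * \<gamma>" and k: "k > 0"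
  shows "a 1 = real (k - 1) * \<beta> * (normal_mom (k - 2) * sqrt \<alpha> ^ (k - 2))"
proof -
  have "((\<lambda>s. \<Sum>j\<le>k. real (k choose j) * s ^ j * a j) has_real_derivative
      (\<Sum>j\<le>k. real (k choose j) * (real j * 0 ^ (j - 1)) * a j)) (at 0)"
    by (auto intro!: derivative_eq_intros sum.cong)
  also have "(\<Sum>j\<le>k. real (k choose j) * (real j * 0 ^ (j - 1)) * a j) = (\<Sum>j\<in>{1}. real (k choose j) * (real j * 0 ^ (j - 1)) * a j)"
    using k by (intro sum.mono_neutral_right) (auto simp: power_0_left)
  finally have D: "((\<lambda>s. \<Sum>j\<le>k. real (k choose j) * s ^ j * a j) has_real_derivative real k * a 1) (at 0)" by simp
  show ?thesis
  proof (cases "even k")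
    case False
    then have "(\<lambda>s. \<Sum>j\<le>k. real (k choose j) * s ^ j * a j) = (\<lambda>_. 0)"
      using assms(1) by (auto simp: normal_mom_def)
    then have "((\<lambda>s. \<Sum>j\<le>k. real (k choose j) * s ^ j * a j) has_real_derivative 0) (at 0)" by simp
    then have "real k * a 1 = 0" using DERIV_unique[OF D] by blast
    then have "a 1 = 0" using k by simp
    \<comment> \<open>For \<open>k = 1\<close> the truncated index \<open>k - 2\<close> is 0 and
      \<open>normal_mom 0 = 1\<close>, so the zero has to come from the factor
      \<open>k - 1\<close>.\<close>
    moreover have "k - 1 = 0 \<or> normal_mom (k - 2) = 0" using False by (auto simp: normal_mom_def)
    ultimately show ?thesis by auto
  next
    case True
    then obtain b where "k = 2 * b" by (elim evenE)
    moreover obtain r where "b = Suc r" using k calculation by (cases b) auto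
    ultimately have r: "k = Suc (Suc (2 * r))" by simp
    have sq: "sqrt x ^ (2 * n) = x ^ n" if "x \<ge> 0" for x n using that by (simp add: power_mult)
    have "(\<lambda>s. \<Sum>j\<le>k. real (k choose j) * s ^ j * a j) = (\<lambda>s. normal_mom k * (\<alpha> + 2 * s * \<beta> + s\<^sup>2 * \<gamma>) ^ Suc r)"
      using assms(1) sq[OF nn, of _ "Suc r"] by (auto simp: r)
    moreover have "((\<lambda>s. normal_mom k * (\<alpha> + 2 * s * \<beta> + s\<^sup>2 * \<gamma>) ^ Suc r) has_real_derivative
       normal_mom k * (real (Suc r) * \<alpha> ^ r * (2 * \<beta>))) (at 0)"
    proof -
      have "((\<lambda>s. \<alpha> + 2 * s * \<beta> + s\<^sup>2 * \<gamma>) has_real_derivative 2 * \<beta>) (at 0)"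
        by (auto intro!: derivative_eq_intros)
      from DERIV_cmult[OF DERIV_power[OF this, of "Suc r"], of "normal_mom k"] show ?thesis
        by (simp add: mult_ac del: power_Suc of_nat_Suc)
    qed
    ultimately have "real k * a 1 = normal_mom k * (real (Suc r) * \<alpha> ^ r * (2 * \<beta>))"
      using DERIV_unique[OF D] by simp
    also have "\<dots> = real k * (real (k - 1) * \<beta> * (normal_mom (2 * r) * \<alpha> ^ r))"
      unfolding r normal_mom_Suc_Suc by (simp add: algebra_simps)
    finally have "a 1 = real (k - 1) * \<beta> * (normal_mom (2 * r) * \<alpha> ^ r)" using k by simp
    moreover have "\<alpha> \<ge> 0" using nn[of 0] by simp
    ultimately show ?thesis by (simp add: r sq)
  qed
qed

text \<open>Closed under linear combinations only, not in L2: integration by parts is applied to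
  point values of the field, never to limits of them.\<close>

locale gaussian_space = prob_space M for M :: "'w measure" +
  fixes V :: "('w \<Rightarrow> real) set"
  assumes V_add: "X \<in> V \<Longrightarrow> Y \<in> V \<Longrightarrow> (\<lambda>w. X w + Y w) \<in> V"
    and V_scale: "X \<in> V \<Longrightarrow> (\<lambda>w. c * X w) \<in> V"
    and V_normal: "X \<in> V \<Longrightarrow> centered_normal_rv M X"
begin

lemma V_moments: "X \<in> V \<Longrightarrow> all_moments M X"
  using V_normal centered_normal_moments(1) by blast

lemma expand_power:
  assumes "all_moments M X" "all_moments M Y" "all_moments M F"
  shows "expectation (\<lambda>w. F w * (X w + s * Y w) ^ k) =
    (\<Sum>j\<le>k. real (k choose j) * s ^ j * expectation (\<lambda>w. F w * (X w ^ (k - j) * Y w ^ j)))"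
proof -
  have "F w * (X w + s * Y w) ^ k = (\<Sum>j\<le>k. (real (k choose j) * s ^ j) * (F w * (X w ^ (k - j) * Y w ^ j)))" for w
    by (subst add.commute, subst binomial_ring) (simp add: sum_distrib_left power_mult_distrib mult_ac)
  moreover have "integrable M (\<lambda>w. F w * (X w ^ (k - j) * Y w ^ j))" for j
    by (intro all_moments_integrable all_moments_mult all_moments_power assms)
  ultimately show ?thesis by simp
qed

text \<open>The variable X + s Z is Gaussian for every \<open>s\<close>, with a variance quadratic
  in \<open>s\<close>; the linear coefficient of its moment of order \<open>Suc k\<close> contains
  the claim.\<close>

lemma ibp_power:
  assumes X: "X \<in> V" and Z: "Z \<in> V"
  shows "expectation (\<lambda>w. Z w * X w ^ k) = real k * expectation (\<lambda>w. Z w * X w) * expectation (\<lambda>w. X w ^ (k - 1))"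
proof -
  have am: "all_moments M X" "all_moments M Z" using X Z V_moments by auto
  have int: "integrable M (\<lambda>w. (X w)\<^sup>2)" "integrable M (\<lambda>w. (Z w)\<^sup>2)" "integrable M (\<lambda>w. Z w * X w)"
    by (intro all_moments_integrable all_moments_mult all_moments_power am)+
  let ?\<alpha> = "expectation (\<lambda>w. (X w)\<^sup>2)" and ?\<beta> = "expectation (\<lambda>w. Z w * X w)" and ?\<gamma> = "expectation (\<lambda>w. (Z w)\<^sup>2)"
  have var: "expectation (\<lambda>w. (X w + s * Z w)\<^sup>2) = ?\<alpha> + 2 * s * ?\<beta> + s\<^sup>2 * ?\<gamma>" for s
  proof -
    have "(X w + s * Z w)\<^sup>2 = (X w)\<^sup>2 + 2 * s * (Z w * X w) + s\<^sup>2 * (Z w)\<^sup>2" for w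
      by (simp add: power2_eq_square algebra_simps)
    then show ?thesis using int by simp
  qed
  have XZ: "(\<lambda>w. X w + s * Z w) \<in> V" for s using X Z V_add V_scale by blast
  have "(\<Sum>j\<le>Suc k. real (Suc k choose j) * s ^ j * expectation (\<lambda>w. 1 * (X w ^ (Suc k - j) * Z w ^ j)))
     = normal_mom (Suc k) * sqrt (?\<alpha> + 2 * s * ?\<beta> + s\<^sup>2 * ?\<gamma>) ^ Suc k" for s
    using centered_normal_moments(2)[OF V_normal[OF XZ], of s "Suc k"] expand_power[OF am all_moments_const, of 1 s "Suc k"]
    by (simp add: var)
  then have "expectation (\<lambda>w. 1 * (X w ^ (Suc k - 1) * Z w ^ 1)) = real (Suc k - 1) * ?\<beta> * (normal_mom (Suc k - 2) * sqrt ?\<alpha> ^ (Suc k - 2))"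
  proof (rule gaussian_coefficient)
    show "0 \<le> ?\<alpha> + 2 * s * ?\<beta> + s\<^sup>2 * ?\<gamma>" for s unfolding var[symmetric] by simp
  qed simp
  then show ?thesis
    using centered_normal_moments(2)[OF V_normal[OF X], of "k - 1"] by (simp add: mult.commute numeral_2_eq_2)
qed

text \<open>The spare power of an arbitrary \<open>X\<close> makes the induction on \<open>I\<close>
  work: the hypothesis is used for X + s Y_r with all \<open>s\<close>, and
  \<open>coefficient_extraction\<close> separates the powers of X and Y_r. Linear combination over
  the powers of Y_r then gives the polynomial \<open>p r\<close>.\<close>

lemma ibp_poly_aux:
  assumes "finite I" "\<And>i. i \<in> I \<Longrightarrow> Y i \<in> V" "Z \<in> V" "X \<in> V"
  shows "expectation (\<lambda>w. Z w * (\<Prod>i\<in>I. poly (p i) (Y i w)) * X w ^ k) =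
    (\<Sum>i\<in>I. expectation (\<lambda>w. Z w * Y i w) *
       expectation (\<lambda>w. poly (pderiv (p i)) (Y i w) * (\<Prod>j\<in>I - {i}. poly (p j) (Y j w)) * X w ^ k))
    + real k * expectation (\<lambda>w. Z w * X w) * expectation (\<lambda>w. (\<Prod>i\<in>I. poly (p i) (Y i w)) * X w ^ (k - 1))"
  using assms(1,2,4)
proof (induction I arbitrary: X k rule: finite_induct)
  case empty
  then show ?case using ibp_power[OF _ assms(3), of X k] by simp
next
  case (insert r I)
  let ?P = "\<lambda>w. \<Prod>i\<in>I. poly (p i) (Y i w)"
  let ?Q = "\<lambda>i w. poly (pderiv (p i)) (Y i w) * (\<Prod>j\<in>I - {i}. poly (p j) (Y j w))"
  let ?u = "expectation (\<lambda>w. Z w * X w)" and ?v = "expectation (\<lambda>w. Z w * Y r w)"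
  have YV: "Y i \<in> V" if "i \<in> insert r I" for i using insert.prems that by auto
  have am: "all_moments M X" "all_moments M (Y r)" "all_moments M Z" "\<And>i. i \<in> I \<Longrightarrow> all_moments M (Y i)"
    using insert.prems assms(3) V_moments by auto
  have amP: "all_moments M ?P" "all_moments M (\<lambda>w. Z w * ?P w)"
    by (intro all_moments_mult all_moments_prod all_moments_poly am; assumption)+
  have amQ: "all_moments M (?Q i)" if "i \<in> I" for i
    using that by (intro all_moments_mult all_moments_prod all_moments_poly am) auto
  define \<alpha> where "\<alpha> a b = expectation (\<lambda>w. Z w * ?P w * (X w ^ a * Y r w ^ b))" for a b
  define \<delta> where "\<delta> a b = (\<Sum>i\<in>I. expectation (\<lambda>w. Z w * Y i w) * expectation (\<lambda>w. ?Q i w * (X w ^ a * Y r w ^ b)))" for a b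
  define \<beta> where "\<beta> a b = expectation (\<lambda>w. ?P w * (X w ^ a * Y r w ^ b))" for a b
  \<comment> \<open>\<open>\<alpha>\<close> is the left side, \<open>\<delta>\<close> the
    derivatives falling on the old factors, \<open>\<beta>\<close> those falling on X or
    Y_r.\<close>
  have mono: "\<alpha> a b = \<delta> a b + real a * ?u * \<beta> (a - 1) b + real b * ?v * \<beta> a (b - 1)" for a b
  proof (rule coefficient_extraction)
    fix K s
    have XY: "(\<lambda>w. X w + s * Y r w) \<in> V" using V_add[OF insert.prems(2) V_scale[OF YV[of r]]] by simp
    have "expectation (\<lambda>w. Z w * (X w + s * Y r w)) = ?u + s * ?v"
    proof -
      have "integrable M (\<lambda>w. Z w * X w)" "integrable M (\<lambda>w. Z w * Y r w)"
        by (intro all_moments_integrable all_moments_mult am)+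
      then show ?thesis by (simp add: distrib_left mult.left_commute[of _ s])
    qed
    moreover have "(\<Sum>i\<in>I. expectation (\<lambda>w. Z w * Y i w) * expectation (\<lambda>w. ?Q i w * (X w + s * Y r w) ^ K)) =
       (\<Sum>j\<le>K. real (K choose j) * s ^ j * \<delta> (K - j) j)"
    proof -
      have "(\<Sum>i\<in>I. expectation (\<lambda>w. Z w * Y i w) * expectation (\<lambda>w. ?Q i w * (X w + s * Y r w) ^ K)) =
        (\<Sum>i\<in>I. expectation (\<lambda>w. Z w * Y i w) * (\<Sum>j\<le>K. real (K choose j) * s ^ j * expectation (\<lambda>w. ?Q i w * (X w ^ (K - j) * Y r w ^ j))))"
        by (intro sum.cong refl arg_cong2[where f="(*)"] expand_power am amQ)
      also have "\<dots> = (\<Sum>j\<le>K. real (K choose j) * s ^ j * \<delta> (K - j) j)"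
        unfolding \<delta>_def sum_distrib_left by (subst sum.swap) (simp only: mult_ac)
      finally show ?thesis .
    qed
    moreover have "expectation (\<lambda>w. Z w * ?P w * (X w + s * Y r w) ^ K) = (\<Sum>j\<le>K. real (K choose j) * s ^ j * \<alpha> (K - j) j)"
      unfolding \<alpha>_def by (intro expand_power am amP)
    moreover have "expectation (\<lambda>w. ?P w * (X w + s * Y r w) ^ (K - 1)) = (\<Sum>j\<le>K - 1. real (K - 1 choose j) * s ^ j * \<beta> (K - 1 - j) j)"
      unfolding \<beta>_def by (intro expand_power am amP)
    ultimately show "(\<Sum>j\<le>K. real (K choose j) * s ^ j * \<alpha> (K - j) j) = (\<Sum>j\<le>K. real (K choose j) * s ^ j * \<delta> (K - j) j)
      + real K * (?u + s * ?v) * (\<Sum>j\<le>K - 1. real (K - 1 choose j) * s ^ j * \<beta> (K - 1 - j) j)"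
      using insert.IH[of "\<lambda>w. X w + s * Y r w" K] XY insert.prems by simp
  qed
  have lin: "expectation (\<lambda>w. F w * (X w ^ a * poly q (Y r w))) = (\<Sum>b\<le>degree q. coeff q b * expectation (\<lambda>w. F w * (X w ^ a * Y r w ^ b)))"
    if "all_moments M F" for F a q
  proof -
    have "F w * (X w ^ a * poly q (Y r w)) = (\<Sum>b\<le>degree q. coeff q b * (F w * (X w ^ a * Y r w ^ b)))" for w
      unfolding poly_altdef by (simp add: sum_distrib_left mult_ac)
    moreover have "integrable M (\<lambda>w. F w * (X w ^ a * Y r w ^ b))" for b
      by (intro all_moments_integrable all_moments_mult all_moments_power that am)
    ultimately show ?thesis by simp
  qed
  let ?q = "p r"
  have pd: "poly (pderiv ?q) y = (\<Sum>b\<le>degree ?q. coeff ?q b * (real b * y ^ (b - 1)))" for y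
  proof -
    have "pderiv ?q = pderiv (\<Sum>b\<le>degree ?q. monom (coeff ?q b) b)" by (simp only: poly_as_sum_of_monoms)
    also have "\<dots> = (\<Sum>b\<le>degree ?q. monom (real b * coeff ?q b) (b - 1))"
      by (simp add: pderiv_sum pderiv_monom)
    finally show ?thesis by (simp add: poly_sum poly_monom mult_ac)
  qed
  have lin': "expectation (\<lambda>w. ?P w * (X w ^ k * poly (pderiv ?q) (Y r w))) = (\<Sum>b\<le>degree ?q. coeff ?q b * (real b * \<beta> k (b - 1)))"
  proof -
    have "?P w * (X w ^ k * poly (pderiv ?q) (Y r w)) = (\<Sum>b\<le>degree ?q. coeff ?q b * (real b * (?P w * (X w ^ k * Y r w ^ (b - 1)))))" for w
      unfolding pd by (simp add: sum_distrib_left mult_ac)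
    moreover have "integrable M (\<lambda>w. ?P w * (X w ^ k * Y r w ^ (b - 1)))" for b
      by (intro all_moments_integrable all_moments_mult all_moments_power amP am)
    ultimately show ?thesis by (simp add: \<beta>_def)
  qed
  have "expectation (\<lambda>w. Z w * ?P w * (X w ^ k * poly ?q (Y r w))) = (\<Sum>b\<le>degree ?q. coeff ?q b * \<alpha> k b)"
    unfolding \<alpha>_def by (rule lin[OF amP(2)])
  also have "\<dots> = (\<Sum>b\<le>degree ?q. coeff ?q b * \<delta> k b) + real k * ?u * (\<Sum>b\<le>degree ?q. coeff ?q b * \<beta> (k - 1) b)
      + ?v * (\<Sum>b\<le>degree ?q. coeff ?q b * (real b * \<beta> k (b - 1)))"
    unfolding mono by (simp add: sum.distrib sum_distrib_left algebra_simps)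
  also have "(\<Sum>b\<le>degree ?q. coeff ?q b * \<delta> k b) = (\<Sum>i\<in>I. expectation (\<lambda>w. Z w * Y i w) * expectation (\<lambda>w. ?Q i w * (X w ^ k * poly ?q (Y r w))))"
  proof -
    have "(\<Sum>i\<in>I. expectation (\<lambda>w. Z w * Y i w) * expectation (\<lambda>w. ?Q i w * (X w ^ k * poly ?q (Y r w)))) =
      (\<Sum>i\<in>I. expectation (\<lambda>w. Z w * Y i w) * (\<Sum>b\<le>degree ?q. coeff ?q b * expectation (\<lambda>w. ?Q i w * (X w ^ k * Y r w ^ b))))"
      by (intro sum.cong refl arg_cong2[where f="(*)"] lin amQ)
    also have "\<dots> = (\<Sum>b\<le>degree ?q. coeff ?q b * \<delta> k b)"
      unfolding \<delta>_def sum_distrib_left by (subst sum.swap) (simp only: mult_ac)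
    finally show ?thesis ..
  qed
  also have "(\<Sum>b\<le>degree ?q. coeff ?q b * \<beta> (k - 1) b) = expectation (\<lambda>w. ?P w * (X w ^ (k - 1) * poly ?q (Y r w)))"
    unfolding \<beta>_def by (rule lin[OF amP(1), symmetric])
  also have "(\<Sum>b\<le>degree ?q. coeff ?q b * (real b * \<beta> k (b - 1))) = expectation (\<lambda>w. ?P w * (X w ^ k * poly (pderiv ?q) (Y r w)))"
    by (rule lin'[symmetric])
  finally have main: "expectation (\<lambda>w. Z w * ?P w * (X w ^ k * poly ?q (Y r w))) =
      (\<Sum>i\<in>I. expectation (\<lambda>w. Z w * Y i w) * expectation (\<lambda>w. ?Q i w * (X w ^ k * poly ?q (Y r w))))
      + real k * ?u * expectation (\<lambda>w. ?P w * (X w ^ (k - 1) * poly ?q (Y r w)))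
      + ?v * expectation (\<lambda>w. ?P w * (X w ^ k * poly (pderiv ?q) (Y r w)))" .
  have "(\<Prod>j\<in>insert r I - {i}. poly (p j) (Y j w)) = (\<Prod>j\<in>I - {i}. poly (p j) (Y j w)) * poly ?q (Y r w)" if "i \<in> I" for i w
    using that insert.hyps by (subst insert_Diff_if) auto
  moreover have "insert r I - {r} = I" using insert.hyps by auto
  ultimately show ?case
    using main insert.hyps by (simp add: mult_ac)
qed

lemma ibp_poly:
  assumes "finite I" "\<And>i. i \<in> I \<Longrightarrow> Y i \<in> V" "Z \<in> V"
  shows "expectation (\<lambda>w. Z w * (\<Prod>i\<in>I. poly (p i) (Y i w))) =
    (\<Sum>i\<in>I. expectation (\<lambda>w. Z w * Y i w) *
       expectation (\<lambda>w. poly (pderiv (p i)) (Y i w) * (\<Prod>j\<in>I - {i}. poly (p j) (Y j w))))"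
  using ibp_poly_aux[OF assms assms(3), where p=p and k=0] by simp

text \<open>In the recursion for Hermite polynomials the derivative term cancels the contribution of
  \<open>Y v\<close> paired with itself, precisely because its variance is 1. This is why diagrams
  have no loops.\<close>

lemma ibp_hermite:
  assumes I: "finite I" "v \<notin> I" and Y: "\<And>i. i \<in> insert v I \<Longrightarrow> Y i \<in> V" and var: "expectation (\<lambda>w. (Y v w)\<^sup>2) = 1"
  shows "expectation (\<lambda>w. hermite (Suc m) (Y v w) * (\<Prod>i\<in>I. hermite (n i) (Y i w))) =
    (\<Sum>i\<in>I. real (n i) * expectation (\<lambda>w. Y v w * Y i w) *
       expectation (\<lambda>w. hermite m (Y v w) * (\<Prod>j\<in>I. hermite ((n(i := n i - 1)) j) (Y j w))))"
proof -
  have am: "\<And>i. i \<in> insert v I \<Longrightarrow> all_moments M (Y i)" using Y V_moments by blast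
  let ?p = "(\<lambda>i. hpoly (n i))(v := hpoly m)"
  let ?P = "\<lambda>w. \<Prod>i\<in>I. poly (hpoly (n i)) (Y i w)"
  have P: "(\<Prod>i\<in>I. poly (?p i) (Y i w)) = ?P w" for w
    using I by (intro prod.cong) auto
  have int: "integrable M (\<lambda>w. Y v w * (poly (hpoly m) (Y v w) * ?P w))" "integrable M (\<lambda>w. poly (pderiv (hpoly m)) (Y v w) * ?P w)"
    by (intro all_moments_integrable all_moments_mult all_moments_prod all_moments_poly am; simp)+
  have "expectation (\<lambda>w. Y v w * (poly (hpoly m) (Y v w) * ?P w)) = expectation (\<lambda>w. Y v w * (\<Prod>i\<in>insert v I. poly (?p i) (Y i w)))"
    using I by (simp add: P fun_upd_same del: fun_upd_apply)
  also have "\<dots> = (\<Sum>i\<in>insert v I. expectation (\<lambda>w. Y v w * Y i w) *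
       expectation (\<lambda>w. poly (pderiv (?p i)) (Y i w) * (\<Prod>j\<in>insert v I - {i}. poly (?p j) (Y j w))))"
    by (rule ibp_poly) (use I Y in auto)
  also have "\<dots> = expectation (\<lambda>w. poly (pderiv (hpoly m)) (Y v w) * ?P w) + (\<Sum>i\<in>I. expectation (\<lambda>w. Y v w * Y i w) *
       expectation (\<lambda>w. poly (pderiv (?p i)) (Y i w) * (\<Prod>j\<in>insert v I - {i}. poly (?p j) (Y j w))))"
    using I var by (simp add: P power2_eq_square fun_upd_same del: fun_upd_apply)
  also have "(\<Sum>i\<in>I. expectation (\<lambda>w. Y v w * Y i w) *
       expectation (\<lambda>w. poly (pderiv (?p i)) (Y i w) * (\<Prod>j\<in>insert v I - {i}. poly (?p j) (Y j w)))) =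
    (\<Sum>i\<in>I. real (n i) * expectation (\<lambda>w. Y v w * Y i w) *
       expectation (\<lambda>w. hermite m (Y v w) * (\<Prod>j\<in>I. hermite ((n(i := n i - 1)) j) (Y j w))))"
  proof (rule sum.cong[OF refl])
    fix i assume i: "i \<in> I"
    then have iv: "i \<noteq> v" using I by auto
    have 1: "(\<Prod>j\<in>insert v I - {i}. poly (?p j) (Y j w)) = poly (hpoly m) (Y v w) * (\<Prod>j\<in>I - {i}. poly (hpoly (n j)) (Y j w))" for w
    proof -
      have "insert v I - {i} = insert v (I - {i})" using iv by auto
      moreover have "(\<Prod>j\<in>I - {i}. poly (?p j) (Y j w)) = (\<Prod>j\<in>I - {i}. poly (hpoly (n j)) (Y j w))"
        using I by (intro prod.cong) auto
      ultimately show ?thesis using I by simp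
    qed
    have 2: "(\<Prod>j\<in>I. hermite ((n(i := n i - 1)) j) (Y j w)) = poly (hpoly (n i - 1)) (Y i w) * (\<Prod>j\<in>I - {i}. poly (hpoly (n j)) (Y j w))" for w
      using I i by (subst prod.remove[of I i]) (auto simp: hermite_eq_poly intro!: prod.cong)
    show "expectation (\<lambda>w. Y v w * Y i w) * expectation (\<lambda>w. poly (pderiv (?p i)) (Y i w) * (\<Prod>j\<in>insert v I - {i}. poly (?p j) (Y j w))) =
      real (n i) * expectation (\<lambda>w. Y v w * Y i w) * expectation (\<lambda>w. hermite m (Y v w) * (\<Prod>j\<in>I. hermite ((n(i := n i - 1)) j) (Y j w)))"
      unfolding 1 2 using iv by (simp add: pderiv_hpoly hermite_eq_poly mult_ac)
  qed
  finally have "expectation (\<lambda>w. Y v w * (poly (hpoly m) (Y v w) * ?P w)) - expectation (\<lambda>w. poly (pderiv (hpoly m)) (Y v w) * ?P w) =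
     (\<Sum>i\<in>I. real (n i) * expectation (\<lambda>w. Y v w * Y i w) *
       expectation (\<lambda>w. hermite m (Y v w) * (\<Prod>j\<in>I. hermite ((n(i := n i - 1)) j) (Y j w))))" by simp
  moreover have "expectation (\<lambda>w. hermite (Suc m) (Y v w) * (\<Prod>i\<in>I. hermite (n i) (Y i w))) =
     expectation (\<lambda>w. Y v w * (poly (hpoly m) (Y v w) * ?P w)) - expectation (\<lambda>w. poly (pderiv (hpoly m)) (Y v w) * ?P w)"
    by (subst Bochner_Integration.integral_diff[symmetric, OF int]) (simp add: hermite_eq_poly algebra_simps)
  ultimately show ?thesis by simp
qed

end

section \<open>Trigonometric polynomials and convergence in law\<close>

text \<open>Their expectations are read off from characteristic functions, and their closure under
  products (\<open>trig_mult\<close>) makes them accessible to Stone-Weierstrass.\<close>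

inductive_set trig :: "nat \<Rightarrow> ((nat \<Rightarrow> real) \<Rightarrow> real) set" for N :: nat where
  cos: "(\<lambda>x. cos (\<Sum>i<N. c i * x i)) \<in> trig N"
| sin: "(\<lambda>x. sin (\<Sum>i<N. c i * x i)) \<in> trig N"
| add: "f \<in> trig N \<Longrightarrow> g \<in> trig N \<Longrightarrow> (\<lambda>x. f x + g x) \<in> trig N"
| scale: "f \<in> trig N \<Longrightarrow> (\<lambda>x. a * f x) \<in> trig N"

lemma trig_mult_base:
  "(\<lambda>x. cos (\<Sum>i<N. c i * x i) * cos (\<Sum>i<N. d i * x i)) \<in> trig N"
  "(\<lambda>x. sin (\<Sum>i<N. c i * x i) * sin (\<Sum>i<N. d i * x i)) \<in> trig N"
  "(\<lambda>x. sin (\<Sum>i<N. c i * x i) * cos (\<Sum>i<N. d i * x i)) \<in> trig N"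
proof -
  let ?C = "\<lambda>x::nat\<Rightarrow>real. \<Sum>i<N. c i * x i" and ?D = "\<lambda>x::nat\<Rightarrow>real. \<Sum>i<N. d i * x i"
  have p: "(\<Sum>i<N. (c i + d i) * x i) = ?C x + ?D x" and m: "(\<Sum>i<N. (c i - d i) * x i) = ?C x - ?D x" for x
    by (simp_all add: algebra_simps sum.distrib sum_subtractf)
  have gen: "(1/2) * cos (a - b) + (1/2) * cos (a + b) = cos a * cos b"
    "(1/2) * cos (a - b) + (-1/2) * cos (a + b) = sin a * sin b"
    "(1/2) * sin (a - b) + (1/2) * sin (a + b) = sin a * cos b" for a b :: real
    by (simp_all add: cos_add cos_diff sin_add sin_diff field_simps)
  have "(\<lambda>x. (1/2) * cos (\<Sum>i<N. (c i - d i) * x i) + (1/2) * cos (\<Sum>i<N. (c i + d i) * x i)) \<in> trig N"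
    by (intro trig.intros)
  then show "(\<lambda>x. cos (?C x) * cos (?D x)) \<in> trig N"
    by (rule back_subst[of "\<lambda>f. f \<in> trig N"]) (simp only: p m gen)
  have "(\<lambda>x. (1/2) * cos (\<Sum>i<N. (c i - d i) * x i) + (-1/2) * cos (\<Sum>i<N. (c i + d i) * x i)) \<in> trig N"
    by (intro trig.intros)
  then show "(\<lambda>x. sin (?C x) * sin (?D x)) \<in> trig N"
    by (rule back_subst[of "\<lambda>f. f \<in> trig N"]) (simp only: p m gen)
  have "(\<lambda>x. (1/2) * sin (\<Sum>i<N. (c i - d i) * x i) + (1/2) * sin (\<Sum>i<N. (c i + d i) * x i)) \<in> trig N"
    by (intro trig.intros)
  then show "(\<lambda>x. sin (?C x) * cos (?D x)) \<in> trig N"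
    by (rule back_subst[of "\<lambda>f. f \<in> trig N"]) (simp only: p m gen)
qed

lemma trig_mult:
  assumes "f \<in> trig N" "g \<in> trig N"
  shows "(\<lambda>x. f x * g x) \<in> trig N"
  using assms(1)
proof induction
  case (cos c)
  show ?case using assms(2)
  proof induction
    case (sin d)
    show ?case using trig_mult_base(3)[where c=d and d=c and N=N] by (simp add: mult.commute)
  next
    case (add f g)
    from trig.add[OF add.IH] show ?case by (simp add: distrib_left)
  next
    case (scale f a)
    from trig.scale[OF scale.IH, of a] show ?case by (simp add: mult_ac)
  qed (rule trig_mult_base)
next
  case (sin c)
  show ?case using assms(2)
  proof induction
    case (add f g)
    from trig.add[OF add.IH] show ?case by (simp add: distrib_left)
  next
    case (scale f a)
    from trig.scale[OF scale.IH, of a] show ?case by (simp add: mult_ac)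
  qed (rule trig_mult_base)+
next
  case (add f1 f2)
  from trig.add[OF add.IH] show ?case by (simp add: distrib_right)
next
  case (scale f a)
  from trig.scale[OF scale.IH, of a] show ?case by (simp add: mult_ac)
qed

lemma trig_const: "(\<lambda>_. a) \<in> trig N"
  using trig.scale[OF trig.cos[where c="\<lambda>_. 0"], of a] by simp

lemma trig_coord:
  assumes "k < N"
  shows "(\<lambda>x. cos (a * x k)) \<in> trig N" "(\<lambda>x. sin (a * x k)) \<in> trig N"
proof -
  have "(\<Sum>i<N. (if i = k then a else 0) * x i) = a * x k" for x :: "nat \<Rightarrow> real"
    using assms by (simp add: if_distrib[of "\<lambda>c. c * _"] sum.delta cong: if_cong)
  then show "(\<lambda>x. cos (a * x k)) \<in> trig N" "(\<lambda>x. sin (a * x k)) \<in> trig N"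
    using trig.cos[of "\<lambda>i. if i = k then a else 0" N] trig.sin[of "\<lambda>i. if i = k then a else 0" N] by simp_all
qed

text \<open>The torus of side \<open>8L\<close> makes the approximating trigonometric polynomial bounded on the whole
  space, not only on the cube where it is close to \<open>h\<close>.\<close>

lemma trig_approx:
  fixes h :: "(nat \<Rightarrow> real) \<Rightarrow> real"
  assumes h: "continuous_on UNIV h" and B: "\<And>x. \<bar>h x\<bar> \<le> B" and L: "L > 0" and e: "\<epsilon> > 0"
  shows "\<exists>g\<in>trig N. \<forall>x. (\<forall>i\<ge>N. x i = 0) \<longrightarrow> \<bar>h x - g x\<bar> \<le> \<epsilon> + (2 * B + \<epsilon>) * (\<Sum>i<N. (x i)\<^sup>2 / L\<^sup>2)"
proof -
  define a where "a = pi / (4 * L)"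
  have a: "a > 0" using L by (simp add: a_def)
  \<comment> \<open>Coordinates from \<open>N\<close> on are frozen at 1, so that the torus is
    compact inside the infinite product.\<close>
  define S where "S = {z::nat \<Rightarrow> complex. (\<forall>i<N. norm (z i) = 1) \<and> (\<forall>i\<ge>N. z i = 1)}"
  define \<theta> where "\<theta> x = (\<lambda>i. if i < N then cis (a * x i) else 1)" for x :: "nat \<Rightarrow> real"
  \<comment> \<open>A continuous cut-off on each circle, equal to 1 at all angles up to pi/4, since
    the cosine there is at least 1/2.\<close>
  define \<kappa> where "\<kappa> c = max 0 (min 1 (2 * c))" for c :: real
  \<comment> \<open>On the cube the angles \<open>a * x i\<close> are at most pi/4 in size, so the
    arcsine of the imaginary part recovers \<open>x i\<close>; clamping keeps the argument in the
    domain of the arcsine.\<close>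
  define \<Phi> where "\<Phi> z = h (\<lambda>i. if i < N then arcsin (max (-1) (min 1 (Im (z i)))) / a else 0) * (\<Prod>i<N. \<kappa> (Re (z i)))" for z :: "nat \<Rightarrow> complex"
  define R where "R = {f. continuous_on S f \<and> (\<lambda>x. f (\<theta> x)) \<in> trig N}"
  have compact: "compact S"
  proof -
    have "S = PiE UNIV (\<lambda>i. if i < N then sphere 0 1 else {1})"
      by (auto simp: S_def PiE_UNIV_domain Pi_iff not_less split: if_splits) (metis leD)
    moreover have "compact (PiE UNIV (\<lambda>i. if i < N then sphere (0::complex) 1 else {1}))"
      using compactin_PiE[of "\<lambda>_::nat. euclidean :: complex topology" UNIV "\<lambda>i. if i < N then sphere 0 1 else {1}"]
      by (simp add: euclidean_product_topology compactin_euclidean_iff)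
    ultimately show ?thesis by simp
  qed
  have contz: "continuous_on S (\<lambda>z. z i)" for i
    by (rule continuous_on_subset[OF continuous_on_product_coordinates]) auto
  interpret function_ring_on R S
  proof
    show "compact S" by (rule compact)
    show "continuous_on S f" if "f \<in> R" for f using that by (simp add: R_def)
    show "(\<lambda>x. f x + g x) \<in> R" if "f \<in> R" "g \<in> R" for f g
      using that by (auto simp: R_def intro: continuous_intros trig.add)
    show "(\<lambda>x. f x * g x) \<in> R" if "f \<in> R" "g \<in> R" for f g
      using that by (auto simp: R_def intro: continuous_intros trig_mult)
    show "(\<lambda>_. c) \<in> R" for c by (auto simp: R_def trig_const)
    fix x y assume xy: "x \<in> S" "y \<in> S" "x \<noteq> y"
    then obtain i where i: "x i \<noteq> y i" by auto
    then have iN: "i < N" using xy by (auto simp: S_def intro: ccontr)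
    have ReIm: "(\<lambda>z. Re (z i)) \<in> R" "(\<lambda>z. Im (z i)) \<in> R"
      using iN trig_coord[of i N a] contz[of i] by (auto simp: R_def \<theta>_def intro!: continuous_intros)
    have "Re (x i) \<noteq> Re (y i) \<or> Im (x i) \<noteq> Im (y i)" using i by (simp add: complex_eq_iff)
    then show "\<exists>f\<in>R. f x \<noteq> f y"
    proof
      assume "Re (x i) \<noteq> Re (y i)" then show "\<exists>f\<in>R. f x \<noteq> f y" by (intro bexI[OF _ ReIm(1)])
    next
      assume "Im (x i) \<noteq> Im (y i)" then show "\<exists>f\<in>R. f x \<noteq> f y" by (intro bexI[OF _ ReIm(2)])
    qed
  qed
  have "continuous_on S \<Phi>"
  proof -
    have "continuous_on S (\<lambda>x i. if i < N then arcsin (max (- 1) (min 1 (Im (x i)))) / a else 0)"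
    proof (rule continuous_on_coordinatewise_then_product)
      fix i
      show "continuous_on S (\<lambda>x. if i < N then arcsin (max (- 1) (min 1 (Im (x i)))) / a else 0)"
        by (cases "i < N") (use a in \<open>auto intro!: continuous_intros contz\<close>)
    qed
    then have "continuous_on S (\<lambda>z. h (\<lambda>i. if i < N then arcsin (max (- 1) (min 1 (Im (z i)))) / a else 0))"
      by (rule continuous_on_compose2[OF h]) simp
    moreover have "continuous_on S (\<lambda>z. \<Prod>i<N. \<kappa> (Re (z i)))"
      unfolding \<kappa>_def by (intro continuous_intros contz)
    ultimately show ?thesis unfolding \<Phi>_def by (rule continuous_on_mult)
  qed
  from Stone_Weierstrass_basic[OF this e] obtain f where f: "f \<in> R" "\<And>z. z \<in> S \<Longrightarrow> \<bar>\<Phi> z - f z\<bar> < \<epsilon>" by blast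
  have \<kappa>: "0 \<le> \<kappa> c" "\<kappa> c \<le> 1" for c by (auto simp: \<kappa>_def)
  have B0: "B \<ge> 0" using B[of undefined] by linarith
  show ?thesis
  proof (intro bexI[of _ "\<lambda>x. f (\<theta> x)"] allI impI)
    show "(\<lambda>x. f (\<theta> x)) \<in> trig N" using f by (simp add: R_def)
    fix x :: "nat \<Rightarrow> real" assume x: "\<forall>i\<ge>N. x i = 0"
    have S: "\<theta> x \<in> S" by (auto simp: S_def \<theta>_def)
    have sum0: "(\<Sum>i<N. (x i)\<^sup>2 / L\<^sup>2) \<ge> 0" by (intro sum_nonneg) auto
    show "\<bar>h x - f (\<theta> x)\<bar> \<le> \<epsilon> + (2 * B + \<epsilon>) * (\<Sum>i<N. (x i)\<^sup>2 / L\<^sup>2)"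
    proof (cases "\<forall>i<N. \<bar>x i\<bar> \<le> L")
      case True
      have ax: "\<bar>a * x i\<bar> \<le> pi / 4" if "i < N" for i
      proof -
        have "\<bar>a * x i\<bar> \<le> a * L" using True that a by (simp add: abs_mult)
        then show ?thesis using L by (simp add: a_def)
      qed
      have "\<kappa> (cos (a * x i)) = 1" if "i < N" for i
      proof -
        have "cos (pi / 4) \<le> cos \<bar>a * x i\<bar>"
          using ax[OF that] pi_gt_zero by (intro cos_monotone_0_pi_le) linarith+
        moreover have "cos (pi / 4) \<ge> 1 / 2" unfolding cos_45 using real_le_rsqrt[of 1 2] by simp
        ultimately show ?thesis by (simp add: \<kappa>_def)
      qed
      moreover have "arcsin (max (- 1) (min 1 (sin (a * x i)))) / a = x i" if "i < N" for i
      proof -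
        have "arcsin (sin (a * x i)) = a * x i" using ax[OF that] by (intro arcsin_sin) linarith+
        then show ?thesis using a by simp
      qed
      ultimately have "\<Phi> (\<theta> x) = h x"
        using x by (auto simp: \<Phi>_def \<theta>_def intro!: arg_cong[where f=h])
      then have "\<bar>h x - f (\<theta> x)\<bar> \<le> \<epsilon>" using f(2)[OF S] by simp
      moreover have "(2 * B + \<epsilon>) * (\<Sum>i<N. (x i)\<^sup>2 / L\<^sup>2) \<ge> 0" using sum0 B0 e by simp
      ultimately show ?thesis by linarith
    next
      case False
      \<comment> \<open>Outside the cube some quotient of squares exceeds 1, so the crude bound
        \<open>2 * B + \<epsilon>\<close> is absorbed by the sum, as in Chebyshev's
        inequality.\<close>
      then obtain i where i: "i < N" "\<bar>x i\<bar> > L" by force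
      have "\<bar>\<Prod>i<N. \<kappa> (Re (\<theta> x i))\<bar> \<le> 1"
        using \<kappa> by (auto simp: abs_prod intro!: prod_le_1)
      then have "\<bar>\<Phi> (\<theta> x)\<bar> \<le> B * 1"
        unfolding \<Phi>_def abs_mult by (intro mult_mono B) (use B0 in auto)
      then have "- B \<le> \<Phi> (\<theta> x)" "\<Phi> (\<theta> x) \<le> B" by (simp_all add: abs_le_iff)
      moreover have "- B \<le> h x" "h x \<le> B" using B[of x] by (simp_all add: abs_le_iff)
      moreover have "\<Phi> (\<theta> x) - f (\<theta> x) < \<epsilon>" "- \<epsilon> < \<Phi> (\<theta> x) - f (\<theta> x)"
        using f(2)[OF S] by (simp_all add: abs_less_iff)
      ultimately have 1: "\<bar>h x - f (\<theta> x)\<bar> \<le> (2 * B + \<epsilon>) * 1" unfolding abs_le_iff by simp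
      have "L\<^sup>2 \<le> (x i)\<^sup>2" using i L by (metis abs_le_square_iff abs_of_pos less_imp_le)
      then have "1 \<le> (x i)\<^sup>2 / L\<^sup>2" using L by simp
      also have "\<dots> \<le> (\<Sum>i<N. (x i)\<^sup>2 / L\<^sup>2)"
        using i by (intro member_le_sum) auto
      finally have "(2 * B + \<epsilon>) * 1 \<le> (2 * B + \<epsilon>) * (\<Sum>i<N. (x i)\<^sup>2 / L\<^sup>2)"
        using B0 e by (intro mult_left_mono) auto
      then show ?thesis using 1 e by linarith
    qed
  qed
qed

lemma (in prob_space) trig_integrable:
  fixes U :: "'a \<Rightarrow> nat \<Rightarrow> real"
  assumes "\<And>i. i < N \<Longrightarrow> (\<lambda>w. U w i) \<in> borel_measurable M"
  shows "g \<in> trig N \<Longrightarrow> integrable M (\<lambda>w. g (U w))"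
proof (induction rule: trig.induct)
  case (cos c)
  show ?case by (rule integrable_const_bound[of _ 1]) (use assms in auto)
next
  case (sin c)
  show ?case by (rule integrable_const_bound[of _ 1]) (use assms in auto)
qed auto

lemma trig_expectation_tendsto:
  fixes U :: "nat \<Rightarrow> 'w \<Rightarrow> nat \<Rightarrow> real"
  assumes M: "prob_space M" and M': "prob_space M'"
    and U: "\<And>l i. i < N \<Longrightarrow> (\<lambda>w. U l w i) \<in> borel_measurable M"
    and Y: "\<And>i. i < N \<Longrightarrow> (\<lambda>v. Y v i) \<in> borel_measurable M'"
    and char: "\<And>c. (\<lambda>l. \<integral>w. exp (\<i> * complex_of_real (\<Sum>i<N. c i * U l w i)) \<partial>M)
      \<longlonglongrightarrow> (\<integral>v. exp (\<i> * complex_of_real (\<Sum>i<N. c i * Y v i)) \<partial>M')"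
  shows "g \<in> trig N \<Longrightarrow> (\<lambda>l. \<integral>w. g (U l w) \<partial>M) \<longlonglongrightarrow> (\<integral>v. g (Y v) \<partial>M')"
proof (induction rule: trig.induct)
  have i1: "integrable M (\<lambda>w. exp (\<i> * complex_of_real (\<Sum>i<N. c i * U l w i)))" for c l
    using prob_space.integrable_iexp[OF M, of "\<lambda>w. complex_of_real (\<Sum>i<N. c i * U l w i)"] U by simp
  have i2: "integrable M' (\<lambda>v. exp (\<i> * complex_of_real (\<Sum>i<N. c i * Y v i)))" for c
    using prob_space.integrable_iexp[OF M', of "\<lambda>w. complex_of_real (\<Sum>i<N. c i * Y w i)"] Y by simp
  {
    case (cos c)
    show ?case using tendsto_Re[OF char, of c] i1[of c] i2[of c] by (simp add: Re_exp integral_Re[symmetric])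
  next
    case (sin c)
    show ?case using tendsto_Im[OF char, of c] i1[of c] i2[of c] by (simp add: Im_exp integral_Im[symmetric])
  }
next
  case (add f g)
  have "integrable M (\<lambda>w. k (U l w))" "integrable M' (\<lambda>v. k (Y v))" if "k \<in> trig N" for k l
    using prob_space.trig_integrable[where N=N and U="U l" and g=k, OF M] prob_space.trig_integrable[where N=N and U=Y and g=k, OF M'] U Y that by auto
  then show ?case
    using add by (simp add: Bochner_Integration.integral_add tendsto_add)
next
  case (scale f a)
  then show ?case by (simp add: tendsto_mult_left)
qed

text \<open>Integrating the pointwise bound of \<open>trig_approx\<close> makes second moments do
  the work of tightness; the error is the same for all laws with moments below
  \<open>D\<close>.\<close>

lemma (in prob_space) expectation_close:
  fixes h :: "(nat \<Rightarrow> real) \<Rightarrow> real"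
  assumes X: "\<And>i. (\<lambda>w. X w i) \<in> borel_measurable M" and X0: "\<And>w i. i \<ge> N \<Longrightarrow> X w i = 0"
    and Xi: "\<And>i. integrable M (\<lambda>w. (X w i)\<^sup>2)" and XD: "\<And>i. (\<integral>w. (X w i)\<^sup>2 \<partial>M) \<le> D"
    and h: "continuous_on UNIV h" and B: "\<And>x. \<bar>h x\<bar> \<le> B" and e: "\<epsilon> > 0" and g: "g \<in> trig N"
    and hg: "\<And>x. (\<forall>i\<ge>N. x i = 0) \<Longrightarrow> \<bar>h x - g x\<bar> \<le> \<epsilon> + (2 * B + \<epsilon>) * (\<Sum>i<N. (x i)\<^sup>2 / L\<^sup>2)"
  shows "\<bar>(\<integral>w. h (X w) \<partial>M) - (\<integral>w. g (X w) \<partial>M)\<bar> \<le> \<epsilon> + (2 * B + \<epsilon>) * (real N * D) / L\<^sup>2"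
proof -
  have B0: "B \<ge> 0" using B[of undefined] by linarith
  have [measurable]: "X \<in> borel_measurable M" by (rule measurable_coordinatewise_then_product[OF X])
  have [measurable]: "h \<in> borel_measurable borel" using h by (rule borel_measurable_continuous_onI)
  have ih: "integrable M (\<lambda>w. h (X w))" by (rule integrable_const_bound[of _ B]) (use B in auto)
  have ig: "integrable M (\<lambda>w. g (X w))" by (rule trig_integrable[where U=X, OF X g])
  have ib: "integrable M (\<lambda>w. \<epsilon> + (2 * B + \<epsilon>) * (\<Sum>i<N. (X w i)\<^sup>2 / L\<^sup>2))"
    using Xi by (auto intro!: Bochner_Integration.integrable_add integrable_mult_right Bochner_Integration.integrable_sum)
  have "\<bar>(\<integral>w. h (X w) \<partial>M) - (\<integral>w. g (X w) \<partial>M)\<bar> = \<bar>\<integral>w. h (X w) - g (X w) \<partial>M\<bar>"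
    using ih ig by simp
  also have "\<dots> \<le> (\<integral>w. \<bar>h (X w) - g (X w)\<bar> \<partial>M)" by (rule integral_abs_bound)
  also have "\<dots> \<le> (\<integral>w. \<epsilon> + (2 * B + \<epsilon>) * (\<Sum>i<N. (X w i)\<^sup>2 / L\<^sup>2) \<partial>M)"
    by (intro integral_mono ib integrable_abs Bochner_Integration.integrable_diff ih ig hg) (use X0 in auto)
  also have "\<dots> = \<epsilon> + (2 * B + \<epsilon>) * (\<Sum>i<N. (\<integral>w. (X w i)\<^sup>2 \<partial>M) / L\<^sup>2)"
    using Xi by (simp add: prob_space)
  also have "\<dots> \<le> \<epsilon> + (2 * B + \<epsilon>) * (\<Sum>i<N. D / L\<^sup>2)"
    using B0 e XD by (intro add_left_mono mult_left_mono sum_mono divide_right_mono) auto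
  also have "\<dots> = \<epsilon> + (2 * B + \<epsilon>) * (real N * D) / L\<^sup>2" by simp
  finally show ?thesis .
qed

text \<open>One trigonometric polynomial is close to \<open>h\<close> in expectation under all laws
  at once, which leaves only its own expectation to converge. Vectors are padded with zeros, so a
  single function type serves every dimension.\<close>

lemma convergence_from_characteristic_functions:
  fixes U :: "nat \<Rightarrow> 'w \<Rightarrow> nat \<Rightarrow> real" and h :: "(nat \<Rightarrow> real) \<Rightarrow> real"
  assumes M: "prob_space M" and M': "prob_space M'"
    and U: "\<And>l i. (\<lambda>w. U l w i) \<in> borel_measurable M" and U0: "\<And>l w i. i \<ge> N \<Longrightarrow> U l w i = 0"
    and Y: "\<And>i. (\<lambda>v. Y v i) \<in> borel_measurable M'" and Y0: "\<And>v i. i \<ge> N \<Longrightarrow> Y v i = 0"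
    and char: "\<And>c. (\<lambda>l. \<integral>w. exp (\<i> * complex_of_real (\<Sum>i<N. c i * U l w i)) \<partial>M)
      \<longlonglongrightarrow> (\<integral>v. exp (\<i> * complex_of_real (\<Sum>i<N. c i * Y v i)) \<partial>M')"
    and Ui: "\<And>l i. integrable M (\<lambda>w. (U l w i)\<^sup>2)" and UD: "\<And>l i. (\<integral>w. (U l w i)\<^sup>2 \<partial>M) \<le> D"
    and Yi: "\<And>i. integrable M' (\<lambda>v. (Y v i)\<^sup>2)" and YD: "\<And>i. (\<integral>v. (Y v i)\<^sup>2 \<partial>M') \<le> D"
    and h: "continuous_on UNIV h" and B: "\<And>x. \<bar>h x\<bar> \<le> B"
  shows "(\<lambda>l. \<integral>w. h (U l w) \<partial>M) \<longlonglongrightarrow> (\<integral>v. h (Y v) \<partial>M')"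
proof (rule LIMSEQ_I)
  fix r :: real assume r: "r > 0"
  have B0: "B \<ge> 0" using B[of undefined] by linarith
  have "0 \<le> (\<integral>w. (U 0 w 0)\<^sup>2 \<partial>M)" by simp
  also note UD[of 0 0]
  finally have D0: "D \<ge> 0" .
  \<comment> \<open>The comparison costs 2 + 1 + 2 times \<open>\<epsilon>\<close>, which is less
    than r.\<close>
  define \<epsilon> where "\<epsilon> = r / 8"
  have e: "\<epsilon> > 0" using r by (simp add: \<epsilon>_def)
  define E where "E = (2 * B + \<epsilon>) * (real N * D)"
  have E0: "E \<ge> 0" using B0 e D0 by (simp add: E_def)
  \<comment> \<open>Makes the tail term equal to \<open>E * \<epsilon> / (E + 1)\<close>; the added
    1 guards against \<open>E = 0\<close>.\<close>
  define L where "L = sqrt ((E + 1) / \<epsilon>)"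
  have L: "L > 0" using E0 e by (simp add: L_def)
  have L2: "L\<^sup>2 = (E + 1) / \<epsilon>" using E0 e by (simp add: L_def)
  obtain g where g: "g \<in> trig N" "\<And>x. (\<forall>i\<ge>N. x i = 0) \<Longrightarrow> \<bar>h x - g x\<bar> \<le> \<epsilon> + (2 * B + \<epsilon>) * (\<Sum>i<N. (x i)\<^sup>2 / L\<^sup>2)"
    using trig_approx[OF h B L e, of N] by blast
  have E: "\<epsilon> + (2 * B + \<epsilon>) * (real N * D) / L\<^sup>2 \<le> 2 * \<epsilon>"
  proof -
    have "(2 * B + \<epsilon>) * (real N * D) / L\<^sup>2 = E * \<epsilon> / (E + 1)" by (simp add: L2 E_def)
    also have "\<dots> \<le> \<epsilon>" using E0 e by (simp add: field_simps)
    finally show ?thesis by simp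
  qed
  have close_U: "\<bar>(\<integral>w. h (U l w) \<partial>M) - (\<integral>w. g (U l w) \<partial>M)\<bar> \<le> 2 * \<epsilon>" for l
    by (rule order.trans[OF prob_space.expectation_close[where X="U l", OF M U U0 Ui UD h B e g] E]; assumption)
  have close_Y: "\<bar>(\<integral>w. h (Y w) \<partial>M') - (\<integral>w. g (Y w) \<partial>M')\<bar> \<le> 2 * \<epsilon>"
    by (rule order.trans[OF prob_space.expectation_close[where X=Y, OF M' Y Y0 Yi YD h B e g] E]; assumption)
  have "(\<lambda>l. \<integral>w. g (U l w) \<partial>M) \<longlonglongrightarrow> (\<integral>v. g (Y v) \<partial>M')"
    by (rule trig_expectation_tendsto[OF M M' U Y char g(1)])
  from LIMSEQ_D[OF this e] obtain n0 where n0: "\<And>l. l \<ge> n0 \<Longrightarrow> \<bar>(\<integral>w. g (U l w) \<partial>M) - (\<integral>v. g (Y v) \<partial>M')\<bar> < \<epsilon>" by auto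
  have "norm ((\<integral>w. h (U l w) \<partial>M) - (\<integral>v. h (Y v) \<partial>M')) < r" if "l \<ge> n0" for l
    using n0[OF that] close_U[of l] close_Y r
    unfolding \<epsilon>_def by (simp only: real_norm_def)
  then show "\<exists>n0. \<forall>l\<ge>n0. norm ((\<integral>w. h (U l w) \<partial>M) - (\<integral>v. h (Y v) \<partial>M')) < r" by blast
qed

section \<open>Characteristic functions from moments\<close>

lemma exp_even_series:
  "(\<lambda>r. \<Sum>k\<le>2 * r. \<i> ^ k * complex_of_real (normal_mom k * s ^ k) / fact k) \<longlonglongrightarrow> complex_of_real (exp (- (s\<^sup>2) / 2))"
proof -
  have "(\<Sum>k\<le>2 * r. \<i> ^ k * complex_of_real (normal_mom k * s ^ k) / fact k) = complex_of_real (\<Sum>k\<le>r. (- (s\<^sup>2) / 2) ^ k / fact k)" for r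
  proof (induction r)
    case 0
    then show ?case by (simp add: normal_mom_def)
  next
    case (Suc r)
    have "\<i> ^ (2 * Suc r) * complex_of_real (normal_mom (2 * Suc r) * s ^ (2 * Suc r)) / fact (2 * Suc r)
       = complex_of_real ((- (s\<^sup>2) / 2) ^ Suc r / fact (Suc r))"
    proof -
      have "\<i> ^ (2 * Suc r) = complex_of_real ((-1) ^ Suc r)" by (simp only: power_mult power2_i) simp
      moreover have "(fact (2 * Suc r) :: complex) = complex_of_real (fact (2 * Suc r))" by simp
      moreover have "(-1) ^ Suc r * (normal_mom (2 * Suc r) * s ^ (2 * Suc r)) / fact (2 * Suc r) = (- (s\<^sup>2) / 2) ^ Suc r / fact (Suc r)"
      proof -
        have "normal_mom (2 * Suc r) = fact (2 * Suc r) / (2 ^ Suc r * fact (Suc r))" by (simp add: normal_mom_def)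
        moreover have "(- (s\<^sup>2) / 2) ^ Suc r = (-1) ^ Suc r * s ^ (2 * Suc r) / 2 ^ Suc r"
          by (simp only: power_mult power_divide power_minus[of "s\<^sup>2"])
        moreover have "a * (F / (P * G) * x) / F = a * x / P / G" if "F \<noteq> 0" for a F P G x :: real
          using that by (cases "P = 0"; cases "G = 0") (auto simp: field_simps)
        from this[OF fact_nonzero] have "(-1) ^ Suc r * (fact (2 * Suc r) / (2 ^ Suc r * fact (Suc r)) * s ^ (2 * Suc r)) / fact (2 * Suc r)
          = (-1) ^ Suc r * s ^ (2 * Suc r) / 2 ^ Suc r / fact (Suc r)" .
        ultimately show ?thesis by (simp only:)
      qed
      ultimately show ?thesis by (simp only: of_real_mult[symmetric] of_real_divide[symmetric])
    qed
    moreover have "normal_mom (Suc (2 * r)) = 0" by (simp add: normal_mom_def)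
    moreover have "2 * Suc r = Suc (Suc (2 * r))" by simp
    ultimately show ?case using Suc.IH by (simp del: fact_Suc power_Suc)
  qed
  moreover have "(\<lambda>r. \<Sum>k\<le>r. (- (s\<^sup>2) / 2) ^ k / fact k) \<longlonglongrightarrow> exp (- (s\<^sup>2) / 2)"
  proof -
    have "x ^ k /\<^sub>R fact k = x ^ k / fact k" for x :: real and k by (simp add: divide_inverse)
    then show ?thesis using exp_converges[of "- (s\<^sup>2) / 2"] unfolding sums_def_le by simp
  qed
  ultimately show ?thesis by (simp only: tendsto_of_real_iff)
qed

text \<open>The Taylor remainder of order 2n is at most twice the 2n-th moment over (2n)!. For
  Gaussian limits this quotient tends to the n-th term of the series of exp(s^2/2), so it is small
  for large n.\<close>

lemma characteristic_function_from_moments: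
  fixes X :: "nat \<Rightarrow> 'w \<Rightarrow> real"
  assumes M: "prob_space M" and am: "\<And>l. all_moments M (X l)"
    and lim: "\<And>k. (\<lambda>l. \<integral>w. X l w ^ k \<partial>M) \<longlonglongrightarrow> normal_mom k * s ^ k"
  shows "(\<lambda>l. \<integral>w. exp (\<i> * complex_of_real (X l w)) \<partial>M) \<longlonglongrightarrow> complex_of_real (exp (- (s\<^sup>2) / 2))"
proof (rule LIMSEQ_I)
  interpret prob_space M by (rule M)
  fix r :: real assume r: "r > 0"
  let ?S = "\<lambda>n. \<Sum>k\<le>n. \<i> ^ k * complex_of_real (normal_mom k * s ^ k) / fact k"
  let ?T = "\<lambda>n l. \<Sum>k\<le>n. \<i> ^ k * complex_of_real (\<integral>w. X l w ^ k \<partial>M) / fact k"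
  have "eventually (\<lambda>n. norm (?S (2 * n) - complex_of_real (exp (- (s\<^sup>2) / 2))) < r / 4) sequentially"
    using tendstoD[OF exp_even_series, of "r / 4" s] r by (simp add: dist_norm)
  moreover have "(\<lambda>n. inverse (fact n) * ((s\<^sup>2) / 2) ^ n) \<longlonglongrightarrow> 0"
    using summable_LIMSEQ_zero[OF summable_exp[of "(s\<^sup>2) / 2"]] .
  then have "eventually (\<lambda>n. inverse (fact n) * ((s\<^sup>2) / 2) ^ n < r / 8) sequentially"
    using r by (intro order_tendstoD(2)) auto
  ultimately have "eventually (\<lambda>n. norm (?S (2 * n) - complex_of_real (exp (- (s\<^sup>2) / 2))) < r / 4 \<and> inverse (fact n) * ((s\<^sup>2) / 2) ^ n < r / 8) sequentially"
    by (rule eventually_conj)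
  \<comment> \<open>The degree is fixed before the index \<open>l\<close>; both the limiting series
    and the limiting remainder are already small at it.\<close>
  then obtain n where n1: "norm (?S (2 * n) - complex_of_real (exp (- (s\<^sup>2) / 2))) < r / 4" and n2: "inverse (fact n) * ((s\<^sup>2) / 2) ^ n < r / 8"
    by (auto simp: eventually_sequentially)
  have mom: "normal_mom (2 * n) * s ^ (2 * n) / fact (2 * n) = inverse (fact n) * ((s\<^sup>2) / 2) ^ n"
    by (simp add: normal_mom_def power_even_eq power_divide field_simps power2_eq_square power_mult_distrib mult_2_right power_add)
  have bound: "norm ((\<integral>w. exp (\<i> * complex_of_real (X l w)) \<partial>M) - ?T (2 * n) l) \<le> 2 * (\<integral>w. X l w ^ (2 * n) \<partial>M) / fact (2 * n)" for l
  proof -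
    have [measurable]: "X l \<in> borel_measurable M" using am by (simp add: all_moments_def)
    have int: "integrable M (\<lambda>w. X l w ^ k)" for k by (intro all_moments_integrable all_moments_power am)
    have i1: "integrable M (\<lambda>w. exp (\<i> * complex_of_real (X l w)))" by (rule integrable_iexp) auto
    have i2: "integrable M (\<lambda>w. (\<i> * complex_of_real (X l w)) ^ k / fact k)" for k
    proof -
      have "(\<lambda>w. (\<i> * complex_of_real (X l w)) ^ k / fact k) = (\<lambda>w. (\<i> ^ k / fact k) * complex_of_real (X l w ^ k))"
        by (auto simp: power_mult_distrib)
      then show ?thesis by (simp only:) (intro integrable_mult_right integrable_of_real int)
    qed
    have "?T (2 * n) l = (\<integral>w. (\<Sum>k\<le>2 * n. (\<i> * complex_of_real (X l w)) ^ k / fact k) \<partial>M)"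
    proof -
      have "(\<integral>w. (\<i> * complex_of_real (X l w)) ^ k / fact k \<partial>M) = \<i> ^ k * complex_of_real (\<integral>w. X l w ^ k \<partial>M) / fact k" for k
      proof -
        have "(\<integral>w. (\<i> * complex_of_real (X l w)) ^ k / fact k \<partial>M) = (\<integral>w. (\<i> ^ k / fact k) * complex_of_real (X l w ^ k) \<partial>M)"
          by (simp add: power_mult_distrib)
        also have "\<dots> = (\<i> ^ k / fact k) * complex_of_real (\<integral>w. X l w ^ k \<partial>M)" by (simp only: integral_mult_right_zero integral_complex_of_real)
        finally show ?thesis by simp
      qed
      then show ?thesis using i2 by (subst Bochner_Integration.integral_sum) auto
    qed
    then have "norm ((\<integral>w. exp (\<i> * complex_of_real (X l w)) \<partial>M) - ?T (2 * n) l) =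
      norm (\<integral>w. exp (\<i> * complex_of_real (X l w)) - (\<Sum>k\<le>2 * n. (\<i> * complex_of_real (X l w)) ^ k / fact k) \<partial>M)"
      using i1 i2 by (simp add: Bochner_Integration.integral_diff Bochner_Integration.integrable_sum)
    also have "\<dots> \<le> (\<integral>w. norm (exp (\<i> * complex_of_real (X l w)) - (\<Sum>k\<le>2 * n. (\<i> * complex_of_real (X l w)) ^ k / fact k)) \<partial>M)"
      by (rule integral_norm_bound)
    also have "\<dots> \<le> (\<integral>w. 2 * X l w ^ (2 * n) / fact (2 * n) \<partial>M)"
    proof (rule integral_mono)
      show "integrable M (\<lambda>w. norm (exp (\<i> * complex_of_real (X l w)) - (\<Sum>k\<le>2 * n. (\<i> * complex_of_real (X l w)) ^ k / fact k)))"
        using i1 i2 by (intro integrable_norm Bochner_Integration.integrable_diff Bochner_Integration.integrable_sum)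
      show "integrable M (\<lambda>w. 2 * X l w ^ (2 * n) / fact (2 * n))" using int by simp
      show "norm (exp (\<i> * complex_of_real (X l w)) - (\<Sum>k\<le>2 * n. (\<i> * complex_of_real (X l w)) ^ k / fact k)) \<le> 2 * X l w ^ (2 * n) / fact (2 * n)" for w
        using iexp_approx2[of "X l w" "2 * n"] power_even_abs[of "2 * n" "X l w"] by simp
    qed
    also have "\<dots> = 2 * (\<integral>w. X l w ^ (2 * n) \<partial>M) / fact (2 * n)" by simp
    finally show ?thesis .
  qed
  have "(\<lambda>l. ?T (2 * n) l) \<longlonglongrightarrow> ?S (2 * n)"
    by (intro tendsto_sum tendsto_divide tendsto_mult tendsto_of_real lim tendsto_const) auto
  then have "eventually (\<lambda>l. norm (?T (2 * n) l - ?S (2 * n)) < r / 4) sequentially"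
    using r by (auto dest!: tendstoD[where e="r / 4"] simp: dist_norm)
  moreover have lim2: "(\<lambda>l. 2 * (\<integral>w. X l w ^ (2 * n) \<partial>M) / fact (2 * n)) \<longlonglongrightarrow> 2 * (normal_mom (2 * n) * s ^ (2 * n)) / fact (2 * n)"
    by (intro tendsto_divide tendsto_mult lim tendsto_const) auto
  moreover have "2 * (normal_mom (2 * n) * s ^ (2 * n)) / fact (2 * n) < r / 4"
  proof -
    have "2 * (normal_mom (2 * n) * s ^ (2 * n)) / fact (2 * n) = 2 * (normal_mom (2 * n) * s ^ (2 * n) / fact (2 * n))"
      by (rule times_divide_eq_right[symmetric])
    also have "\<dots> = 2 * (inverse (fact n) * ((s\<^sup>2) / 2) ^ n)" by (simp only: mom)
    also have "\<dots> < r / 4" using n2 by linarith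
    finally show ?thesis .
  qed
  then have "eventually (\<lambda>l. 2 * (\<integral>w. X l w ^ (2 * n) \<partial>M) / fact (2 * n) < r / 4) sequentially"
    by (rule order_tendstoD(2)[OF lim2])
  ultimately have "eventually (\<lambda>l. norm (?T (2 * n) l - ?S (2 * n)) < r / 4 \<and> 2 * (\<integral>w. X l w ^ (2 * n) \<partial>M) / fact (2 * n) < r / 4) sequentially"
    by (intro eventually_conj)
  then obtain l0 where l0: "\<And>l. l \<ge> l0 \<Longrightarrow> norm (?T (2 * n) l - ?S (2 * n)) < r / 4 \<and> 2 * (\<integral>w. X l w ^ (2 * n) \<partial>M) / fact (2 * n) < r / 4"
    by (auto simp: eventually_sequentially)
  have "norm ((\<integral>w. exp (\<i> * complex_of_real (X l w)) \<partial>M) - complex_of_real (exp (- (s\<^sup>2) / 2))) < r" if "l \<ge> l0" for l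
  proof -
    have "norm ((\<integral>w. exp (\<i> * complex_of_real (X l w)) \<partial>M) - complex_of_real (exp (- (s\<^sup>2) / 2))) \<le>
      norm ((\<integral>w. exp (\<i> * complex_of_real (X l w)) \<partial>M) - ?T (2 * n) l) + norm (?T (2 * n) l - ?S (2 * n)) + norm (?S (2 * n) - complex_of_real (exp (- (s\<^sup>2) / 2)))"
      by norm
    then show ?thesis using bound[of l] l0[OF that] n1 r by linarith
  qed
  then show "\<exists>l0. \<forall>l\<ge>l0. norm ((\<integral>w. exp (\<i> * complex_of_real (X l w)) \<partial>M) - complex_of_real (exp (- (s\<^sup>2) / 2))) < r" by blast
qed

section \<open>Harmonic analysis on a compact Abelian group\<close>

text \<open>Log-convexity makes the ratios increase, submultiplicativity bounds them, and
  \<open>L\<close> is their limit. In the application \<open>s n\<close> is the squared norm of the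
  power n + 1 of a self-adjoint function.\<close>

lemma ratio_limit:
  fixes s :: "nat \<Rightarrow> real"
  assumes pos: "s 0 > 0" "s 1 > 0" and logconv: "\<And>n. (s (Suc n))\<^sup>2 \<le> s n * s (Suc (Suc n))"
    and submult: "\<And>a b. s (Suc (a + b)) \<le> s a * s b"
  shows "\<exists>L>0. (\<forall>n. 1 \<le> s n / L ^ Suc n) \<and> decseq (\<lambda>n. s n / L ^ Suc n)"
proof -
  have s: "s n > 0 \<and> s (Suc n) > 0" for n
  proof (induction n)
    case (Suc n)
    have "0 < (s (Suc n))\<^sup>2" using Suc by simp
    also have "\<dots> \<le> s n * s (Suc (Suc n))" by (rule logconv)
    finally show ?case using Suc by (simp add: zero_less_mult_iff)
  qed (use pos in auto)
  then have sp: "s n > 0" for n by blast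
  define r where "r n = s (Suc n) / s n" for n
  have rpos: "r n > 0" for n using sp by (simp add: r_def)
  have "r n \<le> r (Suc n)" for n
    using logconv[of n] sp[of n] sp[of "Suc n"] by (simp add: r_def field_simps power2_eq_square)
  then have inc: "incseq r" by (rule incseq_SucI)
  have "r n \<le> s 0" for n using submult[of n 0] sp[of n] by (simp add: r_def field_simps)
  then obtain L where lim: "r \<longlonglongrightarrow> L" and r: "\<And>n. r n \<le> L"
    using incseq_convergent[OF inc] by blast
  have l: "L > 0" using r[of 0] rpos[of 0] by linarith
  \<comment> \<open>Growth from \<open>N\<close> on is at least geometric with ratio
    \<open>r N\<close>; compared with submultiplicativity the factor \<open>s N\<close> cancels, and
    \<open>N\<close> may tend to infinity.\<close>
  have ge: "s (Suc (N + n)) \<ge> s N * r N ^ Suc n" for N n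
  proof (induction n)
    case 0
    then show ?case using sp[of N] by (simp add: r_def)
  next
    case (Suc n)
    have "r N \<le> r (Suc (N + n))" by (rule incseqD[OF inc]) simp
    then have "s N * r N ^ Suc (Suc n) \<le> s (Suc (N + n)) * r (Suc (N + n))"
      using mult_mono[OF Suc.IH, of "r N" "r (Suc (N + n))"] rpos sp by (simp add: less_imp_le mult_ac)
    also have "\<dots> = s (Suc (N + Suc n))" using sp[of "Suc (N + n)"] by (simp add: r_def)
    finally show ?case .
  qed
  have "r N ^ Suc n \<le> s n" for N n
    using order.trans[OF ge submult, of N n] sp[of N] by simp
  moreover have "(\<lambda>N. r N ^ Suc n) \<longlonglongrightarrow> L ^ Suc n" for n by (intro tendsto_power lim)
  ultimately have "L ^ Suc n \<le> s n" for n by (meson LIMSEQ_le_const2)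
  then have 1: "1 \<le> s n / L ^ Suc n" for n using l by simp
  have "s (Suc n) / L ^ Suc (Suc n) \<le> s n / L ^ Suc n" for n
    using r[of n] sp[of n] l by (simp add: r_def field_simps)
  then have "decseq (\<lambda>n. s n / L ^ Suc n)" by (rule decseq_SucI)
  with 1 l show ?thesis by blast
qed

abbreviation cont :: "('a::topological_space \<Rightarrow> 'b::topological_space) \<Rightarrow> bool" where
  "cont f \<equiv> continuous_on UNIV f"

lemma cont_sequentially:
  fixes f :: "'a::first_countable_topology \<Rightarrow> 'b::topological_space"
  assumes "\<And>X x. X \<longlonglongrightarrow> x \<Longrightarrow> (\<lambda>n. f (X n)) \<longlonglongrightarrow> f x"
  shows "cont f"
  unfolding continuous_on_def tendsto_at_iff_sequentially using assms by (auto simp: comp_def)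

lemma cont_tendsto: "cont f \<Longrightarrow> X \<longlonglongrightarrow> x \<Longrightarrow> (\<lambda>n. f (X n)) \<longlonglongrightarrow> f x"
  by (rule continuous_on_tendsto_compose[of UNIV f]) auto

locale compact_haar =
  fixes H :: "'g::{topological_ab_group_add, t2_space, second_countable_topology} measure"
  assumes compact_UNIV: "compact (UNIV :: 'g set)" and haar: "normalized_haar H"
begin

sublocale prob_space H using haar by (simp add: normalized_haar_def)

lemma sets_H[measurable_cong]: "sets H = sets borel" using haar by (simp add: normalized_haar_def)
lemma space_H[simp]: "space H = UNIV" using sets_eq_imp_space_eq[OF sets_H] by simp

lemma prob_UNIV[simp]: "measure H UNIV = 1" using prob_space by simp

lemma distr_shift: "distr H borel (\<lambda>g. h + g) = H" using haar by (simp add: normalized_haar_def)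

lemma meas_add[measurable]: "(\<lambda>g. h + g) \<in> borel_measurable H" "(\<lambda>g. g + h) \<in> borel_measurable H"
  "(\<lambda>g. h - g) \<in> borel_measurable H" "(\<lambda>g. g - h) \<in> borel_measurable H" "uminus \<in> borel_measurable H"
  unfolding measurable_cong_sets[OF sets_H refl]
  by (intro borel_measurable_continuous_onI continuous_intros)+

lemma integral_shift:
  fixes f :: "'g \<Rightarrow> 'b::{banach, second_countable_topology}"
  assumes "f \<in> borel_measurable borel"
  shows "(LINT g|H. f (h + g)) = (LINT g|H. f g)"
proof -
  have "(LINT g|H. f g) = (LINT g|distr H borel (\<lambda>g. h + g). f g)" by (simp only: distr_shift)
  also have "\<dots> = (LINT g|H. f (h + g))" by (rule integral_distr) (use assms in auto)
  finally show ?thesis ..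
qed

lemma integral_shift_minus:
  fixes f :: "'g \<Rightarrow> 'b::{banach, second_countable_topology}"
  assumes "f \<in> borel_measurable borel"
  shows "(LINT g|H. f (g - h)) = (LINT g|H. f g)"
  using integral_shift[OF assms, of "- h"] by simp

lemma cont_measurable: "cont (f :: 'g \<Rightarrow> 'b::topological_space) \<Longrightarrow> f \<in> borel_measurable borel"
  by (rule borel_measurable_continuous_onI)

lemma cont_bounded: "cont (f :: 'g \<Rightarrow> 'b::real_normed_vector) \<Longrightarrow> \<exists>B. \<forall>x. norm (f x) \<le> B"
proof -
  assume "cont f"
  then have "bounded (range f)" by (intro compact_imp_bounded compact_continuous_image compact_UNIV)
  then obtain B where "\<forall>x\<in>range f. norm x \<le> B" by (auto simp: bounded_iff)
  then show ?thesis by auto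
qed

lemma cont_integrable:
  fixes f :: "'g \<Rightarrow> 'b::{banach, second_countable_topology}"
  assumes "cont f" shows "integrable H f"
proof -
  obtain B where "\<And>x. norm (f x) \<le> B" using cont_bounded[OF assms] by blast
  then show ?thesis
    by (intro integrable_const_bound[of f B]) (use cont_measurable[OF assms] in \<open>auto simp: measurable_cong_sets[OF sets_H refl]\<close>)
qed

lemma sets_HH: "sets (H \<Otimes>\<^sub>M H) = sets (borel :: ('g \<times> 'g) measure)"
proof -
  have "sets (H \<Otimes>\<^sub>M H) = sets (borel \<Otimes>\<^sub>M borel :: ('g \<times> 'g) measure)"
    by (rule sets_pair_measure_cong[OF sets_H sets_H])
  also have "(borel \<Otimes>\<^sub>M borel :: ('g \<times> 'g) measure) = borel" by (rule borel_prod)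
  finally show ?thesis .
qed

lemma cont_integrable_pair:
  fixes f :: "'g \<Rightarrow> 'g \<Rightarrow> 'b::{banach, second_countable_topology}"
  assumes "cont (\<lambda>(x, y). f x y)"
  shows "integrable (H \<Otimes>\<^sub>M H) (\<lambda>(x, y). f x y)"
proof -
  interpret P: pair_prob_space H H ..
  have "compact (UNIV :: ('g \<times> 'g) set)" using compact_Times[OF compact_UNIV compact_UNIV] by simp
  then have "bounded (range (\<lambda>(x, y). f x y))" by (intro compact_imp_bounded compact_continuous_image assms)
  then obtain B where "\<forall>z\<in>range (\<lambda>(x, y). f x y). norm z \<le> B" by (auto simp: bounded_iff)
  then have "\<And>z. norm ((\<lambda>(x, y). f x y) z) \<le> B" by blast
  then show ?thesis
    by (intro P.integrable_const_bound[of _ B])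
      (auto intro!: borel_measurable_continuous_onI assms simp: measurable_cong_sets[OF sets_HH refl])
qed

lemma fubini_cont:
  fixes f :: "'g \<Rightarrow> 'g \<Rightarrow> 'b::{banach, second_countable_topology}"
  assumes "cont (\<lambda>(x, y). f x y)"
  shows "(LINT x|H. LINT y|H. f x y) = (LINT y|H. LINT x|H. f x y)"
proof -
  interpret P: pair_sigma_finite H H ..
  show ?thesis using P.Fubini_integral[OF cont_integrable_pair[OF assms]] by simp
qed

text \<open>Translation invariance allows \<open>- g\<close> to be replaced by \<open>h - g\<close>
  for every \<open>h\<close>; averaging over \<open>h\<close> and exchanging the integrals turns the
  reflection into a translation.\<close>

lemma integral_uminus:
  fixes f :: "'g \<Rightarrow> 'b::{banach, second_countable_topology}"
  assumes f: "cont f" shows "(LINT g|H. f (- g)) = (LINT g|H. f g)"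
proof -
  have "(LINT g|H. f (- g)) = (LINT h|H. LINT g|H. f (h - g))"
  proof -
    have "(LINT g|H. f (h - g)) = (LINT g|H. f (- g))" for h
      using integral_shift_minus[of "\<lambda>g. f (- g)" h] cont_measurable[of "\<lambda>g. f (- g)"]
        continuous_on_compose2[OF f, of UNIV uminus] by (auto simp: continuous_intros)
    then show ?thesis by (simp add: prob_space)
  qed
  also have "\<dots> = (LINT g|H. LINT h|H. f (h - g))"
    by (rule fubini_cont) (auto simp: case_prod_beta intro!: continuous_on_compose2[OF f] continuous_intros)
  also have "\<dots> = (LINT g|H. f g)"
    by (simp add: integral_shift_minus[OF cont_measurable[OF f]] prob_space)
  finally show ?thesis .
qed

text \<open>By compactness finitely many translates of \<open>U\<close> cover the group, and all
  have the same measure.\<close>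

lemma open_pos:
  assumes "open U" "U \<noteq> {}" shows "measure H U > 0"
proof -
  have U: "U \<in> sets borel" using assms by auto
  let ?V = "\<lambda>h. {g. h + g \<in> U}"
  have opV: "open (?V h)" for h
    using open_vimage[OF assms(1), of "\<lambda>g. h + g"] by (simp add: vimage_def continuous_intros)
  have mV: "measure H (?V h) = measure H U" for h
  proof -
    have "measure H U = measure (distr H borel (\<lambda>g. h + g)) U" by (simp only: distr_shift)
    also have "\<dots> = measure H (?V h)" using U by (subst measure_distr) (auto simp: vimage_def)
    finally show ?thesis ..
  qed
  obtain x where x: "x \<in> U" using assms by auto
  have "UNIV \<subseteq> (\<Union>h\<in>UNIV. ?V h)"
  proof
    fix g
    have "g \<in> ?V (x - g)" using x by simp
    then show "g \<in> (\<Union>h\<in>UNIV. ?V h)" by blast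
  qed
  then obtain D where D: "finite D" "UNIV \<subseteq> (\<Union>h\<in>D. ?V h)"
    using compactE_image[OF compact_UNIV, of UNIV ?V] opV by metis
  have "1 = measure H (\<Union>h\<in>D. ?V h)" using D(2) by (simp add: top.extremum_unique)
  also have "\<dots> \<le> (\<Sum>h\<in>D. measure H (?V h))"
    using D opV by (intro finite_measure_subadditive_finite) (auto simp: sets_H)
  also have "\<dots> = (\<Sum>h\<in>D. measure H U)" using mV by (intro sum.cong) auto
  finally have "1 \<le> real (card D) * measure H U" by simp
  then show ?thesis using measure_nonneg[of H U] by (cases "measure H U = 0") (auto simp: less_le)
qed

definition n2 :: "('g \<Rightarrow> complex) \<Rightarrow> real" where "n2 f = (LINT g|H. (norm (f g))\<^sup>2)"

lemma n2_nonneg: "n2 f \<ge> 0" by (simp add: n2_def)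

lemma n2_pos:
  assumes "cont f" "f x \<noteq> 0" shows "n2 f > 0"
proof -
  have c: "cont (\<lambda>g. (norm (f g))\<^sup>2)" by (intro continuous_intros assms)
  have op: "open {g. f g \<noteq> 0}"
    using open_vimage[of "- {0}" f] assms(1) by (auto simp: vimage_def)
  have "n2 f \<noteq> 0"
  proof
    assume "n2 f = 0"
    then have "AE g in H. (norm (f g))\<^sup>2 = 0"
      unfolding n2_def using integral_nonneg_eq_0_iff_AE[OF cont_integrable[OF c]] by simp
    then have "AE g in H. g \<notin> {g. f g \<noteq> 0}" by simp
    then have "measure H {g. f g \<noteq> 0} = 0"
      using op by (subst (asm) AE_iff_measurable[of "{g. f g \<noteq> 0}"]) (auto simp: sets_H measure_def)
    then show False using open_pos[OF op] assms(2) by auto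
  qed
  then show ?thesis using n2_nonneg[of f] by linarith
qed

definition conv :: "('g \<Rightarrow> complex) \<Rightarrow> ('g \<Rightarrow> complex) \<Rightarrow> 'g \<Rightarrow> complex" where
  "conv f g x = (LINT y|H. f y * g (x - y))"

definition star :: "('g \<Rightarrow> complex) \<Rightarrow> 'g \<Rightarrow> complex" where "star f x = cnj (f (- x))"

lemma star_star[simp]: "star (star f) = f" by (auto simp: star_def)

lemma cont_star: assumes "cont f" shows "cont (star f)"
  unfolding star_def by (intro continuous_intros continuous_on_compose2[OF assms]) auto

lemma cont_shift: "cont f \<Longrightarrow> cont (\<lambda>y. f (x - y))" "cont f \<Longrightarrow> cont (\<lambda>y. f (y - x))" "cont f \<Longrightarrow> cont (\<lambda>y. f (y + x))"
  for f :: "'g \<Rightarrow> 'b::topological_space"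
  by (erule continuous_on_compose2; auto intro!: continuous_intros)+

lemma cont_conv:
  assumes "cont f" "cont g" shows "cont (conv f g)"
proof (rule cont_sequentially)
  fix X x assume X: "X \<longlonglongrightarrow> (x :: 'g)"
  obtain B where B: "\<And>x. norm (f x) \<le> B" using cont_bounded[OF assms(1)] by blast
  obtain D where D: "\<And>x. norm (g x) \<le> D" using cont_bounded[OF assms(2)] by blast
  show "(\<lambda>n. conv f g (X n)) \<longlonglongrightarrow> conv f g x"
    unfolding conv_def
  proof (rule integral_dominated_convergence[where w="\<lambda>_. B * D"])
    show "(\<lambda>y. f y * g (x - y)) \<in> borel_measurable H" "(\<lambda>y. f y * g (X n - y)) \<in> borel_measurable H" for n
      by (intro borel_measurable_integrable cont_integrable continuous_intros assms cont_shift)+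
    show "AE y in H. (\<lambda>n. f y * g (X n - y)) \<longlonglongrightarrow> f y * g (x - y)"
      by (intro AE_I2 tendsto_mult tendsto_const cont_tendsto[OF assms(2)] tendsto_diff X)
    show "AE y in H. norm (f y * g (X n - y)) \<le> B * D" for n
      using B D by (intro AE_I2) (simp add: norm_mult mult_mono' order.trans[OF norm_ge_zero B])
  qed simp
qed

lemma conv_add: "cont f \<Longrightarrow> cont g \<Longrightarrow> cont h \<Longrightarrow> conv f (\<lambda>x. g x + h x) = (\<lambda>x. conv f g x + conv f h x)"
  unfolding conv_def
  by (rule ext) (simp add: distrib_left Bochner_Integration.integral_add cont_integrable cont_shift continuous_intros)

lemma conv_scale: "conv f (\<lambda>x. c * g x) = (\<lambda>x. c * conv f g x)"
  unfolding conv_def by (rule ext) (simp add: mult.left_commute[of _ c])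

lemma conv_comm:
  assumes "cont f" "cont g" shows "conv f g = conv g f"
proof
  fix x
  have c: "cont (\<lambda>y. g (x - y) * f y)" by (intro continuous_intros cont_shift assms)
  have c2: "cont (\<lambda>y. f (x + y) * g (- y))"
    by (intro continuous_intros continuous_on_compose2[OF assms(1)] continuous_on_compose2[OF assms(2)]) auto
  have "conv f g x = (LINT y|H. (\<lambda>y. f y * g (x - y)) (x + y))"
    unfolding conv_def by (rule integral_shift[symmetric]) (intro cont_measurable continuous_intros cont_shift assms)
  also have "\<dots> = (LINT y|H. f (x + y) * g (- y))" by simp
  also have "\<dots> = (LINT y|H. f (x + - y) * g (- (- y)))" by (rule integral_uminus[OF c2, symmetric])
  also have "\<dots> = conv g f x" by (simp add: conv_def mult.commute)
  finally show "conv f g x = conv g f x" .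
qed

lemma conv_assoc:
  assumes "cont f" "cont g" "cont h" shows "conv (conv f g) h = conv f (conv g h)"
proof
  fix x
  have "conv (conv f g) h x = (LINT y|H. LINT z|H. f z * g (y - z) * h (x - y))"
    by (simp add: conv_def)
  also have "\<dots> = (LINT z|H. LINT y|H. f z * g (y - z) * h (x - y))"
    by (rule fubini_cont) (auto simp: case_prod_beta intro!: continuous_intros
        continuous_on_compose2[OF assms(1)] continuous_on_compose2[OF assms(2)] continuous_on_compose2[OF assms(3)])
  also have "\<dots> = (LINT z|H. f z * (LINT y|H. (\<lambda>y. g y * h (x - z - y)) (y - z)))"
    by (simp add: mult.assoc)
  also have "\<dots> = (LINT z|H. f z * (LINT y|H. g y * h (x - z - y)))"
  proof -
    have "(LINT y|H. (\<lambda>y. g y * h (x - z - y)) (y - z)) = (LINT y|H. g y * h (x - z - y))" for z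
      by (rule integral_shift_minus) (intro cont_measurable continuous_intros cont_shift assms)
    then show ?thesis by simp
  qed
  also have "\<dots> = conv f (conv g h) x" by (simp add: conv_def)
  finally show "conv (conv f g) h x = conv f (conv g h) x" .
qed

lemma conv_star:
  assumes "cont f" "cont g" shows "star (conv f g) = conv (star f) (star g)"
proof
  fix x
  have c: "cont (\<lambda>y. cnj (f y) * cnj (g (- x - y)))"
    by (intro continuous_intros cont_shift assms)
  have "star (conv f g) x = (LINT y|H. cnj (f y) * cnj (g (- x - y)))"
    unfolding star_def conv_def by (simp flip: complex_cnj_mult)
  also have "\<dots> = (LINT y|H. cnj (f (- y)) * cnj (g (- x - (- y))))"
    by (rule integral_uminus[OF c, symmetric])
  also have "\<dots> = conv (star f) (star g) x" by (simp add: star_def conv_def)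
  finally show "star (conv f g) x = conv (star f) (star g) x" .
qed

text \<open>Convolution sends L2 pairs to bounded functions; this is how L2 convergence becomes
  uniform below.\<close>

lemma conv_norm_le:
  assumes "cont f" "cont g" shows "(norm (conv f g x))\<^sup>2 \<le> n2 f * n2 g"
proof -
  have g: "cont (\<lambda>y. g (x - y))" by (rule cont_shift[OF assms(2)])
  have nn: "(\<integral>\<^sup>+y. (ennreal (norm (k y)))\<^sup>2 \<partial>H) = ennreal (n2 k)" if "cont k" for k
    unfolding n2_def by (subst nn_integral_eq_integral[symmetric])
      (auto simp: ennreal_power intro!: cont_integrable continuous_intros that)
  have meas: "(\<lambda>y. ennreal (norm (k y))) \<in> borel_measurable H" if "cont k" for k :: "'g \<Rightarrow> complex"
    using borel_measurable_integrable[OF cont_integrable[OF that]] by simp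
  have "norm (conv f g x) \<le> (LINT y|H. norm (f y) * norm (g (x - y)))"
    unfolding conv_def by (rule order.trans[OF integral_norm_bound]) (simp add: norm_mult)
  then have "ennreal (norm (conv f g x)) \<le> (\<integral>\<^sup>+y. ennreal (norm (f y)) * ennreal (norm (g (x - y))) \<partial>H)"
    by (subst ennreal_mult[symmetric], simp, simp, subst nn_integral_eq_integral)
      (auto intro!: cont_integrable continuous_intros assms g ennreal_leI)
  then have "(ennreal (norm (conv f g x)))\<^sup>2 \<le> (\<integral>\<^sup>+y. ennreal (norm (f y)) * ennreal (norm (g (x - y))) \<partial>H)\<^sup>2"
    by (rule power_mono) simp
  also have "\<dots> \<le> (\<integral>\<^sup>+y. (ennreal (norm (f y)))\<^sup>2 \<partial>H) * (\<integral>\<^sup>+y. (ennreal (norm (g (x - y))))\<^sup>2 \<partial>H)"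
    by (rule Cauchy_Schwarz_nn_integral) (intro meas assms g)+
  also have "\<dots> = ennreal (n2 f) * ennreal (n2 (\<lambda>y. g (x - y)))" by (simp add: nn assms g)
  also have "n2 (\<lambda>y. g (x - y)) = n2 g"
  proof -
    have c: "cont (\<lambda>y. (norm (g y))\<^sup>2)" by (intro continuous_intros assms)
    have c2: "cont (\<lambda>y. (norm (g (x + y)))\<^sup>2)"
      by (intro continuous_intros continuous_on_compose2[OF assms(2)]) auto
    have "n2 (\<lambda>y. g (x - y)) = (LINT y|H. (norm (g (x + y)))\<^sup>2)"
      unfolding n2_def using integral_uminus[OF c2] by simp
    also have "\<dots> = n2 g" unfolding n2_def by (rule integral_shift[OF cont_measurable[OF c]])
    finally show ?thesis .
  qed
  finally show ?thesis
    by (simp add: ennreal_power n2_nonneg flip: ennreal_mult)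
qed

lemma conv_at_0: "cont f \<Longrightarrow> conv f (star f) 0 = complex_of_real (n2 f)"
  unfolding conv_def star_def n2_def integral_complex_of_real[symmetric]
  by (simp add: complex_norm_square[symmetric] del: of_real_power integral_complex_of_real)

lemma n2_le:
  assumes "cont f" "\<And>x. (norm (f x))\<^sup>2 \<le> B" shows "n2 f \<le> B"
proof -
  have "n2 f \<le> (LINT g|H. B)"
    unfolding n2_def by (intro integral_mono cont_integrable continuous_intros assms) 
  then show ?thesis by (simp add: prob_space)
qed

text \<open>Self-adjointness turns inner products into values of convolutions at 0, which are known
  for powers of one function.\<close>

lemma n2_diff:
  assumes "cont f" "cont g" "star f = f" "star g = g"
  shows "complex_of_real (n2 (\<lambda>x. f x - g x)) = conv f f 0 - 2 * conv f g 0 + conv g g 0"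
proof -
  have d: "cont (\<lambda>x. f x - g x)" by (intro continuous_intros assms)
  have sd: "star (\<lambda>x. f x - g x) = (\<lambda>x. f x - g x)"
    using assms(3,4) by (auto simp: star_def fun_eq_iff)
  have neg: "(\<lambda>x. f x - g x) = (\<lambda>x. f x + (- 1) * g x)" by simp
  have cg: "cont (\<lambda>x. (- 1) * g x)" by (intro continuous_intros assms)
  have e: "conv (\<lambda>x. f x - g x) h 0 = conv h f 0 - conv h g 0" if "cont h" for h
    using conv_comm[OF d that] conv_add[OF that assms(1) cg] conv_scale[of h "- 1" g] by simp
  have "complex_of_real (n2 (\<lambda>x. f x - g x)) = conv (\<lambda>x. f x - g x) (\<lambda>x. f x + (- 1) * g x) 0"
    using conv_at_0[OF d] unfolding sd by simp
  also have "\<dots> = conv (\<lambda>x. f x - g x) f 0 - conv (\<lambda>x. f x - g x) g 0"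
    unfolding conv_add[OF d assms(1) cg] conv_scale by simp
  finally show ?thesis unfolding e[OF assms(1)] e[OF assms(2)] using conv_comm[OF assms(1,2)] by simp
qed

text \<open>The exponent is shifted by one, \<open>cpower F 0 = F\<close>, since convolution of
  continuous functions has no unit in general.\<close>

primrec cpower :: "('g \<Rightarrow> complex) \<Rightarrow> nat \<Rightarrow> 'g \<Rightarrow> complex" where
  "cpower F 0 = F"
| "cpower F (Suc n) = conv F (cpower F n)"

lemma cont_cpower: "cont F \<Longrightarrow> cont (cpower F n)"
  by (induction n) (auto intro: cont_conv)

lemma conv_cpower: "cont F \<Longrightarrow> conv (cpower F a) (cpower F b) = cpower F (Suc (a + b))"
  by (induction a) (auto simp: conv_assoc cont_cpower)

lemma star_cpower: "cont F \<Longrightarrow> star F = F \<Longrightarrow> star (cpower F n) = cpower F n"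
  by (induction n) (auto simp: conv_star cont_cpower)

lemma conv_tendsto:
  assumes f: "\<And>n. cont (f n)" "\<And>n x. norm (f n x) \<le> B" "\<And>x. (\<lambda>n. f n x) \<longlonglongrightarrow> F x"
    and g: "\<And>n. cont (g n)" "\<And>n x. norm (g n x) \<le> D" "\<And>x. (\<lambda>n. g n x) \<longlonglongrightarrow> G x"
    and FG: "cont F" "cont G"
  shows "(\<lambda>n. conv (f n) (g n) x) \<longlonglongrightarrow> conv F G x"
  unfolding conv_def
proof (rule integral_dominated_convergence[where w="\<lambda>_. B * D"])
  show "(\<lambda>y. F y * G (x - y)) \<in> borel_measurable H" "(\<lambda>y. f n y * g n (x - y)) \<in> borel_measurable H" for n
    by (intro borel_measurable_integrable cont_integrable continuous_intros f g FG cont_shift)+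
  show "AE y in H. (\<lambda>n. f n y * g n (x - y)) \<longlonglongrightarrow> F y * G (x - y)"
    by (intro AE_I2 tendsto_mult f g)
  show "AE y in H. norm (f n y * g n (x - y)) \<le> B * D" for n
    using f(2) g(2) by (intro AE_I2) (simp add: norm_mult mult_mono' order.trans[OF norm_ge_zero f(2)])
qed simp

text \<open>Power method: the normalised powers of the positive operator \<open>conv (conv F F)\<close> converge
  to the spectral projection of its largest eigenvalue.\<close>

lemma idempotent_exists:
  assumes F: "cont F" "star F = F" "F x0 \<noteq> 0"
  shows "\<exists>Q L. cont Q \<and> star Q = Q \<and> conv Q Q = Q \<and> Q \<noteq> (\<lambda>_. 0) \<and> (L::real) > 0 \<and>
    conv (conv F F) Q = (\<lambda>x. complex_of_real L * Q x)"
proof -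
  let ?P = "cpower F"
  have cP: "cont (?P n)" for n by (rule cont_cpower[OF F(1)])
  have sP: "star (?P n) = ?P n" for n by (rule star_cpower[OF F(1,2)])
  \<comment> \<open>The squared norm of a power is the value at 0 of the power with twice the
    exponent, so Cauchy-Schwarz makes \<open>s\<close> log-convex and submultiplicative.\<close>
  define s where "s n = n2 (?P n)" for n
  have s0: "conv (?P n) (?P n) 0 = complex_of_real (s n)" for n
    using conv_at_0[OF cP, of n] by (simp add: sP s_def)
  have P0: "?P (Suc (2 * n)) 0 = complex_of_real (s n)" for n
    using s0[of n] by (simp add: conv_cpower[OF F(1)] mult_2)
  have CS: "(norm (?P (Suc (a + b)) x))\<^sup>2 \<le> s a * s b" for a b x
    using conv_norm_le[OF cP cP, of a b x] by (simp only: conv_cpower[OF F(1)] s_def)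
  have nn: "s n \<ge> 0" for n by (simp add: s_def n2_nonneg)
  have "\<exists>L>0. (\<forall>n. 1 \<le> s n / L ^ Suc n) \<and> decseq (\<lambda>n. s n / L ^ Suc n)"
  proof (rule ratio_limit)
    show "s 0 > 0" unfolding s_def using n2_pos[of F x0] F by simp
    then have "?P 1 0 \<noteq> 0" using P0[of 0] by simp
    then show "s 1 > 0" unfolding s_def by (rule n2_pos[OF cP])
    show "(s (Suc n))\<^sup>2 \<le> s n * s (Suc (Suc n))" for n
      using CS[of n "Suc (Suc n)" 0] P0[of "Suc n"] by (simp add: mult_2 del: cpower.simps)
    show "s (Suc (a + b)) \<le> s a * s b" for a b
      unfolding s_def[of "Suc (a + b)"] by (rule n2_le[OF cP CS])
  qed
  then obtain L where L: "L > 0" and t1: "\<And>n. 1 \<le> s n / L ^ Suc n" and dec: "decseq (\<lambda>n. s n / L ^ Suc n)" by blast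
  define t where "t n = s n / L ^ Suc n" for n
  have dec: "decseq t" using dec by (simp add: t_def[abs_def])
  have t1: "1 \<le> t n" for n using t1 by (simp add: t_def)
  obtain t' where t': "t \<longlonglongrightarrow> t'" using decseq_convergent[OF dec, of 1] t1 by blast
  \<comment> \<open>Powers of \<open>conv F F\<close> divided by powers of the growth rate
    \<open>L\<close>. They multiply as \<open>conv (f a) (f b) = f (Suc (a + b))\<close>, so a limit
    has to be idempotent.\<close>
  define f where "f n x = ?P (Suc (2 * n)) x / complex_of_real (L ^ Suc n)" for n x
  have f': "f n = (\<lambda>x. (1 / complex_of_real (L ^ Suc n)) * ?P (Suc (2 * n)) x)" for n by (auto simp: f_def)
  have cf: "cont (f n)" for n unfolding f' by (intro continuous_intros cP)
  have sf: "star (f n) = f n" for n using sP[of "Suc (2 * n)"] by (auto simp: f_def star_def fun_eq_iff simp del: cpower.simps)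
  have cff: "conv (f a) (f b) = f (Suc (a + b))" for a b
  proof -
    have 1: "conv (f a) (?P k) = (\<lambda>x. (1 / complex_of_real (L ^ Suc a)) * conv (?P k) (?P (Suc (2 * a))) x)" for k
    proof -
      have "conv (f a) (?P k) = conv (?P k) (f a)" by (rule conv_comm[OF cf cP])
      also have "\<dots> = (\<lambda>x. (1 / complex_of_real (L ^ Suc a)) * conv (?P k) (?P (Suc (2 * a))) x)"
        unfolding f'[of a] by (rule conv_scale)
      finally show ?thesis .
    qed
    have "conv (f a) (f b) = (\<lambda>x. (1 / complex_of_real (L ^ Suc b)) * ((1 / complex_of_real (L ^ Suc a)) * conv (?P (Suc (2 * b))) (?P (Suc (2 * a))) x))"
      unfolding f'[of b] conv_scale 1 ..
    also have "\<dots> = f (Suc (a + b))"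
    proof -
      have idx: "Suc (Suc (2 * b) + Suc (2 * a)) = Suc (2 * Suc (a + b))" by simp
      have "L ^ Suc b * L ^ Suc a = L ^ Suc (Suc (a + b))" by (simp flip: power_add) (simp add: add.commute)
      then have e: "complex_of_real (L ^ Suc b) * complex_of_real (L ^ Suc a) = complex_of_real (L ^ Suc (Suc (a + b)))"
        by (simp only: of_real_mult[symmetric])
      have gen: "(1 / U) * ((1 / V) * y) = y / (U * V)" for U V y :: complex by simp
      show ?thesis
        by (rule ext) (simp only: conv_cpower[OF F(1)] f_def idx gen e)
    qed
    finally show ?thesis .
  qed
  have f0: "f n 0 = complex_of_real (t n)" for n by (simp add: f_def P0 t_def del: cpower.simps)
  have fb: "norm (f n x) \<le> t 0" for n x
  proof -
    have "(norm (?P (Suc (n + n)) x))\<^sup>2 \<le> (s n)\<^sup>2" using CS[of n n x] by (simp add: power2_eq_square)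
    then have "norm (?P (Suc (2 * n)) x) \<le> s n" using nn by (simp only: mult_2) (rule power2_le_imp_le)
    then have "norm (f n x) \<le> t n" using L by (simp add: f_def t_def norm_divide norm_mult norm_power divide_right_mono del: cpower.simps)
    also have "t n \<le> t 0" using dec by (rule decseqD) simp
    finally show ?thesis .
  qed
  \<comment> \<open>L2 distances between the \<open>f n\<close> are expressed by the convergent
    sequence \<open>t\<close>, hence tend to 0.\<close>
  have n2f: "n2 (\<lambda>x. f a x - f b x) = t (Suc (2 * a)) - 2 * t (Suc (a + b)) + t (Suc (2 * b))" for a b
  proof -
    have "complex_of_real (n2 (\<lambda>x. f a x - f b x)) = f (Suc (a + a)) 0 - 2 * f (Suc (a + b)) 0 + f (Suc (b + b)) 0"
      by (simp only: n2_diff[OF cf[of a] cf[of b] sf[of a] sf[of b]] cff)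
    also have "\<dots> = complex_of_real (t (Suc (2 * a)) - 2 * t (Suc (a + b)) + t (Suc (2 * b)))"
      by (simp add: f0 mult_2[of a, symmetric] mult_2[of b, symmetric])
    finally have "complex_of_real (n2 (\<lambda>x. f a x - f b x)) = complex_of_real (t (Suc (2 * a)) - 2 * t (Suc (a + b)) + t (Suc (2 * b)))" .
    then show ?thesis by (simp only: of_real_eq_iff)
  qed
  have S: "f (Suc n) x = conv (f 0) (f n) x" for n x by (simp add: cff)
  have dist: "(norm (f (Suc a) x - f (Suc b) x))\<^sup>2 \<le> n2 (f 0) * (t (Suc (2 * a)) - 2 * t (Suc (a + b)) + t (Suc (2 * b)))" for a b x
  proof -
    have neg: "(\<lambda>x. f a x - f b x) = (\<lambda>x. f a x + (- 1) * f b x)" by simp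
    have cb: "cont (\<lambda>x. (- 1) * f b x)" and cd: "cont (\<lambda>x. f a x - f b x)" by (intro continuous_intros cf)+
    have "f (Suc a) x - f (Suc b) x = conv (f 0) (\<lambda>x. f a x - f b x) x"
      unfolding neg conv_add[OF cf cf cb] conv_scale S by simp
    then show ?thesis using conv_norm_le[OF cf cd, of 0 x] by (simp only: n2f)
  qed
  \<comment> \<open>One further convolution with \<open>f 0\<close> upgrades L2 to uniform, hence
    the shift to \<open>Suc n\<close>.\<close>
  have "uniformly_Cauchy_on UNIV (\<lambda>n. f (Suc n))"
  proof (rule uniformly_Cauchy_onI)
    fix e :: real assume e: "e > 0"
    define \<epsilon> where "\<epsilon> = e\<^sup>2 / (4 * (n2 (f 0) + 1))"
    have ep: "\<epsilon> > 0" using e n2_nonneg[of "f 0"] by (simp add: \<epsilon>_def)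
    then obtain N where N: "\<And>n. n \<ge> N \<Longrightarrow> \<bar>t n - t'\<bar> < \<epsilon>" using LIMSEQ_D[OF t' ep] by auto
    show "\<exists>N. \<forall>x\<in>UNIV. \<forall>m\<ge>N. \<forall>n\<ge>N. dist (f (Suc m) x) (f (Suc n) x) < e"
    proof (intro exI[of _ N] ballI allI impI)
      fix x a b assume ab: "a \<ge> N" "b \<ge> N"
      have "t (Suc (2 * a)) - 2 * t (Suc (a + b)) + t (Suc (2 * b)) < 4 * \<epsilon>"
        using N[of "Suc (2 * a)"] N[of "Suc (a + b)"] N[of "Suc (2 * b)"] ab by (simp add: abs_less_iff)
      then have "n2 (f 0) * (t (Suc (2 * a)) - 2 * t (Suc (a + b)) + t (Suc (2 * b))) \<le> n2 (f 0) * (4 * \<epsilon>)"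
        by (intro mult_left_mono n2_nonneg) simp
      also have "\<dots> < e\<^sup>2"
        using e n2_nonneg[of "f 0"] by (simp add: \<epsilon>_def field_simps)
      finally have "(norm (f (Suc a) x - f (Suc b) x))\<^sup>2 < e\<^sup>2" using dist[of a x b] by linarith
      then show "dist (f (Suc a) x) (f (Suc b) x) < e" using e by (simp add: dist_norm power2_less_imp_less)
    qed
  qed
  then obtain Q where Q: "uniform_limit UNIV (\<lambda>n. f (Suc n)) Q sequentially"
    using Cauchy_uniformly_convergent uniformly_convergent_on_def by blast
  have cQ: "cont Q" by (rule uniform_limit_theorem[OF _ Q]) (auto simp: cf)
  have limS: "(\<lambda>n. f (Suc n) x) \<longlonglongrightarrow> Q x" for x using tendsto_uniform_limitI[OF Q] by simp
  then have lim: "(\<lambda>n. f n x) \<longlonglongrightarrow> Q x" for x by (rule LIMSEQ_imp_Suc)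
  have sQ: "star Q = Q"
  proof
    fix x
    have "(\<lambda>n. cnj (f n (- x))) \<longlonglongrightarrow> cnj (Q (- x))" by (intro tendsto_intros lim)
    moreover have "(\<lambda>n. cnj (f n (- x))) = (\<lambda>n. f n x)" using sf by (auto simp: star_def fun_eq_iff)
    ultimately show "star Q x = Q x" using lim[of x] LIMSEQ_unique by (auto simp: star_def)
  qed
  have QQ: "conv Q Q = Q"
  proof
    fix x
    have "(\<lambda>n. conv (f n) (f n) x) \<longlonglongrightarrow> conv Q Q x" by (rule conv_tendsto[OF cf fb lim cf fb lim cQ cQ])
    moreover have "(\<lambda>n. conv (f n) (f n) x) \<longlonglongrightarrow> Q x"
      unfolding cff using LIMSEQ_subseq_LIMSEQ[OF lim, of "\<lambda>n. Suc (n + n)" x] by (auto simp: strict_mono_def o_def)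
    ultimately show "conv Q Q x = Q x" by (rule LIMSEQ_unique)
  qed
  have SQ: "conv (conv F F) Q = (\<lambda>x. complex_of_real L * Q x)"
  proof
    fix x
    have FF: "conv F F = (\<lambda>x. complex_of_real L * f 0 x)" using L by (auto simp: f_def)
    have "(\<lambda>n. conv (f 0) (f n) x) \<longlonglongrightarrow> conv (f 0) Q x"
      by (rule conv_tendsto[OF cf fb tendsto_const cf fb lim cf cQ])
    then have "(\<lambda>n. f (Suc n) x) \<longlonglongrightarrow> conv (f 0) Q x" by (simp add: cff)
    then have "conv (f 0) Q x = Q x" using limS LIMSEQ_unique by blast
    then show "conv (conv F F) Q x = complex_of_real L * Q x"
      unfolding FF using conv_comm[OF _ cQ, of "\<lambda>x. complex_of_real L * f 0 x"] conv_comm[OF cf cQ, of 0] conv_scale[of Q "complex_of_real L" "f 0"]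
      by (simp add: continuous_intros cf)
  qed
  \<comment> \<open>The lower bound of \<open>ratio_limit\<close> keeps the limit from vanishing,
    since \<open>Q 0\<close> is \<open>t'\<close>.\<close>
  have "1 \<le> t'" using t' t1 by (meson LIMSEQ_le_const)
  moreover have "Q 0 = complex_of_real t'"
    using lim[of 0] tendsto_of_real[OF t'] unfolding f0 by (rule LIMSEQ_unique)
  ultimately have "Q \<noteq> (\<lambda>_. 0)" by auto
  then show ?thesis using cQ sQ QQ SQ L by blast
qed

text \<open>Real and imaginary part with respect to the involution \<open>star\<close>, both of
  which are fixed by \<open>P\<close> along with \<open>u\<close>.\<close>

lemma hermitian_decomposition:
  assumes P: "cont P" "star P = P" and u: "cont u" "conv P u = u"
    and real: "\<And>F. cont F \<Longrightarrow> star F = F \<Longrightarrow> conv P F = F \<Longrightarrow> \<exists>c. F = (\<lambda>x. c * P x)"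
  shows "\<exists>c. u = (\<lambda>x. c * P x)"
proof -
  have su: "cont (star u)" "conv P (star u) = star u"
    using conv_star[OF P(1) u(1)] cont_star[OF u(1)] by (simp_all add: u P)
  define A where "A x = u x + star u x" for x
  define B where "B x = \<i> * u x + (- \<i>) * star u x" for x
  have ci: "cont (\<lambda>x. \<i> * u x)" "cont (\<lambda>x. (- \<i>) * star u x)" by (intro continuous_intros u su)+
  have "\<exists>c. A = (\<lambda>x. c * P x)"
  proof (rule real)
    show "cont A" unfolding A_def[abs_def] by (intro continuous_intros u su)
    show "star A = A" by (auto simp: A_def star_def fun_eq_iff)
    show "conv P A = A" unfolding A_def[abs_def] conv_add[OF P(1) u(1) su(1)] by (simp only: u su)
  qed
  then obtain a where a: "A = (\<lambda>x. a * P x)" by blast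
  have "\<exists>c. B = (\<lambda>x. c * P x)"
  proof (rule real)
    show "cont B" unfolding B_def[abs_def] by (intro continuous_intros u su)
    show "star B = B" by (auto simp: B_def star_def fun_eq_iff)
    show "conv P B = B" unfolding B_def[abs_def] conv_add[OF P(1) ci] conv_scale by (simp only: u su)
  qed
  then obtain b where b: "B = (\<lambda>x. b * P x)" by blast
  have "u x = (a - \<i> * b) / 2 * P x" for x
  proof -
    have "2 * u x = A x - \<i> * B x" by (simp add: A_def B_def algebra_simps)
    then show ?thesis by (simp add: a b algebra_simps)
  qed
  then show ?thesis by blast
qed

text \<open>\<open>n2 P\<close> is the trace of the projection, hence its rank; the lower bound
  follows by integrating the sup bound for \<open>conv P P\<close>.\<close>

lemma n2_idempotent:
  assumes P: "cont P" "star P = P" "conv P P = P" and nz: "P \<noteq> (\<lambda>_. 0)"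
  shows "P 0 = complex_of_real (n2 P)" "1 \<le> n2 P"
proof -
  show "P 0 = complex_of_real (n2 P)" using conv_at_0[OF P(1)] by (simp add: P)
  obtain x where "P x \<noteq> 0" using nz by auto
  then have pos: "n2 P > 0" by (rule n2_pos[OF P(1)])
  have "n2 P \<le> n2 P * n2 P" by (rule n2_le[OF P(1)]) (use conv_norm_le[OF P(1,1)] P(3) in simp)
  then show "1 \<le> n2 P" using pos by simp
qed

text \<open>A nonzero \<open>f\<close> yields an idempotent \<open>Q\<close> for
  \<open>conv f (star f)\<close>. A minimal idempotent below \<open>Q\<close> reproduces itself
  under translations up to a factor, and this factor is a character at which \<open>f\<close> has a
  nonzero coefficient.\<close>

lemma dual_complete:
  assumes f: "cont f" and coef: "\<And>\<xi>. \<xi> \<in> dual \<Longrightarrow> (LINT g|H. f g * \<xi> (- g)) = 0"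
  shows "f = (\<lambda>_. 0)"
proof (rule ccontr)
  assume "f \<noteq> (\<lambda>_. 0)"
  then obtain x0 where x0: "f x0 \<noteq> 0" by auto
  define F where "F = conv f (star f)"
  have sf: "cont (star f)" by (rule cont_star[OF f])
  have cF: "cont F" unfolding F_def by (rule cont_conv[OF f sf])
  have sF: "star F = F" unfolding F_def conv_star[OF f sf] star_star by (rule conv_comm[OF sf f])
  have "F 0 \<noteq> 0" unfolding F_def conv_at_0[OF f] using n2_pos[OF f x0] by simp
  from idempotent_exists[OF cF sF this] obtain Q L where Q: "cont Q" "star Q = Q" "conv Q Q = Q" "Q \<noteq> (\<lambda>_. 0)"
    and L: "(L::real) > 0" and FQ: "conv (conv F F) Q = (\<lambda>x. complex_of_real L * Q x)" by blast
  \<comment> \<open>The nonzero idempotents below \<open>Q\<close>.\<close>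
  define A where "A = {P. cont P \<and> star P = P \<and> conv P P = P \<and> P \<noteq> (\<lambda>_. 0) \<and> conv P Q = P}"
  have QA: "Q \<in> A" using Q by (simp add: A_def)
  have bdd: "bdd_below (n2 ` A)" by (rule bdd_belowI[of _ 0]) (auto simp: n2_nonneg)
  \<comment> \<open>A proper subidempotent has \<open>n2\<close> smaller by at least 1, so an
    element within 1 of the infimum is already minimal.\<close>
  have "Inf (n2 ` A) < Inf (n2 ` A) + 1" by simp
  then obtain P where PA: "P \<in> A" and Pm: "n2 P < Inf (n2 ` A) + 1"
    using QA by (subst (asm) cInf_less_iff) (use bdd in auto)
  have P: "cont P" "star P = P" "conv P P = P" "P \<noteq> (\<lambda>_. 0)" "conv P Q = P" using PA by (auto simp: A_def)
  have minimal: "R = P" if R: "cont R" "star R = R" "conv R R = R" "R \<noteq> (\<lambda>_. 0)" "conv R P = R" for R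
  proof (rule ccontr)
    assume ne: "R \<noteq> P"
    have "conv (conv R P) Q = conv R P" by (simp only: conv_assoc[OF R(1) P(1) Q(1)] P(5))
    then have "conv R Q = R" by (simp only: R(5))
    then have RA: "R \<in> A" using R by (simp add: A_def)
    have PR: "conv P R = R" using conv_comm[OF P(1) R(1)] R(5) by simp
    let ?D = "\<lambda>x. P x - R x"
    have cR: "cont (\<lambda>x. (- 1) * R x)" by (intro continuous_intros R)
    have cD: "cont ?D" by (intro continuous_intros R P)
    have D': "?D = (\<lambda>x. P x + (- 1) * R x)" by simp
    have sD: "star ?D = ?D" using P(2) R(2) by (auto simp: star_def fun_eq_iff)
    have PD: "conv P ?D = ?D" unfolding D' conv_add[OF P(1) P(1) cR] conv_scale by (simp only: P PR)
    have RD: "conv R ?D = (\<lambda>_. 0)" unfolding D' conv_add[OF R(1) P(1) cR] conv_scale by (simp only: R) simp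
    have DD: "conv ?D ?D = ?D"
    proof -
      have "conv ?D ?D = (\<lambda>x. conv ?D P x + (- 1) * conv ?D R x)"
        by (subst (2) D') (simp only: conv_add[OF cD P(1) cR] conv_scale)
      also have "\<dots> = ?D" by (simp only: conv_comm[OF cD P(1)] conv_comm[OF cD R(1)] PD RD) simp
      finally show ?thesis .
    qed
    have "?D \<noteq> (\<lambda>_. 0)"
    proof
      assume "?D = (\<lambda>_. 0)"
      then have "P x - R x = 0" for x by (rule fun_cong)
      then have "R = P" by (intro ext) simp
      with ne show False by simp
    qed
    from n2_idempotent[OF cD sD DD this] have D0: "?D 0 = complex_of_real (n2 ?D)" and D1: "1 \<le> n2 ?D" by auto
    have "complex_of_real (n2 P - n2 R) = complex_of_real (n2 ?D)"
      using D0 n2_idempotent(1)[OF P(1-4)] n2_idempotent(1)[OF R(1-4)] by simp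
    then have "n2 P - n2 R = n2 ?D" by (simp only: of_real_eq_iff)
    moreover have "Inf (n2 ` A) \<le> n2 R" using bdd RA by (intro cInf_lower) auto
    ultimately show False using D1 Pm by linarith
  qed
  \<comment> \<open>The power method applied to \<open>G\<close> returns an idempotent below
    \<open>P\<close>, hence \<open>P\<close> itself; \<open>conv G G\<close> is fixed by
    \<open>P\<close> and so becomes a multiple of it.\<close>
  have square: "\<exists>c. conv G G = (\<lambda>x. c * P x)" if G: "cont G" "star G = G" "conv P G = G" for G
  proof (cases "G = (\<lambda>_. 0)")
    case True
    then have "conv G G = (\<lambda>x. 0 * P x)" by (simp add: conv_def fun_eq_iff)
    then show ?thesis by blast
  next
    case False
    then obtain x1 where "G x1 \<noteq> 0" by auto
    from idempotent_exists[OF G(1,2) this] obtain R K where R: "cont R" "star R = R" "conv R R = R" "R \<noteq> (\<lambda>_. 0)"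
      and K: "(K::real) > 0" and GR: "conv (conv G G) R = (\<lambda>x. complex_of_real K * R x)" by blast
    have cGG: "cont (conv G G)" by (rule cont_conv[OF G(1,1)])
    have PGG: "conv P (conv G G) = conv G G" by (simp only: conv_assoc[OF P(1) G(1,1), symmetric] G(3))
    have R': "R = (\<lambda>x. (1 / complex_of_real K) * conv (conv G G) R x)" using K by (simp add: GR)
    have "conv P R = R"
    proof -
      have "conv P R = conv P (\<lambda>x. (1 / complex_of_real K) * conv (conv G G) R x)" using R' by simp
      also have "\<dots> = (\<lambda>x. (1 / complex_of_real K) * conv (conv G G) R x)"
        unfolding conv_scale by (simp only: conv_assoc[OF P(1) cGG R(1), symmetric] PGG)
      finally show ?thesis using R' by simp
    qed
    then have "R = P" using minimal[OF R] conv_comm[OF P(1) R(1)] by simp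
    moreover have "conv (conv G G) P = conv G G" using PGG conv_comm[OF P(1) cGG] by simp
    ultimately show ?thesis using GR by auto
  qed
  \<comment> \<open>Polarisation: the square of \<open>G + P\<close> contains \<open>2 * G\<close>
    besides multiples of \<open>P\<close>.\<close>
  have multiple: "\<exists>c. G = (\<lambda>x. c * P x)" if G: "cont G" "star G = G" "conv P G = G" for G
  proof -
    let ?E = "\<lambda>x. G x + P x"
    have cE: "cont ?E" by (intro continuous_intros G P)
    have sE: "star ?E = ?E" using G(2) P(2) by (auto simp: star_def fun_eq_iff)
    have PE: "conv P ?E = ?E" by (simp only: conv_add[OF P(1) G(1) P(1)] G(3) P(3))
    obtain a where a: "conv G G = (\<lambda>x. a * P x)" using square[OF G] by blast
    obtain b where b: "conv ?E ?E = (\<lambda>x. b * P x)" using square[OF cE sE PE] by blast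
    have GP: "conv G P = G" using G(3) conv_comm[OF G(1) P(1)] by simp
    have "conv ?E ?E = (\<lambda>x. conv ?E G x + conv ?E P x)" by (rule conv_add[OF cE G(1) P(1)])
    also have "\<dots> = (\<lambda>x. a * P x + 2 * G x + P x)"
      by (simp only: conv_comm[OF cE G(1)] conv_comm[OF cE P(1)] PE conv_add[OF G(1) G(1) P(1)] a GP) (simp add: fun_eq_iff)
    finally have "(\<lambda>x. b * P x) = (\<lambda>x. a * P x + 2 * G x + P x)" by (simp only: b)
    then have "b * P x = a * P x + 2 * G x + P x" for x by (rule fun_cong)
    moreover have "z = ((b - a - 1) / 2) * y" if "b * y = a * y + 2 * z + y" for y z :: complex
    proof -
      have "z * 2 = (b - a - 1) * y" using that by (simp add: algebra_simps)
      then show ?thesis by simp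
    qed
    ultimately have "G x = ((b - a - 1) / 2) * P x" for x by blast
    then show ?thesis by blast
  qed
  have P0: "P 0 \<noteq> 0" using n2_idempotent[OF P(1-4)] by auto
  \<comment> \<open>Convolution commutes with translation, so a translate of \<open>P\<close> is
    fixed by \<open>P\<close> and thus a multiple of it; the factor depends multiplicatively on
    \<open>h\<close>.\<close>
  have "\<exists>c. (\<lambda>x. P (x + h)) = (\<lambda>x. c * P x)" for h
  proof (rule hermitian_decomposition[OF P(1,2)])
    show "cont (\<lambda>x. P (x + h))" by (rule cont_shift[OF P(1)])
    show "conv P (\<lambda>x. P (x + h)) = (\<lambda>x. P (x + h))"
    proof
      fix x
      have "conv P P (x + h) = P (x + h)" by (simp only: P(3))
      then show "conv P (\<lambda>x. P (x + h)) x = P (x + h)" by (simp add: conv_def algebra_simps)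
    qed
    show "\<exists>c. G = (\<lambda>x. c * P x)" if "cont G" "star G = G" "conv P G = G" for G by (rule multiple[OF that])
  qed
  then obtain c where c: "\<And>h. (\<lambda>x. P (x + h)) = (\<lambda>x. c h * P x)" by metis
  have c': "P (x + h) = c h * P x" for x h using c[of h] by (rule fun_cong)
  have Pc: "P h = c h * P 0" for h using c'[of 0 h] by simp
  have ch: "c h = P h / P 0" for h unfolding nonzero_eq_divide_eq[OF P0] by (rule Pc[symmetric])
  have cmul: "c (x + h) = c x * c h" for x h
  proof -
    have "c (x + h) * P 0 = P (x + h)" by (rule Pc[symmetric])
    also have "\<dots> = c h * P x" by (rule c')
    also have "\<dots> = c h * (c x * P 0)" by (rule arg_cong[OF Pc])
    also have "\<dots> = (c x * c h) * P 0" by (simp only: mult_ac)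
    finally show ?thesis by (rule mult_right_cancel[OF P0, THEN iffD1])
  qed
  have c1: "c 0 = 1" unfolding ch using P0 by simp
  have P0r: "cnj (P 0) = P 0" using n2_idempotent(1)[OF P(1-4)] by simp
  have cneg: "c (- x) = cnj (c x)" for x
  proof -
    have "star P x = P x" by (simp only: P(2))
    then have "cnj (P x) = P (- x)" unfolding star_def by (metis complex_cnj_cnj)
    then show ?thesis unfolding ch by (simp add: P0r)
  qed
  have "norm (c x) = 1" for x
  proof -
    have "c x * cnj (c x) = 1" using cmul[of x "- x"] c1 unfolding cneg by simp
    then have "complex_of_real ((norm (c x))\<^sup>2) = 1" by (simp only: complex_norm_square)
    then have "(norm (c x))\<^sup>2 = 1" by (simp only: of_real_eq_1_iff)
    then show ?thesis using norm_ge_zero[of "c x"] by (auto simp: power2_eq_1_iff)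
  qed
  moreover have "cont c"
  proof -
    have "c = (\<lambda>h. P h / P 0)" by (auto simp: ch)
    then show ?thesis using P(1) P0 by (auto intro!: continuous_intros)
  qed
  ultimately have cd: "c \<in> dual" using cmul by (simp add: dual_def)
  \<comment> \<open>\<open>P\<close> is \<open>P 0\<close> times the character \<open>c\<close>, so
    this convolution is a multiple of the vanishing coefficient of \<open>f\<close> at
    \<open>c\<close>.\<close>
  have fP: "conv f P = (\<lambda>_. 0)"
  proof
    fix x
    have "conv f P x = (LINT y|H. (P 0 * c x) * (f y * c (- y)))"
    proof -
      have "f y * P (x - y) = (P 0 * c x) * (f y * c (- y))" for y
        unfolding Pc[of "x - y"] using cmul[of x "- y"] by (simp add: mult_ac)
      then show ?thesis by (simp only: conv_def)
    qed
    also have "\<dots> = 0" by (simp add: coef[OF cd])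
    finally show "conv f P x = 0" .
  qed
  \<comment> \<open>\<open>Q\<close> has \<open>conv F F\<close> as a factor while \<open>F\<close>
    annihilates \<open>P\<close>, so \<open>conv P Q\<close> vanishes; but it equals
    \<open>P\<close>.\<close>
  have Qe: "Q = (\<lambda>x. (1 / complex_of_real L) * conv (conv F F) Q x)" using L by (simp add: FQ)
  have FP: "conv F P = (\<lambda>_. 0)"
  proof -
    have "F = conv (star f) f" unfolding F_def by (rule conv_comm[OF f sf])
    then have "conv F P = conv (star f) (conv f P)" by (simp only: conv_assoc[OF sf f P(1)])
    then show ?thesis by (simp add: fP) (simp add: conv_def fun_eq_iff)
  qed
  have cFF: "cont (conv F F)" by (rule cont_conv[OF cF cF])
  have "conv P Q = (\<lambda>x. (1 / complex_of_real L) * conv P (conv (conv F F) Q) x)"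
    by (subst Qe) (rule conv_scale)
  also have "conv P (conv (conv F F) Q) = conv (conv (conv F F) P) Q"
    by (simp only: conv_assoc[OF P(1) cFF Q(1), symmetric] conv_comm[OF P(1) cFF])
  also have "conv (conv F F) P = (\<lambda>_. 0)"
    by (simp only: conv_assoc[OF cF cF P(1)] FP) (simp add: conv_def fun_eq_iff)
  finally have "P = (\<lambda>_. 0)" using P(5) by (simp add: conv_def fun_eq_iff)
  then show False using P(4) by simp
qed

end

section \<open>The character group\<close>

text \<open>A type with additive notation, so that the Wick sums, stated over any
  \<open>ab_group_add\<close>, apply to the dual.\<close>

typedef (overloaded) 'g character = "dual :: ('g::topological_ab_group_add \<Rightarrow> complex) set"
  morphisms chr Abs_character
  by (rule exI[of _ "\<lambda>_. 1"]) (simp add: dual_def)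

lemma chr_dual: "chr a \<in> dual" by (rule chr)

lemma chr_cont: "continuous_on UNIV (chr a)" and norm_chr[simp]: "norm (chr a g) = 1" and chr_hom: "chr a (g + h) = chr a g * chr a h"
  using chr[of a] by (auto simp: dual_def)

lemma chr_zero_arg[simp]: "chr a 0 = 1"
proof -
  have "chr a 0 * chr a 0 = chr a 0" using chr_hom[of a 0 0] by simp
  moreover have "chr a 0 \<noteq> 0" using norm_chr[of a 0] by (auto simp del: norm_chr)
  ultimately show ?thesis by simp
qed

lemma chr_mult_cnj[simp]: "chr a g * cnj (chr a g) = 1" "cnj (chr a g) * chr a g = 1"
  by (simp_all add: complex_norm_square[symmetric] mult.commute[of "cnj (chr a g)"])

lemma chr_minus_arg: "chr a (- g) = cnj (chr a g)"
proof -
  have "chr a (- g) = chr a (- g) * (chr a g * cnj (chr a g))" by simp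
  also have "\<dots> = chr a (- g + g) * cnj (chr a g)" by (simp only: chr_hom mult.assoc)
  finally show ?thesis by simp
qed

lemma chr_diff_arg: "chr a (g - h) = chr a g * cnj (chr a h)"
  using chr_hom[of a g "- h"] by (simp add: chr_minus_arg)

lemma chr_eqI: "(\<And>g. chr a g = chr b g) \<Longrightarrow> a = b"
  using chr_inject[of a b] by (auto simp: fun_eq_iff)

instantiation character :: (topological_ab_group_add) ab_group_add
begin
definition "a + b = Abs_character (\<lambda>g. chr a g * chr b g)"
definition "0 = Abs_character (\<lambda>_. 1)"
definition "- a = Abs_character (\<lambda>g. cnj (chr a g))"
definition "a - b = a + (- b :: 'a character)"

lemma chr_add: "chr (a + b) g = chr a g * chr b g"
proof -
  have "(\<lambda>g. chr a g * chr b g) \<in> dual"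
    by (auto simp: dual_def norm_mult chr_hom intro!: continuous_intros chr_cont)
  then show ?thesis by (simp add: plus_character_def Abs_character_inverse)
qed

lemma chr_zero: "chr 0 g = 1"
proof -
  have "(\<lambda>_::'a. 1) \<in> dual" by (simp add: dual_def)
  then show ?thesis by (simp add: zero_character_def Abs_character_inverse)
qed

lemma chr_uminus: "chr (- a) g = cnj (chr a g)"
proof -
  have "(\<lambda>g. cnj (chr a g)) \<in> dual"
    by (auto simp: dual_def chr_hom intro!: continuous_intros chr_cont)
  then show ?thesis by (simp add: uminus_character_def Abs_character_inverse)
qed

instance
proof
  fix a b c :: "'a character"
  show "a + b + c = a + (b + c)" by (rule chr_eqI) (simp add: chr_add mult.assoc)
  show "a + b = b + a" by (rule chr_eqI) (simp add: chr_add mult.commute)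
  show "0 + a = a" by (rule chr_eqI) (simp add: chr_add chr_zero)
  show "- a + a = 0" by (rule chr_eqI) (simp add: chr_add chr_zero chr_uminus)
  show "a - b = a + - b" by (rule minus_character_def)
qed

end

lemma chr_diff: "chr (a - b) g = chr a g * cnj (chr b g)"
  by (simp only: minus_character_def chr_add chr_uminus)

lemma chr_sum: "chr (\<Sum>i\<in>I. f i) g = (\<Prod>i\<in>I. chr (f i) g)"
  by (induction I rule: infinite_finite_induct) (auto simp: chr_add chr_zero)

text \<open>A character of finite order takes values in finitely many roots of unity, and a
  connected finite set is a point.\<close>

lemma torsion_free:
  fixes a :: "'g::{topological_ab_group_add, t2_space} character" and n :: nat
  assumes conn: "connected (UNIV :: 'g set)" and n: "n > 0" and a: "(\<Sum>i<n. a) = 0"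
  shows "a = 0"
proof (rule chr_eqI)
  fix g
  have "chr a g ^ n = 1" for g using a chr_sum[of "\<lambda>_. a" "{..<n}" g] by (simp add: chr_zero)
  then have "range (chr a) \<subseteq> {z. z ^ n = 1}" by auto
  moreover have "finite {z::complex. z ^ n = 1}" using n by (intro finite_roots_unity) simp
  ultimately have "finite (range (chr a))" by (rule finite_subset)
  moreover have "connected (range (chr a))" by (intro connected_continuous_image conn chr_cont)
  ultimately obtain c where "range (chr a) = {c}" using connected_finite_iff_sing[of "range (chr a)"] by auto
  then have "chr a g = chr a 0" using rangeI[of "chr a" g] rangeI[of "chr a" 0] by simp
  then show "chr a g = chr 0 g" by (simp add: chr_zero)
qed

context compact_haar begin

lemma integral_character: "(LINT g|H. chr a g) = (if a = 0 then 1 else 0)"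
proof (cases "a = 0")
  case True
  then show ?thesis by (simp add: chr_zero)
next
  case False
  then obtain h where h: "chr a h \<noteq> 1" using chr_eqI[of a 0] by (auto simp: chr_zero)
  have "(LINT g|H. chr a g) = (LINT g|H. chr a (h + g))"
    by (rule integral_shift[symmetric]) (rule cont_measurable[OF chr_cont])
  also have "\<dots> = chr a h * (LINT g|H. chr a g)" by (simp add: chr_hom)
  finally show ?thesis using h False by simp
qed

section \<open>Continuity of translations in L1\<close>

definition translation_continuous :: "('g \<Rightarrow> real) \<Rightarrow> bool" where
  "translation_continuous f \<longleftrightarrow> integrable H f \<and>
     (\<forall>X. X \<longlonglongrightarrow> 0 \<longrightarrow> (\<lambda>n. LINT g|H. \<bar>f (X n + g) - f g\<bar>) \<longlonglongrightarrow> 0)"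

lemma measurable_H: "f \<in> measurable H N \<longleftrightarrow> f \<in> measurable borel N"
  by (rule arg_cong[where f="\<lambda>S. f \<in> S"], rule measurable_cong_sets[OF sets_H refl])

lemma integrable_shift:
  fixes f :: "'g \<Rightarrow> real"
  assumes "integrable H f" shows "integrable H (\<lambda>g. f (h + g))"
proof -
  have "f \<in> borel_measurable borel" using borel_measurable_integrable[OF assms] by (simp add: measurable_H)
  moreover have "integrable (distr H borel (\<lambda>g. h + g)) f" by (simp only: distr_shift assms)
  ultimately show ?thesis by (subst (asm) integrable_distr_eq[OF meas_add(1)])
qed

text \<open>A three-epsilon argument. The factor 2 in the domination is the one offered by
  \<open>integrable_induct\<close>.\<close>

lemma tc_lim:
  assumes s: "\<And>i. translation_continuous (s i)" and lim: "\<And>g. (\<lambda>i. s i g) \<longlonglongrightarrow> f g"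
    and bd: "\<And>i g. \<bar>s i g\<bar> \<le> 2 * \<bar>f g\<bar>" and f: "integrable H f"
  shows "translation_continuous f"
  unfolding translation_continuous_def
proof (intro conjI allI impI f)
  fix X :: "nat \<Rightarrow> 'g" assume X: "X \<longlonglongrightarrow> 0"
  have si: "integrable H (s i)" for i using s by (simp add: translation_continuous_def)
  have "(\<lambda>i. LINT g|H. \<bar>s i g - f g\<bar>) \<longlonglongrightarrow> (LINT g|H. 0)"
  proof (rule integral_dominated_convergence[where w="\<lambda>g. 3 * \<bar>f g\<bar>"])
    show "(\<lambda>g. \<bar>s i g - f g\<bar>) \<in> borel_measurable H" for i
      using f si by (intro borel_measurable_integrable) auto
    show "integrable H (\<lambda>g. 3 * \<bar>f g\<bar>)" using f by auto
    show "AE g in H. (\<lambda>i. \<bar>s i g - f g\<bar>) \<longlonglongrightarrow> 0"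
    proof (rule AE_I2)
      fix g
      have "(\<lambda>i. \<bar>s i g - f g\<bar>) \<longlonglongrightarrow> \<bar>f g - f g\<bar>" by (intro tendsto_intros lim)
      then show "(\<lambda>i. \<bar>s i g - f g\<bar>) \<longlonglongrightarrow> 0" by simp
    qed
    show "AE g in H. norm \<bar>s i g - f g\<bar> \<le> 3 * \<bar>f g\<bar>" for i
    proof (rule AE_I2)
      fix g
      have "\<bar>s i g - f g\<bar> \<le> \<bar>s i g\<bar> + \<bar>f g\<bar>" by simp
      then show "norm \<bar>s i g - f g\<bar> \<le> 3 * \<bar>f g\<bar>" using bd[of i g] by simp
    qed
  qed auto
  then have L1: "(\<lambda>i. LINT g|H. \<bar>s i g - f g\<bar>) \<longlonglongrightarrow> 0" by simp
  show "(\<lambda>n. LINT g|H. \<bar>f (X n + g) - f g\<bar>) \<longlonglongrightarrow> 0"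
  proof (rule LIMSEQ_I)
    fix r :: real assume r: "r > 0"
    obtain i where "norm ((LINT g|H. \<bar>s i g - f g\<bar>) - 0) < r / 4"
      using LIMSEQ_D[OF L1, of "r / 4"] r by auto
    then have i: "(LINT g|H. \<bar>s i g - f g\<bar>) < r / 4" by simp
    have "(\<lambda>n. LINT g|H. \<bar>s i (X n + g) - s i g\<bar>) \<longlonglongrightarrow> 0" using s X by (simp add: translation_continuous_def)
    from LIMSEQ_D[OF this, of "r / 4"] r obtain n0 where n0: "\<And>n. n \<ge> n0 \<Longrightarrow> norm ((LINT g|H. \<bar>s i (X n + g) - s i g\<bar>) - 0) < r / 4" by auto
    have "norm ((LINT g|H. \<bar>f (X n + g) - f g\<bar>) - 0) < r" if "n \<ge> n0" for n
    proof -
      have d: "integrable H (\<lambda>g. \<bar>s i g - f g\<bar>)" using f si by auto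
      have int: "integrable H (\<lambda>g. \<bar>f (X n + g) - f g\<bar>)" "integrable H (\<lambda>g. \<bar>s i (X n + g) - f (X n + g)\<bar>)" "integrable H (\<lambda>g. \<bar>s i (X n + g) - s i g\<bar>)"
        using f si integrable_shift[OF f, of "X n"] integrable_shift[OF si, of i "X n"] by auto
      have "(LINT g|H. \<bar>f (X n + g) - f g\<bar>) \<le> (LINT g|H. \<bar>s i (X n + g) - f (X n + g)\<bar> + \<bar>s i (X n + g) - s i g\<bar> + \<bar>s i g - f g\<bar>)"
        by (intro integral_mono int Bochner_Integration.integrable_add d) linarith
      also have "\<dots> = (LINT g|H. \<bar>s i (X n + g) - f (X n + g)\<bar>) + (LINT g|H. \<bar>s i (X n + g) - s i g\<bar>) + (LINT g|H. \<bar>s i g - f g\<bar>)"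
        using int d by simp
      also have "(LINT g|H. \<bar>s i (X n + g) - f (X n + g)\<bar>) = (LINT g|H. \<bar>s i g - f g\<bar>)"
        using integral_shift[of "\<lambda>g. \<bar>s i g - f g\<bar>" "X n"] borel_measurable_integrable[OF d] by (simp add: measurable_H)
      finally show ?thesis using i n0[OF that] r by simp
    qed
    then show "\<exists>n0. \<forall>n\<ge>n0. norm ((LINT g|H. \<bar>f (X n + g) - f g\<bar>) - 0) < r" by blast
  qed
qed

lemma tc_add:
  assumes "translation_continuous f" "translation_continuous k"
  shows "translation_continuous (\<lambda>g. f g + k g)"
  unfolding translation_continuous_def
proof (intro conjI allI impI)
  have i: "integrable H f" "integrable H k" using assms by (auto simp: translation_continuous_def)
  show "integrable H (\<lambda>g. f g + k g)" using i by simp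
  fix X :: "nat \<Rightarrow> 'g" assume X: "X \<longlonglongrightarrow> 0"
  have L: "(\<lambda>n. (LINT g|H. \<bar>f (X n + g) - f g\<bar>) + (LINT g|H. \<bar>k (X n + g) - k g\<bar>)) \<longlonglongrightarrow> 0"
    using tendsto_add[of "\<lambda>n. LINT g|H. \<bar>f (X n + g) - f g\<bar>" 0 sequentially "\<lambda>n. LINT g|H. \<bar>k (X n + g) - k g\<bar>" 0]
      assms X by (simp add: translation_continuous_def)
  have bd: "(LINT g|H. \<bar>f (X n + g) + k (X n + g) - (f g + k g)\<bar>) \<le> (LINT g|H. \<bar>f (X n + g) - f g\<bar>) + (LINT g|H. \<bar>k (X n + g) - k g\<bar>)" for n
  proof -
    have i2: "integrable H (\<lambda>g. f (X n + g))" "integrable H (\<lambda>g. k (X n + g))" using i integrable_shift by auto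
    have "(LINT g|H. \<bar>f (X n + g) + k (X n + g) - (f g + k g)\<bar>) \<le> (LINT g|H. \<bar>f (X n + g) - f g\<bar> + \<bar>k (X n + g) - k g\<bar>)"
    proof (rule integral_mono)
      fix g
      have "f (X n + g) + k (X n + g) - (f g + k g) = (f (X n + g) - f g) + (k (X n + g) - k g)" by simp
      then show "\<bar>f (X n + g) + k (X n + g) - (f g + k g)\<bar> \<le> \<bar>f (X n + g) - f g\<bar> + \<bar>k (X n + g) - k g\<bar>"
        by (simp only: abs_triangle_ineq)
    qed (use i i2 in simp_all)
    also have "\<dots> = (LINT g|H. \<bar>f (X n + g) - f g\<bar>) + (LINT g|H. \<bar>k (X n + g) - k g\<bar>)" using i i2 by simp
    finally show ?thesis .
  qed
  show "(\<lambda>n. LINT g|H. \<bar>f (X n + g) + k (X n + g) - (f g + k g)\<bar>) \<longlonglongrightarrow> 0"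
    by (rule tendsto_sandwich[OF _ _ tendsto_const L]) (auto intro!: always_eventually bd)
qed

lemma tc_scale: "translation_continuous f \<Longrightarrow> translation_continuous (\<lambda>g. c * f g)"
proof -
  assume f: "translation_continuous f"
  have "(LINT g|H. \<bar>c * f (x + g) - c * f g\<bar>) = \<bar>c\<bar> * (LINT g|H. \<bar>f (x + g) - f g\<bar>)" for x
    by (simp add: abs_mult flip: right_diff_distrib)
  then show ?thesis using f by (auto simp: translation_continuous_def intro!: tendsto_mult_right_zero)
qed

lemma tc_const: "translation_continuous (\<lambda>_. c)"
  by (simp add: translation_continuous_def)

lemma integrable_indicator: "A \<in> sets borel \<Longrightarrow> integrable H (indicator A :: 'g \<Rightarrow> real)"
  by (intro integrable_const_bound[of _ 1]) (auto simp: measurable_H indicator_def)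

text \<open>A set and its translate have equal measure, so the symmetric difference is twice a
  one-sided difference. That one is controlled at points off \<open>K\<close>, from which nearby
  translates stay away because the complement is open.\<close>

lemma tc_closed:
  assumes K: "closed K" shows "translation_continuous (indicator K)"
  unfolding translation_continuous_def
proof (intro conjI allI impI)
  have bK: "K \<in> sets borel" using K by simp
  show iK: "integrable H (indicator K :: 'g \<Rightarrow> real)" by (rule integrable_indicator[OF bK])
  fix X :: "nat \<Rightarrow> 'g" assume X: "X \<longlonglongrightarrow> 0"
  let ?b = "\<lambda>g. indicator K g :: real" and ?a = "\<lambda>n g. indicator K (X n + g) :: real"
  have iA: "integrable H (?a n)" for n by (rule integrable_shift[OF iK])
  have mP: "(\<lambda>g. ?a n g * (1 - ?b g)) \<in> borel_measurable H" for n
    using borel_measurable_integrable[OF iA[of n]] borel_measurable_integrable[OF iK] by simp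
  have iP: "integrable H (\<lambda>g. ?a n g * (1 - ?b g))" for n
    by (rule integrable_const_bound[of _ 1]) (use mP in \<open>auto simp: indicator_def\<close>)
  have "(LINT g|H. \<bar>?a n g - ?b g\<bar>) = 2 * (LINT g|H. ?a n g * (1 - ?b g))" for n
  proof -
    have "\<bar>?a n g - ?b g\<bar> = 2 * (?a n g * (1 - ?b g)) - ?a n g + ?b g" for g
      by (simp add: indicator_def)
    then have "(LINT g|H. \<bar>?a n g - ?b g\<bar>) = (LINT g|H. 2 * (?a n g * (1 - ?b g)) - ?a n g + ?b g)" by simp
    also have "\<dots> = 2 * (LINT g|H. ?a n g * (1 - ?b g)) - (LINT g|H. ?a n g) + (LINT g|H. ?b g)"
    proof -
      have i2: "integrable H (\<lambda>g. 2 * (?a n g * (1 - ?b g)))" using iP by (rule integrable_mult_right)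
      show ?thesis using iA[of n] iK i2 by (subst Bochner_Integration.integral_add Bochner_Integration.integral_diff; (simp only: integral_mult_right_zero)?; auto)+
    qed
    also have "(LINT g|H. ?a n g) = (LINT g|H. ?b g)"
      by (rule integral_shift) (use bK in simp)
    finally show ?thesis by simp
  qed
  moreover have "(\<lambda>n. LINT g|H. ?a n g * (1 - ?b g)) \<longlonglongrightarrow> (LINT g|H. 0)"
  proof (rule integral_dominated_convergence[where w="\<lambda>_. 1"])
    show "AE g in H. (\<lambda>n. ?a n g * (1 - ?b g)) \<longlonglongrightarrow> 0"
    proof (rule AE_I2)
      fix g
      show "(\<lambda>n. ?a n g * (1 - ?b g)) \<longlonglongrightarrow> 0"
      proof (cases "g \<in> K")
        case False
        have "(\<lambda>n. X n + g) \<longlonglongrightarrow> 0 + g" by (intro tendsto_intros X)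
        then have "eventually (\<lambda>n. X n + g \<in> - K) sequentially"
          using K False by (intro topological_tendstoD) auto
        then have "eventually (\<lambda>n. ?a n g * (1 - ?b g) = 0) sequentially" by eventually_elim auto
        then show ?thesis by (rule tendsto_eventually)
      qed simp
    qed
    show "AE g in H. norm (?a n g * (1 - ?b g)) \<le> 1" for n by (auto simp: indicator_def)
  qed (use mP in auto)
  ultimately show "(\<lambda>n. LINT g|H. \<bar>?a n g - ?b g\<bar>) \<longlonglongrightarrow> 0"
    by (simp add: tendsto_mult_right_zero)
qed

lemma tc_borel:
  assumes "A \<in> sets borel" shows "translation_continuous (indicator A)"
proof -
  have "Int_stable {S::'g set. closed S}" by (auto simp: Int_stable_def)
  moreover have "{S::'g set. closed S} \<subseteq> Pow UNIV" by simp
  moreover have "A \<in> sigma_sets UNIV {S. closed S}" using assms by (simp add: borel_eq_closed)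
  ultimately show ?thesis
  proof (induction rule: sigma_sets_induct_disjoint[consumes 3])
    case (basic A)
    then show ?case using tc_closed by simp
  next
    case empty
    show ?case using tc_const[of 0] by simp
  next
    case (compl A)
    have "indicator (UNIV - A) = (\<lambda>g. 1 + (- 1) * (indicator A g :: real))" by (auto simp: indicator_def)
    then show ?case using tc_add[OF tc_const[of 1] tc_scale[OF compl(2), of "- 1"]] by simp
  next
    case (union A)
    have sb: "sigma_sets UNIV {S::'g set. closed S} = sets borel" by (simp add: borel_eq_closed)
    have Ab: "A i \<in> sets borel" for i using union(2) sb by blast
    have fin: "translation_continuous (indicator (\<Union>i<N. A i))" for N
    proof (induction N)
      case 0
      show ?case using tc_const[of 0] by simp
    next
      case (Suc N)
      have "A N \<inter> (\<Union>i<N. A i) = {}" 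
      proof -
        have "A i \<inter> A N = {}" if "i < N" for i
          using disjoint_family_onD[OF union(1), of i N] that by auto
        then show ?thesis by blast
      qed
      then have "indicator (\<Union>i<Suc N. A i) = (\<lambda>g. indicator (\<Union>i<N. A i) g + (indicator (A N) g :: real))"
        by (auto simp: indicator_def lessThan_Suc fun_eq_iff)
      then show ?case using tc_add[OF Suc union(3)] by simp
    qed
    show ?case
    proof (rule tc_lim[OF fin])
      show "(\<lambda>N. indicator (\<Union>i<N. A i) g :: real) \<longlonglongrightarrow> indicator (\<Union>i. A i) g" for g
        by (rule LIMSEQ_indicator_UN)
      show "\<bar>indicator (\<Union>i<N. A i) g :: real\<bar> \<le> 2 * \<bar>indicator (\<Union>i. A i) g\<bar>" for N g
        by (auto simp: indicator_def)
      show "integrable H (indicator (\<Union>i. A i) :: 'g \<Rightarrow> real)" using Ab by (intro integrable_indicator) auto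
    qed
  qed
qed

lemma tc_integrable:
  assumes "integrable H f" shows "translation_continuous f"
  using assms
proof (induction rule: integrable_induct)
  case (base A c)
  then have "A \<in> sets borel" by (simp add: sets_H)
  from tc_scale[OF tc_borel[OF this], of c] show ?case by (simp add: mult.commute)
next
  case (add f g)
  then show ?case by (intro tc_add)
next
  case (lim f s)
  show ?case by (rule tc_lim[of s]) (use lim in auto)
qed

end

section \<open>Unordered sums, Fubini and two moment inequalities\<close>

lemma infsum_eq_nsum:
  fixes f :: "'a \<Rightarrow> real"
  assumes f: "\<And>x. f x \<ge> 0" and fin: "nsum (\<lambda>x. ennreal (f x)) < top"
  shows "f summable_on UNIV" "infsum f UNIV = enn2real (nsum (\<lambda>x. ennreal (f x)))"
proof -
  have int: "integrable (count_space UNIV) f"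
    using fin f by (simp add: integrable_iff_bounded)
  then have "Infinite_Set_Sum.abs_summable_on f UNIV" by (simp add: Infinite_Set_Sum.abs_summable_on_def)
  then have s: "(\<lambda>x. norm (f x)) summable_on UNIV" by (simp only: abs_summable_equivalent)
  then show "f summable_on UNIV" using f by simp
  have "infsum f UNIV = infsetsum f UNIV"
    using int infsetsum_infsum[of f UNIV] by (simp add: Infinite_Set_Sum.abs_summable_on_def)
  also have "\<dots> = enn2real (nsum (\<lambda>x. ennreal (f x)))"
    unfolding infsetsum_def by (rule integral_eq_nn_integral) (use f in auto)
  finally show "infsum f UNIV = enn2real (nsum (\<lambda>x. ennreal (f x)))" .
qed

lemma nsum_eq_infsum:
  fixes f :: "'a \<Rightarrow> real"
  assumes f: "\<And>x. f x \<ge> 0" and bd: "\<And>F. finite F \<Longrightarrow> sum f F \<le> B"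
  shows "nsum (\<lambda>x. ennreal (f x)) \<le> ennreal B" "f summable_on UNIV"
proof -
  show s: "f summable_on UNIV"
    by (rule nonneg_bdd_above_summable_on) (use f bd in \<open>auto intro!: bdd_aboveI[of _ B]\<close>)
  then have "(\<lambda>x. norm (f x)) summable_on UNIV" using f by simp
  then have abs: "Infinite_Set_Sum.abs_summable_on f UNIV" by (simp only: abs_summable_equivalent)
  then have int: "integrable (count_space UNIV) f" by (simp add: Infinite_Set_Sum.abs_summable_on_def)
  have "nsum (\<lambda>x. ennreal (f x)) = ennreal (infsetsum f UNIV)"
    unfolding infsetsum_def by (rule nn_integral_eq_integral[OF int]) (use f in auto)
  also have "infsetsum f UNIV = infsum f UNIV" by (rule infsetsum_infsum[OF abs])
  also have "infsum f UNIV \<le> B" by (rule infsum_le_finite_sums[OF s]) (use bd in auto)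
  finally show "nsum (\<lambda>x. ennreal (f x)) \<le> ennreal B" by (simp add: ennreal_leI)
qed

text \<open>A uniform bound on the inner L1 norms is what isotropy supplies for functions of the
  field.\<close>

lemma Fubini_bounded:
  fixes f :: "'x \<Rightarrow> 'y \<Rightarrow> 'b::{banach, second_countable_topology}"
  assumes N: "prob_space N" and M: "prob_space M"
    and [measurable]: "(\<lambda>(x, w). f x w) \<in> borel_measurable (N \<Otimes>\<^sub>M M)"
    and int: "\<And>x. x \<in> space N \<Longrightarrow> integrable M (f x)" and bd: "\<And>x. x \<in> space N \<Longrightarrow> (LINT w|M. norm (f x w)) \<le> K"
  shows "(LINT x|N. LINT w|M. f x w) = (LINT w|M. LINT x|N. f x w)"
    and "AE w in M. integrable N (\<lambda>x. f x w)" and "integrable M (\<lambda>w. LINT x|N. f x w)"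
    and "integrable N (\<lambda>x. LINT w|M. f x w)"
proof -
  interpret N: prob_space N by (rule N)
  interpret M: prob_space M by (rule M)
  interpret P: pair_sigma_finite N M ..
  have i: "integrable (N \<Otimes>\<^sub>M M) (\<lambda>(x, w). f x w)"
  proof (rule P.Fubini_integrable)
    show "integrable N (\<lambda>x. LINT w|M. norm (case (x, w) of (x, w) \<Rightarrow> f x w))"
      by (rule N.integrable_const_bound[of _ K]) (use bd in \<open>auto intro!: AE_I2\<close>)
  qed (use int in auto)
  show "(LINT x|N. LINT w|M. f x w) = (LINT w|M. LINT x|N. f x w)"
    using P.Fubini_integral[OF i] by simp
  show "AE w in M. integrable N (\<lambda>x. f x w)" using P.AE_integrable_snd[OF i] .
  show "integrable M (\<lambda>w. LINT x|N. f x w)" using P.integrable_snd[OF i] .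
  show "integrable N (\<lambda>x. LINT w|M. f x w)" using P.integrable_fst[OF i] .
qed

lemma power_tangent:
  fixes x a :: real
  assumes "x \<ge> 0" "a \<ge> 0"
  shows "x ^ Suc k \<ge> a ^ Suc k + real (Suc k) * a ^ k * (x - a)"
proof (induction k)
  case (Suc k)
  have "x ^ Suc (Suc k) \<ge> x * (a ^ Suc k + real (Suc k) * a ^ k * (x - a))"
    using mult_left_mono[OF Suc assms(1)] by simp
  moreover have "x * (a ^ Suc k + real (Suc k) * a ^ k * (x - a)) - (a ^ Suc (Suc k) + real (Suc (Suc k)) * a ^ Suc k * (x - a))
     = real (Suc k) * a ^ k * (x - a)\<^sup>2"
    by (simp add: power2_eq_square algebra_simps)
  moreover have "real (Suc k) * a ^ k * (x - a)\<^sup>2 \<ge> 0" using assms by simp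
  ultimately show ?case by linarith
qed simp

text \<open>Jensen's inequality, from the tangent at the mean.\<close>

lemma (in prob_space) power_expectation_le:
  fixes X :: "'a \<Rightarrow> real"
  assumes X: "integrable M X" "integrable M (\<lambda>w. X w ^ k)" "\<And>w. X w \<ge> 0"
  shows "(expectation X) ^ k \<le> expectation (\<lambda>w. X w ^ k)"
proof (cases k)
  case 0
  then show ?thesis by (simp add: prob_space)
next
  case (Suc n)
  let ?a = "expectation X"
  have a: "?a \<ge> 0" using X by simp
  have "?a ^ Suc n = expectation (\<lambda>w. ?a ^ Suc n + real (Suc n) * ?a ^ n * (X w - ?a))"
    using X by (simp add: prob_space)
  also have "\<dots> \<le> expectation (\<lambda>w. X w ^ Suc n)"
    using X power_tangent[OF X(3) a, where k=n] unfolding Suc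
    by (intro integral_mono Bochner_Integration.integrable_add integrable_mult_right Bochner_Integration.integrable_diff) auto
  finally show ?thesis by (simp add: Suc)
qed

text \<open>L1 and L2 norm of a centred Gaussian are proportional; through this, L1 continuity of
  paths yields information on the covariance.\<close>

lemma (in prob_space) centered_normal_abs:
  assumes "centered_normal_rv M X"
  shows "expectation (\<lambda>w. \<bar>X w\<bar>) = sqrt (2 / pi) * sqrt (expectation (\<lambda>w. (X w)\<^sup>2))"
proof -
  have [measurable]: "X \<in> borel_measurable M" using assms by (simp add: centered_normal_rv_def)
  consider \<sigma> where "\<sigma> > 0" "distributed M lborel X (normal_density 0 \<sigma>)" | "AE w in M. X w = 0"
    using assms by (auto simp: centered_normal_rv_def)
  then show ?thesis
  proof cases
    case 1
    have "expectation (\<lambda>w. \<bar>X w\<bar>) = (LINT x|lborel. normal_density 0 \<sigma> x * \<bar>x - 0\<bar> ^ (2 * 0 + 1))"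
      using distributed_integral[OF 1(2), of "\<lambda>x. \<bar>x\<bar>"] by simp
    also have "\<dots> = \<sigma> * sqrt (2 / pi)" using integral_normal_moment_abs_odd[OF 1(1), of 0 0] by simp
    moreover have "expectation (\<lambda>w. (X w)\<^sup>2) = (LINT x|lborel. normal_density 0 \<sigma> x * (x - 0) ^ (2 * 1))"
      using distributed_integral[OF 1(2), of "\<lambda>x. x\<^sup>2"] by simp
    then have "expectation (\<lambda>w. (X w)\<^sup>2) = \<sigma>\<^sup>2"
      using integral_normal_moment_even[OF 1(1), of 0 1] by (simp add: numeral_2_eq_2)
    ultimately show ?thesis using 1 by simp
  next
    case 2
    have "expectation (\<lambda>w. \<bar>X w\<bar>) = expectation (\<lambda>w. 0)" by (rule integral_cong_AE) (use 2 in auto)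
    moreover have "expectation (\<lambda>w. (X w)\<^sup>2) = expectation (\<lambda>w. 0)" by (rule integral_cong_AE) (use 2 in auto)
    ultimately show ?thesis by simp
  qed
qed

section \<open>The covariance of the field\<close>

locale gaussian_field = compact_haar H + M: prob_space M
  for H :: "'g::{topological_ab_group_add, t2_space, second_countable_topology} measure" and M :: "'w measure" +
  fixes T :: "'g \<Rightarrow> 'w \<Rightarrow> real"
  assumes meas: "(\<lambda>(g, w). T g w) \<in> borel_measurable (borel \<Otimes>\<^sub>M M)"
    and gauss: "centered_gaussian_field M T"
    and iso: "isotropic_field M T"
    and var1: "\<And>g. (\<integral>w. (T g w)\<^sup>2 \<partial>M) = 1"
    and spec_pos: "\<And>chi. chi \<in> dual \<Longrightarrow> spec M H T chi > 0"
begin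

definition V :: "('w \<Rightarrow> real) set" where
  "V = {X. \<exists>(n::nat) gs c. X = (\<lambda>w. \<Sum>i<n. c i * T (gs i) w)}"

sublocale gs: gaussian_space M V
proof
  fix X Y assume "X \<in> V" "Y \<in> V"
  then obtain n gs c m gs' c' where X: "X = (\<lambda>w. \<Sum>i<(n::nat). c i * T (gs i) w)" and Y: "Y = (\<lambda>w. \<Sum>i<(m::nat). c' i * T (gs' i) w)"
    by (auto simp: V_def)
  have split: "(\<Sum>i<n + m. (if i < n then f i else f' (i - n))) = (\<Sum>i<n. f i) + (\<Sum>i<m. f' i)" for f f' :: "nat \<Rightarrow> real"
    by (induction m) auto
  have "X w + Y w = (\<Sum>i<n + m. (if i < n then c i else c' (i - n)) * T (if i < n then gs i else gs' (i - n)) w)" for w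
  proof -
    have "(\<Sum>i<n + m. (if i < n then c i else c' (i - n)) * T (if i < n then gs i else gs' (i - n)) w)
      = (\<Sum>i<n + m. (if i < n then c i * T (gs i) w else c' (i - n) * T (gs' (i - n)) w))"
      by (rule sum.cong) auto
    also have "\<dots> = (\<Sum>i<n. c i * T (gs i) w) + (\<Sum>i<m. c' i * T (gs' i) w)"
      by (rule split[of "\<lambda>i. c i * T (gs i) w" "\<lambda>i. c' i * T (gs' i) w"])
    finally show ?thesis by (simp add: X Y)
  qed
  then have e: "(\<lambda>w. X w + Y w) = (\<lambda>w. \<Sum>i<n + m. (\<lambda>i. if i < n then c i else c' (i - n)) i * T ((\<lambda>i. if i < n then gs i else gs' (i - n)) i) w)"
    by auto
  show "(\<lambda>w. X w + Y w) \<in> V" unfolding V_def mem_Collect_eq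
    by (intro exI) (rule e)
next
  fix X and a :: real assume "X \<in> V"
  then obtain n gs c where X: "X = (\<lambda>w. \<Sum>i<(n::nat). c i * T (gs i) w)" by (auto simp: V_def)
  have e: "(\<lambda>w. a * X w) = (\<lambda>w. \<Sum>i<n. (\<lambda>i. a * c i) i * T (gs i) w)"
    by (simp add: X sum_distrib_left mult.assoc)
  show "(\<lambda>w. a * X w) \<in> V" unfolding V_def mem_Collect_eq by (intro exI) (rule e)
next
  fix X assume "X \<in> V"
  then show "centered_normal_rv M X" using gauss by (auto simp: V_def centered_gaussian_field_def)
qed

lemma T_V: "T g \<in> V"
  unfolding V_def mem_Collect_eq
  by (intro exI[of _ 1] exI[of _ "\<lambda>_. g"] exI[of _ "\<lambda>_. 1"]) simp

lemma T_am: "all_moments M (T g)" by (rule gs.V_moments[OF T_V])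

lemma T_pair[measurable]: "(\<lambda>(g, w). T g w) \<in> borel_measurable (H \<Otimes>\<^sub>M M)"
  using meas by (simp add: measurable_cong_sets[OF sets_pair_measure_cong[OF sets_H refl] refl])

lemma T_meas[measurable]: "T g \<in> borel_measurable M"
  using T_am by (rule all_moments_measurable)

lemma integral_isotropic:
  fixes F :: "(nat \<Rightarrow> real) \<Rightarrow> real"
  assumes F: "F \<in> borel_measurable (PiM {..<p} (\<lambda>_. borel))" and p: "p \<ge> 1"
  shows "(LINT w|M. F (\<lambda>i\<in>{..<p}. T (h + gs i) w)) = (LINT w|M. F (\<lambda>i\<in>{..<p}. T (gs i) w))"
proof -
  have m: "(\<lambda>w. \<lambda>i\<in>{..<p}. T (gs' i) w) \<in> measurable M (PiM {..<p} (\<lambda>_. borel))" for gs'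
    by (rule measurable_restrict) simp
  have "(LINT w|M. F (\<lambda>i\<in>{..<p}. T (gs' i) w)) = (LINT x|distr M (PiM {..<p} (\<lambda>_. borel)) (\<lambda>w. \<lambda>i\<in>{..<p}. T (gs' i) w). F x)" for gs'
    by (rule integral_distr[OF m F, symmetric])
  moreover have "distr M (PiM {..<p} (\<lambda>_. borel)) (\<lambda>w. \<lambda>i\<in>{..<p}. T (h + gs i) w) =
        distr M (PiM {..<p} (\<lambda>_. borel)) (\<lambda>w. \<lambda>i\<in>{..<p}. T (gs i) w)"
    using iso p unfolding isotropic_field_def by blast
  ultimately show ?thesis by simp
qed

lemma integral_T_shift:
  assumes f: "f \<in> borel_measurable borel" shows "(LINT w|M. f (T g w) :: real) = (LINT w|M. f (T 0 w))"
proof -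
  have "(\<lambda>x. f (x 0)) \<in> borel_measurable (PiM {..<1::nat} (\<lambda>_. borel :: real measure))"
    using f by (intro measurable_compose[OF measurable_component_singleton]) auto
  from integral_isotropic[OF this, of g "\<lambda>_. 0"] show ?thesis by simp
qed

definition R :: "'g \<Rightarrow> real" where "R g = (LINT w|M. T g w * T 0 w)"

lemma covariance: "(LINT w|M. T g w * T h w) = R (g - h)"
proof -
  have "(\<lambda>x. x 0 * x (Suc 0)) \<in> borel_measurable (PiM {..<2::nat} (\<lambda>_. borel :: real measure))"
    by (intro borel_measurable_times measurable_component_singleton) auto
  from integral_isotropic[OF this, of h "\<lambda>i. if i = 0 then g - h else 0"] show ?thesis by (simp add: R_def)
qed

lemma R_0: "R 0 = 1" using var1[of 0] by (simp add: R_def power2_eq_square)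

lemma R_uminus: "R (- g) = R g"
  using covariance[of "- g" 0] covariance[of 0 "- g"] by (simp add: mult.commute)

lemma TT_int: "integrable M (\<lambda>w. T g w * T h w)" "integrable M (\<lambda>w. (T g w)\<^sup>2)"
  by (intro all_moments_integrable all_moments_mult T_am M.all_moments_power)+

lemma increment_var: "(LINT w|M. (T g w - T h w)\<^sup>2) = 2 - 2 * R (g - h)"
proof -
  have "(T g w - T h w)\<^sup>2 = (T g w)\<^sup>2 - 2 * (T g w * T h w) + (T h w)\<^sup>2" for w
    by (simp add: power2_eq_square algebra_simps)
  then show ?thesis using TT_int by (simp add: var1 covariance)
qed

lemma increment_V: "(\<lambda>w. T g w - T h w) \<in> V"
  using gs.V_add[OF T_V[of g] gs.V_scale[OF T_V[of h], of "- 1"]] by simp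

text \<open>Bessel's inequality for the increment against the unit vector \<open>T 0\<close>; it
  spreads continuity at 0 to all points.\<close>

lemma R_square_diff: "(R g - R h)\<^sup>2 \<le> 2 - 2 * R (g - h)"
proof -
  define U where "U = (\<lambda>w. T g w - T h w)"
  define t where "t = (LINT w|M. U w * T 0 w)"
  have am: "all_moments M U" unfolding U_def by (rule gs.V_moments[OF increment_V])
  have int: "integrable M (\<lambda>w. U w * T 0 w)" "integrable M (\<lambda>w. (U w)\<^sup>2)"
    by (intro all_moments_integrable all_moments_mult am T_am M.all_moments_power)+
  have "0 \<le> (LINT w|M. (U w - t * T 0 w)\<^sup>2)" by simp
  also have "\<dots> = (LINT w|M. (U w)\<^sup>2 - 2 * t * (U w * T 0 w) + t\<^sup>2 * (T 0 w)\<^sup>2)"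
    by (simp add: power2_eq_square algebra_simps)
  also have "\<dots> = (LINT w|M. (U w)\<^sup>2) - 2 * t * t + t\<^sup>2"
    using int TT_int by (simp add: var1 t_def)
  finally have "t\<^sup>2 \<le> (LINT w|M. (U w)\<^sup>2)" by (simp add: power2_eq_square)
  moreover have "t = R g - R h"
    unfolding t_def U_def R_def left_diff_distrib by (intro Bochner_Integration.integral_diff TT_int)
  ultimately show ?thesis by (simp add: U_def increment_var)
qed

text \<open>Almost every path is integrable over the group, hence L1-continuous under translation.
  Its L1 increment is dominated by twice the L1 norm of the path, and its expectation is an explicit
  function of the covariance at \<open>X n\<close>.\<close>

lemma R_tendsto_0:
  assumes X: "X \<longlonglongrightarrow> 0" shows "(\<lambda>n. R (X n)) \<longlonglongrightarrow> 1"
proof -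
  have shift[measurable]: "(\<lambda>(g, w). T (h + g) w) \<in> borel_measurable (H \<Otimes>\<^sub>M M)" for h
  proof -
    have "(\<lambda>p. (h + fst p, snd p)) \<in> measurable (H \<Otimes>\<^sub>M M) (H \<Otimes>\<^sub>M M)"
      using meas_add(1)[of h] by (intro measurable_Pair measurable_compose[OF measurable_fst] measurable_snd)
        (simp add: measurable_cong_sets[OF refl sets_H])
    from measurable_compose[OF this T_pair] show ?thesis by (simp add: case_prod_beta)
  qed
  have abs1: "(LINT w|M. \<bar>T g w\<bar>) = sqrt (2 / pi)" for g
    using M.centered_normal_abs[OF gs.V_normal[OF T_V[of g]]] by (simp add: var1)
  note F1 = Fubini_bounded[OF prob_space_axioms M.prob_space_axioms, of T "sqrt (2 / pi)"]
  have AE1: "AE w in M. integrable H (\<lambda>g. T g w)"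
    by (rule F1) (auto simp: abs1 intro: all_moments_integrable T_am)
  have F2: "integrable M (\<lambda>w. LINT g|H. \<bar>T g w\<bar>)"
    by (rule Fubini_bounded(3)[OF prob_space_axioms M.prob_space_axioms, of _ "sqrt (2 / pi)"])
      (auto simp: abs1 intro!: all_moments_integrable T_am integrable_abs)
  have sw: "(LINT g|H. LINT w|M. \<bar>T (X n + g) w - T g w\<bar>) = (LINT w|M. LINT g|H. \<bar>T (X n + g) w - T g w\<bar>)" for n
  proof (rule Fubini_bounded(1)[OF prob_space_axioms M.prob_space_axioms, of _ "2 * sqrt (2 / pi)"])
    show "(\<lambda>(g, w). \<bar>T (X n + g) w - T g w\<bar>) \<in> borel_measurable (H \<Otimes>\<^sub>M M)"
      using shift[of "X n"] T_pair by (simp add: case_prod_beta')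
    show "integrable M (\<lambda>w. \<bar>T (X n + g) w - T g w\<bar>)" for g
      by (intro integrable_abs Bochner_Integration.integrable_diff all_moments_integrable T_am)
    show "(LINT w|M. norm \<bar>T (X n + g) w - T g w\<bar>) \<le> 2 * sqrt (2 / pi)" for g
    proof -
      have "(LINT w|M. norm \<bar>T (X n + g) w - T g w\<bar>) \<le> (LINT w|M. \<bar>T (X n + g) w\<bar> + \<bar>T g w\<bar>)"
        by (intro integral_mono Bochner_Integration.integrable_add integrable_norm integrable_abs Bochner_Integration.integrable_diff all_moments_integrable T_am) simp
      also have "\<dots> = 2 * sqrt (2 / pi)"
      proof -
        have "integrable M (\<lambda>w. \<bar>T g w\<bar>)" for g by (intro integrable_abs all_moments_integrable T_am)
        then show ?thesis by (simp add: abs1)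
      qed
      finally show ?thesis .
    qed
  qed
  \<comment> \<open>By stationarity the mean increment does not depend on \<open>g\<close>, so
    integrating over the group changes nothing.\<close>
  have e: "(LINT w|M. \<bar>T (X n + g) w - T g w\<bar>) = sqrt (2 / pi) * sqrt (2 - 2 * R (X n))" for n g
    using M.centered_normal_abs[OF gs.V_normal[OF increment_V[of "X n + g" g]]] by (simp add: increment_var)
  have "(\<lambda>n. LINT w|M. LINT g|H. \<bar>T (X n + g) w - T g w\<bar>) \<longlonglongrightarrow> (LINT w|M. 0)"
  proof (rule integral_dominated_convergence[where w="\<lambda>w. 2 * (LINT g|H. \<bar>T g w\<bar>)"])
    show "(\<lambda>w. LINT g|H. \<bar>T (X n + g) w - T g w\<bar>) \<in> borel_measurable M" for n
    proof -
      have "(\<lambda>(w, g). \<bar>T (X n + g) w - T g w\<bar>) \<in> borel_measurable (M \<Otimes>\<^sub>M H)"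
        using measurable_compose[OF measurable_pair_swap' shift[of "X n"]] measurable_compose[OF measurable_pair_swap' T_pair]
        by (simp add: case_prod_beta')
      then show ?thesis by (rule borel_measurable_lebesgue_integral)
    qed
    show "integrable M (\<lambda>w. 2 * (LINT g|H. \<bar>T g w\<bar>))" using F2 by simp
    show "AE w in M. (\<lambda>n. LINT g|H. \<bar>T (X n + g) w - T g w\<bar>) \<longlonglongrightarrow> 0"
      using AE1
    proof eventually_elim
      case (elim w)
      from tc_integrable[OF elim] X show ?case by (simp add: translation_continuous_def)
    qed
    show "AE w in M. norm (LINT g|H. \<bar>T (X n + g) w - T g w\<bar>) \<le> 2 * (LINT g|H. \<bar>T g w\<bar>)" for n
      using AE1
    proof eventually_elim
      case (elim w)
      have i2: "integrable H (\<lambda>g. T (X n + g) w)" by (rule integrable_shift[OF elim])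
      have m: "(\<lambda>g. \<bar>T g w\<bar>) \<in> borel_measurable borel" using borel_measurable_integrable[OF elim] by (simp add: measurable_H)
      have "norm (LINT g|H. \<bar>T (X n + g) w - T g w\<bar>) = (LINT g|H. \<bar>T (X n + g) w - T g w\<bar>)" by simp
      also have "\<dots> \<le> (LINT g|H. \<bar>T (X n + g) w\<bar> + \<bar>T g w\<bar>)"
        using elim i2 by (intro integral_mono) auto
      also have "\<dots> = 2 * (LINT g|H. \<bar>T g w\<bar>)" using elim i2 integral_shift[OF m, of "X n"] by simp
      finally show ?case .
    qed
  qed auto
  then have "(\<lambda>n. sqrt (2 / pi) * sqrt (2 - 2 * R (X n))) \<longlonglongrightarrow> 0"
    by (simp only: sw[symmetric] e) simp
  then have "(\<lambda>n. (sqrt (2 / pi) * sqrt (2 - 2 * R (X n)))\<^sup>2) \<longlonglongrightarrow> 0\<^sup>2" by (rule tendsto_power)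
  moreover have nn: "2 - 2 * R g \<ge> 0" for g using increment_var[of g 0] integral_nonneg_AE[of "\<lambda>w. (T g w - T 0 w)\<^sup>2" M] by simp
  moreover have sq: "(sqrt (2 / pi) * sqrt x)\<^sup>2 = (2 / pi) * x" if "x \<ge> 0" for x
    using that by (simp add: power_mult_distrib)
  ultimately have "(\<lambda>n. (2 / pi) * (2 - 2 * R (X n))) \<longlonglongrightarrow> 0"
    by (simp only: sq[OF nn]) simp
  then have "(\<lambda>n. 1 - (pi / 4) * ((2 / pi) * (2 - 2 * R (X n)))) \<longlonglongrightarrow> 1 - (pi / 4) * 0"
    by (intro tendsto_intros)
  then show ?thesis by (simp add: field_simps)
qed

lemma R_cont: "continuous_on UNIV R"
proof (rule cont_sequentially)
  fix X x assume X: "X \<longlonglongrightarrow> (x :: 'g)"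
  have "(\<lambda>n. X n - x) \<longlonglongrightarrow> x - x" by (intro tendsto_intros X)
  then have "(\<lambda>n. R (X n - x)) \<longlonglongrightarrow> 1" by (intro R_tendsto_0) simp
  then have "(\<lambda>n. 2 - 2 * R (X n - x)) \<longlonglongrightarrow> 2 - 2 * 1" by (intro tendsto_intros)
  then have "(\<lambda>n. (R (X n) - R x)\<^sup>2) \<longlonglongrightarrow> 0"
    by (intro tendsto_sandwich[of "\<lambda>_. 0" "\<lambda>n. (R (X n) - R x)\<^sup>2" sequentially "\<lambda>n. 2 - 2 * R (X n - x)" 0])
      (auto intro!: always_eventually R_square_diff)
  then have "(\<lambda>n. sqrt ((R (X n) - R x)\<^sup>2)) \<longlonglongrightarrow> sqrt 0" by (intro tendsto_intros)
  then have "(\<lambda>n. R (X n) - R x) \<longlonglongrightarrow> 0" by (simp add: tendsto_rabs_zero_iff)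
  then show "(\<lambda>n. R (X n)) \<longlonglongrightarrow> R x" by (simp add: LIM_zero_iff)
qed

section \<open>Fourier coefficients and the spectral measure\<close>

abbreviation A :: "nat \<Rightarrow> 'g character \<Rightarrow> 'w \<Rightarrow> complex" where
  "A n a w \<equiv> hcoef H T n (chr a) w"

lemma hermite_measurable[measurable]: "hermite n \<in> borel_measurable borel"
proof -
  have "hermite n = (\<lambda>x. poly (hpoly n) x)" by (auto simp: hermite_eq_poly)
  then show ?thesis by (simp only:) (intro borel_measurable_continuous_onI continuous_intros)
qed

lemma chr_cont_minus: "cont (\<lambda>g. chr a (- g))"
  by (rule continuous_on_compose2[OF chr_cont]) (auto intro!: continuous_intros)

lemma chr_measurable[measurable]: "chr a \<in> borel_measurable H" "(\<lambda>g. chr a (- g)) \<in> borel_measurable H"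
  unfolding measurable_H by (intro cont_measurable chr_cont chr_cont_minus)+

lemma hermite_am: "all_moments M (\<lambda>w. hermite n (T g w))"
  unfolding hermite_eq_poly by (rule M.all_moments_poly[OF T_am])

lemma hermite_moment_const: "(LINT w|M. \<bar>hermite n (T g w)\<bar> ^ k) = (LINT w|M. \<bar>hermite n (T 0 w)\<bar> ^ k)"
  by (rule integral_T_shift[of "\<lambda>x. \<bar>hermite n x\<bar> ^ k"]) measurable

lemma hermite_pair[measurable]: "(\<lambda>(g, w). hermite n (T g w)) \<in> borel_measurable (H \<Otimes>\<^sub>M M)"
  using measurable_compose[OF T_pair hermite_measurable[of n]] by (simp add: case_prod_beta')

lemma hermite_AE: "AE w in M. integrable H (\<lambda>g. \<bar>hermite n (T g w)\<bar> ^ k)"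
  and hermite_int: "integrable M (\<lambda>w. LINT g|H. \<bar>hermite n (T g w)\<bar> ^ k)"
proof -
  have 1: "(\<lambda>(g, w). \<bar>hermite n (T g w)\<bar> ^ k) \<in> borel_measurable (H \<Otimes>\<^sub>M M)"
    using hermite_pair[of n] by (simp add: case_prod_beta')
  have 2: "integrable M (\<lambda>w. \<bar>hermite n (T g w)\<bar> ^ k)" for g
    using hermite_am[of n g] by (auto simp: all_moments_def)
  have 3: "(LINT w|M. norm (\<bar>hermite n (T g w)\<bar> ^ k)) \<le> (LINT w|M. \<bar>hermite n (T 0 w)\<bar> ^ k)" for g
    using hermite_moment_const[of n g k] by simp
  show "AE w in M. integrable H (\<lambda>g. \<bar>hermite n (T g w)\<bar> ^ k)" "integrable M (\<lambda>w. LINT g|H. \<bar>hermite n (T g w)\<bar> ^ k)"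
    using Fubini_bounded(2,3)[OF prob_space_axioms M.prob_space_axioms 1 2 3] by auto
qed

lemma hermite_int_AE: "AE w in M. integrable H (\<lambda>g. hermite n (T g w))"
proof -
  have "AE w in M. (\<lambda>g. hermite n (T g w)) \<in> borel_measurable H"
  proof (rule AE_I2)
    fix w assume "w \<in> space M"
    from measurable_Pair1'[OF this, of H] have "(\<lambda>g. (g, w)) \<in> measurable H (H \<Otimes>\<^sub>M M)"
      by (simp add: \<open>w \<in> space M\<close>)
    from measurable_compose[OF this hermite_pair] show "(\<lambda>g. hermite n (T g w)) \<in> borel_measurable H" by simp
  qed
  with hermite_AE[of n 1] show ?thesis
    by eventually_elim (auto intro: integrable_abs_cancel)
qed

lemma A_measurable[measurable]: "A n a \<in> borel_measurable M"
proof -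
  have "(\<lambda>(w, g). complex_of_real (hermite n (T g w)) * chr a (- g)) \<in> borel_measurable (M \<Otimes>\<^sub>M H)"
    using measurable_compose[OF measurable_pair_swap' hermite_pair[of n]] by (simp add: case_prod_beta')
  then show ?thesis unfolding hcoef_def[abs_def] by (rule borel_measurable_lebesgue_integral)
qed

text \<open>Jensen on the group moves the power inside the integral, where Fubini and isotropy give
  a finite expectation.\<close>

lemma A_am: "all_moments M (A n a)"
  unfolding all_moments_def
proof (intro conjI allI A_measurable)
  fix k
  show "integrable M (\<lambda>w. norm (A n a w) ^ k)"
  proof (rule Bochner_Integration.integrable_bound[OF hermite_int[of n k]])
    show "AE w in M. norm (norm (A n a w) ^ k) \<le> norm (LINT g|H. \<bar>hermite n (T g w)\<bar> ^ k)"
      using hermite_int_AE[of n] hermite_AE[of n k]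
    proof eventually_elim
      case (elim w)
      have "norm (A n a w) \<le> (LINT g|H. \<bar>hermite n (T g w)\<bar>)"
        unfolding hcoef_def by (rule order.trans[OF integral_norm_bound]) (simp add: norm_mult)
      then have "norm (A n a w) ^ k \<le> (LINT g|H. \<bar>hermite n (T g w)\<bar>) ^ k" by (rule power_mono) simp
      also have "\<dots> \<le> (LINT g|H. \<bar>hermite n (T g w)\<bar> ^ k)"
        using elim by (intro power_expectation_le) auto
      finally show ?case by simp
    qed
  qed measurable
qed

lemma A_cnj: "cnj (A n a w) = A n (- a) w"
  unfolding hcoef_def Bochner_Integration.integral_cnj[symmetric] by (simp add: chr_uminus)

lemma A_0: "A 0 a w = (if a = 0 then 1 else 0)"
  using integral_character[of "- a"] by (simp add: hcoef_def hermite_eq_poly chr_minus_arg chr_uminus)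

lemma coef_eq_A: "coef H T (chr a) w = A (Suc 0) a w"
  by (simp add: coef_def hcoef_def hermite_eq_poly)

definition S :: "'g character \<Rightarrow> real" where "S a = spec M H T (chr a)"

lemma S_nonneg: "S a \<ge> 0" by (simp add: S_def spec_def)

text \<open>The Fourier coefficient of the covariance; it turns out to be the spectrum in
  \<open>RF_eq_S\<close>.\<close>

definition RF :: "'g character \<Rightarrow> complex" where "RF a = (LINT u|H. complex_of_real (R u) * chr a (- u))"

lemma R_of_cont: "cont (\<lambda>u. complex_of_real (R u))" by (intro continuous_intros R_cont)

lemma RF_uminus: "RF (- a) = RF a"
proof -
  have c: "cont (\<lambda>u. complex_of_real (R u) * chr a (- u))" by (intro continuous_intros R_of_cont chr_cont_minus)
  show ?thesis unfolding RF_def using integral_uminus[OF c] by (simp add: R_uminus chr_minus_arg chr_uminus)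
qed


lemma swap_A1:
  assumes "all_moments M Y"
  shows "(LINT w|M. Y w * A (Suc 0) a w) = (LINT g|H. chr a (- g) * (LINT w|M. Y w * complex_of_real (T g w)))"
proof -
  have [measurable]: "Y \<in> borel_measurable M" using assms by (rule all_moments_measurable)
  have Y2: "integrable M (\<lambda>w. norm (Y w) ^ 2)" using assms by (auto simp: all_moments_def)
  have amT: "all_moments M (\<lambda>w. complex_of_real (T g w))" for g
    using T_am[of g] by (simp add: all_moments_def)
  have meas1: "(\<lambda>(g, w). Y w * (complex_of_real (T g w) * chr a (- g))) \<in> borel_measurable (H \<Otimes>\<^sub>M M)"
    using T_pair by (simp add: case_prod_beta')
  have int: "integrable M (\<lambda>w. Y w * (complex_of_real (T g w) * chr a (- g)))" for g
    unfolding mult.assoc[symmetric] by (intro integrable_mult_left all_moments_integrable all_moments_mult assms amT)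
  have bd: "(LINT w|M. norm (Y w * (complex_of_real (T g w) * chr a (- g)))) \<le> (LINT w|M. norm (Y w) ^ 2) + 1" for g
  proof -
    have "(LINT w|M. norm (Y w * (complex_of_real (T g w) * chr a (- g)))) \<le> (LINT w|M. norm (Y w) ^ 2 + (T g w)\<^sup>2)"
    proof (rule integral_mono)
      show "norm (Y w * (complex_of_real (T g w) * chr a (- g))) \<le> norm (Y w) ^ 2 + (T g w)\<^sup>2" for w
      proof -
        have "2 * norm (Y w) * \<bar>T g w\<bar> \<le> norm (Y w) ^ 2 + (T g w)\<^sup>2"
          using sum_squares_bound[of "norm (Y w)" "\<bar>T g w\<bar>"] by simp
        moreover have "0 \<le> norm (Y w) * \<bar>T g w\<bar>" by simp
        ultimately have "norm (Y w) * \<bar>T g w\<bar> \<le> norm (Y w) ^ 2 + (T g w)\<^sup>2"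
          unfolding mult.assoc by linarith
        then show ?thesis by (simp add: norm_mult)
      qed
    qed (use int Y2 TT_int in auto)
    then show ?thesis using Y2 TT_int by (simp add: var1)
  qed
  have "(LINT w|M. Y w * A (Suc 0) a w) = (LINT w|M. LINT g|H. Y w * (complex_of_real (T g w) * chr a (- g)))"
    by (simp add: hcoef_def hermite_eq_poly)
  also have "\<dots> = (LINT g|H. LINT w|M. Y w * (complex_of_real (T g w) * chr a (- g)))"
    by (rule Fubini_bounded(1)[OF prob_space_axioms M.prob_space_axioms meas1 int bd, symmetric])
  also have "\<dots> = (LINT g|H. chr a (- g) * (LINT w|M. Y w * complex_of_real (T g w)))"
  proof -
    have "(LINT w|M. Y w * (complex_of_real (T g w) * chr a (- g))) = chr a (- g) * (LINT w|M. Y w * complex_of_real (T g w))" for g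
      by (subst integral_mult_right_zero[symmetric]) (simp add: mult_ac)
    then show ?thesis by simp
  qed
  finally show ?thesis .
qed

lemma T_of_am: "all_moments M (\<lambda>w. complex_of_real (T g w))"
  using T_am[of g] by (simp add: all_moments_def)

lemma E_T_A: "(LINT w|M. complex_of_real (T g w) * A (Suc 0) a w) = chr a (- g) * RF a"
proof -
  have "(LINT w|M. complex_of_real (T g w) * A (Suc 0) a w) = (LINT h|H. chr a (- h) * complex_of_real (R (g - h)))"
    unfolding swap_A1[OF T_of_am] by (simp add: covariance flip: of_real_mult)
  also have "\<dots> = (LINT h|H. (\<lambda>u. complex_of_real (R u) * chr a (- (u + g))) (h - g))"
    using R_uminus[of "_ - g"] by (simp add: mult.commute)
  also have "\<dots> = (LINT u|H. complex_of_real (R u) * chr a (- (u + g)))"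
  proof (rule integral_shift_minus)
    have "cont (\<lambda>u. complex_of_real (R u) * chr a (- (u + g)))"
      by (intro continuous_intros R_of_cont continuous_on_compose2[OF chr_cont_minus]) auto
    then show "(\<lambda>u. complex_of_real (R u) * chr a (- (u + g))) \<in> borel_measurable borel" by (rule cont_measurable)
  qed
  also have "\<dots> = chr a (- g) * RF a"
  proof -
    have "chr a (- (u + g)) = chr a (- g) * chr a (- u)" for u
      by (simp only: chr_minus_arg chr_hom complex_cnj_mult mult.commute)
    then have "complex_of_real (R u) * chr a (- (u + g)) = chr a (- g) * (complex_of_real (R u) * chr a (- u))" for u
      by (simp only: mult_ac)
    then show ?thesis unfolding RF_def by (simp only: integral_mult_right_zero)
  qed
  finally show ?thesis .
qed

text \<open>Coefficients of non-opposite characters are uncorrelated by orthogonality of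
  characters.\<close>

lemma E_A_A: "(LINT w|M. A (Suc 0) b w * A (Suc 0) a w) = (if a + b = 0 then RF a else 0)"
proof -
  have "(LINT w|M. A (Suc 0) b w * A (Suc 0) a w) = (LINT g|H. chr a (- g) * (chr b (- g) * RF b))"
    unfolding swap_A1[OF A_am] E_T_A[symmetric] by (simp add: mult.commute)
  also have "\<dots> = (LINT g|H. chr (- (a + b)) g * RF b)"
    by (simp only: mult.assoc[symmetric] chr_minus_arg chr_uminus chr_add complex_cnj_mult)
  also have "\<dots> = (if a + b = 0 then RF b else 0)" 
    by (simp only: integral_mult_left_zero integral_character neg_equal_0_iff_equal) simp
  also have "\<dots> = (if a + b = 0 then RF a else 0)"
  proof (cases "a + b = 0")
    case True
    then have "b = - a" by (simp add: eq_neg_iff_add_eq_0 add.commute)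
    then show ?thesis by (simp add: RF_uminus)
  qed simp
  finally show ?thesis .
qed

lemma RF_eq_S: "RF a = complex_of_real (S a)"
proof -
  have "complex_of_real (S a) = (LINT w|M. complex_of_real ((norm (A (Suc 0) a w))\<^sup>2))"
    by (simp only: S_def spec_def coef_eq_A integral_complex_of_real)
  also have "\<dots> = (LINT w|M. A (Suc 0) a w * A (Suc 0) (- a) w)" by (simp only: complex_norm_square A_cnj)
  also have "\<dots> = RF a" by (simp add: E_A_A RF_uminus)
  finally show ?thesis ..
qed

lemma S_uminus: "S (- a) = S a"
  using RF_uminus[of a] by (simp add: RF_eq_S)

text \<open>Cross terms and the square of the Fourier sum all equal the partial sum of the spectrum.
  It first serves as Bessel's inequality; once the spectrum is known to sum to 1 it gives L2
  approximation of \<open>T g\<close>, uniformly in \<open>g\<close>.\<close>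

lemma truncation_error:
  assumes F: "finite F"
  shows "(LINT w|M. (norm (complex_of_real (T g w) - (\<Sum>a\<in>F. chr a g * A (Suc 0) a w)))\<^sup>2) = 1 - (\<Sum>a\<in>F. S a)"
proof -
  let ?T = "\<lambda>w. complex_of_real (T g w)"
  let ?Z = "\<lambda>w. \<Sum>a\<in>F. chr a g * A (Suc 0) a w"
  let ?Y = "\<lambda>w. \<Sum>a\<in>F. cnj (chr a g) * A (Suc 0) (- a) w"
  have am: "all_moments M ?Z" "all_moments M ?Y"
    by (intro M.all_moments_sum all_moments_mult M.all_moments_const A_am)+
  have int: "integrable M (\<lambda>w. ?T w * ?T w)" "integrable M (\<lambda>w. ?T w * ?Y w)" "integrable M (\<lambda>w. ?Z w * ?T w)" "integrable M (\<lambda>w. ?Z w * ?Y w)"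
    by (intro all_moments_integrable all_moments_mult am T_of_am)+
  have iTA: "integrable M (\<lambda>w. ?T w * A (Suc 0) a w)" "integrable M (\<lambda>w. A (Suc 0) b w * A (Suc 0) a w)" for a b
    by (intro all_moments_integrable all_moments_mult A_am T_of_am)+
  have TT: "(LINT w|M. ?T w * ?T w) = 1"
    using covariance[of g g] by (simp add: R_0 flip: of_real_mult)
  have ZT: "(LINT w|M. ?Z w * ?T w) = complex_of_real (\<Sum>a\<in>F. S a)"
  proof -
    have "(LINT w|M. ?Z w * ?T w) = (LINT w|M. (\<Sum>a\<in>F. chr a g * (?T w * A (Suc 0) a w)))"
      by (simp add: sum_distrib_left sum_distrib_right mult_ac)
    also have "\<dots> = (\<Sum>a\<in>F. chr a g * (chr a (- g) * RF a))"
      using iTA by (subst Bochner_Integration.integral_sum) (auto simp: E_T_A)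
    finally show ?thesis by (simp add: chr_minus_arg mult.assoc[symmetric] RF_eq_S)
  qed
  have TY: "(LINT w|M. ?T w * ?Y w) = complex_of_real (\<Sum>a\<in>F. S a)"
  proof -
    have "(LINT w|M. ?T w * ?Y w) = (LINT w|M. (\<Sum>a\<in>F. cnj (chr a g) * (?T w * A (Suc 0) (- a) w)))"
      by (simp add: sum_distrib_left sum_distrib_right mult_ac)
    also have "\<dots> = (\<Sum>a\<in>F. cnj (chr a g) * (chr (- a) (- g) * RF (- a)))"
      using iTA by (subst Bochner_Integration.integral_sum) (auto simp: E_T_A)
    finally show ?thesis by (simp add: chr_minus_arg chr_uminus mult.assoc[symmetric] RF_eq_S S_uminus)
  qed
  have ZY: "(LINT w|M. ?Z w * ?Y w) = complex_of_real (\<Sum>a\<in>F. S a)"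
  proof -
    have "(LINT w|M. ?Z w * ?Y w) = (LINT w|M. (\<Sum>a\<in>F. \<Sum>b\<in>F. (chr a g * cnj (chr b g)) * (A (Suc 0) a w * A (Suc 0) (- b) w)))"
      by (simp add: sum_product mult_ac)
    also have "\<dots> = (\<Sum>a\<in>F. \<Sum>b\<in>F. (chr a g * cnj (chr b g)) * (if a = b then RF a else 0))"
    proof -
      have "(- b + a = 0) = (a = b)" for a b :: "'g character" by (auto simp: add.commute)
      then show ?thesis
        using iTA by (subst Bochner_Integration.integral_sum, simp, subst Bochner_Integration.integral_sum) (auto simp: E_A_A RF_uminus intro!: sum.cong)
    qed
    also have "\<dots> = (\<Sum>a\<in>F. \<Sum>b\<in>F. if b = a then RF a else 0)"
      by (intro sum.cong refl) auto
    finally show ?thesis using F by (simp add: RF_eq_S)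
  qed
  have "complex_of_real (LINT w|M. (norm (?T w - ?Z w))\<^sup>2) = (LINT w|M. (?T w - ?Z w) * cnj (?T w - ?Z w))"
    unfolding complex_norm_square[symmetric] by (simp only: integral_complex_of_real)
  also have "\<dots> = (LINT w|M. ?T w * ?T w - ?T w * ?Y w - ?Z w * ?T w + ?Z w * ?Y w)"
    by (simp add: A_cnj algebra_simps)
  also have "\<dots> = complex_of_real (1 - (\<Sum>a\<in>F. S a))"
    using int by (simp add: TT ZT TY ZY)
  finally show ?thesis by (simp only: of_real_eq_iff)
qed

lemma sum_S_le: "finite F \<Longrightarrow> sum S F \<le> 1"
  using truncation_error[of F 0] integral_nonneg_AE[of "\<lambda>w. (norm (complex_of_real (T 0 w) - (\<Sum>a\<in>F. chr a 0 * A (Suc 0) a w)))\<^sup>2" M]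
  by simp

lemma S_pos: "S a > 0" by (simp add: S_def spec_pos chr_dual)

definition C :: "'g character \<Rightarrow> ennreal" where "C a = ennreal (S a)"

lemma C_uminus: "C (- a) = C a" by (simp add: C_def S_uminus)
lemma C_pos: "C a > 0" by (simp add: C_def S_pos)

lemma nsum_C_le: "nsum C \<le> 1"
  using nsum_eq_infsum(1)[of S 1, OF S_nonneg sum_S_le] by (simp add: C_def[abs_def])

text \<open>A summable family of positive terms has a countable index set. Countability makes
  functions on the product with the discrete measure \<open>\<nu>\<close> measurable slice by
  slice.\<close>

lemma countable_chr: "countable (UNIV :: 'g character set)"
proof -
  have "S summable_on UNIV" by (rule nsum_eq_infsum(2)[OF S_nonneg sum_S_le])
  then have "countable {x \<in> UNIV. S x \<noteq> 0}" by (rule summable_countable_real)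
  moreover have "S x \<noteq> 0" for x using S_pos[of x] by simp
  ultimately show ?thesis by simp
qed

text \<open>The spectral measure: turning sums over characters into integrals lets Fubini exchange
  them with the other integrals.\<close>

definition \<nu> :: "'g character measure" where "\<nu> = density (count_space UNIV) C"

lemma sets_\<nu>[measurable_cong]: "sets \<nu> = sets (count_space UNIV)" and space_\<nu>[simp]: "space \<nu> = UNIV"
  by (simp_all add: \<nu>_def)

lemma emeasure_\<nu>: "emeasure \<nu> UNIV = nsum C"
  by (simp add: \<nu>_def emeasure_density)

lemma finite_\<nu>: "finite_measure \<nu>"
  using nsum_C_le by (intro finite_measureI) (auto simp: emeasure_\<nu> top_unique)

lemma measure_\<nu>_single: "measure \<nu> {a} = S a"
proof -
  have "emeasure \<nu> {a} = nsum (\<lambda>x. C x * indicator {a} x)" by (simp add: \<nu>_def emeasure_density)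
  also have "\<dots> = nsum (\<lambda>x. if x = a then C x else 0)" by (rule nn_integral_cong) (auto simp: indicator_def)
  also have "\<dots> = C a" by (rule nsum_delta)
  finally show ?thesis by (simp add: measure_def C_def S_nonneg)
qed

lemma measurable_\<nu>: "f \<in> measurable \<nu> N \<longleftrightarrow> f \<in> UNIV \<rightarrow> space N"
  by (simp add: measurable_cong_sets[OF sets_\<nu> refl])

lemma measurable_\<nu>_pair:
  assumes "\<And>l. (\<lambda>x. f l x) \<in> measurable N K"
  shows "(\<lambda>(l, x). f l x) \<in> measurable (\<nu> \<Otimes>\<^sub>M N) K"
  unfolding measurable_cong_sets[OF sets_pair_measure_cong[OF sets_\<nu> refl] refl]
  by (rule measurable_pair_measure_countable1[OF countable_chr]) (use assms in simp)

lemma Fubini_\<nu>: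
  fixes f :: "'g character \<Rightarrow> 'x \<Rightarrow> complex"
  assumes N: "prob_space N" and meas: "\<And>l. f l \<in> borel_measurable N" and bd: "\<And>l x. x \<in> space N \<Longrightarrow> norm (f l x) \<le> K"
  shows "(LINT x|N. LINT l|\<nu>. f l x) = (LINT l|\<nu>. LINT x|N. f l x)"
    and "integrable N (\<lambda>x. LINT l|\<nu>. f l x)"
proof -
  interpret N: prob_space N by (rule N)
  interpret nu: finite_measure \<nu> by (rule finite_\<nu>)
  interpret P: pair_sigma_finite \<nu> N ..
  interpret PP: finite_measure "\<nu> \<Otimes>\<^sub>M N" by (rule finite_measure_pair_measure) unfold_locales
  have "integrable (\<nu> \<Otimes>\<^sub>M N) (\<lambda>(l, x). f l x)"
    by (rule PP.integrable_const_bound[of _ K])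
      (auto intro!: AE_I2 measurable_\<nu>_pair meas bd simp: space_pair_measure)
  from P.Fubini_integral[OF this] P.integrable_snd[OF this]
  show "(LINT x|N. LINT l|\<nu>. f l x) = (LINT l|\<nu>. LINT x|N. f l x)" "integrable N (\<lambda>x. LINT l|\<nu>. f l x)" by auto
qed

lemma chr_int_\<nu>: "integrable \<nu> (\<lambda>l. chr l g)"
  by (rule finite_measure.integrable_const_bound[OF finite_\<nu>, of _ 1]) (auto simp: measurable_\<nu>)

lemma \<rho>_cont: "continuous_on UNIV (\<lambda>g. LINT l|\<nu>. chr l g)"
proof (rule cont_sequentially)
  fix X x assume X: "X \<longlonglongrightarrow> (x :: 'g)"
  show "(\<lambda>n. LINT l|\<nu>. chr l (X n)) \<longlonglongrightarrow> (LINT l|\<nu>. chr l x)"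
  proof (rule integral_dominated_convergence[where w="\<lambda>_. 1"])
    show "integrable \<nu> (\<lambda>_. 1 :: real)" by (rule finite_measure.integrable_const[OF finite_\<nu>])
    show "AE l in \<nu>. (\<lambda>n. chr l (X n)) \<longlonglongrightarrow> chr l x" by (intro AE_I2 cont_tendsto[OF chr_cont X])
  qed (auto simp: measurable_\<nu>)
qed

text \<open>Both sides are continuous with Fourier coefficients \<open>S a\<close>, so completeness
  of the characters identifies them.\<close>

lemma R_expansion: "complex_of_real (R g) = (LINT l|\<nu>. chr l g)"
proof -
  define f where "f g = complex_of_real (R g) - (LINT l|\<nu>. chr l g)" for g
  have "f = (\<lambda>_. 0)"
  proof (rule dual_complete)
    show "cont f" unfolding f_def[abs_def] by (intro continuous_intros R_of_cont \<rho>_cont)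
    fix c :: "'g \<Rightarrow> complex" assume "c \<in> dual"
    then obtain a where a: "c = chr a" by (metis Abs_character_inverse)
    have "(LINT g|H. f g * c (- g)) = (LINT g|H. complex_of_real (R g) * chr a (- g) - (LINT l|\<nu>. chr l g) * chr a (- g))"
      by (simp add: f_def a algebra_simps)
    also have "\<dots> = RF a - (LINT g|H. (LINT l|\<nu>. chr l g) * chr a (- g))"
      unfolding RF_def
      by (rule Bochner_Integration.integral_diff) (intro cont_integrable continuous_intros R_of_cont \<rho>_cont chr_cont_minus)+
    also have "(LINT g|H. (LINT l|\<nu>. chr l g) * chr a (- g)) = (LINT g|H. LINT l|\<nu>. chr (l - a) g)"
      by (simp add: chr_diff chr_minus_arg)
    also have "\<dots> = (LINT l|\<nu>. LINT g|H. chr (l - a) g)"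
      by (rule Fubini_\<nu>(1)[OF prob_space_axioms, of _ 1]) auto
    also have "\<dots> = (LINT l|\<nu>. complex_of_real (indicator {a} l))"
    proof -
      have "(LINT g|H. chr (l - a) g) = complex_of_real (indicator {a} l)" for l
        by (simp add: integral_character indicator_def)
      then show ?thesis by (simp only:)
    qed
    also have "\<dots> = complex_of_real (S a)"
      unfolding integral_complex_of_real by (simp add: measure_\<nu>_single measurable_\<nu>)
    finally show "(LINT g|H. f g * c (- g)) = 0" by (simp add: RF_eq_S)
  qed
  then show ?thesis by (auto simp: f_def fun_eq_iff)
qed

text \<open>Evaluate the expansion at 0, where the covariance is the variance 1.\<close>

lemma nsum_C: "nsum C = 1"
proof -
  have "complex_of_real (measure \<nu> UNIV) = 1" using R_expansion[of 0] by (simp add: R_0 scaleR_conv_of_real)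
  then have "measure \<nu> UNIV = 1" by (simp only: of_real_eq_1_iff)
  then show ?thesis using finite_measure.emeasure_eq_measure[OF finite_\<nu>, of UNIV] by (simp add: emeasure_\<nu>)
qed

end

section \<open>Wick's formula for the coefficients\<close>

lemma prod_le_sum_powers:
  fixes a :: "'i \<Rightarrow> real"
  assumes I: "finite I" and a: "\<And>i. i \<in> I \<Longrightarrow> a i \<ge> 0"
  shows "(\<Prod>i\<in>I. a i) \<le> 1 + (\<Sum>i\<in>I. a i ^ card I)"
proof (cases "I = {}")
  case False
  define m where "m = Max (a ` I)"
  have "m \<in> a ` I" unfolding m_def using I False by (intro Max_in) auto
  then obtain j where j: "j \<in> I" "m = a j" by auto
  have "(\<Prod>i\<in>I. a i) \<le> (\<Prod>i\<in>I. m)"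
    using I a by (intro prod_mono) (auto simp: m_def)
  also have "\<dots> = a j ^ card I" by (simp add: j)
  also have "\<dots> \<le> (\<Sum>i\<in>I. a i ^ card I)" using I a j by (intro member_le_sum) auto
  finally show ?thesis by simp
qed simp

lemma enn2real_sum_finite:
  fixes f :: "'i \<Rightarrow> ennreal"
  shows "(\<And>i. i \<in> I \<Longrightarrow> f i < top) \<Longrightarrow> enn2real (\<Sum>i\<in>I. f i) = (\<Sum>i\<in>I. enn2real (f i))"
proof (induction I rule: infinite_finite_induct)
  case (insert i I)
  then have "f i < top" "(\<Sum>i\<in>I. f i) < top" by auto
  then show ?case using insert by (simp add: enn2real_plus)
qed auto

text \<open>Split off the last coordinate of the tuple.\<close>

lemma cpow_eq_tuple_sum:
  "(\<integral>\<^sup>+s. (if (\<Sum>i<m. s i) = a then \<Prod>i<m. C (s i) else 0) \<partial>count_space (PiE {..<m} (\<lambda>_. UNIV))) = cpow C m a"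
proof (induction m arbitrary: a)
  case 0
  then show ?case by (auto simp: nn_integral_count_space_finite)
next
  case (Suc m)
  let ?P = "\<lambda>m. PiE {..<m} (\<lambda>_. UNIV :: 'a set)"
  let ?h = "\<lambda>(l, s). s(m := l) :: nat \<Rightarrow> 'a"
  let ?f = "\<lambda>k a s. if (\<Sum>i<k. s i) = a then \<Prod>i<k. C (s i) else 0"
  have bij: "bij_betw ?h (UNIV \<times> ?P m) (?P (Suc m))"
  proof (rule bij_betw_byWitness[where f'="\<lambda>s. (s m, s(m := undefined))"])
    show "\<forall>p\<in>UNIV \<times> ?P m. (?h p m, (?h p)(m := undefined)) = p"
      by (auto simp: PiE_def extensional_def fun_eq_iff)
    show "\<forall>s\<in>?P (Suc m). ?h (s m, s(m := undefined)) = s" by auto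
    show "?h ` (UNIV \<times> ?P m) \<subseteq> ?P (Suc m)" by (auto simp: PiE_def extensional_def)
    show "(\<lambda>s. (s m, s(m := undefined))) ` ?P (Suc m) \<subseteq> UNIV \<times> ?P m"
      by (auto simp: PiE_def extensional_def)
  qed
  have upd: "(\<Sum>i<m. (s(m := l)) i) = (\<Sum>i<m. s i)" "(\<Prod>i<m. C ((s(m := l)) i)) = (\<Prod>i<m. C (s i))" for s and l :: 'a
    by (auto intro!: sum.cong prod.cong)
  have "(\<integral>\<^sup>+s. ?f (Suc m) a s \<partial>count_space (?P (Suc m))) = (\<integral>\<^sup>+p. ?f (Suc m) a (?h p) \<partial>count_space (UNIV \<times> ?P m))"
    by (rule nn_integral_bij_count_space[OF bij, symmetric])
  also have "\<dots> = (\<integral>\<^sup>+p. C (fst p) * ?f m (a - fst p) (snd p) \<partial>count_space (UNIV \<times> ?P m))"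
  proof (rule nn_integral_cong)
    fix p :: "'a \<times> (nat \<Rightarrow> 'a)"
    obtain l s where p: "p = (l, s)" by force
    have 1: "(\<Sum>i<Suc m. (s(m := l)) i) = (\<Sum>i<m. s i) + l"
      by (simp only: sum.lessThan_Suc upd fun_upd_same)
    have 2: "(\<Prod>i<Suc m. C ((s(m := l)) i)) = C l * (\<Prod>i<m. C (s i))"
      by (simp only: prod.lessThan_Suc upd fun_upd_same mult.commute)
    show "?f (Suc m) a (?h p) = C (fst p) * ?f m (a - fst p) (snd p)"
      unfolding p case_prod_conv fst_conv snd_conv 1 2 eq_diff_eq by simp
  qed
  also have "\<dots> = nsum (\<lambda>p. C (fst p) * ?f m (a - fst p) (snd p) * indicator (UNIV \<times> ?P m) p)"
    by (rule nn_integral_count_space_indicator) simp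
  also have "\<dots> = nsum (\<lambda>l. nsum (\<lambda>s. C l * ?f m (a - l) s * indicator (UNIV \<times> ?P m) (l, s)))"
    using nn_integral_fst_count_space[of "\<lambda>p. C (fst p) * ?f m (a - fst p) (snd p) * indicator (UNIV \<times> ?P m) p", symmetric]
    by (simp only: fst_conv snd_conv)
  also have "\<dots> = nsum (\<lambda>l. C l * nsum (\<lambda>s. ?f m (a - l) s * indicator (?P m) s))"
    by (simp add: nsum_cmult[symmetric] indicator_times mult.assoc)
  also have "\<dots> = nsum (\<lambda>l. C l * cpow C m (a - l))"
    by (simp add: Suc.IH[symmetric] nn_integral_count_space_indicator)
  finally show ?case by simp
qed

context gaussian_field begin

lemma hermite_am_complex: "all_moments M (\<lambda>w. complex_of_real (hermite n (T g w)))"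
  using hermite_am[of n g] by (simp add: all_moments_def)

lemma prob_PiM: "prob_space (PiM I (\<lambda>_::nat. H))"
  by (rule prob_space_PiM) (rule prob_space_axioms)

lemma hermite_PiM_pair:
  assumes "i \<in> I"
  shows "(\<lambda>(x, w). hermite n (T (x i) w)) \<in> borel_measurable (PiM I (\<lambda>_::nat. H) \<Otimes>\<^sub>M M)"
proof -
  have "(\<lambda>p. (fst p i, snd p)) \<in> measurable (PiM I (\<lambda>_. H) \<Otimes>\<^sub>M M) (H \<Otimes>\<^sub>M M)"
    using assms by (intro measurable_Pair measurable_compose[OF measurable_fst] measurable_component_singleton measurable_snd) auto
  from measurable_compose[OF this hermite_pair[of n]] show ?thesis by (simp add: case_prod_beta')
qed

lemma chr_PiM:
  assumes "i \<in> I" shows "(\<lambda>x. chr a (- x i)) \<in> borel_measurable (PiM I (\<lambda>_::nat. H))"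
proof -
  have "(\<lambda>x. x i) \<in> measurable (PiM I (\<lambda>_. H)) H" using assms by (rule measurable_component_singleton)
  from measurable_compose[OF this chr_measurable(2)] show ?thesis .
qed

text \<open>The expectation at fixed points of the group, where Gaussian integration by parts is
  available; the coefficients arise by integrating it against \<open>pchr\<close>.\<close>

definition qmom :: "nat set \<Rightarrow> (nat \<Rightarrow> nat) \<Rightarrow> (nat \<Rightarrow> 'g) \<Rightarrow> complex" where
  "qmom I n x = (LINT w|M. (\<Prod>i\<in>I. complex_of_real (hermite (n i) (T (x i) w))))"

definition pchr :: "nat set \<Rightarrow> (nat \<Rightarrow> 'g character) \<Rightarrow> (nat \<Rightarrow> 'g) \<Rightarrow> complex" where
  "pchr I \<pi> x = (\<Prod>i\<in>I. chr (\<pi> i) (- x i))"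

lemma norm_pchr[simp]: "norm (pchr I \<pi> x) = 1"
  by (simp add: pchr_def prod_norm[symmetric])

lemma hermite_prod_bound:
  assumes I: "finite I"
  shows "(LINT w|M. norm (\<Prod>i\<in>I. complex_of_real (hermite (n i) (T (x i) w)))) \<le>
    1 + (\<Sum>i\<in>I. LINT w|M. \<bar>hermite (n i) (T 0 w)\<bar> ^ card I)"
proof -
  have int: "integrable M (\<lambda>w. \<bar>hermite (n i) (T (x i) w)\<bar> ^ card I)" for i
    using hermite_am[of "n i" "x i"] by (auto simp: all_moments_def)
  have "(LINT w|M. norm (\<Prod>i\<in>I. complex_of_real (hermite (n i) (T (x i) w)))) \<le>
     (LINT w|M. 1 + (\<Sum>i\<in>I. \<bar>hermite (n i) (T (x i) w)\<bar> ^ card I))"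
  proof (rule integral_mono)
    show "integrable M (\<lambda>w. norm (\<Prod>i\<in>I. complex_of_real (hermite (n i) (T (x i) w))))"
      by (intro integrable_norm all_moments_integrable M.all_moments_prod hermite_am_complex)
    show "integrable M (\<lambda>w. 1 + (\<Sum>i\<in>I. \<bar>hermite (n i) (T (x i) w)\<bar> ^ card I))"
      using int by auto
    show "norm (\<Prod>i\<in>I. complex_of_real (hermite (n i) (T (x i) w))) \<le> 1 + (\<Sum>i\<in>I. \<bar>hermite (n i) (T (x i) w)\<bar> ^ card I)" for w
      using prod_le_sum_powers[OF I, of "\<lambda>i. \<bar>hermite (n i) (T (x i) w)\<bar>"] by (simp add: prod_norm[symmetric])
  qed
  also have "\<dots> = 1 + (\<Sum>i\<in>I. LINT w|M. \<bar>hermite (n i) (T (x i) w)\<bar> ^ card I)"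
    using int by (simp add: M.prob_space)
  also have "\<dots> = 1 + (\<Sum>i\<in>I. LINT w|M. \<bar>hermite (n i) (T 0 w)\<bar> ^ card I)"
    by (intro arg_cong2[where f="(+)"] sum.cong refl hermite_moment_const)
  finally show ?thesis .
qed

lemma qmom_bound:
  assumes "finite I"
  shows "norm (qmom I n x) \<le> 1 + (\<Sum>i\<in>I. LINT w|M. \<bar>hermite (n i) (T 0 w)\<bar> ^ card I)"
  unfolding qmom_def by (rule order.trans[OF integral_norm_bound hermite_prod_bound[OF assms]])

lemma qmom_measurable: "qmom I n \<in> borel_measurable (PiM I (\<lambda>_. H))"
proof -
  have "(\<lambda>(x, w). \<Prod>i\<in>I. complex_of_real (hermite (n i) (T (x i) w))) \<in> borel_measurable (PiM I (\<lambda>_. H) \<Otimes>\<^sub>M M)"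
    using hermite_PiM_pair by (simp add: case_prod_beta') 
  then show ?thesis unfolding qmom_def[abs_def] by (rule M.borel_measurable_lebesgue_integral)
qed

lemma pchr_measurable: "pchr I \<pi> \<in> borel_measurable (PiM I (\<lambda>_. H))"
  unfolding pchr_def[abs_def] by (intro borel_measurable_prod chr_PiM)

lemma moment_PiM:
  assumes I: "finite I"
  shows "(LINT w|M. (\<Prod>i\<in>I. A (n i) (\<pi> i) w)) = (LINT x|PiM I (\<lambda>_. H). qmom I n x * pchr I \<pi> x)"
proof -
  interpret P: product_sigma_finite "\<lambda>_::nat. H" by standard
  let ?f = "\<lambda>x w. \<Prod>i\<in>I. complex_of_real (hermite (n i) (T (x i) w)) * chr (\<pi> i) (- x i)"
  have split: "?f x w = (\<Prod>i\<in>I. complex_of_real (hermite (n i) (T (x i) w))) * pchr I \<pi> x" for x w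
    by (simp add: prod.distrib pchr_def)
  have am: "all_moments M (\<lambda>w. \<Prod>i\<in>I. complex_of_real (hermite (n i) (T (x i) w)))" for x
    by (intro M.all_moments_prod hermite_am_complex)
  have meas: "(\<lambda>(x, w). ?f x w) \<in> borel_measurable (PiM I (\<lambda>_. H) \<Otimes>\<^sub>M M)"
  proof -
    have "(\<lambda>p. chr (\<pi> i) (- fst p i)) \<in> borel_measurable (PiM I (\<lambda>_. H) \<Otimes>\<^sub>M M)" if "i \<in> I" for i
      by (rule measurable_compose[OF measurable_fst chr_PiM[OF that]])
    then show ?thesis using hermite_PiM_pair by (simp add: case_prod_beta')
  qed
  have "(LINT x|PiM I (\<lambda>_. H). LINT w|M. ?f x w) = (LINT w|M. LINT x|PiM I (\<lambda>_. H). ?f x w)"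
  proof (rule Fubini_bounded(1)[OF prob_PiM M.prob_space_axioms meas])
    show "integrable M (?f x)" for x
      unfolding split by (intro integrable_mult_left all_moments_integrable am)
    show "(LINT w|M. norm (?f x w)) \<le> 1 + (\<Sum>i\<in>I. LINT w|M. \<bar>hermite (n i) (T 0 w)\<bar> ^ card I)" for x
      using hermite_prod_bound[OF I, of n x] unfolding split by (simp add: norm_mult)
  qed
  moreover have "(LINT w|M. LINT x|PiM I (\<lambda>_. H). ?f x w) = (LINT w|M. (\<Prod>i\<in>I. A (n i) (\<pi> i) w))"
  proof (rule integral_cong_AE)
    have "AE w in M. \<forall>i\<in>I. integrable H (\<lambda>g. hermite (n i) (T g w))"
      using I by (intro AE_finite_allI hermite_int_AE) 
    then show "AE w in M. (LINT x|PiM I (\<lambda>_. H). ?f x w) = (\<Prod>i\<in>I. A (n i) (\<pi> i) w)"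
    proof eventually_elim
      case (elim w)
      have "(LINT x|PiM I (\<lambda>_. H). (\<Prod>i\<in>I. (\<lambda>g. complex_of_real (hermite (n i) (T g w)) * chr (\<pi> i) (- g)) (x i))) =
        (\<Prod>i\<in>I. LINT g|H. complex_of_real (hermite (n i) (T g w)) * chr (\<pi> i) (- g))"
      proof (rule P.product_integral_prod[OF I])
        fix i assume "i \<in> I"
        then have i: "integrable H (\<lambda>g. hermite (n i) (T g w))" using elim by blast
        then have [measurable]: "(\<lambda>g. hermite (n i) (T g w)) \<in> borel_measurable H" by (rule borel_measurable_integrable)
        show "integrable H (\<lambda>g. complex_of_real (hermite (n i) (T g w)) * chr (\<pi> i) (- g))"
          by (rule Bochner_Integration.integrable_bound[OF i], measurable) (simp add: norm_mult)
      qed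
      then show ?case by (simp add: hcoef_def)
    qed
    show "(\<lambda>w. \<Prod>i\<in>I. A (n i) (\<pi> i) w) \<in> borel_measurable M" by measurable
    have "(\<lambda>(w, x). ?f x w) \<in> borel_measurable (M \<Otimes>\<^sub>M PiM I (\<lambda>_. H))"
      using measurable_compose[OF measurable_pair_swap' meas] by (simp add: case_prod_beta')
    then show "(\<lambda>w. LINT x|PiM I (\<lambda>_. H). ?f x w) \<in> borel_measurable M"
      by (rule sigma_finite_measure.borel_measurable_lebesgue_integral[OF prob_space_imp_sigma_finite[OF prob_PiM]])
  qed
  moreover have "(LINT w|M. ?f x w) = qmom I n x * pchr I \<pi> x" for x
    unfolding split qmom_def by (rule integral_mult_left_zero)
  ultimately show ?thesis by simp
qed

lemma qmom_recursion:
  assumes I: "finite I" "v \<notin> I"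
  shows "qmom (insert v I) (n(v := Suc m)) x =
    (\<Sum>i\<in>I. of_nat (n i) * complex_of_real (R (x v - x i)) * qmom (insert v I) (n(v := m, i := n i - 1)) x)"
proof -
  have e: "qmom J k x = complex_of_real (LINT w|M. (\<Prod>i\<in>J. hermite (k i) (T (x i) w)))" for J k
    by (simp add: qmom_def flip: of_real_prod)
  have "(LINT w|M. (\<Prod>i\<in>insert v I. hermite ((n(v := Suc m)) i) (T (x i) w))) =
     (LINT w|M. hermite (Suc m) (T (x v) w) * (\<Prod>i\<in>I. hermite (n i) (T (x i) w)))"
  proof -
    have "(\<Prod>i\<in>I. hermite ((n(v := Suc m)) i) (T (x i) w)) = (\<Prod>i\<in>I. hermite (n i) (T (x i) w))" for w
      using I by (intro prod.cong) auto
    then show ?thesis using I by simp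
  qed
  also have "\<dots> = (\<Sum>i\<in>I. real (n i) * (LINT w|M. T (x v) w * T (x i) w) *
       (LINT w|M. hermite m (T (x v) w) * (\<Prod>j\<in>I. hermite ((n(i := n i - 1)) j) (T (x j) w))))"
    by (rule gs.ibp_hermite[OF I]) (auto simp: T_V var1)
  also have "\<dots> = (\<Sum>i\<in>I. real (n i) * R (x v - x i) * (LINT w|M. (\<Prod>j\<in>insert v I. hermite ((n(v := m, i := n i - 1)) j) (T (x j) w))))"
  proof (rule sum.cong[OF refl])
    fix i assume "i \<in> I"
    then have "i \<noteq> v" using I by auto
    then have "(\<Prod>j\<in>I. hermite ((n(v := m, i := n i - 1)) j) (T (x j) w)) = (\<Prod>j\<in>I. hermite ((n(i := n i - 1)) j) (T (x j) w))" for w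
      using I by (intro prod.cong) auto
    then show "real (n i) * (LINT w|M. T (x v) w * T (x i) w) *
       (LINT w|M. hermite m (T (x v) w) * (\<Prod>j\<in>I. hermite ((n(i := n i - 1)) j) (T (x j) w))) =
       real (n i) * R (x v - x i) * (LINT w|M. (\<Prod>j\<in>insert v I. hermite ((n(v := m, i := n i - 1)) j) (T (x j) w)))"
      using I \<open>i \<noteq> v\<close> by (simp add: covariance)
  qed
  finally show ?thesis by (simp add: e)
qed

text \<open>A character in the difference of two points transports the charge \<open>l\<close> from
  one vertex to the other.\<close>

lemma pchr_update:
  assumes I: "finite I" "v \<notin> I" "i \<in> I"
  shows "chr l (x v - x i) * pchr (insert v I) (\<pi>(v := \<rho>)) x = pchr (insert v I) (\<pi>(v := \<rho> - l, i := \<pi> i + l)) x"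
proof -
  have iv: "i \<noteq> v" using I by auto
  have jv: "j \<noteq> v" if "j \<in> I" for j using I that by auto
  have rest: "(\<Prod>j\<in>I - {i}. chr ((\<pi>(v := \<rho>)) j) (- x j)) = (\<Prod>j\<in>I - {i}. chr (\<pi> j) (- x j))"
    "(\<Prod>j\<in>I - {i}. chr ((\<pi>(v := \<rho> - l, i := \<pi> i + l)) j) (- x j)) = (\<Prod>j\<in>I - {i}. chr (\<pi> j) (- x j))"
    by (auto intro!: prod.cong simp: jv)
  let ?P = "\<Prod>j\<in>I - {i}. chr (\<pi> j) (- x j)"
  have vi: "v \<noteq> i" using iv by simp
  have 1: "pchr (insert v I) (\<pi>(v := \<rho>)) x = chr \<rho> (- x v) * (chr (\<pi> i) (- x i) * ?P)"
    unfolding pchr_def by (subst prod.insert[OF I(1,2)], subst prod.remove[OF I(1,3)])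
      (simp only: rest fun_upd_same fun_upd_other[OF iv])
  have 2: "pchr (insert v I) (\<pi>(v := \<rho> - l, i := \<pi> i + l)) x = chr (\<rho> - l) (- x v) * (chr (\<pi> i + l) (- x i) * ?P)"
    unfolding pchr_def by (subst prod.insert[OF I(1,2)], subst prod.remove[OF I(1,3)])
      (simp only: rest fun_upd_same fun_upd_other[OF iv] fun_upd_other[OF vi])
  show ?thesis unfolding 1 2 by (simp add: chr_diff chr_add chr_minus_arg chr_diff_arg mult_ac)
qed

text \<open>Integration by parts at fixed points produces the covariance between two of them. Its
  expansion in characters turns this factor into an edge of charge \<open>l\<close>, so the moments
  satisfy the recursion that defines \<open>edges\<close>.\<close>

lemma moment_recursion:
  fixes I :: "nat set"
  assumes I: "finite I" "v \<notin> I"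
  shows "(LINT w|M. A (Suc m) \<rho> w * (\<Prod>i\<in>I. A (n i) (\<pi> i) w)) =
    (\<Sum>i\<in>I. of_nat (n i) * (LINT l|\<nu>. LINT w|M. A m (\<rho> - l) w * (\<Prod>j\<in>I. A ((n(i := n i - 1)) j) ((\<pi>(i := \<pi> i + l)) j) w)))"
proof -
  let ?I = "insert v I" and ?N = "PiM (insert v I) (\<lambda>_. H)"
  have fin: "finite ?I" using I by simp
  have ins: "(\<Prod>i\<in>?I. A ((k(v := r)) i) ((\<tau>(v := \<sigma>)) i) w) = A r \<sigma> w * (\<Prod>i\<in>I. A (k i) (\<tau> i) w)" for k r \<tau> \<sigma> w
  proof -
    have "(\<Prod>i\<in>I. A ((k(v := r)) i) ((\<tau>(v := \<sigma>)) i) w) = (\<Prod>i\<in>I. A (k i) (\<tau> i) w)"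
      using I by (intro prod.cong) auto
    then show ?thesis using I by simp
  qed
  let ?n = "\<lambda>i. n(v := m, i := n i - 1)" and ?\<pi> = "\<lambda>i l. \<pi>(v := \<rho> - l, i := \<pi> i + l)"
  let ?g = "\<lambda>i l x. qmom ?I (?n i) x * pchr ?I (?\<pi> i l) x"
  have bd: "norm (?g i l x) \<le> 1 + (\<Sum>j\<in>?I. LINT w|M. \<bar>hermite (?n i j) (T 0 w)\<bar> ^ card ?I)" for i l x
    using qmom_bound[OF fin, of "?n i" x] by (simp add: norm_mult)
  have gm: "?g i l \<in> borel_measurable ?N" for i l
    by (intro borel_measurable_times qmom_measurable pchr_measurable)
  have "(LINT w|M. A (Suc m) \<rho> w * (\<Prod>i\<in>I. A (n i) (\<pi> i) w)) = (LINT x|?N. qmom ?I (n(v := Suc m)) x * pchr ?I (\<pi>(v := \<rho>)) x)"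
    unfolding ins[symmetric] by (rule moment_PiM[OF fin])
  also have "\<dots> = (LINT x|?N. (\<Sum>i\<in>I. of_nat (n i) * (LINT l|\<nu>. ?g i l x)))"
  proof (rule Bochner_Integration.integral_cong[OF refl])
    fix x
    have "complex_of_real (R (x v - x i)) * qmom ?I (?n i) x * pchr ?I (\<pi>(v := \<rho>)) x = (LINT l|\<nu>. ?g i l x)" if "i \<in> I" for i
    proof -
      have "complex_of_real (R (x v - x i)) * (qmom ?I (?n i) x * pchr ?I (\<pi>(v := \<rho>)) x) =
         (LINT l|\<nu>. chr l (x v - x i) * (qmom ?I (?n i) x * pchr ?I (\<pi>(v := \<rho>)) x))"
        unfolding R_expansion by (rule integral_mult_left_zero[symmetric])
      also have "\<dots> = (LINT l|\<nu>. qmom ?I (?n i) x * (chr l (x v - x i) * pchr ?I (\<pi>(v := \<rho>)) x))"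
        by (simp add: mult_ac)
      finally show ?thesis unfolding pchr_update[OF I that] by (simp add: mult.assoc)
    qed
    then show "qmom ?I (n(v := Suc m)) x * pchr ?I (\<pi>(v := \<rho>)) x = (\<Sum>i\<in>I. of_nat (n i) * (LINT l|\<nu>. ?g i l x))"
      unfolding qmom_recursion[OF I] sum_distrib_right by (intro sum.cong refl) (simp add: mult.assoc)
  qed
  also have "\<dots> = (\<Sum>i\<in>I. of_nat (n i) * (LINT x|?N. LINT l|\<nu>. ?g i l x))"
  proof -
    have "integrable ?N (\<lambda>x. LINT l|\<nu>. ?g i l x)" for i
      by (rule Fubini_\<nu>(2)[OF prob_PiM gm bd])
    then show ?thesis by (subst Bochner_Integration.integral_sum) auto
  qed
  also have "\<dots> = (\<Sum>i\<in>I. of_nat (n i) * (LINT l|\<nu>. LINT x|?N. ?g i l x))"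
    by (intro sum.cong refl arg_cong2[where f="(*)"] Fubini_\<nu>(1)[OF prob_PiM gm bd])
  also have "\<dots> = (\<Sum>i\<in>I. of_nat (n i) * (LINT l|\<nu>. LINT w|M. A m (\<rho> - l) w * (\<Prod>j\<in>I. A ((n(i := n i - 1)) j) ((\<pi>(i := \<pi> i + l)) j) w)))"
  proof (intro sum.cong refl arg_cong2[where f="(*)"] Bochner_Integration.integral_cong)
    fix i l assume i: "i \<in> I"
    then have iv: "i \<noteq> v" using I by auto
    have "(LINT x|?N. ?g i l x) = (LINT w|M. (\<Prod>j\<in>?I. A (?n i j) (?\<pi> i l j) w))"
      by (rule moment_PiM[OF fin, symmetric])
    also have "\<dots> = (LINT w|M. A m (\<rho> - l) w * (\<Prod>j\<in>I. A ((n(i := n i - 1)) j) ((\<pi>(i := \<pi> i + l)) j) w))"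
      using ins[of "n(i := n i - 1)" m "\<pi>(i := \<pi> i + l)" "\<rho> - l"] iv by (simp add: fun_upd_twist)
    finally show "(LINT x|?N. ?g i l x) = (LINT w|M. A m (\<rho> - l) w * (\<Prod>j\<in>I. A ((n(i := n i - 1)) j) ((\<pi>(i := \<pi> i + l)) j) w))" .
  qed
  finally show ?thesis .
qed

lemma integral_\<nu>_enn2real:
  assumes "\<And>l. f l < top"
  shows "(LINT l|\<nu>. complex_of_real (enn2real (f l))) = complex_of_real (enn2real (nsum (\<lambda>l. C l * f l)))"
proof -
  have "(LINT l|\<nu>. enn2real (f l)) = enn2real (\<integral>\<^sup>+l. ennreal (enn2real (f l)) \<partial>\<nu>)"
    by (rule integral_eq_nn_integral) (auto simp: measurable_\<nu>)
  also have "(\<integral>\<^sup>+l. ennreal (enn2real (f l)) \<partial>\<nu>) = (\<integral>\<^sup>+l. f l \<partial>\<nu>)"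
    using assms by simp
  also have "\<dots> = nsum (\<lambda>l. C l * f l)"
    unfolding \<nu>_def by (rule nn_integral_density) auto
  finally show ?thesis by (simp only: integral_complex_of_real)
qed

text \<open>Regard the dangling half-edges as those of a fresh vertex and use finiteness of the
  resulting \<open>wick\<close>.\<close>

lemma edges_finite:
  assumes "distinct vs"
  shows "edges C (wick C vs) (set vs) m \<rho> n \<pi> < top"
proof -
  obtain v where v: "v \<notin> set vs" using ex_new_if_finite[of "set vs"] by auto
  have "edges C (wick C vs) (set vs) m \<rho> n \<pi> = edges C (wick C vs) (set vs) m \<rho> (n(v := m)) (\<pi>(v := \<rho>))"
    by (rule edges_cong[where I="set vs"]) (use v in \<open>auto intro: wick_cong\<close>)
  also have "\<dots> = wick C (v # vs) (n(v := m)) (\<pi>(v := \<rho>))" by simp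
  also have "\<dots> < top" by (rule wick_finite) (use v assms nsum_C in \<open>auto simp: C_uminus\<close>)
  finally show ?thesis .
qed

text \<open>Induction over the vertices and, inside, over the half-edges of the first. When none is
  left, the coefficient of order 0 tests for zero charge, as in the base case of
  \<open>edges\<close>.\<close>

theorem moment_wick:
  assumes "distinct vs"
  shows "(LINT w|M. (\<Prod>i\<in>set vs. A (n i) (\<pi> i) w)) = complex_of_real (enn2real (wick C vs n \<pi>))"
  using assms
proof (induction vs arbitrary: n \<pi>)
  case Nil
  then show ?case by (simp add: M.prob_space scaleR_conv_of_real)
next
  case (Cons v vs)
  have d: "distinct vs" and v: "v \<notin> set vs" using Cons.prems by auto
  let ?e = "edges C (wick C vs) (set vs)"
  have "(LINT w|M. A m \<rho> w * (\<Prod>i\<in>set vs. A (n i) (\<pi> i) w)) = complex_of_real (enn2real (?e m \<rho> n \<pi>))" for m \<rho> n \<pi>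
  proof (induction m arbitrary: \<rho> n \<pi>)
    case 0
    then show ?case using Cons.IH[OF d, of n \<pi>] by (simp add: A_0)
  next
    case (Suc m)
    let ?t = "\<lambda>i. of_nat (n i) * nsum (\<lambda>l. C l * ?e m (\<rho> - l) (n(i := n i - 1)) (\<pi>(i := \<pi> i + l)))"
    have fin: "?t i < top" if "i \<in> set vs" for i
    proof -
      have "?t i \<le> ?e (Suc m) \<rho> n \<pi>" unfolding edges.simps using that by (intro member_le_sum) auto
      then show ?thesis using edges_finite[OF d] by (rule le_less_trans)
    qed
    have "(LINT w|M. A (Suc m) \<rho> w * (\<Prod>i\<in>set vs. A (n i) (\<pi> i) w)) =
      (\<Sum>i\<in>set vs. of_nat (n i) * (LINT l|\<nu>. complex_of_real (enn2real (?e m (\<rho> - l) (n(i := n i - 1)) (\<pi>(i := \<pi> i + l))))))"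
      unfolding moment_recursion[OF finite_set v] Suc.IH ..
    also have "\<dots> = (\<Sum>i\<in>set vs. of_nat (n i) * complex_of_real (enn2real (nsum (\<lambda>l. C l * ?e m (\<rho> - l) (n(i := n i - 1)) (\<pi>(i := \<pi> i + l))))))"
      by (simp only: integral_\<nu>_enn2real[OF edges_finite[OF d]])
    also have "\<dots> = complex_of_real (\<Sum>i\<in>set vs. enn2real (?t i))"
      by (simp add: enn2real_mult)
    also have "(\<Sum>i\<in>set vs. enn2real (?t i)) = enn2real (?e (Suc m) \<rho> n \<pi>)"
      unfolding edges.simps by (rule enn2real_sum_finite[symmetric]) (rule fin)
    finally show ?case .
  qed
  from this[of "n v" "\<pi> v" n \<pi>] show ?case using v by simp
qed

section \<open>Convolved spectra as real numbers\<close>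

definition cc :: "nat \<Rightarrow> 'g character \<Rightarrow> real" where "cc m a = enn2real (cpow C m a)"

lemma cpow_le_1: "cpow C m a \<le> 1" by (rule cpow_le) (simp add: nsum_C)

lemma cpow_top: "cpow C m a < top" using cpow_le_1[of m a] ennreal_one_less_top by (rule le_less_trans)

lemma ennreal_cc: "ennreal (cc m a) = cpow C m a" using cpow_top[of m a] by (simp add: cc_def)

lemma cc_nonneg: "cc m a \<ge> 0" by (simp add: cc_def)

lemma cc_pos: "m > 0 \<Longrightarrow> cc m a > 0"
  using cpow_pos[of C m a] C_pos cpow_top[of m a] by (auto simp: cc_def enn2real_positive_iff)

lemma chr_image: "range chr = dual"
  using chr_dual Abs_character_inverse by (metis (no_types, lifting) image_subset_iff rangeI subsetI subset_antisym UNIV_I image_eqI)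

lemma spec_conv_eq: "spec_conv M H T (chr a) m = cc m a"
proof -
  let ?P = "PiE {..<m} (\<lambda>_. UNIV :: 'g character set)"
  let ?X = "{s \<in> ?P. (\<Sum>i<m. s i) = a}"
  let ?D = "{\<sigma> \<in> PiE {..<m} (\<lambda>_. dual). (\<lambda>g. \<Prod>i<m. \<sigma> i g) = chr a}"
  let ?h = "\<lambda>s. \<lambda>i\<in>{..<m}. chr (s i)"
  let ?k = "\<lambda>\<sigma>. \<lambda>i\<in>{..<m}. Abs_character (\<sigma> i)"
  have hD: "(\<lambda>g. \<Prod>i<m. ?h s i g) = chr (\<Sum>i<m. s i)" for s
    by (auto simp: chr_sum)
  have bij: "bij_betw ?h ?X ?D"
  proof (rule bij_betw_byWitness[where f'="?k"])
    show "\<forall>s\<in>?X. ?k (?h s) = s" by (auto simp: chr_inverse PiE_def extensional_def fun_eq_iff)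
    show hk: "\<forall>\<sigma>\<in>?D. ?h (?k \<sigma>) = \<sigma>"
      by (auto simp: PiE_def extensional_def fun_eq_iff Abs_character_inverse Pi_iff)
    show "?h ` ?X \<subseteq> ?D" using hD chr_dual by auto
    show "?k ` ?D \<subseteq> ?X"
    proof
      fix s assume "s \<in> ?k ` ?D"
      then obtain \<sigma> where \<sigma>: "\<sigma> \<in> ?D" "s = ?k \<sigma>" by blast
      then have "?h s = \<sigma>" using hk by blast
      then have "chr (\<Sum>i<m. s i) = chr a" using \<sigma>(1) hD[of s] by simp
      then show "s \<in> ?X" using \<sigma>(2) by (auto simp: chr_inject)
    qed
  qed
  let ?f = "\<lambda>s. if s \<in> ?P \<and> (\<Sum>i<m. s i) = a then \<Prod>i<m. S (s i) else 0"
  have "nsum (\<lambda>s. ennreal (?f s)) = nsum (\<lambda>s. (if (\<Sum>i<m. s i) = a then \<Prod>i<m. C (s i) else 0) * indicator ?P s)"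
    by (rule nn_integral_cong) (auto simp: C_def prod_ennreal S_nonneg indicator_def)
  also have "\<dots> = cpow C m a"
    by (simp add: cpow_eq_tuple_sum[symmetric] nn_integral_count_space_indicator)
  finally have ns: "nsum (\<lambda>s. ennreal (?f s)) = cpow C m a" .
  have "spec_conv M H T (chr a) m = infsum (\<lambda>\<sigma>. \<Prod>i<m. spec M H T (\<sigma> i)) ?D"
    by (simp add: spec_conv_def)
  also have "\<dots> = infsum (\<lambda>s. \<Prod>i<m. spec M H T (?h s i)) ?X"
    by (rule infsum_reindex_bij_betw[OF bij, symmetric])
  also have "\<dots> = infsum (\<lambda>s. \<Prod>i<m. S (s i)) ?X" by (simp add: S_def)
  also have "\<dots> = infsum ?f UNIV"
    by (rule infsum_cong_neutral) auto
  also have "\<dots> = cc m a"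
    unfolding cc_def ns[symmetric]
    by (rule infsum_eq_nsum(2)) (auto simp: ns cpow_top intro!: prod_nonneg S_nonneg)
  finally show ?thesis .
qed

lemma char_div_eq: "char_div (chr a) (chr b) = chr (a - b)"
  by (auto simp: char_div_def chr_diff)

lemma infsum_dual:
  fixes f :: "('g \<Rightarrow> complex) \<Rightarrow> real"
  assumes "\<And>a. f (chr a) \<ge> 0" and "nsum (\<lambda>a. ennreal (f (chr a))) < top"
  shows "infsum f dual = enn2real (nsum (\<lambda>a. ennreal (f (chr a))))"
proof -
  have "inj chr" by (auto simp: inj_def chr_inject)
  then have "infsum f (range chr) = infsum (f \<circ> chr) UNIV" by (rule infsum_reindex)
  then show ?thesis using infsum_eq_nsum(2)[of "f \<circ> chr"] assms by (simp add: chr_image o_def)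
qed

end

section \<open>Normalised coefficients and contraction norms\<close>

context gaussian_field begin

lemma cc_uminus: "cc n (- a) = cc n a"
  by (simp add: cc_def cpow_uminus C_uminus)

definition Bn :: "nat \<Rightarrow> 'g character \<Rightarrow> 'w \<Rightarrow> complex" where
  "Bn n a w = A n a w / complex_of_real (sqrt (fact n * cc n a))"

lemma nhcoef_eq: "nhcoef M H T n (chr a) w = Bn n a w"
  by (simp add: nhcoef_def spec_conv_eq Bn_def)

lemma Bn_am: "all_moments M (Bn n a)"
proof -
  have "Bn n a = (\<lambda>w. A n a w * (1 / complex_of_real (sqrt (fact n * cc n a))))" by (auto simp: Bn_def)
  then show ?thesis by (simp only:) (intro all_moments_mult A_am M.all_moments_const)
qed

lemma Bn_cnj: "cnj (Bn n a w) = Bn n (- a) w"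
  by (simp add: Bn_def A_cnj cc_uminus)

lemma moment_Bn:
  assumes "distinct vs"
  shows "(LINT w|M. (\<Prod>i\<in>set vs. Bn (n i) (\<pi> i) w)) =
    complex_of_real (enn2real (wick C vs n \<pi>) / (\<Prod>i\<in>set vs. sqrt (fact (n i) * cc (n i) (\<pi> i))))"
proof -
  let ?z = "\<Prod>i\<in>set vs. complex_of_real (sqrt (fact (n i) * cc (n i) (\<pi> i)))"
  have "(LINT w|M. (\<Prod>i\<in>set vs. Bn (n i) (\<pi> i) w)) = (LINT w|M. (\<Prod>i\<in>set vs. A (n i) (\<pi> i) w) / ?z)"
    by (simp add: Bn_def prod_dividef)
  also have "\<dots> = complex_of_real (enn2real (wick C vs n \<pi>)) / ?z"
    by (simp add: moment_wick[OF assms])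
  finally show ?thesis by (simp flip: of_real_prod)
qed

text \<open>The sum over \<lambda> in condition (c).\<close>

definition DD :: "nat \<Rightarrow> nat \<Rightarrow> 'g character \<Rightarrow> real" where
  "DD m q \<tau> = enn2real (nsum (\<lambda>a. (cpow C q a)\<^sup>2 * (cpow C (m - q) (\<tau> - a))\<^sup>2))"

lemma nsum_cpow_le_1: "(\<And>a. f a \<le> cpow C q a) \<Longrightarrow> nsum f \<le> 1"
  using nn_integral_mono[of "count_space UNIV" f "cpow C q"] nsum_cpow[of C q] by (simp add: nsum_C)

lemma cpow_sq_le: "(cpow C q a)\<^sup>2 * x \<le> cpow C q a" if "x \<le> 1"
proof -
  have "cpow C q a * (cpow C q a * x) \<le> cpow C q a * (1 * 1)"
    using cpow_le_1 that by (intro mult_left_mono mult_mono) auto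
  then show ?thesis by (simp add: power2_eq_square mult.assoc)
qed

lemma ennreal_DD: "ennreal (DD m q \<tau>) = nsum (\<lambda>a. (cpow C q a)\<^sup>2 * (cpow C (m - q) (\<tau> - a))\<^sup>2)"
proof -
  have "nsum (\<lambda>a. (cpow C q a)\<^sup>2 * (cpow C (m - q) (\<tau> - a))\<^sup>2) \<le> 1"
  proof (rule nsum_cpow_le_1[where q = q])
    show "(cpow C q a)\<^sup>2 * (cpow C (m - q) (\<tau> - a))\<^sup>2 \<le> cpow C q a" for a
      using cpow_le_1 by (intro cpow_sq_le power_le_one) auto
  qed
  then have "nsum (\<lambda>a. (cpow C q a)\<^sup>2 * (cpow C (m - q) (\<tau> - a))\<^sup>2) < top" using ennreal_one_less_top by (rule le_less_trans)
  then show ?thesis by (simp add: DD_def)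
qed

lemma DD_nonneg: "DD m q \<tau> \<ge> 0" by (simp add: DD_def)

lemma ennreal_cc_sq: "(cpow C q a)\<^sup>2 * (cpow C r b)\<^sup>2 = ennreal ((cc q a * cc r b)\<^sup>2)"
  by (simp add: ennreal_cc[symmetric] ennreal_power ennreal_mult[symmetric] cc_nonneg power_mult_distrib)

lemma DD_ge: "(cc q a * cc (m - q) (\<tau> - a))\<^sup>2 \<le> DD m q \<tau>"
proof -
  have "ennreal ((cc q a * cc (m - q) (\<tau> - a))\<^sup>2) \<le> ennreal (DD m q \<tau>)"
    unfolding ennreal_DD ennreal_cc_sq[symmetric] by (rule nsum_ge)
  then show ?thesis by (simp add: DD_nonneg)
qed

lemma DD_uminus: "DD m q (- \<tau>) = DD m q \<tau>"
proof -
  have "nsum (\<lambda>a. (cpow C q a)\<^sup>2 * (cpow C (m - q) (- \<tau> - a))\<^sup>2) = nsum (\<lambda>a. (cpow C q (0 - a))\<^sup>2 * (cpow C (m - q) (- \<tau> - (0 - a)))\<^sup>2)"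
    by (rule nsum_minus_shift[symmetric])
  also have "\<dots> = nsum (\<lambda>a. (cpow C q a)\<^sup>2 * (cpow C (m - q) (\<tau> - a))\<^sup>2)"
    using cpow_uminus[of C q] cpow_uminus[of C "m - q" "\<tau> - _"] by (simp add: C_uminus)
  finally show ?thesis by (simp add: DD_def)
qed

lemma gain_sym: "gain C m1 \<pi>1 m2 \<pi>2 q = gain C m2 \<pi>2 m1 \<pi>1 q"
proof -
  have "gain C m1 \<pi>1 m2 \<pi>2 q = nsum (\<lambda>\<mu>. (cpow C q (0 - \<mu>))\<^sup>2 * cpow C (m1 - q) (\<pi>1 - (0 - \<mu>)) * cpow C (m2 - q) (\<pi>2 + (0 - \<mu>)))"
    unfolding gain_def by (rule nsum_minus_shift[symmetric])
  also have "\<dots> = gain C m2 \<pi>2 m1 \<pi>1 q"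
    unfolding gain_def using cpow_uminus[of C q] by (simp add: C_uminus mult_ac)
  finally show ?thesis .
qed

lemma gain_le_1: "gain C m1 \<pi>1 m2 \<pi>2 q \<le> 1"
  unfolding gain_def
proof (rule nsum_cpow_le_1)
  fix a
  have "cpow C (m1 - q) (\<pi>1 - a) * cpow C (m2 - q) (\<pi>2 + a) \<le> 1 * 1"
    by (intro mult_mono cpow_le_1) auto
  then show "(cpow C q a)\<^sup>2 * cpow C (m1 - q) (\<pi>1 - a) * cpow C (m2 - q) (\<pi>2 + a) \<le> cpow C q a"
    unfolding mult.assoc by (intro cpow_sq_le) simp
qed

definition gn :: "nat \<Rightarrow> 'g character \<Rightarrow> nat \<Rightarrow> 'g character \<Rightarrow> nat \<Rightarrow> real" where
  "gn m1 \<pi>1 m2 \<pi>2 q = enn2real (gain C m1 \<pi>1 m2 \<pi>2 q)"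

lemma ennreal_gn: "ennreal (gn m1 \<pi>1 m2 \<pi>2 q) = gain C m1 \<pi>1 m2 \<pi>2 q"
  using gain_le_1[of m1 \<pi>1 m2 \<pi>2 q] ennreal_one_less_top by (simp add: gn_def le_less_trans)

lemma gn_nonneg: "gn m1 \<pi>1 m2 \<pi>2 q \<ge> 0" by (simp add: gn_def)

text \<open>Cauchy-Schwarz separates a contraction between two vertices into the contraction norms
  of each; this is how conditions on single orders control mixed moments.\<close>

lemma gn_square_le: "(gn m1 \<pi>1 m2 \<pi>2 q)\<^sup>2 \<le> DD m1 q \<pi>1 * DD m2 q \<pi>2"
proof -
  let ?a = "\<lambda>\<mu>. (cpow C q \<mu>)\<^sup>2 * (cpow C (m1 - q) (\<pi>1 - \<mu>))\<^sup>2"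
  let ?b = "\<lambda>\<mu>. (cpow C q \<mu>)\<^sup>2 * (cpow C (m2 - q) (\<pi>2 + \<mu>))\<^sup>2"
  let ?w = "\<lambda>\<mu>. (cpow C q \<mu>)\<^sup>2 * cpow C (m1 - q) (\<pi>1 - \<mu>) * cpow C (m2 - q) (\<pi>2 + \<mu>)"
  have "(nsum (\<lambda>\<mu>. 1 * ?w \<mu>))\<^sup>2 \<le> nsum (\<lambda>\<mu>. 1 * ?a \<mu>) * nsum (\<lambda>\<mu>. 1 * ?b \<mu>)"
    by (rule nsum_square_le) (simp add: power2_eq_square mult_ac)
  moreover have "nsum ?b = nsum (\<lambda>\<mu>. (cpow C q \<mu>)\<^sup>2 * (cpow C (m2 - q) (\<pi>2 - \<mu>))\<^sup>2)"
    using nsum_minus_shift[of ?b 0] cpow_uminus[of C q] by (simp add: C_uminus)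
  ultimately have "(ennreal (gn m1 \<pi>1 m2 \<pi>2 q))\<^sup>2 \<le> ennreal (DD m1 q \<pi>1) * ennreal (DD m2 q \<pi>2)"
    by (simp add: ennreal_gn ennreal_DD gain_def)
  then have "ennreal ((gn m1 \<pi>1 m2 \<pi>2 q)\<^sup>2) \<le> ennreal (DD m1 q \<pi>1 * DD m2 q \<pi>2)"
    by (simp only: ennreal_power[OF gn_nonneg] ennreal_mult[OF DD_nonneg DD_nonneg])
  then show ?thesis by (simp add: DD_nonneg)
qed

lemma gn_full:
  "gn m1 \<pi>1 m2 \<pi>2 m1 = (cc m1 \<pi>1)\<^sup>2 * cc (m2 - m1) (\<pi>2 + \<pi>1)"
proof -
  have "gain C m1 \<pi>1 m2 \<pi>2 m1 = nsum (\<lambda>\<mu>. if \<mu> = \<pi>1 then (cpow C m1 \<mu>)\<^sup>2 * cpow C (m2 - m1) (\<pi>2 + \<mu>) else 0)"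
    unfolding gain_def by (rule nn_integral_cong) auto
  also have "\<dots> = (cpow C m1 \<pi>1)\<^sup>2 * cpow C (m2 - m1) (\<pi>2 + \<pi>1)" by (rule nsum_delta)
  also have "\<dots> = ennreal ((cc m1 \<pi>1)\<^sup>2 * cc (m2 - m1) (\<pi>2 + \<pi>1))"
    by (simp add: ennreal_cc[symmetric] ennreal_power ennreal_mult cc_nonneg)
  finally show ?thesis by (simp add: gn_def cc_nonneg)
qed

text \<open>Condition (c) for a sequence in the character type. For order 1 it is vacuous, which
  admits the coefficients of the field itself.\<close>

definition contracts :: "nat \<Rightarrow> (nat \<Rightarrow> 'g character) \<Rightarrow> bool" where
  "contracts m \<tau> \<longleftrightarrow> (\<forall>q. 1 \<le> q \<longrightarrow> q < m \<longrightarrow> (\<lambda>l. DD m q (\<tau> l) / (cc m (\<tau> l))\<^sup>2) \<longlonglongrightarrow> 0)"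

lemma contracts_uminus: "contracts m \<tau> \<Longrightarrow> contracts m (\<lambda>l. - \<tau> l)"
  by (simp add: contracts_def DD_uminus cc_uminus)

lemma square_tendsto_zero:
  fixes r x :: "nat \<Rightarrow> real"
  assumes "\<And>l. (r l)\<^sup>2 \<le> x l" "x \<longlonglongrightarrow> 0"
  shows "r \<longlonglongrightarrow> 0"
proof -
  have "(\<lambda>l. (r l)\<^sup>2) \<longlonglongrightarrow> 0"
    by (rule tendsto_sandwich[OF _ _ tendsto_const assms(2)]) (auto intro!: always_eventually assms(1))
  then have "(\<lambda>l. sqrt ((r l)\<^sup>2)) \<longlonglongrightarrow> sqrt 0" by (rule tendsto_real_sqrt)
  then show ?thesis by (simp add: tendsto_rabs_zero_iff)
qed

text \<open>A bundle exhausting the smaller vertex leaves a single summand of the contraction norm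
  of the larger one, namely at \<open>- \<tau>1 l\<close>. The case \<open>m1 = 1\<close> decouples
  the coefficients from the field.\<close>

lemma gain_ratio_full:
  assumes m: "1 \<le> m1" "m1 < m2" and c: "contracts m2 \<tau>2"
  shows "(\<lambda>l. gn m1 (\<tau>1 l) m2 (\<tau>2 l) m1 / (cc m1 (\<tau>1 l) * cc m2 (\<tau>2 l))) \<longlonglongrightarrow> 0"
proof (rule square_tendsto_zero)
  show "(\<lambda>l. DD m2 m1 (\<tau>2 l) / (cc m2 (\<tau>2 l))\<^sup>2) \<longlonglongrightarrow> 0" using c m by (simp add: contracts_def)
  fix l
  have p: "cc m1 (\<tau>1 l) > 0" "cc m2 (\<tau>2 l) > 0" using m by (auto intro!: cc_pos)
  have "gn m1 (\<tau>1 l) m2 (\<tau>2 l) m1 / (cc m1 (\<tau>1 l) * cc m2 (\<tau>2 l)) = cc m1 (- \<tau>1 l) * cc (m2 - m1) (\<tau>2 l - - \<tau>1 l) / cc m2 (\<tau>2 l)"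
    using p by (simp add: gn_full cc_uminus power2_eq_square field_simps)
  then show "(gn m1 (\<tau>1 l) m2 (\<tau>2 l) m1 / (cc m1 (\<tau>1 l) * cc m2 (\<tau>2 l)))\<^sup>2 \<le> DD m2 m1 (\<tau>2 l) / (cc m2 (\<tau>2 l))\<^sup>2"
    using DD_ge[of m1 "- \<tau>1 l" m2 "\<tau>2 l"] by (simp add: power_divide divide_right_mono)
qed

lemma gain_ratio:
  assumes c: "contracts m1 \<tau>1" "contracts m2 \<tau>2" and q: "1 \<le> q" "q \<le> m1" "q \<le> m2" "\<not> (m1 = m2 \<and> q = m2)"
  shows "(\<lambda>l. gn m1 (\<tau>1 l) m2 (\<tau>2 l) q / (cc m1 (\<tau>1 l) * cc m2 (\<tau>2 l))) \<longlonglongrightarrow> 0"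
proof -
  consider "q < m1" "q < m2" | "q = m1" "m1 < m2" | "q = m2" "m2 < m1" using q by linarith
  then show ?thesis
  proof cases
    case 1
    show ?thesis
    proof (rule square_tendsto_zero)
      show "(\<lambda>l. DD m1 q (\<tau>1 l) / (cc m1 (\<tau>1 l))\<^sup>2 * (DD m2 q (\<tau>2 l) / (cc m2 (\<tau>2 l))\<^sup>2)) \<longlonglongrightarrow> 0"
        using c 1 q(1) unfolding contracts_def by (intro tendsto_mult_zero) auto
      show "(gn m1 (\<tau>1 l) m2 (\<tau>2 l) q / (cc m1 (\<tau>1 l) * cc m2 (\<tau>2 l)))\<^sup>2 \<le> DD m1 q (\<tau>1 l) / (cc m1 (\<tau>1 l))\<^sup>2 * (DD m2 q (\<tau>2 l) / (cc m2 (\<tau>2 l))\<^sup>2)" for l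
        using divide_right_mono[OF gn_square_le, of "(cc m1 (\<tau>1 l) * cc m2 (\<tau>2 l))\<^sup>2" m1 "\<tau>1 l" m2 "\<tau>2 l" q]
        by (simp add: power_divide power_mult_distrib)
    qed
  next
    case 2
    then show ?thesis using gain_ratio_full[OF _ _ c(2)] q by simp
  next
    case 3
    then show ?thesis using gain_ratio_full[OF _ _ c(1), of m2 \<tau>2] q
      by (simp add: gn_def gain_sym[of m1 _ m2] mult.commute)
  qed
qed

end

section \<open>Asymptotic Gaussian moments\<close>

text \<open>Abstracts the letters of which mixed moments are words: \<open>\<delta>\<close> records
  which two letters can be matched completely, and it has to be right only for large
  \<open>l\<close>.\<close>

locale vertex_system = gaussian_field H M T
  for H :: "'g::{topological_ab_group_add, t2_space, second_countable_topology} measure" and M :: "'w measure" and T +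
  fixes N :: "'v \<Rightarrow> nat" and P :: "'v \<Rightarrow> nat \<Rightarrow> 'g character" and \<delta> :: "'v \<Rightarrow> 'v \<Rightarrow> bool"
  assumes N_pos: "\<And>v. N v > 0"
    and P_contracts: "\<And>v. contracts (N v) (P v)"
    and delta: "\<And>u v. eventually (\<lambda>l. (N u = N v \<and> P u l + P v l = 0) = \<delta> u v) sequentially"
begin

abbreviation B :: "'v \<Rightarrow> nat \<Rightarrow> 'w \<Rightarrow> complex" where "B v l \<equiv> Bn (N v) (P v l)"

text \<open>After normalisation the complete bundles of \<open>wick_decomp\<close> become moments of
  the word with two letters removed, and the remainder is bounded by quotients covered by
  \<open>gain_ratio\<close>.\<close>

lemma word_moment:
  fixes \<omega> :: "nat \<Rightarrow> 'v"
  assumes d: "distinct (v # vs)"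
  shows "(\<lambda>l. (LINT w|M. (\<Prod>i\<in>set (v # vs). B (\<omega> i) l w)) -
    (\<Sum>i\<in>set vs. if \<delta> (\<omega> v) (\<omega> i) then LINT w|M. (\<Prod>j\<in>set vs - {i}. B (\<omega> j) l w) else 0)) \<longlonglongrightarrow> 0"
proof -
  define n where "n i = N (\<omega> i)" for i
  define \<pi> where "\<pi> l i = P (\<omega> i) l" for l i
  define z where "z l i = fact (n i) * cc (n i) (\<pi> l i)" for l i
  have n0: "n i > 0" for i by (simp add: n_def N_pos)
  have zp: "z l i > 0" for l i by (simp add: z_def cc_pos n0)
  define Z where "Z l I = (\<Prod>i\<in>I. sqrt (z l i))" for l I
  have Zp: "Z l I > 0" for l I unfolding Z_def by (intro prod_pos) (simp add: zp)
  have moment: "(LINT w|M. (\<Prod>i\<in>set us. B (\<omega> i) l w)) = complex_of_real (enn2real (wick C us n (\<pi> l)) / Z l (set us))" if "distinct us" for us l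
    using moment_Bn[OF that, of n "\<pi> l"] by (simp add: n_def \<pi>_def Z_def z_def)
  obtain K where K: "K < top" and dec: "\<And>\<pi>. \<exists>R. wick C (v # vs) n \<pi> =
      (\<Sum>i\<in>set vs. if n i = n v \<and> \<pi> v + \<pi> i = 0 then fact (n v) * cpow C (n v) (\<pi> v) * wick C (remove1 i vs) n \<pi> else 0) + R \<and>
      R\<^sup>2 \<le> K * (\<Sum>(i, q)\<in>partial_pairings v vs n. gain C (n v) (\<pi> v) (n i) (\<pi> i) q * (\<Prod>j\<in>set vs - {i}. cpow C (n j) (\<pi> j)))"
    using wick_decomp[of C v vs n, OF C_uminus d n0] by blast
  define ratio where "ratio l = (\<Sum>(i, q)\<in>partial_pairings v vs n. gn (n v) (\<pi> l v) (n i) (\<pi> l i) q / (cc (n v) (\<pi> l v) * cc (n i) (\<pi> l i)))" for l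
  have "(\<lambda>l. ratio l) \<longlonglongrightarrow> (\<Sum>(i, q)\<in>partial_pairings v vs n. 0)"
    unfolding ratio_def case_prod_beta
  proof (rule tendsto_sum)
    fix s assume "s \<in> partial_pairings v vs n"
    then have "1 \<le> snd s \<and> snd s \<le> n v \<and> snd s \<le> n (fst s) \<and> \<not> (n v = n (fst s) \<and> snd s = n (fst s))"
      by (auto simp: partial_pairings_def)
    then show "(\<lambda>l. gn (n v) (\<pi> l v) (n (fst s)) (\<pi> l (fst s)) (snd s) / (cc (n v) (\<pi> l v) * cc (n (fst s)) (\<pi> l (fst s)))) \<longlonglongrightarrow> 0"
      unfolding n_def \<pi>_def by (intro gain_ratio P_contracts) auto
  qed
  then have ratio0: "ratio \<longlonglongrightarrow> 0" by simp
  have fin_w: "wick C us n (\<pi> l) < top" if "distinct us" for us l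
    by (rule wick_finite) (use that nsum_C in \<open>auto simp: C_uminus\<close>)
  \<comment> \<open>The exact condition on orders and charges is kept here; only at the end is it
    replaced by its eventual value \<open>\<delta>\<close>.\<close>
  define err where "err l = enn2real (wick C (v # vs) n (\<pi> l)) / Z l (set (v # vs)) -
     (\<Sum>i\<in>set vs. if n i = n v \<and> \<pi> l v + \<pi> l i = 0 then enn2real (wick C (remove1 i vs) n (\<pi> l)) / Z l (set vs - {i}) else 0)" for l
  have err_le: "(err l)\<^sup>2 \<le> enn2real K * ratio l" for l
  proof -
    let ?p = "\<pi> l"
    let ?m = "\<lambda>i. if n i = n v \<and> ?p v + ?p i = 0 then fact (n v) * cpow C (n v) (?p v) * wick C (remove1 i vs) n ?p else 0"
    let ?mr = "\<lambda>i. if n i = n v \<and> ?p v + ?p i = 0 then fact (n v) * cc (n v) (?p v) * enn2real (wick C (remove1 i vs) n ?p) else 0"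
    obtain R where R1: "wick C (v # vs) n ?p = (\<Sum>i\<in>set vs. ?m i) + R"
      and R2: "R\<^sup>2 \<le> K * (\<Sum>(i, q)\<in>partial_pairings v vs n. gain C (n v) (?p v) (n i) (?p i) q * (\<Prod>j\<in>set vs - {i}. cpow C (n j) (?p j)))"
      using dec[of ?p] by blast
    have "wick C (v # vs) n ?p < top" by (rule fin_w[OF d])
    then have fin: "(\<Sum>i\<in>set vs. ?m i) < top" "R < top" unfolding R1 by auto
    have "?m i < top" if "i \<in> set vs" for i
      using fin(1) that by (simp add: less_top)
    then have "enn2real (\<Sum>i\<in>set vs. ?m i) = (\<Sum>i\<in>set vs. enn2real (?m i))" by (rule enn2real_sum_finite)
    also have "\<dots> = (\<Sum>i\<in>set vs. ?mr i)"
      by (intro sum.cong refl) (simp add: enn2real_mult cc_def flip: ennreal_fact)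
    finally have Wr: "enn2real (wick C (v # vs) n ?p) = (\<Sum>i\<in>set vs. ?mr i) + enn2real R"
      unfolding R1 using fin by (simp add: enn2real_plus)
    let ?Z = "Z l (set (v # vs))"
    have Zins: "?Z = sqrt (z l v) * Z l (set vs)" using d by (simp add: Z_def)
    have Zrem: "Z l (set vs) = sqrt (z l i) * Z l (set vs - {i})" if "i \<in> set vs" for i
      using that by (simp add: Z_def prod.remove)
    have "?mr i / ?Z = (if n i = n v \<and> ?p v + ?p i = 0 then enn2real (wick C (remove1 i vs) n ?p) / Z l (set vs - {i}) else 0)" if "i \<in> set vs" for i
    proof (cases "n i = n v \<and> ?p v + ?p i = 0")
      case True
      then have "?p i = - ?p v" by (simp add: eq_neg_iff_add_eq_0 add.commute)
      then have "z l i = z l v" using True by (simp add: z_def cc_uminus)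
      then have "?Z = z l v * Z l (set vs - {i})"
        unfolding Zins Zrem[OF that] using zp[of l v] by (simp add: mult.assoc[symmetric] real_sqrt_mult_self)
      moreover have "cc (n v) (?p v) > 0" by (rule cc_pos) (rule n0)
      ultimately show ?thesis using True by (simp add: z_def)
    next
      case False
      show ?thesis unfolding if_not_P[OF False] by simp
    qed
    then have "(\<Sum>i\<in>set vs. ?mr i) / ?Z = (\<Sum>i\<in>set vs. if n i = n v \<and> ?p v + ?p i = 0 then enn2real (wick C (remove1 i vs) n ?p) / Z l (set vs - {i}) else 0)"
      unfolding sum_divide_distrib by (rule sum.cong[OF refl])
    then have err: "err l = enn2real R / ?Z" unfolding err_def Wr by (simp add: add_divide_distrib)
    have "(enn2real R)\<^sup>2 \<le> enn2real K * (\<Sum>(i, q)\<in>partial_pairings v vs n. gn (n v) (?p v) (n i) (?p i) q * (\<Prod>j\<in>set vs - {i}. cc (n j) (?p j)))"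
    proof -
      let ?X = "\<Sum>(i, q)\<in>partial_pairings v vs n. gn (n v) (?p v) (n i) (?p i) q * (\<Prod>j\<in>set vs - {i}. cc (n j) (?p j))"
      have X0: "?X \<ge> 0" by (intro sum_nonneg) (auto intro!: mult_nonneg_nonneg prod_nonneg gn_nonneg cc_nonneg)
      have "(\<Sum>(i, q)\<in>partial_pairings v vs n. gain C (n v) (?p v) (n i) (?p i) q * (\<Prod>j\<in>set vs - {i}. cpow C (n j) (?p j))) = ennreal ?X"
        by (subst sum_ennreal[symmetric])
          (auto simp: ennreal_gn[symmetric] ennreal_cc[symmetric] prod_ennreal cc_nonneg ennreal_mult gn_nonneg prod_nonneg intro!: sum.cong mult_nonneg_nonneg)
      then have "ennreal ((enn2real R)\<^sup>2) \<le> ennreal (enn2real K * ?X)"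
        using R2 fin(2) K X0 by (simp add: ennreal_power[symmetric] ennreal_mult)
      moreover have "0 \<le> enn2real K * ?X" using X0 by simp
      ultimately show ?thesis using ennreal_le_iff by blast
    qed
    also have "(\<Sum>(i, q)\<in>partial_pairings v vs n. gn (n v) (?p v) (n i) (?p i) q * (\<Prod>j\<in>set vs - {i}. cc (n j) (?p j))) \<le> ratio l * ?Z\<^sup>2"
      unfolding ratio_def sum_distrib_right case_prod_beta
    proof (rule sum_mono)
      fix s assume "s \<in> partial_pairings v vs n"
      then have i: "fst s \<in> set vs" by (auto simp: partial_pairings_def)
      let ?i = "fst s"
      have sq: "?Z\<^sup>2 = z l v * (z l ?i * (\<Prod>j\<in>set vs - {?i}. z l j))"
      proof -
        have "?Z\<^sup>2 = z l v * (z l ?i * (Z l (set vs - {?i}))\<^sup>2)"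
          unfolding Zins Zrem[OF i] using zp[of l v] zp[of l ?i] by (simp add: power_mult_distrib less_imp_le)
        also have "(Z l (set vs - {?i}))\<^sup>2 = (\<Prod>j\<in>set vs - {?i}. z l j)"
          unfolding Z_def prod_power_distrib by (intro prod.cong refl) (simp add: zp less_imp_le)
        finally show ?thesis .
      qed
      \<comment> \<open>The normalisation contains the factorial as an extra factor of at least 1,
        so replacing \<open>cc\<close> by \<open>z\<close> enlarges the bound.\<close>
      have f1: "cc (n j) (?p j) \<le> z l j" for j
        using mult_right_mono[of 1 "fact (n j)" "cc (n j) (?p j)"] by (simp add: z_def cc_nonneg fact_ge_1)
      have "cc (n v) (?p v) * (cc (n ?i) (?p ?i) * (\<Prod>j\<in>set vs - {?i}. cc (n j) (?p j))) \<le> ?Z\<^sup>2"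
        unfolding sq by (intro mult_mono f1 prod_mono) (auto intro!: mult_nonneg_nonneg prod_nonneg cc_nonneg f1 less_imp_le[OF zp])
      then have "gn (n v) (?p v) (n ?i) (?p ?i) (snd s) / (cc (n v) (?p v) * cc (n ?i) (?p ?i)) *
          (cc (n v) (?p v) * (cc (n ?i) (?p ?i) * (\<Prod>j\<in>set vs - {?i}. cc (n j) (?p j))))
        \<le> gn (n v) (?p v) (n ?i) (?p ?i) (snd s) / (cc (n v) (?p v) * cc (n ?i) (?p ?i)) * ?Z\<^sup>2"
        by (rule mult_left_mono) (simp add: gn_nonneg cc_nonneg)
      moreover have "cc (n v) (?p v) > 0" "cc (n ?i) (?p ?i) > 0" using n0 by (auto intro: cc_pos)
      ultimately show "gn (n v) (?p v) (n ?i) (?p ?i) (snd s) * (\<Prod>j\<in>set vs - {?i}. cc (n j) (?p j))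
        \<le> gn (n v) (?p v) (n ?i) (?p ?i) (snd s) / (cc (n v) (?p v) * cc (n ?i) (?p ?i)) * ?Z\<^sup>2" by simp
    qed
    finally have "(enn2real R)\<^sup>2 \<le> enn2real K * (ratio l * ?Z\<^sup>2)" by (simp add: mult_left_mono)
    then show ?thesis unfolding err power_divide using Zp[of l "set (v # vs)"] by (simp add: pos_divide_le_eq mult.assoc)
  qed
  have "err \<longlonglongrightarrow> 0"
    by (rule square_tendsto_zero[OF err_le]) (use tendsto_mult_right_zero[OF ratio0] in simp)
  then have "(\<lambda>l. complex_of_real (err l)) \<longlonglongrightarrow> 0" using tendsto_of_real[of err 0] by simp
  moreover have "eventually (\<lambda>l. complex_of_real (err l) = (LINT w|M. (\<Prod>i\<in>set (v # vs). B (\<omega> i) l w)) -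
    (\<Sum>i\<in>set vs. if \<delta> (\<omega> v) (\<omega> i) then LINT w|M. (\<Prod>j\<in>set vs - {i}. B (\<omega> j) l w) else 0)) sequentially"
  proof -
    have "eventually (\<lambda>l. \<forall>i\<in>set vs. (n v = n i \<and> \<pi> l v + \<pi> l i = 0) = \<delta> (\<omega> v) (\<omega> i)) sequentially"
      using delta by (simp add: eventually_ball_finite n_def \<pi>_def)
    then show ?thesis
    proof eventually_elim
      case (elim l)
      have "(if n i = n v \<and> \<pi> l v + \<pi> l i = 0 then complex_of_real (enn2real (wick C (remove1 i vs) n (\<pi> l)) / Z l (set vs - {i})) else 0) =
        (if \<delta> (\<omega> v) (\<omega> i) then LINT w|M. (\<Prod>j\<in>set vs - {i}. B (\<omega> j) l w) else 0)" if "i \<in> set vs" for i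
      proof -
        have di: "distinct (remove1 i vs)" and si: "set (remove1 i vs) = set vs - {i}" using d by simp_all
        have "(n i = n v \<and> \<pi> l v + \<pi> l i = 0) = \<delta> (\<omega> v) (\<omega> i)"
          using bspec[OF elim that] by (simp only: eq_commute[of "n v" "n i"])
        then show ?thesis by (simp only: moment[OF di, unfolded si])
      qed
      then have E1: "(\<Sum>i\<in>set vs. if n i = n v \<and> \<pi> l v + \<pi> l i = 0 then complex_of_real (enn2real (wick C (remove1 i vs) n (\<pi> l)) / Z l (set vs - {i})) else 0) =
        (\<Sum>i\<in>set vs. if \<delta> (\<omega> v) (\<omega> i) then LINT w|M. (\<Prod>j\<in>set vs - {i}. B (\<omega> j) l w) else 0)"
        by (rule sum.cong[OF refl])
      have E2: "complex_of_real (\<Sum>i\<in>set vs. if n i = n v \<and> \<pi> l v + \<pi> l i = 0 then enn2real (wick C (remove1 i vs) n (\<pi> l)) / Z l (set vs - {i}) else 0)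
        = (\<Sum>i\<in>set vs. if n i = n v \<and> \<pi> l v + \<pi> l i = 0 then complex_of_real (enn2real (wick C (remove1 i vs) n (\<pi> l)) / Z l (set vs - {i})) else 0)"
        unfolding of_real_sum by (rule sum.cong[OF refl]) (simp only: if_distrib[of complex_of_real] of_real_0)
      show ?case unfolding err_def of_real_diff moment[OF d] E2 E1 ..
    qed
  qed
  ultimately show ?thesis by (rule Lim_transform_eventually)
qed

text \<open>Expand the power into words of length \<open>k\<close>. In the sum over partners of the
  additional letter \<open>u\<close>, one letter is consumed and the remaining sum over words
  factorises into the power \<open>k - 1\<close>.\<close>

lemma linear_moment_step:
  assumes fin: "finite Vs"
  shows "(\<lambda>l. (LINT w|M. B u l w * (\<Sum>v\<in>Vs. c v * B v l w) ^ k) -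
    of_nat k * (\<Sum>v\<in>Vs. c v * of_bool (\<delta> u v)) * (LINT w|M. (\<Sum>v\<in>Vs. c v * B v l w) ^ (k - 1))) \<longlonglongrightarrow> 0"
proof -
  let ?J = "{1..k}" and ?vs = "[1..<Suc k]"
  have vs: "set ?vs = ?J" by auto
  have d: "distinct (0 # ?vs)" by auto
  have am: "all_moments M (\<lambda>w. \<Prod>i\<in>I. B (\<omega> i) l w)" for I and \<omega> :: "nat \<Rightarrow> 'v" and l
    by (intro M.all_moments_prod Bn_am)
  \<comment> \<open>Position 0 carries \<open>u\<close>, positions 1 to \<open>k\<close> the
    word.\<close>
  let ?w = "\<lambda>\<omega>. fun_upd \<omega> 0 u"
  have upd: "(\<Prod>i\<in>I. B ((?w \<omega>) i) l w) = (\<Prod>i\<in>I. B (\<omega> i) l w)" if "0 \<notin> I" for I \<omega> l w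
    using that by (intro prod.cong) (auto simp: fun_upd_def)
  let ?E = "\<lambda>\<omega> l. (LINT w|M. B u l w * (\<Prod>i\<in>?J. B (\<omega> i) l w))"
  let ?F = "\<lambda>\<omega> l. (\<Sum>i\<in>?J. if \<delta> u (\<omega> i) then LINT w|M. (\<Prod>j\<in>?J - {i}. B (\<omega> j) l w) else 0)"
  have word: "(\<lambda>l. ?E \<omega> l - ?F \<omega> l) \<longlonglongrightarrow> 0" for \<omega>
  proof -
    have z: "0 \<notin> ?J" and z': "0 \<notin> ?J - {i}" for i by auto
    have 1: "(\<Prod>i\<in>set (0 # ?vs). B ((?w \<omega>) i) l w) = B u l w * (\<Prod>i\<in>?J. B (\<omega> i) l w)" for l w
    proof -
      have "(\<Prod>i\<in>set (0 # ?vs). B ((?w \<omega>) i) l w) = B ((?w \<omega>) 0) l w * (\<Prod>i\<in>?J. B ((?w \<omega>) i) l w)"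
        unfolding set_simps(2) vs by (rule prod.insert[OF _ z]) simp
      then show ?thesis unfolding upd[OF z] fun_upd_same .
    qed
    have 2: "(\<Sum>i\<in>set ?vs. if \<delta> ((?w \<omega>) 0) ((?w \<omega>) i) then LINT w|M. (\<Prod>j\<in>set ?vs - {i}. B ((?w \<omega>) j) l w) else 0) = ?F \<omega> l" for l
      unfolding vs
    proof (rule sum.cong[OF refl])
      fix i assume "i \<in> ?J"
      then have "(?w \<omega>) i = \<omega> i" by auto
      then show "(if \<delta> ((?w \<omega>) 0) ((?w \<omega>) i) then LINT w|M. (\<Prod>j\<in>?J - {i}. B ((?w \<omega>) j) l w) else 0)
        = (if \<delta> u (\<omega> i) then LINT w|M. (\<Prod>j\<in>?J - {i}. B (\<omega> j) l w) else 0)"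
        unfolding upd[OF z'] by (simp only: fun_upd_same)
    qed
    show ?thesis using word_moment[OF d, of "?w \<omega>"] unfolding 1 2 .
  qed
  let ?O = "PiE ?J (\<lambda>_. Vs)"
  let ?X = "\<lambda>l w. \<Sum>v\<in>Vs. c v * B v l w"
  let ?c = "\<lambda>\<omega>. \<Prod>i\<in>?J. c (\<omega> i)"
  have finO: "finite ?O" using fin by (intro finite_PiE) auto
  have expand: "(\<Prod>i\<in>?J. \<Sum>v\<in>Vs. c v * f i v) = (\<Sum>\<omega>\<in>?O. ?c \<omega> * (\<Prod>i\<in>?J. f i (\<omega> i)))" for f :: "nat \<Rightarrow> 'v \<Rightarrow> complex"
    using fin by (subst prod_sum_PiE) (auto simp: prod.distrib)
  have lhs: "(LINT w|M. B u l w * ?X l w ^ k) = (\<Sum>\<omega>\<in>?O. ?c \<omega> * ?E \<omega> l)" for l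
  proof -
    have "?X l w ^ k = (\<Sum>\<omega>\<in>?O. ?c \<omega> * (\<Prod>i\<in>?J. B (\<omega> i) l w))" for w
      using expand[of "\<lambda>_ v. B v l w"] by simp
    then have "(LINT w|M. B u l w * ?X l w ^ k) = (LINT w|M. (\<Sum>\<omega>\<in>?O. ?c \<omega> * (B u l w * (\<Prod>i\<in>?J. B (\<omega> i) l w))))"
      by (simp add: sum_distrib_left mult_ac)
    also have "\<dots> = (\<Sum>\<omega>\<in>?O. ?c \<omega> * ?E \<omega> l)"
      by (subst Bochner_Integration.integral_sum)
        (auto intro!: integrable_mult_right all_moments_integrable all_moments_mult M.all_moments_const Bn_am am)
    finally show ?thesis .
  qed
  have rhs: "(\<Sum>\<omega>\<in>?O. ?c \<omega> * ?F \<omega> l) = of_nat k * (\<Sum>v\<in>Vs. c v * of_bool (\<delta> u v)) * (LINT w|M. ?X l w ^ (k - 1))" for l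
  proof -
    \<comment> \<open>The factor at the consumed position is replaced by its matching indicator, so
      that the sum over words is again a product of sums.\<close>
    let ?f = "\<lambda>i w j v. if j = i then of_bool (\<delta> u v) else B v l w"
    have f: "(\<Prod>j\<in>?J. ?f i w j (\<omega> j)) = of_bool (\<delta> u (\<omega> i)) * (\<Prod>j\<in>?J - {i}. B (\<omega> j) l w)" if "i \<in> ?J" for i w \<omega>
      using that by (subst prod.remove[of _ i]) (auto intro!: prod.cong)
    have X: "(\<Prod>j\<in>?J. \<Sum>v\<in>Vs. c v * ?f i w j v) = (\<Sum>v\<in>Vs. c v * of_bool (\<delta> u v)) * ?X l w ^ (k - 1)" if "i \<in> ?J" for i w
    proof -
      have "(\<Prod>j\<in>?J - {i}. \<Sum>v\<in>Vs. c v * ?f i w j v) = (\<Prod>j\<in>?J - {i}. ?X l w)"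
        by (intro prod.cong refl sum.cong) auto
      then show ?thesis using that by (subst prod.remove[of _ i]) auto
    qed
    have "(\<Sum>\<omega>\<in>?O. ?c \<omega> * ?F \<omega> l) = (\<Sum>i\<in>?J. \<Sum>\<omega>\<in>?O. ?c \<omega> * (LINT w|M. (\<Prod>j\<in>?J. ?f i w j (\<omega> j))))"
    proof -
      have "?c \<omega> * ?F \<omega> l = (\<Sum>i\<in>?J. ?c \<omega> * (LINT w|M. (\<Prod>j\<in>?J. ?f i w j (\<omega> j))))" for \<omega>
        unfolding sum_distrib_left
      proof (intro sum.cong refl arg_cong2[where f="(*)"])
        fix i assume "i \<in> ?J"
        then show "(if \<delta> u (\<omega> i) then LINT w|M. (\<Prod>j\<in>?J - {i}. B (\<omega> j) l w) else 0) = (LINT w|M. (\<Prod>j\<in>?J. ?f i w j (\<omega> j)))"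
          unfolding f[OF \<open>i \<in> ?J\<close>] by simp
      qed
      then show ?thesis by (simp only:) (rule sum.swap)
    qed
    also have "\<dots> = (\<Sum>i\<in>?J. LINT w|M. (\<Sum>v\<in>Vs. c v * of_bool (\<delta> u v)) * ?X l w ^ (k - 1))"
    proof (rule sum.cong[OF refl])
      fix i assume i: "i \<in> ?J"
      have "integrable M (\<lambda>w. \<Prod>j\<in>?J. ?f i w j (\<omega> j))" for \<omega>
        unfolding f[OF i] by (intro integrable_mult_right all_moments_integrable am)
      then have "(\<Sum>\<omega>\<in>?O. ?c \<omega> * (LINT w|M. (\<Prod>j\<in>?J. ?f i w j (\<omega> j)))) = (LINT w|M. (\<Sum>\<omega>\<in>?O. ?c \<omega> * (\<Prod>j\<in>?J. ?f i w j (\<omega> j))))"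
        by (subst Bochner_Integration.integral_sum) auto
      also have "\<dots> = (LINT w|M. (\<Sum>v\<in>Vs. c v * of_bool (\<delta> u v)) * ?X l w ^ (k - 1))"
        by (intro Bochner_Integration.integral_cong refl trans[OF expand[of "?f i w" for w, symmetric] X[OF i]])
      finally show "(\<Sum>\<omega>\<in>?O. ?c \<omega> * (LINT w|M. (\<Prod>j\<in>?J. ?f i w j (\<omega> j)))) = (LINT w|M. (\<Sum>v\<in>Vs. c v * of_bool (\<delta> u v)) * ?X l w ^ (k - 1))" .
    qed
    finally show ?thesis by simp
  qed
  have "(\<lambda>l. \<Sum>\<omega>\<in>?O. ?c \<omega> * (?E \<omega> l - ?F \<omega> l)) \<longlonglongrightarrow> (\<Sum>\<omega>\<in>?O. ?c \<omega> * 0)"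
    by (intro tendsto_sum tendsto_mult tendsto_const word)
  then show ?thesis by (simp only: right_diff_distrib sum_subtractf lhs rhs) simp
qed

text \<open>Weighting the step by \<open>c u\<close> and summing gives asymptotically the recursion
  of \<open>normal_mom_Suc_Suc\<close>. The form defining \<open>s\<close> is bilinear without
  conjugation, because limiting covariance 1 belongs to dual vertices.\<close>

lemma linear_moments:
  assumes fin: "finite Vs" and s: "(\<Sum>u\<in>Vs. \<Sum>v\<in>Vs. c u * c v * of_bool (\<delta> u v)) = complex_of_real (s\<^sup>2)"
  shows "(\<lambda>l. LINT w|M. (\<Sum>v\<in>Vs. c v * B v l w) ^ k) \<longlonglongrightarrow> complex_of_real (normal_mom k * s ^ k)"
proof -
  let ?X = "\<lambda>l w. \<Sum>v\<in>Vs. c v * B v l w"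
  have amX: "all_moments M (?X l)" for l by (intro M.all_moments_sum all_moments_mult M.all_moments_const Bn_am)
  have step: "(\<lambda>l. (LINT w|M. ?X l w ^ Suc k) - of_nat k * complex_of_real (s\<^sup>2) * (LINT w|M. ?X l w ^ (k - 1))) \<longlonglongrightarrow> 0" for k
  proof -
    have "(\<lambda>l. \<Sum>u\<in>Vs. c u * ((LINT w|M. B u l w * ?X l w ^ k) - of_nat k * (\<Sum>v\<in>Vs. c v * of_bool (\<delta> u v)) * (LINT w|M. ?X l w ^ (k - 1)))) \<longlonglongrightarrow> (\<Sum>u\<in>Vs. c u * 0)"
      by (intro tendsto_sum tendsto_mult tendsto_const linear_moment_step fin)
    moreover have "(\<Sum>u\<in>Vs. c u * ((LINT w|M. B u l w * ?X l w ^ k) - of_nat k * (\<Sum>v\<in>Vs. c v * of_bool (\<delta> u v)) * (LINT w|M. ?X l w ^ (k - 1)))) =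
      (LINT w|M. ?X l w ^ Suc k) - of_nat k * complex_of_real (s\<^sup>2) * (LINT w|M. ?X l w ^ (k - 1))" for l
    proof -
      have "(LINT w|M. ?X l w ^ Suc k) = (LINT w|M. (\<Sum>u\<in>Vs. c u * (B u l w * ?X l w ^ k)))"
        by (simp add: sum_distrib_right mult.assoc)
      also have "\<dots> = (\<Sum>u\<in>Vs. c u * (LINT w|M. B u l w * ?X l w ^ k))"
        by (subst Bochner_Integration.integral_sum)
          (auto intro!: integrable_mult_right all_moments_integrable all_moments_mult Bn_am M.all_moments_power M.all_moments_const amX)
      finally have 1: "(LINT w|M. ?X l w ^ Suc k) = (\<Sum>u\<in>Vs. c u * (LINT w|M. B u l w * ?X l w ^ k))" .
      have 2: "(\<Sum>u\<in>Vs. c u * (of_nat k * (\<Sum>v\<in>Vs. c v * of_bool (\<delta> u v)) * y)) = of_nat k * complex_of_real (s\<^sup>2) * y" for y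
        unfolding s[symmetric] sum_distrib_left sum_distrib_right by (simp add: mult_ac)
      show ?thesis unfolding right_diff_distrib sum_subtractf 1 2 ..
    qed
    ultimately show ?thesis by simp
  qed
  show ?thesis
  proof (induction k rule: less_induct)
    case (less k)
    show ?case
    proof (cases k)
      case 0
      then show ?thesis by (simp add: normal_mom_0 M.prob_space scaleR_conv_of_real)
    next
      case (Suc j)
      show ?thesis
      proof (cases j)
        case 0
        then show ?thesis using step[of 0] Suc by (simp add: normal_mom_1)
      next
        case (Suc i)
        have "(\<lambda>l. LINT w|M. ?X l w ^ i) \<longlonglongrightarrow> complex_of_real (normal_mom i * s ^ i)"
          using less[of i] Suc \<open>k = Suc j\<close> by simp
        then have L: "(\<lambda>l. ((LINT w|M. ?X l w ^ Suc j) - of_nat j * complex_of_real (s\<^sup>2) * (LINT w|M. ?X l w ^ (j - 1)))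
            + of_nat j * complex_of_real (s\<^sup>2) * (LINT w|M. ?X l w ^ i)) \<longlonglongrightarrow> 0 + of_nat j * complex_of_real (s\<^sup>2) * complex_of_real (normal_mom i * s ^ i)"
          by (intro tendsto_add step tendsto_mult tendsto_const)
        have E: "of_nat j * complex_of_real (s\<^sup>2) * complex_of_real (normal_mom i * s ^ i) = complex_of_real (normal_mom k * s ^ k)"
          using Suc \<open>k = Suc j\<close> by (simp add: normal_mom_Suc_Suc power2_eq_square algebra_simps)
        show ?thesis using L unfolding E by (simp add: Suc \<open>k = Suc j\<close> del: power_Suc)
      qed
    qed
  qed
qed

lemma linear_characteristic_function:
  assumes fin: "finite Vs" and s: "(\<Sum>u\<in>Vs. \<Sum>v\<in>Vs. c u * c v * of_bool (\<delta> u v)) = complex_of_real (s\<^sup>2)"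
    and X: "\<And>l w. complex_of_real (X l w) = (\<Sum>v\<in>Vs. c v * B v l w)"
  shows "(\<lambda>l. LINT w|M. exp (\<i> * complex_of_real (X l w))) \<longlonglongrightarrow> complex_of_real (exp (- (s\<^sup>2) / 2))"
proof (rule characteristic_function_from_moments[OF M.prob_space_axioms])
  fix l
  have "all_moments M (\<lambda>w. complex_of_real (X l w))"
    unfolding X by (intro M.all_moments_sum all_moments_mult M.all_moments_const Bn_am)
  then have "(\<lambda>w. Re (complex_of_real (X l w))) \<in> borel_measurable M \<and> (\<forall>k. integrable M (\<lambda>w. norm (complex_of_real (X l w)) ^ k))"
    unfolding all_moments_def by (intro conjI measurable_compose[OF _ borel_measurable_Re]) auto
  then show "all_moments M (X l)" by (simp add: all_moments_def)
next
  fix k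
  have "(\<lambda>l. LINT w|M. complex_of_real (X l w) ^ k) \<longlonglongrightarrow> complex_of_real (normal_mom k * s ^ k)"
    unfolding X by (rule linear_moments[OF fin s])
  then have "(\<lambda>l. complex_of_real (LINT w|M. X l w ^ k)) \<longlonglongrightarrow> complex_of_real (normal_mom k * s ^ k)"
    by (simp flip: of_real_power)
  then show "(\<lambda>l. LINT w|M. X l w ^ k) \<longlonglongrightarrow> normal_mom k * s ^ k" by (simp only: tendsto_of_real_iff)
qed

end

section \<open>Conditions (c) and (d), and symmetric truncation of the spectrum\<close>

lemma iexp_diff_le: "norm (exp (\<i> * complex_of_real a) - exp (\<i> * complex_of_real b)) \<le> \<bar>a - b\<bar>"
proof -
  have "exp (\<i> * complex_of_real a) - exp (\<i> * complex_of_real b) = exp (\<i> * complex_of_real b) * (exp (\<i> * complex_of_real (a - b)) - 1)"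
    by (simp add: right_diff_distrib of_real_diff flip: exp_add)
  moreover have "norm (exp (\<i> * complex_of_real (a - b)) - 1) \<le> \<bar>a - b\<bar>"
    using iexp_approx1[of "a - b" 0] by simp
  ultimately show ?thesis by (simp add: norm_mult)
qed

lemma (in prob_space) iexp_expectation_diff:
  fixes X Y :: "'a \<Rightarrow> real"
  assumes "integrable M X" "integrable M Y"
  shows "norm (expectation (\<lambda>w. exp (\<i> * complex_of_real (X w))) - expectation (\<lambda>w. exp (\<i> * complex_of_real (Y w)))) \<le> expectation (\<lambda>w. \<bar>X w - Y w\<bar>)"
proof -
  have [measurable]: "X \<in> borel_measurable M" "Y \<in> borel_measurable M" using assms by auto
  have int: "integrable M (\<lambda>w. exp (\<i> * complex_of_real (X w)))" "integrable M (\<lambda>w. exp (\<i> * complex_of_real (Y w)))"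
    by (rule integrable_iexp; simp)+
  have "norm (expectation (\<lambda>w. exp (\<i> * complex_of_real (X w)) - exp (\<i> * complex_of_real (Y w)))) \<le> expectation (\<lambda>w. norm (exp (\<i> * complex_of_real (X w)) - exp (\<i> * complex_of_real (Y w))))"
    by (rule integral_norm_bound)
  also have "\<dots> \<le> expectation (\<lambda>w. \<bar>X w - Y w\<bar>)"
    by (intro integral_mono integrable_norm integrable_abs Bochner_Integration.integrable_diff int assms iexp_diff_le)
  finally show ?thesis using int by simp
qed

context gaussian_field begin

lemma cc_le_1: "cc m a \<le> 1"
  using cpow_le_1[of m a] by (simp add: ennreal_cc[symmetric])

lemma infsum_conv_sq:
  "infsum (\<lambda>la. (spec_conv M H T la q)\<^sup>2 * (spec_conv M H T (char_div (chr \<tau>) la) (m - q))\<^sup>2) dual = DD m q \<tau>"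
proof -
  let ?f = "\<lambda>la. (spec_conv M H T la q)\<^sup>2 * (spec_conv M H T (char_div (chr \<tau>) la) (m - q))\<^sup>2"
  have "nsum (\<lambda>a. ennreal (?f (chr a))) = ennreal (DD m q \<tau>)"
    unfolding ennreal_DD ennreal_cc_sq by (simp add: spec_conv_eq char_div_eq power_mult_distrib)
  then show ?thesis using infsum_dual[of ?f] by (simp add: DD_nonneg)
qed

lemma nsum_cc_mult: "q \<le> m \<Longrightarrow> nsum (\<lambda>a. ennreal (cc q a * cc (m - q) (\<tau> - a))) = ennreal (cc m \<tau>)"
  using cpow_add[of C q "m - q" \<tau>] by (simp add: ennreal_mult cc_nonneg ennreal_cc)

lemma infsum_conv:
  assumes "q \<le> m"
  shows "infsum (\<lambda>\<mu>. spec_conv M H T \<mu> q * spec_conv M H T (char_div (chr \<tau>) \<mu>) (m - q)) dual = cc m \<tau>"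
proof -
  let ?f = "\<lambda>\<mu>. spec_conv M H T \<mu> q * spec_conv M H T (char_div (chr \<tau>) \<mu>) (m - q)"
  have "nsum (\<lambda>a. ennreal (?f (chr a))) = ennreal (cc m \<tau>)"
    using nsum_cc_mult[OF assms] by (simp add: spec_conv_eq char_div_eq)
  then show ?thesis using infsum_dual[of ?f] by (simp add: spec_conv_eq char_div_eq cc_nonneg)
qed

lemma cond_c_iff: "cond_c M H T m (\<lambda>l. chr (\<tau> l)) \<longleftrightarrow> contracts m \<tau>"
proof -
  have "x powi (- 2) * y = y / x\<^sup>2" for x y :: real by (simp add: power_int_minus divide_inverse)
  moreover have "q \<in> {1..m - 1} \<longleftrightarrow> 1 \<le> q \<and> q < m" for q by auto
  ultimately show ?thesis by (simp only: cond_c_def contracts_def infsum_conv_sq spec_conv_eq Ball_def imp_conjL)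
qed

text \<open>The numerator in (d); by \<open>infsum_conv\<close> the denominator is
  \<open>cc m \<tau>\<close> for every \<open>q\<close>.\<close>

definition peak :: "nat \<Rightarrow> nat \<Rightarrow> 'g character \<Rightarrow> real" where
  "peak m q \<tau> = (SUP a. cc q a * cc (m - q) (\<tau> - a))"

lemma peak_upper: "cc q a * cc (m - q) (\<tau> - a) \<le> peak m q \<tau>"
  unfolding peak_def
proof (rule cSUP_upper)
  have "cc q a * cc (m - q) (\<tau> - a) \<le> 1 * 1" for a by (intro mult_mono cc_le_1 cc_nonneg) simp
  then show "bdd_above (range (\<lambda>a. cc q a * cc (m - q) (\<tau> - a)))" by (intro bdd_aboveI[of _ 1]) auto
qed simp

lemma peak_nonneg: "peak m q \<tau> \<ge> 0"
  using order_trans[OF mult_nonneg_nonneg[OF cc_nonneg cc_nonneg] peak_upper] .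

lemma peak_square_le: "(peak m q \<tau>)\<^sup>2 \<le> DD m q \<tau>"
proof -
  have "peak m q \<tau> \<le> sqrt (DD m q \<tau>)"
    unfolding peak_def by (rule cSUP_least) (auto intro: real_le_rsqrt DD_ge)
  then show ?thesis using power_mono[OF _ peak_nonneg, of m q \<tau> _ 2] by (fastforce simp: DD_nonneg)
qed

text \<open>Bound one of the two equal factors by the supremum and sum the other.\<close>

lemma DD_le_peak:
  assumes "q \<le> m"
  shows "DD m q \<tau> \<le> peak m q \<tau> * cc m \<tau>"
proof -
  have "ennreal (DD m q \<tau>) \<le> nsum (\<lambda>a. ennreal (peak m q \<tau>) * ennreal (cc q a * cc (m - q) (\<tau> - a)))"
    unfolding ennreal_DD ennreal_cc_sq
  proof (rule nn_integral_mono)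
    fix a
    show "ennreal ((cc q a * cc (m - q) (\<tau> - a))\<^sup>2) \<le> ennreal (peak m q \<tau>) * ennreal (cc q a * cc (m - q) (\<tau> - a))"
      by (subst ennreal_mult[symmetric])
        (auto intro!: ennreal_leI mult_right_mono peak_upper mult_nonneg_nonneg cc_nonneg peak_nonneg simp: power2_eq_square)
  qed
  also have "\<dots> = ennreal (peak m q \<tau> * cc m \<tau>)"
    using nsum_cmult[of "ennreal (peak m q \<tau>)" "\<lambda>a. ennreal (cc q a * cc (m - q) (\<tau> - a))"]
    by (simp only: nsum_cc_mult[OF assms] ennreal_mult[OF peak_nonneg cc_nonneg])
  finally show ?thesis using ennreal_le_iff[OF mult_nonneg_nonneg[OF peak_nonneg cc_nonneg]] by blast
qed

text \<open>Each quotient in (d) lies between the corresponding quotient in (c) and its square root;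
  the maximum over the finitely many \<open>q\<close> is bounded by the sum of the roots.\<close>

lemma cond_d_iff:
  assumes m: "m \<ge> 2"
  shows "cond_d M H T m (\<lambda>l. chr (\<tau> l)) \<longleftrightarrow> contracts m \<tau>"
proof -
  let ?r = "\<lambda>q l. peak m q (\<tau> l) / cc m (\<tau> l)"
  let ?D = "\<lambda>q l. DD m q (\<tau> l) / (cc m (\<tau> l))\<^sup>2"
  let ?Q = "{1..m - 1}"
  have Q: "finite ?Q" "?Q \<noteq> {}" and Qm: "q \<in> ?Q \<longleftrightarrow> 1 \<le> q \<and> q < m" for q using m by auto
  have cp: "cc m a > 0" for a using m by (intro cc_pos) simp
  have sup: "(SUP la\<in>dual. spec_conv M H T la q * spec_conv M H T (char_div (chr a) la) (m - q)) = peak m q a" for q a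
    unfolding chr_image[symmetric] image_image peak_def by (simp add: spec_conv_eq char_div_eq)
  have "cond_d M H T m (\<lambda>l. chr (\<tau> l)) \<longleftrightarrow> (\<lambda>l. Max ((\<lambda>q. ?r q l) ` ?Q)) \<longlonglongrightarrow> 0"
  proof -
    have "(\<lambda>q. (SUP la\<in>dual. spec_conv M H T la q * spec_conv M H T (char_div (chr (\<tau> l)) la) (m - q))
                  / infsum (\<lambda>\<mu>. spec_conv M H T \<mu> q * spec_conv M H T (char_div (chr (\<tau> l)) \<mu>) (m - q)) dual) ` ?Q = (\<lambda>q. ?r q l) ` ?Q" for l
      by (intro image_cong refl) (subst sup, subst infsum_conv, auto)
    then show ?thesis by (simp only: cond_d_def)
  qed
  also have "\<dots> \<longleftrightarrow> contracts m \<tau>"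
  proof
    assume lim: "(\<lambda>l. Max ((\<lambda>q. ?r q l) ` ?Q)) \<longlonglongrightarrow> 0"
    show "contracts m \<tau>"
      unfolding contracts_def
    proof (intro allI impI)
      fix q assume q: "1 \<le> q" "q < m"
      have "?D q l \<le> Max ((\<lambda>q. ?r q l) ` ?Q)" for l
      proof -
        have "?D q l \<le> peak m q (\<tau> l) * cc m (\<tau> l) / (cc m (\<tau> l))\<^sup>2"
          using q by (intro divide_right_mono DD_le_peak) auto
        also have "\<dots> = ?r q l" using cp[of "\<tau> l"] by (simp add: power2_eq_square)
        also have "\<dots> \<le> Max ((\<lambda>q. ?r q l) ` ?Q)" using q by (intro Max_ge) auto
        finally show ?thesis .
      qed
      then show "?D q \<longlonglongrightarrow> 0"
        by (intro tendsto_sandwich[OF _ _ tendsto_const lim]) (auto intro!: always_eventually simp: DD_nonneg)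
    qed
  next
    assume c: "contracts m \<tau>"
    have "(\<lambda>l. \<Sum>q\<in>?Q. sqrt (?D q l)) \<longlonglongrightarrow> (\<Sum>q\<in>?Q. sqrt 0)"
    proof (intro tendsto_sum tendsto_real_sqrt)
      fix q assume "q \<in> ?Q"
      then have "1 \<le> q" "q < m" using Qm by auto
      then show "?D q \<longlonglongrightarrow> 0" using c unfolding contracts_def by blast
    qed
    then have lim: "(\<lambda>l. \<Sum>q\<in>?Q. sqrt (?D q l)) \<longlonglongrightarrow> 0" by simp
    have rD: "?r q l \<le> sqrt (?D q l)" for q l
      using peak_square_le[of m q "\<tau> l"] by (intro real_le_rsqrt) (simp add: power_divide divide_right_mono)
    have "Max ((\<lambda>q. ?r q l) ` ?Q) \<le> (\<Sum>q\<in>?Q. sqrt (?D q l))" for l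
    proof (rule Max.boundedI)
      fix a assume "a \<in> (\<lambda>q. ?r q l) ` ?Q"
      then obtain q where q: "q \<in> ?Q" "a = ?r q l" by blast
      have "sqrt (?D q l) \<le> (\<Sum>q\<in>?Q. sqrt (?D q l))"
        using q(1) by (intro member_le_sum) (auto simp: DD_nonneg)
      then show "a \<le> (\<Sum>q\<in>?Q. sqrt (?D q l))" using rD[of q l] q(2) by linarith
    qed (use Q in auto)
    moreover have "0 \<le> Max ((\<lambda>q. ?r q l) ` ?Q)" for l
    proof -
      have "0 \<le> ?r 1 l" by (simp add: peak_nonneg cc_nonneg)
      also have "\<dots> \<le> Max ((\<lambda>q. ?r q l) ` ?Q)" using m by (intro Max_ge) auto
      finally show ?thesis .
    qed
    ultimately show "(\<lambda>l. Max ((\<lambda>q. ?r q l) ` ?Q)) \<longlonglongrightarrow> 0"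
      by (intro tendsto_sandwich[OF _ _ tendsto_const lim] always_eventually allI)
  qed
  finally show ?thesis .
qed

text \<open>At the trivial character the quotient is one fixed positive number, so a sequence along
  which it tends to 0 must leave that character.\<close>

lemma contracts_nonzero:
  assumes m: "m \<ge> 2" and c: "contracts m \<tau>"
  shows "eventually (\<lambda>l. \<tau> l \<noteq> 0) sequentially"
proof -
  have "0 < (cc 1 0 * cc (m - 1) (0 - 0))\<^sup>2" using m by (intro zero_less_power mult_pos_pos cc_pos) auto
  also have "\<dots> \<le> DD m 1 0" by (rule DD_ge)
  finally have "DD m 1 0 / (cc m 0)\<^sup>2 > 0" using cc_pos[of m 0] m by simp
  moreover have "(\<lambda>l. DD m 1 (\<tau> l) / (cc m (\<tau> l))\<^sup>2) \<longlonglongrightarrow> 0" using c m by (simp add: contracts_def)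
  ultimately have "eventually (\<lambda>l. DD m 1 (\<tau> l) / (cc m (\<tau> l))\<^sup>2 < DD m 1 0 / (cc m 0)\<^sup>2) sequentially"
    by (intro order_tendstoD(2)) auto
  then show ?thesis by eventually_elim auto
qed

text \<open>Adding negatives only enlarges the partial sum, and the full sum is 1. Symmetry makes
  the truncated field real.\<close>

lemma symmetric_truncation:
  assumes e: "e > 0"
  shows "\<exists>F. finite F \<and> uminus ` F = F \<and> 1 - sum S F < e"
proof (rule ccontr)
  assume neg: "\<not> (\<exists>F. finite F \<and> uminus ` F = F \<and> 1 - sum S F < e)"
  have n: "sum S F \<le> 1 - e" if "finite F" "uminus ` F = F" for F
  proof (rule ccontr)
    assume "\<not> sum S F \<le> 1 - e"
    then have "1 - sum S F < e" by linarith
    then show False using neg that by blast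
  qed
  have "sum S F \<le> 1 - e" if "finite F" for F
  proof -
    have "sum S F \<le> sum S (F \<union> uminus ` F)" using that by (intro sum_mono2 S_nonneg) auto
    also have "\<dots> \<le> 1 - e" using that by (intro n) (auto simp: image_Un image_image)
    finally show ?thesis .
  qed
  then have "nsum (\<lambda>a. ennreal (S a)) \<le> ennreal (1 - e)" by (intro nsum_eq_infsum(1) S_nonneg)
  then have "ennreal 1 \<le> ennreal (1 - e)" using nsum_C by (simp add: C_def)
  then show False using e by (simp add: ennreal_le_iff2)
qed

end

section \<open>Characteristic functions of the field together with the coefficients\<close>

locale contracting_coefficients = gaussian_field H M T
  for H :: "'g::{topological_ab_group_add, t2_space, second_countable_topology} measure" and M :: "'w measure" and T +
  fixes p :: nat and ms :: "nat \<Rightarrow> nat" and \<tau> :: "nat \<Rightarrow> 'g character"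
  assumes conn: "connected (UNIV :: 'g set)" and p_pos: "p > 0"
    and ms_ge: "\<And>j. j < p \<Longrightarrow> ms j \<ge> 2" and ms_inj: "inj_on ms {..<p}"
    and ms_contracts: "\<And>j. j < p \<Longrightarrow> contracts (ms j) \<tau>"
begin

text \<open>Labels from \<open>p\<close> on fall back to 0, because \<open>vertex_system\<close>
  makes demands on every element of the label type.\<close>

definition idx :: "nat \<Rightarrow> nat" where "idx j = (if j < p then j else 0)"

lemma idx_less: "idx j < p" and idx_eq: "j < p \<Longrightarrow> idx j = j" by (auto simp: idx_def p_pos)

lemma ms_idx: "ms (idx j) = ms (idx i) \<longleftrightarrow> idx j = idx i"
  using ms_inj idx_less by (auto simp: inj_on_def)

text \<open>Without 2-torsion a nontrivial character differs from its conjugate, so a coefficient is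
  never matched with itself; this is what makes the limit a circular complex Gaussian.\<close>

lemma \<tau>_double: "eventually (\<lambda>l. \<tau> l + \<tau> l \<noteq> 0) sequentially"
proof -
  have z: "a = 0" if "a + a = 0" for a :: "'g character"
    using torsion_free[OF conn, of 2 a] that by (simp add: lessThan_Suc numeral_2_eq_2)
  show ?thesis
    by (rule eventually_mono[OF contracts_nonzero[OF ms_ge[OF p_pos] ms_contracts[OF p_pos]]]) (use z in blast)
qed

text \<open>\<open>Inl (j, b)\<close> stands for the j-th coefficient if \<open>b\<close> holds and
  for its conjugate otherwise, \<open>Inr a\<close> for the coefficient of the field at
  \<open>a\<close>.\<close>

definition vertex_order :: "nat \<times> bool + 'g character \<Rightarrow> nat" where
  "vertex_order v = (case v of Inl (j, b) \<Rightarrow> ms (idx j) | Inr a \<Rightarrow> 1)"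

definition vertex_char :: "nat \<times> bool + 'g character \<Rightarrow> nat \<Rightarrow> 'g character" where
  "vertex_char v l = (case v of Inl (j, b) \<Rightarrow> if b then \<tau> l else - \<tau> l | Inr a \<Rightarrow> a)"

definition dual_vertices :: "nat \<times> bool + 'g character \<Rightarrow> nat \<times> bool + 'g character \<Rightarrow> bool" where
  "dual_vertices u v = (case (u, v) of (Inl (i, b), Inl (j, c)) \<Rightarrow> idx i = idx j \<and> b \<noteq> c
     | (Inr a, Inr d) \<Rightarrow> a + d = 0 | _ \<Rightarrow> False)"

sublocale vs: vertex_system H M T vertex_order vertex_char dual_vertices
proof
  have ms1: "ms (idx j) \<noteq> Suc 0" "0 < ms (idx j)" for j using ms_ge[OF idx_less, of j] by auto
  show "vertex_order v > 0" for v using ms1 by (auto simp: vertex_order_def split: sum.splits)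
  show "contracts (vertex_order v) (vertex_char v)" for v
  proof (cases v)
    case (Inl s)
    obtain j b where s: "s = (j, b)" by (cases s)
    have "vertex_char v = (if b then \<tau> else (\<lambda>l. - \<tau> l))" by (auto simp: vertex_char_def Inl s)
    then show ?thesis using ms_contracts[OF idx_less, of j] contracts_uminus[of "ms (idx j)" \<tau>]
      by (cases b) (simp_all add: vertex_order_def Inl s)
  next
    case (Inr a)
    then show ?thesis by (simp add: vertex_order_def contracts_def)
  qed
  have neg: "- x - x = 0 \<longleftrightarrow> x + x = 0" for x :: "'g character"
  proof -
    have "- x - x = - (x + x)" by (simp only: minus_add_distrib diff_conv_add_uminus)
    then show ?thesis by (simp only: neg_equal_0_iff_equal)
  qed
  have mixed: "eventually (\<lambda>l. (vertex_order u = vertex_order v \<and> vertex_char u l + vertex_char v l = 0) = dual_vertices u v) sequentially"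
    if "u = Inl s" "v = Inl t" for u v s t
    using \<tau>_double
  proof eventually_elim
    case (elim l)
    obtain i b j c where st: "s = (i, b)" "t = (j, c)" by (cases s, cases t)
    show ?case using elim neg[of "\<tau> l"]
      by (cases b; cases c) (auto simp: that st vertex_order_def vertex_char_def dual_vertices_def ms_idx)
  qed
  show "eventually (\<lambda>l. (vertex_order u = vertex_order v \<and> vertex_char u l + vertex_char v l = 0) = dual_vertices u v) sequentially" for u v
  proof (cases u)
    case u: (Inl s)
    show ?thesis
    proof (cases v)
      case (Inl t)
      then show ?thesis using mixed[OF u] by simp
    next
      case (Inr a)
      then show ?thesis using ms1 u by (auto simp: vertex_order_def dual_vertices_def split: prod.split)
    qed
  next
    case u: (Inr a)
    show ?thesis
    proof (cases v)
      case (Inl t)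
      then show ?thesis using ms1 ms1(1)[THEN not_sym] u by (auto simp: vertex_order_def dual_vertices_def split: prod.split)
    next
      case (Inr b)
      then show ?thesis using u by (simp add: vertex_order_def vertex_char_def dual_vertices_def)
    qed
  qed
qed

definition Q :: "(nat \<Rightarrow> real) \<Rightarrow> (nat \<Rightarrow> real) \<Rightarrow> nat \<Rightarrow> 'w \<Rightarrow> real" where
  "Q x y l w = (\<Sum>j<p. x j * Re (Bn (ms j) (\<tau> l) w) + y j * Im (Bn (ms j) (\<tau> l) w))"

lemma cc_1: "cc (Suc 0) a = S a"
  using cpow_1[of C a] S_nonneg[of a] by (simp add: cc_def C_def)

text \<open>Symmetry of \<open>F\<close> and of \<open>s\<close> makes the Fourier sum real;
  together with \<open>Q\<close> it is a linear form in the letters, and its limiting variance is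
  the bilinear form of dual pairs.\<close>

lemma truncated_characteristic_function:
  assumes F: "finite F" "uminus ` F = F" and s: "\<And>a. s (- a) = cnj (s a)"
  shows "(\<lambda>l. LINT w|M. exp (\<i> * complex_of_real (Re (\<Sum>a\<in>F. s a * A 1 a w) + Q x y l w))) \<longlonglongrightarrow>
    complex_of_real (exp (- (\<Sum>a\<in>F. (norm (s a))\<^sup>2 * S a) / 2) * exp (- (\<Sum>j<p. (x j)\<^sup>2 + (y j)\<^sup>2) / 4))"
proof -
  let ?J = "{..<p} \<times> (UNIV :: bool set)"
  let ?Vs = "?J <+> F"
  \<comment> \<open>x Re z + y Im z is half of (x - i y) z plus its conjugate.\<close>
  define e where "e j b = (if b then Complex (x j / 2) (- y j / 2) else Complex (x j / 2) (y j / 2))" for j b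
  define c where "c v = (case v of Inl (j, b) \<Rightarrow> e j b | Inr a \<Rightarrow> s a * complex_of_real (sqrt (S a)))" for v
  have cs: "c (Inl (j, b)) = e j b" "c (Inr a) = s a * complex_of_real (sqrt (S a))" for j b a by (simp_all add: c_def)
  \<comment> \<open>Each complex coefficient has components of variance 1/2, hence the factor 1/2 in
    the second sum.\<close>
  define v where "v = (\<Sum>a\<in>F. (norm (s a))\<^sup>2 * S a) + (\<Sum>j<p. (x j)\<^sup>2 + (y j)\<^sup>2) / 2"
  have v0: "v \<ge> 0" unfolding v_def by (intro add_nonneg_nonneg divide_nonneg_pos sum_nonneg mult_nonneg_nonneg S_nonneg) auto
  have fin: "finite ?J" "finite ?Vs" using F by auto
  have split: "(\<Sum>u\<in>?Vs. f u) = (\<Sum>j<p. f (Inl (j, True)) + f (Inl (j, False))) + (\<Sum>a\<in>F. f (Inr a))" for f :: "_ \<Rightarrow> complex"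
  proof -
    have "(\<Sum>u\<in>?J. f (Inl u)) = (\<Sum>j<p. \<Sum>b\<in>UNIV. f (Inl (j, b)))" by (simp add: sum.cartesian_product)
    then show ?thesis using sum.Plus[OF fin(1) F(1), of f] by (simp add: o_def UNIV_bool add.commute)
  qed
  have inF: "- a \<in> F" if "a \<in> F" for a using that F(2) by blast
  have neg_iff: "a + b = 0 \<longleftrightarrow> b = - a" for a b :: "'g character" by (auto simp: eq_neg_iff_add_eq_0 add.commute)
  have inner_Inr: "(\<Sum>u\<in>?Vs. c u * of_bool (dual_vertices (Inr a) u)) = c (Inr (- a))" if "a \<in> F" for a
    unfolding split by (simp add: dual_vertices_def neg_iff of_bool_def F(1) inF[OF that] if_distrib[of "\<lambda>z. _ * z"] sum.delta cong: if_cong)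
  have inner_Inl: "(\<Sum>u\<in>?Vs. c u * of_bool (dual_vertices (Inl (j, b)) u)) = e j (\<not> b)" if "j < p" for j b
  proof -
    have "(\<Sum>i<p. c (Inl (i, True)) * of_bool (dual_vertices (Inl (j, b)) (Inl (i, True))) + c (Inl (i, False)) * of_bool (dual_vertices (Inl (j, b)) (Inl (i, False))))
      = (\<Sum>i<p. if i = j then e i (\<not> b) else 0)"
      by (rule sum.cong[OF refl]) (use that in \<open>auto simp: dual_vertices_def idx_eq cs\<close>)
    also have "\<dots> = e j (\<not> b)" using that by simp
    finally show ?thesis unfolding split by (simp add: dual_vertices_def)
  qed
  have "(\<Sum>u\<in>?Vs. \<Sum>t\<in>?Vs. c u * c t * of_bool (dual_vertices u t)) = (\<Sum>u\<in>?Vs. c u * (\<Sum>t\<in>?Vs. c t * of_bool (dual_vertices u t)))"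
    by (simp add: sum_distrib_left mult.assoc)
  also have "\<dots> = (\<Sum>j<p. e j True * e j False + e j False * e j True) + (\<Sum>a\<in>F. c (Inr a) * c (Inr (- a)))"
    unfolding split[of "\<lambda>u. c u * (\<Sum>t\<in>?Vs. c t * of_bool (dual_vertices u t))"]
    by (intro arg_cong2[where f="(+)"] sum.cong refl) (simp_all only: inner_Inr inner_Inl lessThan_iff cs simp_thms)
  also have "(\<Sum>j<p. e j True * e j False + e j False * e j True) = complex_of_real ((\<Sum>j<p. (x j)\<^sup>2 + (y j)\<^sup>2) / 2)"
    unfolding of_real_sum sum_divide_distrib
    by (intro sum.cong refl) (simp add: e_def complex_eq_iff power2_eq_square field_simps)
  also have "(\<Sum>a\<in>F. c (Inr a) * c (Inr (- a))) = complex_of_real (\<Sum>a\<in>F. (norm (s a))\<^sup>2 * S a)"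
    unfolding of_real_sum
  proof (rule sum.cong[OF refl])
    fix a
    have q: "complex_of_real (sqrt (S a)) * complex_of_real (sqrt (S a)) = complex_of_real (S a)"
      by (simp only: of_real_mult[symmetric] real_sqrt_mult_self abs_of_nonneg[OF S_nonneg])
    have "c (Inr a) * c (Inr (- a)) = (s a * cnj (s a)) * (complex_of_real (sqrt (S a)) * complex_of_real (sqrt (S a)))"
      by (simp add: cs s S_uminus)
    then show "c (Inr a) * c (Inr (- a)) = complex_of_real ((norm (s a))\<^sup>2 * S a)"
      unfolding q by (simp only: of_real_mult complex_norm_square)
  qed
  finally have var: "(\<Sum>u\<in>?Vs. \<Sum>t\<in>?Vs. c u * c t * of_bool (dual_vertices u t)) = complex_of_real ((sqrt v)\<^sup>2)"
    using v0 by (simp add: v_def)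
  have X: "complex_of_real (Re (\<Sum>a\<in>F. s a * A 1 a w) + Q x y l w) = (\<Sum>u\<in>?Vs. c u * Bn (vertex_order u) (vertex_char u l) w)" for l w
  proof -
    have "cnj (\<Sum>a\<in>F. s a * A 1 a w) = (\<Sum>a\<in>F. s (- a) * A 1 (- a) w)" by (simp add: s A_cnj)
    also have "\<dots> = (\<Sum>a\<in>uminus ` F. s a * A 1 a w)" by (simp add: sum.reindex inj_on_def)
    finally have "complex_of_real (Re (\<Sum>a\<in>F. s a * A 1 a w)) = (\<Sum>a\<in>F. s a * A 1 a w)"
      unfolding F(2) by (rule of_real_Re[OF iffD2[OF Reals_cnj_iff]])
    moreover have "s a * A 1 a w = c (Inr a) * Bn (vertex_order (Inr a)) (vertex_char (Inr a) l) w" for a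
      using S_pos[of a] by (simp add: cs Bn_def vertex_order_def vertex_char_def cc_1)
    moreover have "complex_of_real (x j * Re (Bn (ms j) (\<tau> l) w) + y j * Im (Bn (ms j) (\<tau> l) w)) =
      c (Inl (j, True)) * Bn (vertex_order (Inl (j, True))) (vertex_char (Inl (j, True)) l) w +
      c (Inl (j, False)) * Bn (vertex_order (Inl (j, False))) (vertex_char (Inl (j, False)) l) w" if "j < p" for j
      using that by (simp add: cs e_def vertex_order_def vertex_char_def idx_eq complex_eq_iff flip: Bn_cnj)
    ultimately show ?thesis unfolding split of_real_add Q_def of_real_sum by (simp only: add.commute) (auto intro!: sum.cong)
  qed
  have "complex_of_real (exp (- ((sqrt v)\<^sup>2) / 2)) = complex_of_real (exp (- (\<Sum>a\<in>F. (norm (s a))\<^sup>2 * S a) / 2) * exp (- (\<Sum>j<p. (x j)\<^sup>2 + (y j)\<^sup>2) / 4))"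
    using v0 by (simp add: v_def add_divide_distrib diff_divide_distrib flip: exp_add)
  then show ?thesis using vs.linear_characteristic_function[OF fin(2) var X] by simp
qed

end

section \<open>The limit law and removal of the truncation\<close>

lemma all_moments_Re_Im:
  assumes "all_moments M X"
  shows "all_moments M (\<lambda>w. Re (X w))" "all_moments M (\<lambda>w. Im (X w))"
proof -
  have [measurable]: "X \<in> borel_measurable M" using assms by (rule all_moments_measurable)
  have int: "integrable M (\<lambda>w. norm (X w) ^ k)" for k using assms by (simp add: all_moments_def)
  have "integrable M (\<lambda>w. norm (Re (X w)) ^ k)" "integrable M (\<lambda>w. norm (Im (X w)) ^ k)" for k
    by (rule Bochner_Integration.integrable_bound[OF int[of k]];
      auto intro!: AE_I2 power_mono simp: abs_Re_le_cmod abs_Im_le_cmod)+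
  then show "all_moments M (\<lambda>w. Re (X w))" "all_moments M (\<lambda>w. Im (X w))" by (auto simp: all_moments_def)
qed

lemma integral_pair_product:
  fixes f :: "'x \<Rightarrow> complex" and g :: "'y \<Rightarrow> complex"
  assumes A: "prob_space A" and B: "prob_space B"
    and [measurable]: "f \<in> borel_measurable A" "g \<in> borel_measurable B"
    and bd: "\<And>x. norm (f x) \<le> K" "\<And>y. norm (g y) \<le> L"
  shows "(LINT z|(A \<Otimes>\<^sub>M B). f (fst z) * g (snd z)) = (LINT x|A. f x) * (LINT y|B. g y)"
proof -
  interpret A: prob_space A by (rule A)
  interpret B: prob_space B by (rule B)
  interpret pair_prob_space A B ..
  have KL: "norm (f x * g y) \<le> K * L" for x y
    using mult_mono[OF bd(1)[of x] bd(2)[of y] order_trans[OF norm_ge_zero bd(1)[of x]] norm_ge_zero] by (simp add: norm_mult)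
  have "integrable (A \<Otimes>\<^sub>M B) (\<lambda>z. f (fst z) * g (snd z))"
    by (rule P.integrable_const_bound[of _ "K * L"]) (auto intro!: KL)
  from integral_fst'[OF this] show ?thesis by simp
qed

lemma distr_pair_snd:
  assumes "prob_space A" "prob_space B"
  shows "distr (A \<Otimes>\<^sub>M B) B snd = B"
proof (rule measure_eqI)
  interpret A: prob_space A by (rule assms)
  interpret B: prob_space B by (rule assms)
  fix X assume "X \<in> sets (distr (A \<Otimes>\<^sub>M B) B snd)"
  then have X: "X \<in> sets B" by simp
  then have "snd -` X \<inter> space (A \<Otimes>\<^sub>M B) = space A \<times> X"
    using sets.sets_into_space by (auto simp: space_pair_measure)
  then show "emeasure (distr (A \<Otimes>\<^sub>M B) B snd) X = emeasure B X"
    using X by (simp add: emeasure_distr B.emeasure_pair_measure_Times A.emeasure_space_1)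
qed simp

lemma prob_space_half_normal: "prob_space half_normal"
  unfolding half_normal_def by (rule prob_space_normal_density) simp

lemma sets_half_normal[measurable_cong]: "sets half_normal = sets borel"
  by (simp add: half_normal_def)

lemma half_normal_moments:
  "all_moments half_normal (\<lambda>x. x)" "(LINT x|half_normal. x ^ k) = normal_mom k * sqrt (1 / 2) ^ k"
proof -
  interpret prob_space half_normal by (rule prob_space_half_normal)
  have "distr half_normal lborel (\<lambda>x. x) = half_normal" by (rule distr_id2) (simp add: sets_half_normal)
  then have d: "distributed half_normal lborel (\<lambda>x. x) (normal_density 0 (sqrt (1 / 2)))"
    by (simp add: distributed_def half_normal_def)
  have n: "centered_normal_rv half_normal (\<lambda>x. x)"
    unfolding centered_normal_rv_def using d by (intro conjI disjI1 exI[of _ "sqrt (1 / 2)"]) auto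
  have "expectation (\<lambda>x. x\<^sup>2) = (LINT x|lborel. normal_density 0 (sqrt (1 / 2)) x * (x - 0) ^ (2 * 1))"
    using distributed_integral[OF d, of "\<lambda>x. x\<^sup>2"] by simp
  also have "\<dots> = 1 / 2"
    using integral_normal_moment_even[of "sqrt (1 / 2)" 0 1] by (simp add: numeral_2_eq_2 real_sqrt_pow2)
  finally have e2: "expectation (\<lambda>x. x\<^sup>2) = 1 / 2" .
  show "all_moments half_normal (\<lambda>x. x)" by (rule centered_normal_moments(1)[OF n])
  show "(LINT x|half_normal. x ^ k) = normal_mom k * sqrt (1 / 2) ^ k"
    using centered_normal_moments(2)[OF n, of k] unfolding e2 .
qed

lemma half_normal_second_moment: "integrable half_normal (\<lambda>x. x\<^sup>2)" "(LINT x|half_normal. x\<^sup>2) = 1 / 2"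
  using half_normal_moments(1) half_normal_moments(2)[of 2]
  by (auto simp: all_moments_def normal_mom_def real_sqrt_pow2 dest!: spec[of _ 2])

text \<open>A constant sequence with Gaussian moments is a special case of the moment
  method.\<close>

lemma half_normal_characteristic_function:
  "(LINT x|half_normal. exp (\<i> * complex_of_real (c * x))) = complex_of_real (exp (- (c\<^sup>2) / 4))"
proof -
  interpret prob_space half_normal by (rule prob_space_half_normal)
  have "(\<lambda>_. LINT x|half_normal. exp (\<i> * complex_of_real (c * x))) \<longlonglongrightarrow> complex_of_real (exp (- ((c * sqrt (1 / 2))\<^sup>2) / 2))"
  proof (rule characteristic_function_from_moments[OF prob_space_half_normal])
    show "all_moments half_normal (\<lambda>x. c * x)" by (intro all_moments_mult all_moments_const half_normal_moments)
    show "(\<lambda>_. LINT x|half_normal. (c * x) ^ k) \<longlonglongrightarrow> normal_mom k * (c * sqrt (1 / 2)) ^ k" for k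
      by (simp add: power_mult_distrib half_normal_moments mult.left_commute)
  qed
  then have "(LINT x|half_normal. exp (\<i> * complex_of_real (c * x))) = complex_of_real (exp (- ((c * sqrt (1 / 2))\<^sup>2) / 2))"
    by (simp only: LIMSEQ_const_iff)
  then show ?thesis by (simp add: power_mult_distrib real_sqrt_pow2)
qed

lemma prob_space_PiM_half_normal: "prob_space (PiM I (\<lambda>_. half_normal))"
  by (rule prob_space_PiM) (rule prob_space_half_normal)

lemma distr_half_normal_component:
  "i \<in> I \<Longrightarrow> distr (PiM I (\<lambda>_. half_normal)) half_normal (\<lambda>x. x i) = half_normal"
  using distr_PiM_component[of I "\<lambda>_. half_normal" i] prob_space_half_normal by blast

lemma PiM_half_normal_characteristic_function:
  "(LINT x|(PiM {..<n::nat} (\<lambda>_. half_normal)). exp (\<i> * complex_of_real (\<Sum>j<n. c j * x j))) = complex_of_real (exp (- (\<Sum>j<n. (c j)\<^sup>2) / 4))"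
proof -
  interpret prob_space half_normal by (rule prob_space_half_normal)
  interpret product_sigma_finite "\<lambda>_::nat. half_normal" by standard
  have "(LINT x|(PiM {..<n} (\<lambda>_. half_normal)). exp (\<i> * complex_of_real (\<Sum>j<n. c j * x j)))
    = (LINT x|(PiM {..<n} (\<lambda>_. half_normal)). (\<Prod>j<n. exp (\<i> * complex_of_real (c j * x j))))"
    by (simp add: sum_distrib_left exp_sum)
  also have "\<dots> = (\<Prod>j<n. LINT x|half_normal. exp (\<i> * complex_of_real (c j * x)))"
    by (rule product_integral_prod) (auto intro!: integrable_iexp)
  also have "\<dots> = complex_of_real (exp (\<Sum>j<n. - ((c j)\<^sup>2) / 4))"
    unfolding half_normal_characteristic_function by (simp add: exp_sum)
  finally show ?thesis by (simp add: sum_negf sum_divide_distrib)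
qed

lemma sum_lessThan_add: "(\<Sum>i<k + n. f i) = (\<Sum>i<k. f i) + (\<Sum>j<n. f (k + j))" for f :: "nat \<Rightarrow> 'a::comm_monoid_add"
  by (induction n) (auto simp: add.assoc)

context gaussian_field begin

lemma Bn_square: "n > 0 \<Longrightarrow> (LINT w|M. (norm (Bn n a w))\<^sup>2) = 1"
proof -
  assume n: "n > 0"
  let ?\<pi> = "\<lambda>i::nat. if i = 0 then a else - a"
  have m0: "(LINT w|M. (\<Prod>i\<in>set [0, 1]. Bn n (?\<pi> i) w)) = complex_of_real (enn2real (wick C [0, 1] (\<lambda>_. n) ?\<pi>) / (\<Prod>i\<in>set [0, 1]. sqrt (fact n * cc n (?\<pi> i))))"
    by (rule moment_Bn[where n = "\<lambda>_. n"]) simp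
  have m1: "wick C [0, 1] (\<lambda>_. n) ?\<pi> = ennreal (fact n * cc n a)"
    by (subst wick_pair) (simp_all add: ennreal_mult cc_nonneg ennreal_cc ennreal_fact)
  have m2: "(\<Prod>i\<in>set [0, 1::nat]. Bn n (?\<pi> i) w) = complex_of_real ((norm (Bn n a w))\<^sup>2)" for w
    unfolding complex_norm_square by (simp flip: Bn_cnj)
  have m3: "(\<Prod>i\<in>set [0, 1::nat]. sqrt (fact n * cc n (?\<pi> i))) = fact n * cc n a"
    by (simp add: cc_uminus cc_nonneg)
  have "(LINT w|M. complex_of_real ((norm (Bn n a w))\<^sup>2)) = complex_of_real (enn2real (ennreal (fact n * cc n a)) / (fact n * cc n a))"
    using m0 unfolding m1 m2 m3 .
  then have "(LINT w|M. (norm (Bn n a w))\<^sup>2) = enn2real (ennreal (fact n * cc n a)) / (fact n * cc n a)"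
    by (simp only: integral_complex_of_real of_real_eq_iff)
  then show ?thesis using cc_pos[OF n, of a] by simp
qed

lemma Bn_Re_am: "all_moments M (\<lambda>w. Re (Bn n a w))" and Bn_Im_am: "all_moments M (\<lambda>w. Im (Bn n a w))"
  by (intro all_moments_Re_Im Bn_am)+

lemma square_integrable: "all_moments M X \<Longrightarrow> integrable M (\<lambda>w. (X w)\<^sup>2)" for X :: "'w \<Rightarrow> real"
  by (intro all_moments_integrable M.all_moments_power)

lemma Bn_part_square:
  assumes n: "n > 0"
  shows "(LINT w|M. (Re (Bn n a w))\<^sup>2) \<le> 1" "(LINT w|M. (Im (Bn n a w))\<^sup>2) \<le> 1"
proof -
  have int: "integrable M (\<lambda>w. (norm (Bn n a w))\<^sup>2)" using Bn_am[of n a] by (simp add: all_moments_def)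
  have "(LINT w|M. (Re (Bn n a w))\<^sup>2) \<le> (LINT w|M. (norm (Bn n a w))\<^sup>2)"
    by (intro integral_mono int square_integrable Bn_Re_am) (simp add: cmod_power2)
  moreover have "(LINT w|M. (Im (Bn n a w))\<^sup>2) \<le> (LINT w|M. (norm (Bn n a w))\<^sup>2)"
    by (intro integral_mono int square_integrable Bn_Im_am) (simp add: cmod_power2)
  ultimately show "(LINT w|M. (Re (Bn n a w))\<^sup>2) \<le> 1" "(LINT w|M. (Im (Bn n a w))\<^sup>2) \<le> 1"
    unfolding Bn_square[OF n] by auto
qed

end

context contracting_coefficients begin

lemma Q_am: "all_moments M (\<lambda>w. Q x y l w)"
  unfolding Q_def
  by (intro M.all_moments_sum all_moments_add all_moments_mult M.all_moments_const Bn_Re_am Bn_Im_am)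

text \<open>Truncating the field costs an L1 error that does not depend on \<open>l\<close>, so the
  limit may be taken for the truncation and the truncation removed afterwards.\<close>

lemma characteristic_function_limit:
  "(\<lambda>l. LINT w|M. exp (\<i> * complex_of_real ((\<Sum>i<k. d i * T (gs i) w) + Q x y l w))) \<longlonglongrightarrow>
    (LINT w|M. exp (\<i> * complex_of_real (\<Sum>i<k. d i * T (gs i) w))) * complex_of_real (exp (- (\<Sum>j<p. (x j)\<^sup>2 + (y j)\<^sup>2) / 4))"
proof (rule LIMSEQ_I)
  fix r :: real assume r: "r > 0"
  define D where "D = (\<Sum>i<k. \<bar>d i\<bar>)"
  have D0: "D \<ge> 0" by (simp add: D_def sum_nonneg)
  define s where "s a = (\<Sum>i<k. complex_of_real (d i) * chr a (gs i))" for a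
  have s: "s (- a) = cnj (s a)" for a by (simp add: s_def chr_uminus)
  \<comment> \<open>The linear form in the field is off by at most \<open>D * \<eta>\<close>, which
    stays below r/4.\<close>
  define \<eta> where "\<eta> = r / (4 * (D + 1))"
  have \<eta>: "\<eta> > 0" using r D0 by (simp add: \<eta>_def)
  obtain F where F: "finite F" "uminus ` F = F" and F\<eta>: "1 - sum S F < \<eta>\<^sup>2"
    using symmetric_truncation[of "\<eta>\<^sup>2"] \<eta> by auto
  define G where "G w = (\<Sum>i<k. d i * T (gs i) w)" for w
  define ZF where "ZF w = (\<Sum>a\<in>F. s a * A 1 a w)" for w
  define E where "E i w = complex_of_real (T (gs i) w) - (\<Sum>a\<in>F. chr a (gs i) * A 1 a w)" for i w
  have amG: "all_moments M G" unfolding G_def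
    by (intro M.all_moments_sum all_moments_mult M.all_moments_const T_am)
  have amZ: "all_moments M ZF" unfolding ZF_def
    by (intro M.all_moments_sum all_moments_mult M.all_moments_const A_am)
  have amE: "all_moments M (E i)" for i
  proof -
    have "all_moments M (\<lambda>w. complex_of_real (T (gs i) w) + (\<Sum>a\<in>F. (- chr a (gs i)) * A 1 a w))"
      by (intro all_moments_add T_of_am M.all_moments_sum all_moments_mult M.all_moments_const A_am)
    moreover have "(\<lambda>w. complex_of_real (T (gs i) w) + (\<Sum>a\<in>F. (- chr a (gs i)) * A 1 a w)) = E i"
      by (simp add: E_def sum_negf fun_eq_iff)
    ultimately show ?thesis by simp
  qed
  have E\<eta>: "(LINT w|M. norm (E i w)) \<le> \<eta>" for i
  proof -
    have int: "integrable M (\<lambda>w. norm (E i w) ^ j)" for j using amE[of i] by (simp add: all_moments_def)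
    have "(LINT w|M. norm (E i w))\<^sup>2 \<le> (LINT w|M. (norm (E i w))\<^sup>2)"
      by (rule M.power_expectation_le) (use int[of 1] int[of 2] in auto)
    also have "\<dots> = 1 - sum S F" unfolding E_def using truncation_error[OF F(1), of "gs i"] by simp
    also have "\<dots> \<le> \<eta>\<^sup>2" using F\<eta> by simp
    finally show ?thesis by (rule power2_le_imp_le) (use \<eta> in simp)
  qed
  have diff: "(LINT w|M. \<bar>G w - Re (ZF w)\<bar>) \<le> r / 4"
  proof -
    have "\<bar>G w - Re (ZF w)\<bar> \<le> (\<Sum>i<k. \<bar>d i\<bar> * norm (E i w))" for w
    proof -
      have "(\<Sum>i<k. complex_of_real (d i) * (\<Sum>a\<in>F. chr a (gs i) * A 1 a w)) = ZF w"
        unfolding ZF_def s_def sum_distrib_left sum_distrib_right mult.assoc by (rule sum.swap)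
      then have "complex_of_real (G w) - ZF w = (\<Sum>i<k. complex_of_real (d i) * E i w)"
        by (simp add: G_def E_def right_diff_distrib sum_subtractf)
      moreover have "norm (\<Sum>i<k. complex_of_real (d i) * E i w) \<le> (\<Sum>i<k. \<bar>d i\<bar> * norm (E i w))"
        by (rule order_trans[OF norm_sum]) (simp add: norm_mult)
      moreover have "\<bar>G w - Re (ZF w)\<bar> \<le> norm (complex_of_real (G w) - ZF w)"
        using abs_Re_le_cmod[of "complex_of_real (G w) - ZF w"] by simp
      ultimately show ?thesis by simp
    qed
    then have "(LINT w|M. \<bar>G w - Re (ZF w)\<bar>) \<le> (LINT w|M. (\<Sum>i<k. \<bar>d i\<bar> * norm (E i w)))"
      by (intro integral_mono integrable_abs Bochner_Integration.integrable_diff Bochner_Integration.integrable_sum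
          integrable_mult_right integrable_norm all_moments_integrable amG amE all_moments_Re_Im(1) amZ)
    also have "\<dots> = (\<Sum>i<k. \<bar>d i\<bar> * (LINT w|M. norm (E i w)))"
      by (subst Bochner_Integration.integral_sum) (auto intro!: integrable_mult_right integrable_norm[OF all_moments_integrable[OF amE]])
    also have "\<dots> \<le> (\<Sum>i<k. \<bar>d i\<bar> * \<eta>)" by (intro sum_mono mult_left_mono E\<eta>) auto
    also have "\<dots> = D * r / (4 * (D + 1))" unfolding sum_distrib_right[symmetric] D_def[symmetric] by (simp add: \<eta>_def)
    also have "\<dots> \<le> r / 4" using D0 r by (simp add: field_simps)
    finally show ?thesis .
  qed
  define L where "L = complex_of_real (exp (- (\<Sum>j<p. (x j)\<^sup>2 + (y j)\<^sup>2) / 4))"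
  have L1: "norm L \<le> 1" by (simp add: L_def sum_nonneg)
  define ph where "ph X = (LINT w|M. exp (\<i> * complex_of_real (X w)))" for X
  define v where "v = complex_of_real (exp (- (\<Sum>a\<in>F. (norm (s a))\<^sup>2 * S a) / 2))"
  \<comment> \<open>With \<open>x = y = 0\<close> the sequence is constant, so the limit is the
    characteristic function of the truncated field itself.\<close>
  have "(\<lambda>_::nat. ph (\<lambda>w. Re (ZF w))) \<longlonglongrightarrow> v"
    using truncated_characteristic_function[where s = s and x = "\<lambda>_. 0" and y = "\<lambda>_. 0", OF F s] by (simp add: ph_def ZF_def Q_def v_def)
  then have phF: "ph (\<lambda>w. Re (ZF w)) = v" by (simp only: LIMSEQ_const_iff)
  have "(\<lambda>l. ph (\<lambda>w. Re (ZF w) + Q x y l w)) \<longlonglongrightarrow> v * L"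
    using truncated_characteristic_function[where s = s and x = x and y = y, OF F s] by (simp only: ph_def ZF_def v_def L_def of_real_mult)
  then have "\<exists>l0. \<forall>l\<ge>l0. norm (ph (\<lambda>w. Re (ZF w) + Q x y l w) - v * L) < r / 4"
    by (rule LIMSEQ_D) (use r in simp)
  then obtain l0 where l0: "\<And>l. l \<ge> l0 \<Longrightarrow> norm (ph (\<lambda>w. Re (ZF w) + Q x y l w) - v * L) < r / 4"
    by blast
  have intG: "integrable M G" "integrable M (\<lambda>w. Re (ZF w))" and intQ: "integrable M (\<lambda>w. Q x y l w)" for l
    by (intro all_moments_integrable amG all_moments_Re_Im(1) amZ Q_am)+
  have b1: "norm (ph G - v) \<le> r / 4"
    using M.iexp_expectation_diff[OF intG] diff unfolding phF[symmetric] ph_def by linarith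
  have b2: "norm (ph (\<lambda>w. G w + Q x y l w) - ph (\<lambda>w. Re (ZF w) + Q x y l w)) \<le> r / 4" for l
    using M.iexp_expectation_diff[OF Bochner_Integration.integrable_add[OF intG(1) intQ] Bochner_Integration.integrable_add[OF intG(2) intQ], of l l] diff
    unfolding ph_def add_diff_cancel_right by linarith
  have "norm (ph (\<lambda>w. G w + Q x y l w) - ph G * L) < r" if "l \<ge> l0" for l
  proof -
    define a b c where "a = ph (\<lambda>w. G w + Q x y l w) - ph (\<lambda>w. Re (ZF w) + Q x y l w)"
      and "b = ph (\<lambda>w. Re (ZF w) + Q x y l w) - v * L" and "c = (ph G - v) * L"
    have "norm (a + b - c) \<le> norm a + norm b + norm c"
      by (rule order_trans[OF norm_triangle_ineq4 add_right_mono[OF norm_triangle_ineq]])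
    moreover have "norm c \<le> r / 4 * 1"
      unfolding c_def norm_mult using r by (intro mult_mono b1 L1) auto
    moreover have "norm a \<le> r / 4" unfolding a_def by (rule b2)
    moreover have "norm b < r / 4" unfolding b_def by (rule l0[OF that])
    moreover have "ph (\<lambda>w. G w + Q x y l w) - ph G * L = a + b - c"
      by (simp add: a_def b_def c_def left_diff_distrib)
    ultimately show ?thesis using r by simp
  qed
  then have "\<exists>l0. \<forall>l\<ge>l0. norm (ph (\<lambda>w. G w + Q x y l w) - ph G * L) < r" by blast
  then show "\<exists>l0. \<forall>l\<ge>l0. norm ((LINT w|M. exp (\<i> * complex_of_real ((\<Sum>i<k. d i * T (gs i) w) + Q x y l w))) -
      (LINT w|M. exp (\<i> * complex_of_real (\<Sum>i<k. d i * T (gs i) w))) * complex_of_real (exp (- (\<Sum>j<p. (x j)\<^sup>2 + (y j)\<^sup>2) / 4))) < r"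
    unfolding ph_def G_def L_def .
qed

end

section \<open>Fourth moments and the way back to (c)\<close>

lemma alternating_product: "(\<Prod>i<2 * k. if even i then x else y) = (x * y) ^ k" for x y :: "'a::comm_monoid_mult"
  by (induction k) (simp_all add: mult_ac)

lemma truncation_gap:
  fixes x n :: real
  assumes n: "n > 0"
  shows "0 \<le> x ^ 4 - min (x ^ 4) n" "x ^ 4 - min (x ^ 4) n \<le> x ^ 8 / n"
proof -
  show "0 \<le> x ^ 4 - min (x ^ 4) n" by simp
  show "x ^ 4 - min (x ^ 4) n \<le> x ^ 8 / n"
  proof (cases "x ^ 4 \<le> n")
    case True
    then show ?thesis using n by (simp add: min_def)
  next
    case False
    have "n * x ^ 4 \<le> x ^ 4 * x ^ 4" by (rule mult_right_mono) (use False in auto)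
    also have "x ^ 4 * x ^ 4 = x ^ 8" by (simp flip: power_add)
    finally have "x ^ 4 \<le> x ^ 8 / n" using n by (simp add: pos_le_divide_eq mult.commute)
    then show ?thesis using False n by (simp add: min_def)
  qed
qed

lemma fourth_truncation:
  fixes Z :: "'a \<Rightarrow> real"
  assumes N: "prob_space N" and Z: "all_moments N Z" and n: "n > 0"
  shows "\<bar>(LINT w|N. Z w ^ 4) - (LINT w|N. min (Z w ^ 4) n)\<bar> \<le> (LINT w|N. Z w ^ 8) / n"
proof -
  interpret prob_space N by (rule N)
  have int: "integrable N (\<lambda>w. Z w ^ k)" for k by (intro all_moments_integrable all_moments_power Z)
  have imin: "integrable N (\<lambda>w. min (Z w ^ 4) n)" by (intro integrable_min int) simp
  have eq: "(LINT w|N. Z w ^ 4) - (LINT w|N. min (Z w ^ 4) n) = (LINT w|N. Z w ^ 4 - min (Z w ^ 4) n)"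
    by (rule Bochner_Integration.integral_diff[symmetric, OF int imin])
  have "0 \<le> (LINT w|N. Z w ^ 4 - min (Z w ^ 4) n)"
    by (rule Bochner_Integration.integral_nonneg) (rule truncation_gap[OF n])
  moreover have "(LINT w|N. Z w ^ 4 - min (Z w ^ 4) n) \<le> (LINT w|N. Z w ^ 8 / n)"
    by (intro integral_mono Bochner_Integration.integrable_diff int imin integrable_divide_zero truncation_gap[OF n])
  ultimately show ?thesis unfolding eq by simp
qed

lemma half_normal_fourth: "(LINT x|half_normal. x ^ 4) = 3 / 4"
proof -
  have s: "sqrt (1 / 2) ^ 4 = (1 / 4 :: real)"
  proof -
    have "sqrt (1 / 2) ^ 4 = ((sqrt (1 / 2))\<^sup>2)\<^sup>2" by (simp only: power_mult[symmetric]) simp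
    also have "(sqrt (1 / 2))\<^sup>2 = (1 / 2 :: real)" by (rule real_sqrt_pow2) simp
    finally show ?thesis by (simp add: power2_eq_square)
  qed
  have "normal_mom 4 = 3" by (simp add: normal_mom_def fact_numeral)
  then show ?thesis by (simp only: half_normal_moments s)
qed

text \<open>Convergence in law tests only the bounded function \<open>min (x ^ 4) n\<close>; eighth
  moments bound what is cut off.\<close>

lemma fourth_moment_limit:
  fixes X :: "nat \<Rightarrow> 'a \<Rightarrow> real"
  assumes M: "prob_space M" and am: "\<And>l. all_moments M (X l)" and K: "\<And>l. (LINT w|M. X l w ^ 8) \<le> K"
    and lim: "\<And>n. n > 0 \<Longrightarrow> (\<lambda>l. LINT w|M. min (X l w ^ 4) n) \<longlonglongrightarrow> (LINT x|half_normal. min (x ^ 4) n)"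
  shows "(\<lambda>l. LINT w|M. X l w ^ 4) \<longlonglongrightarrow> 3 / 4"
proof (rule LIMSEQ_I)
  fix r :: real assume r: "r > 0"
  define K' where "K' = (LINT x|half_normal. x ^ 8)"
  have "0 \<le> (LINT w|M. X 0 w ^ 8)" by (rule Bochner_Integration.integral_nonneg) simp
  then have K0: "K \<ge> 0" using K[of 0] by linarith
  have K'0: "K' \<ge> 0" unfolding K'_def by (rule Bochner_Integration.integral_nonneg) simp
  \<comment> \<open>Makes the two truncation errors together at most r/4.\<close>
  define n where "n = 4 * (K + K' + 1) / r"
  have n: "n > 0" using K0 K'0 r by (simp add: n_def add_nonneg_pos)
  have "K + K' \<le> (r / 4) * n" using r K0 K'0 by (simp add: n_def)
  then have Kn: "K / n + K' / n \<le> r / 4" using n by (simp add: pos_divide_le_eq flip: add_divide_distrib)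
  have "\<exists>l0. \<forall>l\<ge>l0. norm ((LINT w|M. min (X l w ^ 4) n) - (LINT x|half_normal. min (x ^ 4) n)) < r / 4"
    by (rule LIMSEQ_D[OF lim[OF n]]) (use r in simp)
  then obtain l0 where l0: "\<And>l. l \<ge> l0 \<Longrightarrow> \<bar>(LINT w|M. min (X l w ^ 4) n) - (LINT x|half_normal. min (x ^ 4) n)\<bar> < r / 4"
    by auto
  have b: "\<bar>3 / 4 - (LINT x|half_normal. min (x ^ 4) n)\<bar> \<le> K' / n"
    using fourth_truncation[OF prob_space_half_normal half_normal_moments(1) n] unfolding half_normal_fourth K'_def .
  have "norm ((LINT w|M. X l w ^ 4) - 3 / 4) < r" if "l \<ge> l0" for l
  proof -
    have "\<bar>(LINT w|M. X l w ^ 4) - (LINT w|M. min (X l w ^ 4) n)\<bar> \<le> (LINT w|M. X l w ^ 8) / n"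
      by (rule fourth_truncation[OF M am n])
    also have "\<dots> \<le> K / n" using K[of l] n by (simp add: divide_right_mono)
    finally show ?thesis using b l0[OF that] Kn r unfolding real_norm_def by linarith
  qed
  then show "\<exists>l0. \<forall>l\<ge>l0. norm ((LINT w|M. X l w ^ 4) - 3 / 4) < r" by blast
qed

text \<open>For a coefficient at \<open>a\<close> the last two terms carry charges 2a and 4a, so
  they have mean 0 when these are nonzero.\<close>

lemma Re_fourth: "8 * Re z ^ 4 = 3 * norm z ^ 4 + 4 * Re (z * z * z * cnj z) + Re (z * z * z * z)"
proof -
  have "norm z ^ 4 = ((norm z)\<^sup>2)\<^sup>2" by (simp flip: power_mult)
  then have "norm z ^ 4 = ((Re z)\<^sup>2 + (Im z)\<^sup>2)\<^sup>2" by (simp only: cmod_power2)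
  then show ?thesis by (simp add: power2_eq_square power4_eq_xxxx algebra_simps)
qed

lemma moment_gap: "8 * R = 3 * N \<Longrightarrow> 2 + D \<le> N \<Longrightarrow> D \<le> 8 / 3 * (R - 3 / 4)" for R N D :: real
  by argo

lemma prod_four: "(\<Prod>i\<in>set [0, 1, 2, 3::nat]. f i) = f 0 * f 1 * f 2 * f 3" for f :: "nat \<Rightarrow> 'a::comm_monoid_mult"
  by (simp add: mult.assoc)

lemma sum_four: "(\<Sum>i\<in>set [0, 1, 2, 3::nat]. f i) = f 0 + f 1 + f 2 + f 3" for f :: "nat \<Rightarrow> 'a::comm_monoid_add"
  by (simp add: add.assoc)

context gaussian_field begin

lemma moment_bound:
  fixes vs :: "nat list" and n :: "nat \<Rightarrow> nat"
  assumes d: "distinct vs" and n: "\<And>i. n i > 0"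
  shows "\<exists>K. \<forall>\<pi>. norm (LINT w|M. (\<Prod>i\<in>set vs. Bn (n i) (\<pi> i) w)) \<le> K"
proof -
  have "\<exists>K<top. \<forall>\<pi>. (wick C vs n \<pi>)\<^sup>2 \<le> K * (\<Prod>i\<in>set vs. cpow C (n i) (\<pi> i))"
    by (rule wick_bound[where C = C, OF C_uminus d])
  then obtain K where K: "K < top" "\<And>\<pi>. (wick C vs n \<pi>)\<^sup>2 \<le> K * (\<Prod>i\<in>set vs. cpow C (n i) (\<pi> i))"
    by blast
  have "norm (LINT w|M. (\<Prod>i\<in>set vs. Bn (n i) (\<pi> i) w)) \<le> sqrt (enn2real K)" for \<pi>
  proof -
    define W where "W = enn2real (wick C vs n \<pi>)"
    define Z where "Z = (\<Prod>i\<in>set vs. sqrt (fact (n i) * cc (n i) (\<pi> i)))"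
    define P where "P = (\<Prod>i\<in>set vs. cc (n i) (\<pi> i))"
    have fin: "wick C vs n \<pi> < top" by (rule wick_finite) (use d nsum_C in \<open>auto simp: C_uminus\<close>)
    have cp: "cc (n i) (\<pi> i) > 0" for i by (rule cc_pos) (rule n)
    have Zp: "Z > 0" unfolding Z_def by (intro prod_pos) (simp add: cp)
    have P0: "P \<ge> 0" unfolding P_def by (intro prod_nonneg) (simp add: cc_nonneg)
    have W0: "W \<ge> 0" by (simp add: W_def)
    have "ennreal (W\<^sup>2) = (wick C vs n \<pi>)\<^sup>2" using fin by (simp add: W_def ennreal_power[symmetric])
    also have "\<dots> \<le> K * (\<Prod>i\<in>set vs. cpow C (n i) (\<pi> i))" by (rule K(2))
    also have "(\<Prod>i\<in>set vs. cpow C (n i) (\<pi> i)) = ennreal P"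
      unfolding P_def ennreal_cc[symmetric] by (rule prod_ennreal) (simp add: cc_nonneg)
    also have "K * ennreal P = ennreal (enn2real K * P)" using K(1) P0 by (simp add: ennreal_mult)
    finally have "W\<^sup>2 \<le> enn2real K * P" using P0 by (subst (asm) ennreal_le_iff) auto
    also have "\<dots> \<le> enn2real K * Z\<^sup>2"
    proof (rule mult_left_mono)
      show "P \<le> Z\<^sup>2" unfolding P_def Z_def prod_power_distrib
      proof (rule prod_mono)
        fix i
        have "1 * cc (n i) (\<pi> i) \<le> fact (n i) * cc (n i) (\<pi> i)"
          by (intro mult_right_mono fact_ge_1 cc_nonneg)
        then show "0 \<le> cc (n i) (\<pi> i) \<and> cc (n i) (\<pi> i) \<le> (sqrt (fact (n i) * cc (n i) (\<pi> i)))\<^sup>2"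
          by (simp add: cc_nonneg)
      qed
    qed simp
    finally have "W\<^sup>2 / Z\<^sup>2 \<le> enn2real K" using Zp by (simp add: pos_divide_le_eq)
    then have "(W / Z)\<^sup>2 \<le> enn2real K" by (simp only: power_divide)
    then have "W / Z \<le> sqrt (enn2real K)" by (rule real_le_rsqrt)
    moreover have "W / Z \<ge> 0" using W0 Zp by simp
    ultimately show ?thesis
      unfolding moment_Bn[OF d] norm_of_real W_def[symmetric] Z_def[symmetric] by (simp only: abs_of_nonneg)
  qed
  then show ?thesis by blast
qed

lemma Bn_norm_square: "Bn n a w * Bn n (- a) w = complex_of_real ((norm (Bn n a w))\<^sup>2)"
  unfolding Bn_cnj[symmetric] complex_norm_square ..

text \<open>The eighth absolute moment is the moment of the word with charges alternating between
  \<open>a\<close> and \<open>- a\<close>, to which \<open>moment_bound\<close> applies uniformly in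
  \<open>a\<close>.\<close>

lemma Bn_part_eighth:
  assumes n: "n > 0"
  shows "\<exists>K. \<forall>a. (LINT w|M. Re (Bn n a w) ^ 8) \<le> K \<and> (LINT w|M. Im (Bn n a w) ^ 8) \<le> K"
proof -
  have "\<exists>K. \<forall>\<pi>. norm (LINT w|M. (\<Prod>i\<in>set [0..<8]. Bn ((\<lambda>_::nat. n) i) (\<pi> i) w)) \<le> K"
    by (rule moment_bound) (use n in auto)
  then obtain K where K: "\<And>\<pi>. norm (LINT w|M. (\<Prod>i\<in>set [0..<8::nat]. Bn n (\<pi> i) w)) \<le> K" by blast
  have "(LINT w|M. Re (Bn n a w) ^ 8) \<le> K \<and> (LINT w|M. Im (Bn n a w) ^ 8) \<le> K" for a
  proof -
    have "(\<Prod>i\<in>set [0..<8::nat]. Bn n (if even i then a else - a) w) = complex_of_real (norm (Bn n a w) ^ 8)" for w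
    proof -
      have "(\<Prod>i\<in>set [0..<8::nat]. Bn n (if even i then a else - a) w) = (\<Prod>i<2 * (4::nat). if even i then Bn n a w else Bn n (- a) w)"
        by (rule prod.cong) auto
      also have "\<dots> = (Bn n a w * Bn n (- a) w) ^ 4" by (rule alternating_product)
      also have "\<dots> = complex_of_real (((norm (Bn n a w))\<^sup>2) ^ 4)" unfolding Bn_norm_square by (rule of_real_power[symmetric])
      also have "((norm (Bn n a w))\<^sup>2) ^ 4 = norm (Bn n a w) ^ 8" by (simp flip: power_mult)
      finally show ?thesis .
    qed
    then have "norm (complex_of_real (LINT w|M. norm (Bn n a w) ^ 8)) \<le> K"
      using K[of "\<lambda>i. if even i then a else - a"] by (simp only: integral_complex_of_real)
    then have b: "(LINT w|M. norm (Bn n a w) ^ 8) \<le> K" unfolding norm_of_real by linarith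
    have int: "integrable M (\<lambda>w. norm (Bn n a w) ^ 8)" using Bn_am[of n a] by (simp add: all_moments_def)
    have le: "x ^ 8 \<le> y ^ 8" if "\<bar>x\<bar> \<le> y" for x y :: real
      using power_mono[OF that, of 8] by (simp add: power_even_abs)
    have "(LINT w|M. Re (Bn n a w) ^ 8) \<le> (LINT w|M. norm (Bn n a w) ^ 8)"
      by (intro integral_mono int all_moments_integrable M.all_moments_power Bn_Re_am le abs_Re_le_cmod)
    moreover have "(LINT w|M. Im (Bn n a w) ^ 8) \<le> (LINT w|M. norm (Bn n a w) ^ 8)"
      by (intro integral_mono int all_moments_integrable M.all_moments_power Bn_Im_am le abs_Im_le_cmod)
    ultimately show ?thesis using b by linarith
  qed
  then show ?thesis by blast
qed

lemma cond_b_iff: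
  "cond_b M H T m (\<lambda>l. chr (\<tau> l)) \<longleftrightarrow>
    (\<lambda>l. LINT w|M. Re (Bn m (\<tau> l) w) ^ 4) \<longlonglongrightarrow> 3 / 4 \<and> (\<lambda>l. LINT w|M. Im (Bn m (\<tau> l) w) ^ 4) \<longlonglongrightarrow> 3 / 4"
proof -
  have root: "sqrt z ^ 4 = z\<^sup>2" if "z \<ge> 0" for z :: real
  proof -
    have "sqrt z ^ 4 = ((sqrt z)\<^sup>2)\<^sup>2" by (simp only: power_mult[symmetric]) simp
    then show ?thesis by (simp only: real_sqrt_pow2[OF that])
  qed
  have z0: "fact m * cc m a \<ge> 0" for a by (simp add: cc_nonneg)
  have inv: "x powi (- 2) * y = y / x\<^sup>2" for x y :: real by (simp add: power_int_minus divide_inverse)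
  have "(fact m * spec_conv M H T (chr a) m) powi (- 2) * (\<integral>w. Re (hcoef H T m (chr a) w) ^ 4 \<partial>M) = (LINT w|M. Re (Bn m a w) ^ 4)"
    "(fact m * spec_conv M H T (chr a) m) powi (- 2) * (\<integral>w. Im (hcoef H T m (chr a) w) ^ 4 \<partial>M) = (LINT w|M. Im (Bn m a w) ^ 4)" for a
    unfolding inv spec_conv_eq Bn_def Re_divide_of_real Im_divide_of_real power_divide root[OF z0]
    by simp_all
  then show ?thesis by (simp only: cond_b_def)
qed

lemma truncated_laws_imp_cond_b:
  assumes m: "m > 0"
    and Re: "\<And>n. n > 0 \<Longrightarrow> (\<lambda>l. LINT w|M. min (Re (Bn m (\<tau> l) w) ^ 4) n) \<longlonglongrightarrow> (LINT x|half_normal. min (x ^ 4) n)"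
    and Im: "\<And>n. n > 0 \<Longrightarrow> (\<lambda>l. LINT w|M. min (Im (Bn m (\<tau> l) w) ^ 4) n) \<longlonglongrightarrow> (LINT x|half_normal. min (x ^ 4) n)"
  shows "cond_b M H T m (\<lambda>l. chr (\<tau> l))"
proof -
  obtain K where K: "\<And>a. (LINT w|M. Re (Bn m a w) ^ 8) \<le> K" "\<And>a. (LINT w|M. Im (Bn m a w) ^ 8) \<le> K"
    using Bn_part_eighth[OF m] by blast
  show ?thesis
    unfolding cond_b_iff
  proof
    show "(\<lambda>l. LINT w|M. Re (Bn m (\<tau> l) w) ^ 4) \<longlonglongrightarrow> 3 / 4"
      by (rule fourth_moment_limit[OF M.prob_space_axioms Bn_Re_am K(1) Re])
    show "(\<lambda>l. LINT w|M. Im (Bn m (\<tau> l) w) ^ 4) \<longlonglongrightarrow> 3 / 4"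
      by (rule fourth_moment_limit[OF M.prob_space_axioms Bn_Im_am K(2) Im])
  qed
qed

lemma bounded_truncation: "bounded (range (\<lambda>z. min (g z ^ 4) n))" if "n > 0" for g :: "'z \<Rightarrow> real" and n :: real
  using that by (intro boundedI[of _ n]) (auto simp: min_def abs_of_nonneg)

lemma cond_a_imp_cond_b:
  assumes m: "m > 0" and a: "cond_a M H T m (\<lambda>l. chr (\<tau> l))"
  shows "cond_b M H T m (\<lambda>l. chr (\<tau> l))"
proof (rule truncated_laws_imp_cond_b[OF m])
  interpret hn: prob_space half_normal by (rule prob_space_half_normal)
  let ?P = "half_normal \<Otimes>\<^sub>M half_normal"
  have mC: "(\<lambda>(x, y). Complex x y) \<in> borel_measurable ?P"
    unfolding Complex_eq case_prod_beta by (intro borel_measurable_add borel_measurable_times borel_measurable_of_real borel_measurable_const)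
      (auto simp: measurable_cong_sets[OF refl sets_half_normal, symmetric])
  have lim: "(\<lambda>l. LINT w|M. f (Bn m (\<tau> l) w)) \<longlonglongrightarrow> (LINT v|?P. f (Complex (fst v) (snd v)))"
    if f: "continuous_on UNIV f" "bounded (range f)" for f :: "complex \<Rightarrow> real"
  proof -
    have "(LINT x|cgauss. f x) = (LINT v|?P. f (Complex (fst v) (snd v)))"
      unfolding cgauss_def by (subst integral_distr[OF mC]) (auto simp: case_prod_beta intro!: borel_measurable_continuous_onI f)
    moreover have "(\<lambda>l. LINT w|M. f (nhcoef M H T m (chr (\<tau> l)) w)) \<longlonglongrightarrow> (LINT x|cgauss. f x)"
      using a f unfolding cond_a_def converges_in_law_def by blast
    ultimately show ?thesis by (simp only: nhcoef_eq)
  qed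
  have meas4: "(\<lambda>x::real. min (x ^ 4) n) \<in> borel_measurable half_normal" for n
    unfolding measurable_cong_sets[OF sets_half_normal refl] by measurable
  have fst_law: "(LINT v|?P. min (fst v ^ 4) n) = (LINT x|half_normal. min (x ^ 4) n)" for n :: real
  proof -
    have "(LINT x|(distr ?P half_normal fst). min (x ^ 4) n) = (LINT v|?P. min (fst v ^ 4) n)"
      by (rule integral_distr) (auto intro: meas4)
    then show ?thesis unfolding hn.distr_pair_fst by simp
  qed
  have swap: "(LINT v|?P. min (snd v ^ 4) n) = (LINT x|half_normal. min (x ^ 4) n)" for n :: real
  proof -
    have "(LINT x|(distr ?P half_normal snd). min (x ^ 4) n) = (LINT v|?P. min (snd v ^ 4) n)"
      by (rule integral_distr) (auto intro: meas4)
    then show ?thesis unfolding distr_pair_snd[OF prob_space_half_normal prob_space_half_normal] by simp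
  qed
  fix n :: real assume n: "n > 0"
  have cRe: "continuous_on UNIV (\<lambda>z. min (Re z ^ 4) n)" and cIm: "continuous_on UNIV (\<lambda>z. min (Im z ^ 4) n)"
    by (intro continuous_intros)+
  show "(\<lambda>l. LINT w|M. min (Re (Bn m (\<tau> l) w) ^ 4) n) \<longlonglongrightarrow> (LINT x|half_normal. min (x ^ 4) n)"
    using lim[OF cRe bounded_truncation[OF n]] unfolding complex.sel fst_law .
  show "(\<lambda>l. LINT w|M. min (Im (Bn m (\<tau> l) w) ^ 4) n) \<longlonglongrightarrow> (LINT x|half_normal. min (x ^ 4) n)"
    using lim[OF cIm bounded_truncation[OF n]] unfolding complex.sel swap .
qed

text \<open>Only test functions of one complex coordinate are used; under the limit law its two
  parts are single \<open>half_normal\<close> variables.\<close>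

lemma joint_law_imp_cond_b:
  fixes ms :: "nat \<Rightarrow> nat"
  assumes j: "j < p" and m: "ms j > 0"
    and law: "converges_in_law M
      (\<lambda>l w. ((\<lambda>i::nat. if i < k then T (gs i) w else 0), (\<lambda>j. if j < p then nhcoef M H T (ms j) (chr (\<tau> l)) w else 0)))
      (distr M borel (\<lambda>w. \<lambda>i. if i < k then T (gs i) w else 0) \<Otimes>\<^sub>M cgauss_vec p)"
  shows "cond_b M H T (ms j) (\<lambda>l. chr (\<tau> l))"
proof (rule truncated_laws_imp_cond_b[OF m])
  let ?N = "PiM {..<2 * p} (\<lambda>_::nat. half_normal)"
  let ?a = "\<lambda>w i. if i < k then T (gs i) w else 0"
  let ?b = "\<lambda>x j. if j < p then Complex (x j) (x (p + j)) else 0"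
  have a: "?a \<in> borel_measurable M" by (intro measurable_coordinatewise_then_product) simp
  have comp: "(\<lambda>u. u i) \<in> measurable ?N half_normal" if "i < 2 * p" for i
    using measurable_component_singleton[of i "{..<2 * p}" "\<lambda>_. half_normal"] that by simp
  have compb: "(\<lambda>u. u i) \<in> borel_measurable ?N" if "i < 2 * p" for i
    using comp[OF that] unfolding measurable_cong_sets[OF refl sets_half_normal] .
  have b: "?b \<in> borel_measurable ?N"
  proof (rule measurable_coordinatewise_then_product)
    fix i
    show "(\<lambda>x. ?b x i) \<in> borel_measurable ?N"
      by (cases "i < p") (auto simp: Complex_eq intro!: borel_measurable_add borel_measurable_times borel_measurable_of_real borel_measurable_const compb)
  qed
  have pA: "prob_space (distr M borel ?a)" by (rule M.prob_space_distr[OF a])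
  have pB: "prob_space (cgauss_vec p)"
    unfolding cgauss_vec_def by (rule prob_space.prob_space_distr[OF prob_space_PiM_half_normal b])
  have meas4: "(\<lambda>x::real. min (x ^ 4) n) \<in> borel_measurable half_normal" for n
    unfolding measurable_cong_sets[OF sets_half_normal refl] by measurable
  have comp_law: "(LINT x|?N. min (x i ^ 4) n) = (LINT x|half_normal. min (x ^ 4) n)" if i: "i < 2 * p" for i and n :: real
  proof -
    have "(LINT x|(distr ?N half_normal (\<lambda>x. x i)). min (x ^ 4) n) = (LINT x|?N. min (x i ^ 4) n)"
      by (rule integral_distr[OF comp[OF i] meas4])
    moreover have "distr ?N half_normal (\<lambda>x. x i) = half_normal" by (rule distr_half_normal_component) (use i in simp)
    ultimately show ?thesis by simp
  qed
  have lim: "(\<lambda>l. LINT w|M. f (Bn (ms j) (\<tau> l) w)) \<longlonglongrightarrow> (LINT x|?N. f (Complex (x j) (x (p + j))))"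
    if f: "continuous_on UNIV f" "bounded (range f)" for f :: "complex \<Rightarrow> real"
  proof -
    let ?f = "\<lambda>v::(nat \<Rightarrow> real) \<times> (nat \<Rightarrow> complex). f (snd v j)"
    have cs: "continuous_on UNIV (\<lambda>z::nat \<Rightarrow> complex. f (z j))"
      by (intro continuous_on_compose2[OF f(1)]) auto
    have c: "continuous_on UNIV ?f"
      by (intro continuous_on_compose2[OF cs continuous_on_snd[OF continuous_on_id]]) auto
    have bd: "bounded (range ?f)" by (rule bounded_subset[OF f(2)]) auto
    have mf: "(\<lambda>z::nat \<Rightarrow> complex. f (z j)) \<in> borel_measurable borel" by (rule borel_measurable_continuous_onI[OF cs])
    have mg: "(\<lambda>z::nat \<Rightarrow> complex. f (z j)) \<in> borel_measurable (cgauss_vec p)"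
      using mf by (simp add: cgauss_vec_def)
    have "(LINT v|(distr M borel ?a \<Otimes>\<^sub>M cgauss_vec p). ?f v) = (LINT z|(distr (distr M borel ?a \<Otimes>\<^sub>M cgauss_vec p) (cgauss_vec p) snd). f (z j))"
      by (rule integral_distr[symmetric, OF measurable_snd mg])
    also have "\<dots> = (LINT z|cgauss_vec p. f (z j))" by (simp only: distr_pair_snd[OF pA pB])
    also have "\<dots> = (LINT x|?N. f (Complex (x j) (x (p + j))))"
      unfolding cgauss_vec_def by (subst integral_distr[OF b mf]) (simp add: j)
    finally have "(LINT v|(distr M borel ?a \<Otimes>\<^sub>M cgauss_vec p). ?f v) = (LINT x|?N. f (Complex (x j) (x (p + j))))" .
    moreover have "(\<lambda>l. LINT w|M. ?f (?a w, (\<lambda>j. if j < p then nhcoef M H T (ms j) (chr (\<tau> l)) w else 0))) \<longlonglongrightarrow> (LINT v|(distr M borel ?a \<Otimes>\<^sub>M cgauss_vec p). ?f v)"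
      using law[unfolded converges_in_law_def, rule_format, OF c bd] .
    ultimately show ?thesis using j by (simp add: nhcoef_eq)
  qed
  have jp: "j < 2 * p" "p + j < 2 * p" using j by auto
  fix n :: real assume n: "n > 0"
  have cRe: "continuous_on UNIV (\<lambda>z. min (Re z ^ 4) n)" and cIm: "continuous_on UNIV (\<lambda>z. min (Im z ^ 4) n)"
    by (intro continuous_intros)+
  show "(\<lambda>l. LINT w|M. min (Re (Bn (ms j) (\<tau> l) w) ^ 4) n) \<longlonglongrightarrow> (LINT x|half_normal. min (x ^ 4) n)"
    using lim[OF cRe bounded_truncation[OF n]] unfolding complex.sel comp_law[OF jp(1)] .
  show "(\<lambda>l. LINT w|M. min (Im (Bn (ms j) (\<tau> l) w) ^ 4) n) \<longlonglongrightarrow> (LINT x|half_normal. min (x ^ 4) n)"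
    using lim[OF cIm bounded_truncation[OF n]] unfolding complex.sel comp_law[OF jp(2)] .
qed

lemma charged_moment:
  assumes "\<pi> 0 + \<pi> 1 + \<pi> 2 + \<pi> (3::nat) \<noteq> 0"
  shows "(LINT w|M. Bn m (\<pi> 0) w * Bn m (\<pi> 1) w * Bn m (\<pi> 2) w * Bn m (\<pi> 3) w) = 0"
proof -
  have d: "distinct [0, 1, 2, 3::nat]" by simp
  have "wick C [0, 1, 2, 3] (\<lambda>_. m) \<pi> = 0"
  proof (rule ccontr)
    assume "wick C [0, 1, 2, 3] (\<lambda>_. m) \<pi> \<noteq> 0"
    from wick_neutral[OF d this] show False using assms unfolding sum_four by contradiction
  qed
  then have "(LINT w|M. (\<Prod>i\<in>set [0, 1, 2, 3]. Bn m (\<pi> i) w)) = 0"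
    using moment_Bn[OF d, of "\<lambda>_. m" \<pi>] by (simp only: enn2real_0 div_0 of_real_0)
  then show ?thesis unfolding prod_four .
qed

lemma Re_fourth_moment:
  assumes a2: "a + a \<noteq> 0" and a4: "a + a + a + a \<noteq> 0"
  shows "8 * (LINT w|M. Re (Bn m a w) ^ 4) = 3 * (LINT w|M. norm (Bn m a w) ^ 4)"
proof -
  let ?z = "Bn m a"
  let ?u = "\<lambda>w. ?z w * ?z w * ?z w * cnj (?z w)" and ?v = "\<lambda>w. ?z w * ?z w * ?z w * ?z w"
  have u0: "(LINT w|M. ?u w) = 0"
  proof -
    define \<pi> where "\<pi> i = (if i = 3 then - a else a)" for i :: nat
    have \<pi>: "\<pi> 0 = a" "\<pi> 1 = a" "\<pi> 2 = a" "\<pi> 3 = - a" by (simp_all add: \<pi>_def)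
    have "a + a + a + - a \<noteq> 0" using a2 by (simp only: add.assoc add.right_inverse add.right_neutral not_False_eq_True)
    from charged_moment[of \<pi> m, unfolded \<pi>, OF this] show ?thesis unfolding Bn_cnj .
  qed
  have v0: "(LINT w|M. ?v w) = 0" by (rule charged_moment[of "\<lambda>_. a" m, OF a4])
  have am: "all_moments M ?u" "all_moments M ?v"
    unfolding Bn_cnj by (intro all_moments_mult Bn_am)+
  have i4: "integrable M (\<lambda>w. norm (?z w) ^ 4)" using Bn_am[of m a] by (simp add: all_moments_def)
  have iu: "integrable M ?u" "integrable M ?v" using am by (auto intro: all_moments_integrable)
  have ir: "integrable M (\<lambda>w. Re (?u w))" "integrable M (\<lambda>w. Re (?v w))"
    by (intro all_moments_integrable all_moments_Re_Im(1) am)+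
  have "8 * (LINT w|M. Re (?z w) ^ 4) = (LINT w|M. 8 * Re (?z w) ^ 4)" by simp
  also have "\<dots> = (LINT w|M. 3 * norm (?z w) ^ 4 + 4 * Re (?u w) + Re (?v w))" by (simp only: Re_fourth)
  also have "\<dots> = (LINT w|M. 3 * norm (?z w) ^ 4) + (LINT w|M. 4 * Re (?u w)) + (LINT w|M. Re (?v w))"
    by (simp only: Bochner_Integration.integral_add[OF Bochner_Integration.integrable_add[OF integrable_mult_right[OF i4] integrable_mult_right[OF ir(1)]] ir(2)]
      Bochner_Integration.integral_add[OF integrable_mult_right[OF i4] integrable_mult_right[OF ir(1)]])
  also have "(LINT w|M. 4 * Re (?u w)) = 0"
    by (simp only: integral_mult_right_zero integral_Re[OF iu(1)] u0 zero_complex.sel mult_zero_right)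
  also have "(LINT w|M. Re (?v w)) = 0"
    using integral_Re[OF iu(2)] v0 by simp
  finally show ?thesis by simp
qed

text \<open>2 is the fourth absolute moment of a standard complex Gaussian; the excess is the cyclic
  diagram of \<open>wick_fourth_lower\<close>.\<close>

lemma norm_fourth_lower:
  assumes q: "1 \<le> q" "q < m"
  shows "(LINT w|M. norm (Bn m a w) ^ 4) \<ge> 2 + DD m q a / (fact m * cc m a)\<^sup>2"
proof -
  define \<pi> where "\<pi> i = (if i = 0 \<or> i = 2 then a else - a)" for i :: nat
  have \<pi>: "\<pi> 0 = a" "\<pi> 1 = - a" "\<pi> 2 = a" "\<pi> 3 = - a" by (simp_all add: \<pi>_def)
  have d: "distinct [0, 1, 2, 3::nat]" by simp
  have cp: "cc m a > 0" using q by (intro cc_pos) simp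
  define W where "W = enn2real (wick C [0, 1, 2, 3] (\<lambda>_. m) \<pi>)"
  have fin: "wick C [0, 1, 2, 3] (\<lambda>_. m) \<pi> < top"
    by (rule wick_finite[OF _ _ d]) (use nsum_C in \<open>auto simp: C_uminus\<close>)
  have W: "ennreal W = wick C [0, 1, 2, 3] (\<lambda>_. m) \<pi>" using fin by (simp add: W_def)
  have two: "2 * (fact m * cpow C m a)\<^sup>2 = ennreal (2 * (fact m * cc m a)\<^sup>2)"
    by (simp add: ennreal_mult cc_nonneg ennreal_cc[symmetric] ennreal_power[symmetric] flip: ennreal_fact)
  have "2 * (fact m * cpow C m a)\<^sup>2 + nsum (\<lambda>\<mu>. (cpow C q \<mu>)\<^sup>2 * (cpow C (m - q) (a - \<mu>))\<^sup>2) \<le> wick C [0, 1, 2, 3] (\<lambda>_. m) \<pi>"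
    by (rule wick_fourth_lower[where C = C, OF C_uminus q \<pi>])
  then have "ennreal (2 * (fact m * cc m a)\<^sup>2) + ennreal (DD m q a) \<le> ennreal W"
    unfolding two ennreal_DD[symmetric] W .
  then have "ennreal (2 * (fact m * cc m a)\<^sup>2 + DD m q a) \<le> ennreal W"
    by (subst ennreal_plus) (auto simp: DD_nonneg)
  then have le: "2 * (fact m * cc m a)\<^sup>2 + DD m q a \<le> W"
    by (subst (asm) ennreal_le_iff) (auto simp: W_def)
  have "(LINT w|M. (\<Prod>i\<in>set [0, 1, 2, 3]. Bn m (\<pi> i) w)) = complex_of_real (W / (\<Prod>i\<in>set [0, 1, 2, 3]. sqrt (fact m * cc m (\<pi> i))))"
    unfolding W_def by (rule moment_Bn[OF d])
  moreover have "(\<Prod>i\<in>set [0, 1, 2, 3]. Bn m (\<pi> i) w) = complex_of_real (norm (Bn m a w) ^ 4)" for w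
  proof -
    have "(\<Prod>i\<in>set [0, 1, 2, 3]. Bn m (\<pi> i) w) = (Bn m a w * Bn m (- a) w) * (Bn m a w * Bn m (- a) w)"
      unfolding prod_four \<pi> by (simp only: mult.assoc)
    also have "\<dots> = complex_of_real ((norm (Bn m a w))\<^sup>2 * (norm (Bn m a w))\<^sup>2)"
      unfolding Bn_norm_square by (rule of_real_mult[symmetric])
    also have "(norm (Bn m a w))\<^sup>2 * (norm (Bn m a w))\<^sup>2 = norm (Bn m a w) ^ 4" by (simp flip: power_add)
    finally show ?thesis .
  qed
  moreover have "(\<Prod>i\<in>set [0, 1, 2, 3]. sqrt (fact m * cc m (\<pi> i))) = (fact m * cc m a)\<^sup>2"
    unfolding prod_four \<pi> cc_uminus by (simp add: cc_nonneg power2_eq_square mult.assoc flip: real_sqrt_mult)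
  ultimately have "(LINT w|M. norm (Bn m a w) ^ 4) = W / (fact m * cc m a)\<^sup>2"
    by (simp only: integral_complex_of_real of_real_eq_iff)
  moreover have "(2 * (fact m * cc m a)\<^sup>2 + DD m q a) / (fact m * cc m a)\<^sup>2 \<le> W / (fact m * cc m a)\<^sup>2"
    by (rule divide_right_mono[OF le]) simp
  moreover have "(fact m * cc m a)\<^sup>2 \<noteq> 0" using cp by simp
  then have "(2 * (fact m * cc m a)\<^sup>2 + DD m q a) / (fact m * cc m a)\<^sup>2 = 2 + DD m q a / (fact m * cc m a)\<^sup>2"
    by (simp add: add_divide_eq_iff)
  ultimately show ?thesis by linarith
qed

text \<open>The fourth moment of the real part controls the contraction norms once the character is
  nontrivial; the imaginary part guarantees that it eventually is.\<close>

lemma cond_b_imp_contracts: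
  assumes conn: "connected (UNIV :: 'g set)" and b: "cond_b M H T m (\<lambda>l. chr (\<tau> l))"
  shows "contracts m \<tau>"
  unfolding contracts_def
proof (intro allI impI)
  fix q assume q: "1 \<le> q" "q < m"
  let ?r = "\<lambda>l. LINT w|M. Re (Bn m (\<tau> l) w) ^ 4"
  have lim: "?r \<longlonglongrightarrow> 3 / 4" "(\<lambda>l. LINT w|M. Im (Bn m (\<tau> l) w) ^ 4) \<longlonglongrightarrow> 3 / 4"
    using b by (simp_all only: cond_b_iff)
  \<comment> \<open>The coefficient at the trivial character is real, so its imaginary part could
    not have a fourth moment near 3/4.\<close>
  have im0: "(LINT w|M. Im (Bn m 0 w) ^ 4) = 0"
  proof -
    have "Im (Bn m 0 w) = 0" for w using arg_cong[OF Bn_cnj[of m 0 w], of Im] by simp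
    then show ?thesis by simp
  qed
  have "eventually (\<lambda>l. 0 < (LINT w|M. Im (Bn m (\<tau> l) w) ^ 4)) sequentially"
    by (rule order_tendstoD(1)[OF lim(2)]) simp
  then have nz: "eventually (\<lambda>l. \<tau> l \<noteq> 0) sequentially"
    by (rule eventually_mono) (use im0 in force)
  have tf: "a = 0" if "(\<Sum>i<k. a) = 0" "k > 0" for a :: "'g character" and k :: nat
    by (rule torsion_free[OF conn that(2,1)])
  have two: "a = 0" if "a + a = 0" for a :: "'g character"
    by (rule tf[of _ 2]) (use that in \<open>simp_all add: numeral_2_eq_2\<close>)
  have four: "a = 0" if "a + a + a + a = 0" for a :: "'g character"
    using two[of a] two[of "a + a"] that by (simp add: add.assoc)
  have bound: "DD m q (\<tau> l) / (cc m (\<tau> l))\<^sup>2 \<le> 8 / 3 * (fact m)\<^sup>2 * (?r l - 3 / 4)" if "\<tau> l \<noteq> 0" for l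
  proof -
    have "8 * ?r l = 3 * (LINT w|M. norm (Bn m (\<tau> l) w) ^ 4)"
      by (rule Re_fourth_moment) (use two four that in blast)+
    then have "DD m q (\<tau> l) / (fact m * cc m (\<tau> l))\<^sup>2 \<le> 8 / 3 * (?r l - 3 / 4)"
      by (rule moment_gap[OF _ norm_fourth_lower[OF q]])
    then have "(fact m)\<^sup>2 * (DD m q (\<tau> l) / (fact m * cc m (\<tau> l))\<^sup>2) \<le> (fact m)\<^sup>2 * (8 / 3 * (?r l - 3 / 4))"
      by (rule mult_left_mono) simp
    moreover have "(fact m)\<^sup>2 * (DD m q (\<tau> l) / (fact m * cc m (\<tau> l))\<^sup>2) = DD m q (\<tau> l) / (cc m (\<tau> l))\<^sup>2"
      by (simp add: power_mult_distrib)
    ultimately show ?thesis by argo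
  qed
  have "(\<lambda>l. 8 / 3 * (fact m)\<^sup>2 * (?r l - 3 / 4)) \<longlonglongrightarrow> 8 / 3 * (fact m)\<^sup>2 * (3 / 4 - 3 / 4)"
    by (intro tendsto_mult tendsto_const tendsto_diff lim(1))
  then have up: "(\<lambda>l. 8 / 3 * (fact m)\<^sup>2 * (?r l - 3 / 4)) \<longlonglongrightarrow> 0" by simp
  show "(\<lambda>l. DD m q (\<tau> l) / (cc m (\<tau> l))\<^sup>2) \<longlonglongrightarrow> 0"
  proof (rule tendsto_sandwich[OF _ _ tendsto_const up])
    show "eventually (\<lambda>l. 0 \<le> DD m q (\<tau> l) / (cc m (\<tau> l))\<^sup>2) sequentially" by (simp add: DD_nonneg)
    show "eventually (\<lambda>l. DD m q (\<tau> l) / (cc m (\<tau> l))\<^sup>2 \<le> 8 / 3 * (fact m)\<^sup>2 * (?r l - 3 / 4)) sequentially"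
      by (rule eventually_mono[OF nz bound])
  qed
qed

end

section \<open>Joint and single convergence in law\<close>

context contracting_coefficients begin

text \<open>One real vector with \<open>k\<close> values of the field, then the \<open>p\<close>
  real parts, then the \<open>p\<close> imaginary parts; the tail is zero.\<close>

definition U :: "nat \<Rightarrow> (nat \<Rightarrow> 'g) \<Rightarrow> nat \<Rightarrow> 'w \<Rightarrow> nat \<Rightarrow> real" where
  "U k gs l w i = (if i < k then T (gs i) w else if i < k + p then Re (Bn (ms (i - k)) (\<tau> l) w)
     else if i < k + 2 * p then Im (Bn (ms (i - k - p)) (\<tau> l) w) else 0)"

definition Y :: "nat \<Rightarrow> (nat \<Rightarrow> 'g) \<Rightarrow> 'w \<times> (nat \<Rightarrow> real) \<Rightarrow> nat \<Rightarrow> real" where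
  "Y k gs v i = (if i < k then T (gs i) (fst v) else if i < k + 2 * p then snd v (i - k) else 0)"

abbreviation N_law :: "(nat \<Rightarrow> real) measure" where "N_law \<equiv> PiM {..<2 * p} (\<lambda>_. half_normal)"

lemma T_square: "integrable M (\<lambda>w. (T g w)\<^sup>2)" "(LINT w|M. (T g w)\<^sup>2) \<le> 1"
  using square_integrable[OF T_am] var1 by auto

lemma U_component:
  "(\<lambda>w. U k gs l w i) \<in> borel_measurable M \<and> integrable M (\<lambda>w. (U k gs l w i)\<^sup>2) \<and> (LINT w|M. (U k gs l w i)\<^sup>2) \<le> 1"
proof -
  have pos: "ms j > 0" if "j < p" for j using ms_ge[OF that] by simp
  note rules = T_square T_meas square_integrable Bn_Re_am Bn_Im_am all_moments_measurable[OF Bn_Re_am] all_moments_measurable[OF Bn_Im_am] Bn_part_square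
  consider "i < k" | "\<not> i < k" "i < k + p" | "\<not> i < k + p" "i < k + 2 * p" | "\<not> i < k + 2 * p" by blast
  then show ?thesis
  proof cases
    case 1
    then show ?thesis by (simp add: U_def T_square T_meas)
  next
    case 2
    then have "ms (i - k) > 0" by (intro pos) linarith
    with 2 show ?thesis by (simp add: U_def) (intro conjI rules)
  next
    case 3
    then have "ms (i - k - p) > 0" by (intro pos) linarith
    moreover have "\<not> i < k" using 3 by linarith
    ultimately show ?thesis using 3 by (simp add: U_def) (intro conjI rules)
  next
    case 4
    then have "\<not> i < k" "\<not> i < k + p" by linarith+
    then show ?thesis using 4 by (simp add: U_def)
  qed
qed

lemma prob_space_N_law: "prob_space N_law" by (rule prob_space_PiM_half_normal)

lemma Y_component:
  "(\<lambda>v. Y k gs v i) \<in> borel_measurable (M \<Otimes>\<^sub>M N_law) \<and> integrable (M \<Otimes>\<^sub>M N_law) (\<lambda>v. (Y k gs v i)\<^sup>2) \<and>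
    (LINT v|(M \<Otimes>\<^sub>M N_law). (Y k gs v i)\<^sup>2) \<le> 1"
proof -
  interpret NL: prob_space N_law by (rule prob_space_N_law)
  consider "i < k" | "\<not> i < k" "i < k + 2 * p" | "\<not> i < k" "\<not> i < k + 2 * p" by blast
  then show ?thesis
  proof cases
    case 1
    have "integrable (distr (M \<Otimes>\<^sub>M N_law) M fst) (\<lambda>w. (T (gs i) w)\<^sup>2)"
      "(LINT w|(distr (M \<Otimes>\<^sub>M N_law) M fst). (T (gs i) w)\<^sup>2) \<le> 1"
      unfolding NL.distr_pair_fst by (rule T_square)+
    then show ?thesis using 1 by (simp add: Y_def integrable_distr_eq integral_distr)
  next
    case 2
    then have m: "i - k \<in> {..<2 * p}" by auto
    have comp[measurable]: "(\<lambda>x. x (i - k)) \<in> measurable N_law half_normal" by (rule measurable_component_singleton[OF m])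
    have hn: "integrable half_normal (\<lambda>x. x\<^sup>2)" "(LINT x|half_normal. x\<^sup>2) \<le> 1" using half_normal_second_moment by auto
    have "integrable (distr N_law half_normal (\<lambda>x. x (i - k))) (\<lambda>x. x\<^sup>2)"
      "(LINT x|(distr N_law half_normal (\<lambda>x. x (i - k))). x\<^sup>2) \<le> 1"
      unfolding distr_half_normal_component[OF m] by (rule hn)+
    then have "integrable N_law (\<lambda>x. (x (i - k))\<^sup>2)" "(LINT x|N_law. (x (i - k))\<^sup>2) \<le> 1"
      by (simp_all add: integrable_distr_eq integral_distr)
    then have "integrable (distr (M \<Otimes>\<^sub>M N_law) N_law snd) (\<lambda>x. (x (i - k))\<^sup>2)"
      "(LINT x|(distr (M \<Otimes>\<^sub>M N_law) N_law snd). (x (i - k))\<^sup>2) \<le> 1"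
      unfolding distr_pair_snd[OF M.prob_space_axioms prob_space_N_law] by auto
    moreover have [measurable]: "(\<lambda>x. x (i - k)) \<in> borel_measurable N_law"
      using comp unfolding measurable_cong_sets[OF refl sets_half_normal] .
    ultimately show ?thesis using 2 by (simp add: Y_def integrable_distr_eq integral_distr)
  next
    case 3
    then show ?thesis by (simp add: Y_def)
  qed
qed

lemma joint_law:
  fixes h :: "(nat \<Rightarrow> real) \<Rightarrow> real"
  assumes h: "continuous_on UNIV h" and B: "\<And>x. \<bar>h x\<bar> \<le> B"
  shows "(\<lambda>l. \<integral>w. h (U k gs l w) \<partial>M) \<longlonglongrightarrow> (\<integral>v. h (Y k gs v) \<partial>(M \<Otimes>\<^sub>M N_law))"
proof (rule convergence_from_characteristic_functions[where N = "k + (p + p)" and D = 1 and B = B and h = h and U = "U k gs" and Y = "Y k gs"])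
  show "prob_space M" by (rule M.prob_space_axioms)
  show "prob_space (M \<Otimes>\<^sub>M N_law)" by (rule prob_space_pair[OF M.prob_space_axioms prob_space_N_law])
  show "(\<lambda>l. \<integral>w. exp (\<i> * complex_of_real (\<Sum>i<k + (p + p). c i * U k gs l w i)) \<partial>M)
      \<longlonglongrightarrow> (\<integral>v. exp (\<i> * complex_of_real (\<Sum>i<k + (p + p). c i * Y k gs v i)) \<partial>(M \<Otimes>\<^sub>M N_law))" for c
  proof -
    define x where "x j = c (k + j)" for j
    define y where "y j = c (k + (p + j))" for j
    define n where "n = 2 * p"
    have npp: "p + p = n" by (simp add: n_def)
    have "(\<Sum>i<k + (p + p). c i * U k gs l w i) = (\<Sum>i<k. c i * T (gs i) w) + Q x y l w" for l w
      by (simp add: sum_lessThan_add U_def Q_def sum.distrib x_def y_def)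
    moreover have "(\<integral>v. exp (\<i> * complex_of_real (\<Sum>i<k + (p + p). c i * Y k gs v i)) \<partial>(M \<Otimes>\<^sub>M N_law)) =
      (LINT w|M. exp (\<i> * complex_of_real (\<Sum>i<k. c i * T (gs i) w))) * complex_of_real (exp (- (\<Sum>j<p. (x j)\<^sup>2 + (y j)\<^sup>2) / 4))"
    proof -
      let ?f = "\<lambda>w. exp (\<i> * complex_of_real (\<Sum>i<k. c i * T (gs i) w))"
      let ?g = "\<lambda>u. exp (\<i> * complex_of_real (\<Sum>j<2 * p. x j * u j))"
      have "exp (\<i> * complex_of_real (\<Sum>i<k + (p + p). c i * Y k gs v i)) = ?f (fst v) * ?g (snd v)" for v
        unfolding npp sum_lessThan_add by (simp add: Y_def x_def n_def algebra_simps flip: exp_add)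
      moreover have [measurable]: "?f \<in> borel_measurable M" by measurable
      have mj: "(\<lambda>u. u j) \<in> borel_measurable N_law" if "j < 2 * p" for j
        using measurable_component_singleton[of j "{..<2 * p}" "\<lambda>_. half_normal"] that measurable_cong_sets[OF refl sets_half_normal] by auto
      have [measurable]: "(\<lambda>u. \<Sum>j<2 * p. x j * u j) \<in> borel_measurable N_law"
        by (intro borel_measurable_sum borel_measurable_times borel_measurable_const mj) simp
      have [measurable]: "?g \<in> borel_measurable N_law" by measurable
      have "(LINT v|(M \<Otimes>\<^sub>M N_law). ?f (fst v) * ?g (snd v)) = (LINT w|M. ?f w) * (LINT u|N_law. ?g u)"
        by (rule integral_pair_product[OF M.prob_space_axioms prob_space_N_law, where K = 1 and L = 1]) auto
      moreover have "(\<Sum>j<2 * p. (x j)\<^sup>2) = (\<Sum>j<p. (x j)\<^sup>2 + (y j)\<^sup>2)"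
        unfolding mult_2 sum_lessThan_add sum.distrib by (simp add: x_def y_def)
      ultimately show ?thesis by (simp only: PiM_half_normal_characteristic_function)
    qed
    ultimately show ?thesis
      using characteristic_function_limit[where k = k and d = c and gs = gs and x = x and y = y] by (simp only:)
  qed
qed (use U_component Y_component h B in \<open>auto simp: U_def Y_def\<close>)

lemma joint_convergence:
  fixes k :: nat and gs :: "nat \<Rightarrow> 'g"
  shows "converges_in_law M
     (\<lambda>l w. ((\<lambda>i. if i < k then T (gs i) w else 0), (\<lambda>j. if j < p then nhcoef M H T (ms j) (chr (\<tau> l)) w else 0)))
     (distr M borel (\<lambda>w. \<lambda>i. if i < k then T (gs i) w else 0) \<Otimes>\<^sub>M cgauss_vec p)"
  unfolding converges_in_law_def
proof (intro allI impI)
  fix f :: "(nat \<Rightarrow> real) \<times> (nat \<Rightarrow> complex) \<Rightarrow> real"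
  assume f: "continuous_on UNIV f" "bounded (range f)"
  obtain B where B: "\<And>x. \<bar>f x\<bar> \<le> B" using f(2) by (auto simp: bounded_iff)
  \<comment> \<open>A continuous decoding of the real vector into the pair of sequences; composing
    test functions with it transfers \<open>joint_law\<close>.\<close>
  define e :: "(nat \<Rightarrow> real) \<Rightarrow> (nat \<Rightarrow> real) \<times> (nat \<Rightarrow> complex)" where
    "e y = ((\<lambda>i. if i < k then y i else 0), (\<lambda>j. if j < p then complex_of_real (y (k + j)) + \<i> * complex_of_real (y (k + (p + j))) else 0))" for y
  have "continuous_on UNIV e"
    unfolding e_def
  proof (intro continuous_on_Pair continuous_on_coordinatewise_then_product)
    show "continuous_on UNIV (\<lambda>y. if i < k then y i else 0 :: real)" for i by (cases "i < k") auto
    show "continuous_on UNIV (\<lambda>y. if j < p then complex_of_real (y (k + j)) + \<i> * complex_of_real (y (k + (p + j))) else 0)" for j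
      by (cases "j < p") (auto intro!: continuous_intros)
  qed
  then have cont_h: "continuous_on UNIV (\<lambda>y. f (e y))" by (intro continuous_on_compose2[OF f(1)]) auto
  have lim: "(\<lambda>l. \<integral>w. f (e (U k gs l w)) \<partial>M) \<longlonglongrightarrow> (\<integral>v. f (e (Y k gs v)) \<partial>(M \<Otimes>\<^sub>M N_law))"
    by (rule joint_law[OF cont_h B])
  have eU: "e (U k gs l w) = ((\<lambda>i. if i < k then T (gs i) w else 0), (\<lambda>j. if j < p then nhcoef M H T (ms j) (chr (\<tau> l)) w else 0))" for l w
    by (auto simp: e_def U_def nhcoef_eq fun_eq_iff complex_eq_iff)
  let ?a = "\<lambda>w i. if i < k then T (gs i) w else 0"
  let ?b = "\<lambda>x j. if j < p then Complex (x j) (x (p + j)) else 0"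
  have a[measurable]: "?a \<in> borel_measurable M"
    by (intro measurable_coordinatewise_then_product) simp
  have b[measurable]: "?b \<in> borel_measurable N_law"
  proof (rule measurable_coordinatewise_then_product)
    fix j
    have m: "(\<lambda>u. u i) \<in> borel_measurable N_law" if "i < 2 * p" for i
      using measurable_component_singleton[of i "{..<2 * p}" "\<lambda>_. half_normal"] that measurable_cong_sets[OF refl sets_half_normal] by auto
    show "(\<lambda>x. ?b x j) \<in> borel_measurable N_law"
      by (cases "j < p") (auto simp: Complex_eq intro!: borel_measurable_add borel_measurable_times borel_measurable_of_real borel_measurable_const m)
  qed
  have sf: "sigma_finite_measure (distr N_law borel ?b)"
  proof -
    interpret d: prob_space "distr N_law borel ?b" by (rule prob_space.prob_space_distr[OF prob_space_N_law b])
    show ?thesis ..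
  qed
  have "(\<integral>x. f x \<partial>(distr M borel ?a \<Otimes>\<^sub>M cgauss_vec p)) = (\<integral>x. f x \<partial>(distr (M \<Otimes>\<^sub>M N_law) (borel \<Otimes>\<^sub>M borel) (\<lambda>(x, y). (?a x, ?b y))))"
    unfolding cgauss_vec_def pair_measure_distr[OF a b sf] ..
  also have "\<dots> = (\<integral>v. f (?a (fst v), ?b (snd v)) \<partial>(M \<Otimes>\<^sub>M N_law))"
    by (subst integral_distr) (auto simp: borel_prod case_prod_beta intro!: borel_measurable_continuous_onI f(1))
  also have "\<dots> = (\<integral>v. f (e (Y k gs v)) \<partial>(M \<Otimes>\<^sub>M N_law))"
  proof -
    have "e (Y k gs v) = (?a (fst v), ?b (snd v))" for v
      by (auto simp: e_def Y_def fun_eq_iff complex_eq_iff)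
    then show ?thesis by (simp only:)
  qed
  finally show "(\<lambda>l. \<integral>w. f ((\<lambda>i. if i < k then T (gs i) w else 0), (\<lambda>j. if j < p then nhcoef M H T (ms j) (chr (\<tau> l)) w else 0)) \<partial>M)
     \<longlonglongrightarrow> (\<integral>x. f x \<partial>(distr M borel ?a \<Otimes>\<^sub>M cgauss_vec p))"
    using lim unfolding eU by simp
qed

text \<open>The characteristic functions are those of the joint statement with \<open>k = 0\<close>
  and with weights concentrated at \<open>j\<close>.\<close>

lemma single_convergence:
  assumes j: "j < p"
  shows "cond_a M H T (ms j) (\<lambda>l. chr (\<tau> l))"
  unfolding cond_a_def converges_in_law_def
proof (intro allI impI)
  fix f :: "complex \<Rightarrow> real"
  assume f: "continuous_on UNIV f" "bounded (range f)"
  obtain B where B: "\<And>x. \<bar>f x\<bar> \<le> B" using f(2) by (auto simp: bounded_iff)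
  let ?Z = "\<lambda>l. Bn (ms j) (\<tau> l)"
  let ?P = "half_normal \<Otimes>\<^sub>M half_normal"
  define u where "u l w i = (if i = 0 then Re (?Z l w) else if i = Suc 0 then Im (?Z l w) else 0)" for l w and i :: nat
  define y where "y v i = (if i = 0 then fst v else if i = Suc 0 then snd v else 0)" for v :: "real \<times> real" and i :: nat
  define h where "h x = f (complex_of_real (x 0) + \<i> * complex_of_real (x (Suc 0)))" for x :: "nat \<Rightarrow> real"
  have pos: "ms j > 0" using ms_ge[OF j] by simp
  interpret hn: prob_space half_normal by (rule prob_space_half_normal)
  have hc: "continuous_on UNIV h"
    unfolding h_def by (intro continuous_on_compose2[OF f(1)]) (auto intro!: continuous_intros)
  have "(\<lambda>l. \<integral>w. h (u l w) \<partial>M) \<longlonglongrightarrow> (\<integral>v. h (y v) \<partial>?P)"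
  proof (rule convergence_from_characteristic_functions[where N = 2 and D = 1 and B = B and h = h and U = u and Y = y])
    show "prob_space M" by (rule M.prob_space_axioms)
    show "prob_space ?P" by (rule prob_space_pair[OF prob_space_half_normal prob_space_half_normal])
    show "continuous_on UNIV h" by (rule hc)
    show "\<bar>h x\<bar> \<le> B" for x by (simp add: h_def B)
    show "u l w i = 0" if "2 \<le> i" for l w i using that by (simp add: u_def)
    show "y v i = 0" if "2 \<le> i" for v i using that by (simp add: y_def)
    show "(\<lambda>w. u l w i) \<in> borel_measurable M" for l i
      using all_moments_measurable[OF Bn_Re_am] all_moments_measurable[OF Bn_Im_am] by (simp add: u_def)
    have fs: "fst \<in> borel_measurable ?P" "snd \<in> borel_measurable ?P"
      using measurable_fst[of half_normal half_normal] measurable_snd[of half_normal half_normal]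
      unfolding measurable_cong_sets[OF refl sets_half_normal] by auto
    show "(\<lambda>v. y v i) \<in> borel_measurable ?P" for i
      by (cases "i = 0"; cases "i = Suc 0") (simp_all add: y_def fs)
    show "integrable M (\<lambda>w. (u l w i)\<^sup>2)" for l i
      using square_integrable[OF Bn_Re_am] square_integrable[OF Bn_Im_am]
      by (cases "i = 0"; cases "i = Suc 0") (simp_all add: u_def)
    show "(\<integral>w. (u l w i)\<^sup>2 \<partial>M) \<le> 1" for l i
      using Bn_part_square[OF pos]
      by (cases "i = 0"; cases "i = Suc 0") (simp_all add: u_def)
    have "integrable (distr ?P half_normal fst) (\<lambda>x. x\<^sup>2)" "(LINT x|(distr ?P half_normal fst). x\<^sup>2) = 1 / 2"
      "integrable (distr ?P half_normal snd) (\<lambda>x. x\<^sup>2)" "(LINT x|(distr ?P half_normal snd). x\<^sup>2) = 1 / 2"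
      unfolding hn.distr_pair_fst distr_pair_snd[OF prob_space_half_normal prob_space_half_normal]
      by (rule half_normal_second_moment)+
    then have sq: "integrable ?P (\<lambda>v. (fst v)\<^sup>2)" "(LINT v|?P. (fst v)\<^sup>2) = 1 / 2" "integrable ?P (\<lambda>v. (snd v)\<^sup>2)" "(LINT v|?P. (snd v)\<^sup>2) = 1 / 2"
      by (simp_all add: integrable_distr_eq integral_distr)
    show "integrable ?P (\<lambda>v. (y v i)\<^sup>2)" for i
      using sq by (cases "i = 0"; cases "i = Suc 0") (simp_all add: y_def)
    show "(\<integral>v. (y v i)\<^sup>2 \<partial>?P) \<le> 1" for i
      using sq by (cases "i = 0"; cases "i = Suc 0") (simp_all add: y_def)
    show "(\<lambda>l. \<integral>w. exp (\<i> * complex_of_real (\<Sum>i<2. c i * u l w i)) \<partial>M)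
      \<longlonglongrightarrow> (\<integral>v. exp (\<i> * complex_of_real (\<Sum>i<2. c i * y v i)) \<partial>?P)" for c
    proof -
      let ?x = "\<lambda>i. if i = j then c 0 else 0" and ?y = "\<lambda>i. if i = j then c 1 else 0"
      have "(\<Sum>i<2. c i * u l w i) = Q ?x ?y l w" for l w
      proof -
        have "Q ?x ?y l w = (\<Sum>i<p. if i = j then c 0 * Re (?Z l w) + c 1 * Im (?Z l w) else 0)"
          unfolding Q_def by (rule sum.cong) auto
        then show ?thesis using j by (simp add: numeral_2_eq_2 u_def)
      qed
      moreover have "(\<integral>v. exp (\<i> * complex_of_real (\<Sum>i<2. c i * y v i)) \<partial>?P) = complex_of_real (exp (- (\<Sum>i<p. (?x i)\<^sup>2 + (?y i)\<^sup>2) / 4))"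
      proof -
        let ?f = "\<lambda>i x. exp (\<i> * complex_of_real (c i * x))"
        have "exp (\<i> * complex_of_real (\<Sum>i<2. c i * y v i)) = ?f 0 (fst v) * ?f 1 (snd v)" for v
          by (simp add: numeral_2_eq_2 y_def distrib_left flip: exp_add)
        moreover have "(LINT v|?P. ?f 0 (fst v) * ?f 1 (snd v)) = (LINT x|half_normal. ?f 0 x) * (LINT x|half_normal. ?f 1 x)"
          by (rule integral_pair_product[OF prob_space_half_normal prob_space_half_normal, where K = 1 and L = 1]) auto
        moreover have "(\<Sum>i<p. (?x i)\<^sup>2 + (?y i)\<^sup>2) = (\<Sum>i<p. if i = j then (c 0)\<^sup>2 + (c 1)\<^sup>2 else 0)"
          by (rule sum.cong) auto
        ultimately show ?thesis using j
          by (simp only: half_normal_characteristic_function) (simp add: add_divide_distrib diff_divide_distrib flip: exp_add of_real_mult)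
      qed
      ultimately show ?thesis using characteristic_function_limit[where k = 0 and d = "\<lambda>_. 0" and gs = undefined and x = ?x and y = ?y] by (simp add: M.prob_space)
    qed
  qed
  moreover have "h (u l w) = f (nhcoef M H T (ms j) (chr (\<tau> l)) w)" for l w
  proof -
    have "complex_of_real (Re z) + \<i> * complex_of_real (Im z) = z" for z by (simp add: complex_eq_iff)
    then show ?thesis by (simp add: h_def u_def nhcoef_eq)
  qed
  moreover have "(\<integral>v. h (y v) \<partial>?P) = (\<integral>x. f x \<partial>cgauss)"
  proof -
    have "h (y v) = f (Complex (fst v) (snd v))" for v by (simp add: h_def y_def Complex_eq)
    moreover have "(\<lambda>v. Complex (fst v) (snd v)) \<in> borel_measurable ?P"
      unfolding Complex_eq by (intro borel_measurable_add borel_measurable_times borel_measurable_of_real borel_measurable_const)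
        (auto simp: measurable_cong_sets[OF refl sets_half_normal, symmetric])
    ultimately show ?thesis unfolding cgauss_def case_prod_beta
      by (subst integral_distr) (auto intro!: borel_measurable_continuous_onI f(1))
  qed
  ultimately show "(\<lambda>l. \<integral>w. f (nhcoef M H T (ms j) (chr (\<tau> l)) w) \<partial>M) \<longlonglongrightarrow> (\<integral>x. f x \<partial>cgauss)" by simp
qed

end

section \<open>Assembly of both directions\<close>

theorem theorem6p1:
  fixes H :: "'g::{topological_ab_group_add, t2_space, second_countable_topology} measure"
    and M :: "'w measure"
    and T :: "'g \<Rightarrow> 'w \<Rightarrow> real"
    and p :: nat and ms :: "nat \<Rightarrow> nat"
    and \<pi>s :: "nat \<Rightarrow> ('g \<Rightarrow> complex)"
  assumes compact: "compact (UNIV :: 'g set)"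
    and connected: "connected (UNIV :: 'g set)"
    and haar: "normalized_haar H"
    and dual_inf: "infinite (dual :: ('g \<Rightarrow> complex) set)"
    and prob: "prob_space M"
    and meas: "(\<lambda>(g, w). T g w) \<in> borel_measurable (borel \<Otimes>\<^sub>M M)"
    and gauss: "centered_gaussian_field M T"
    and iso: "isotropic_field M T"
    and var1: "\<And>g. (\<integral>w. (T g w)\<^sup>2 \<partial>M) = 1"
    and Cpos: "\<And>chi. chi \<in> dual \<Longrightarrow> spec M H T chi > 0"
    and p2: "p \<ge> 2"
    and m2: "ms 0 \<ge> 2"
    and mono: "\<And>i j. i < j \<Longrightarrow> j < p \<Longrightarrow> ms i < ms j"
    and \<pi>s_dual: "\<And>l. \<pi>s l \<in> dual"
  shows "((\<forall>j<p. cond_a M H T (ms j) \<pi>s \<or> cond_b M H T (ms j) \<pi>s \<or>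
                  cond_c M H T (ms j) \<pi>s \<or> cond_d M H T (ms j) \<pi>s) \<longrightarrow>
          (\<forall>(k::nat) (gs::nat \<Rightarrow> 'g). k \<ge> 1 \<longrightarrow>
             converges_in_law M
               (\<lambda>l w. ((\<lambda>i. if i < k then T (gs i) w else 0),
                       (\<lambda>j. if j < p then nhcoef M H T (ms j) (\<pi>s l) w else 0)))
               (distr M borel (\<lambda>w. \<lambda>i. if i < k then T (gs i) w else 0)
                  \<Otimes>\<^sub>M cgauss_vec p)))
       \<and> ((\<forall>(k::nat) (gs::nat \<Rightarrow> 'g). k \<ge> 1 \<longrightarrow>
             converges_in_law M
               (\<lambda>l w. ((\<lambda>i. if i < k then T (gs i) w else 0),
                       (\<lambda>j. if j < p then nhcoef M H T (ms j) (\<pi>s l) w else 0)))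
               (distr M borel (\<lambda>w. \<lambda>i. if i < k then T (gs i) w else 0)
                  \<Otimes>\<^sub>M cgauss_vec p)) \<longrightarrow>
          (\<forall>j<p. cond_a M H T (ms j) \<pi>s \<and> cond_b M H T (ms j) \<pi>s \<and>
                  cond_c M H T (ms j) \<pi>s \<and> cond_d M H T (ms j) \<pi>s))"
proof -
  interpret gaussian_field H M T
    by (intro gaussian_field.intro compact_haar.intro gaussian_field_axioms.intro assms)
  have "\<exists>a. \<pi>s l = chr a" for l using \<pi>s_dual[of l] unfolding chr_image[symmetric] by blast
  then obtain \<tau> where "\<And>l. \<pi>s l = chr (\<tau> l)" by metis
  then have \<pi>s: "\<pi>s = (\<lambda>l. chr (\<tau> l))" by (rule ext)
  have ms2: "ms j \<ge> 2" if "j < p" for j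
    using m2 mono[of 0 j] that by (cases "j = 0") auto
  have inj: "inj_on ms {..<p}"
  proof (rule inj_onI)
    fix i j assume "i \<in> {..<p}" "j \<in> {..<p}" "ms i = ms j"
    then show "i = j" using mono[of i j] mono[of j i] by (cases i j rule: linorder_cases) auto
  qed
  \<comment> \<open>All four conditions are routed through (c), in the form
    \<open>contracts\<close>.\<close>
  have contracting: "contracting_coefficients H M T p ms \<tau>" if "\<forall>j<p. contracts (ms j) \<tau>"
    by (intro contracting_coefficients.intro gaussian_field_axioms contracting_coefficients_axioms.intro connected)
      (use p2 ms2 inj that in auto)
  have b: "contracts (ms j) \<tau>" if "cond_b M H T (ms j) \<pi>s" for j
    using cond_b_imp_contracts[OF connected] that unfolding \<pi>s .
  have a: "contracts (ms j) \<tau>" if "cond_a M H T (ms j) \<pi>s" "j < p" for j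
  proof -
    have "ms j > 0" using ms2[OF that(2)] by simp
    then show ?thesis using b cond_a_imp_cond_b that(1) unfolding \<pi>s by blast
  qed
  have c: "cond_c M H T (ms j) \<pi>s \<longleftrightarrow> contracts (ms j) \<tau>" for j
    unfolding \<pi>s by (rule cond_c_iff)
  have d: "cond_d M H T (ms j) \<pi>s \<longleftrightarrow> contracts (ms j) \<tau>" if "j < p" for j
    unfolding \<pi>s by (rule cond_d_iff[OF ms2[OF that]])
  show ?thesis
  proof (rule conjI; rule impI)
    assume "\<forall>j<p. cond_a M H T (ms j) \<pi>s \<or> cond_b M H T (ms j) \<pi>s \<or> cond_c M H T (ms j) \<pi>s \<or> cond_d M H T (ms j) \<pi>s"
    then have "\<forall>j<p. contracts (ms j) \<tau>" using a b c d by blast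
    then interpret cont: contracting_coefficients H M T p ms \<tau> by (rule contracting)
    show "\<forall>(k::nat) (gs::nat \<Rightarrow> 'g). k \<ge> 1 \<longrightarrow>
             converges_in_law M
               (\<lambda>l w. ((\<lambda>i. if i < k then T (gs i) w else 0),
                       (\<lambda>j. if j < p then nhcoef M H T (ms j) (\<pi>s l) w else 0)))
               (distr M borel (\<lambda>w. \<lambda>i. if i < k then T (gs i) w else 0)
                  \<Otimes>\<^sub>M cgauss_vec p)"
      unfolding \<pi>s by (intro allI impI cont.joint_convergence)
  next
    assume law: "\<forall>(k::nat) (gs::nat \<Rightarrow> 'g). k \<ge> 1 \<longrightarrow>
             converges_in_law M
               (\<lambda>l w. ((\<lambda>i. if i < k then T (gs i) w else 0),
                       (\<lambda>j. if j < p then nhcoef M H T (ms j) (\<pi>s l) w else 0)))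
               (distr M borel (\<lambda>w. \<lambda>i. if i < k then T (gs i) w else 0)
                  \<Otimes>\<^sub>M cgauss_vec p)"
    \<comment> \<open>A single evaluation point suffices to read off the law of the j-th
      coefficient.\<close>
    have cb: "cond_b M H T (ms j) \<pi>s" if j: "j < p" for j
    proof -
      have "ms j > 0" using ms2[OF j] by simp
      moreover note law[rule_format, of 1 "\<lambda>_. 0", OF order_refl, unfolded \<pi>s]
      ultimately show ?thesis unfolding \<pi>s by (rule joint_law_imp_cond_b[OF j])
    qed
    \<comment> \<open>From (b) back to (c); then (a) follows from the convergence theorem for one
      order rather than by projecting the joint law.\<close>
    then have con: "\<forall>j<p. contracts (ms j) \<tau>" using b by blast
    then interpret cont: contracting_coefficients H M T p ms \<tau> by (rule contracting)
    show "\<forall>j<p. cond_a M H T (ms j) \<pi>s \<and> cond_b M H T (ms j) \<pi>s \<and>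
                  cond_c M H T (ms j) \<pi>s \<and> cond_d M H T (ms j) \<pi>s"
      using cb con c d cont.single_convergence unfolding \<pi>s by blast
  qed
qed

end
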